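(* Assume the Riemann Hypothesis. There is a function $\eta(X)$ with $\eta(X)\to 0$ as $X\to\infty$ and an absolute constant $C>0$ such that, for all sufficiently large $X$ and all real $h$ with $$1\le h\le \exp\left(\sqrt{\left(\tfrac12-\eta(X)\right)\log X\,\log\log X}\right),$$ one has $$\int_X^{2X}\Big|\sum_{x\le n\le x+h}\lambda(n)\Big|^2\,\mathrm{d}x\le C\,X h(\log X)^6 .$$
   Context: $\lambda$ denotes the Liouville function, i.e. the completely multiplicative function with $\lambda(p)=-1$ for every prime $p$. Sums over $n$ are over positive integers. *)

theory Defs
  imports "HOL-Analysis.Analysis" "HOL-Computational_Algebra.Primes"
begin

definition liouville :: "nat \<Rightarrow> int" where
  "liouville n = (-1) ^ size (prime_factorization n)"

text \<open>Dirichlet eta function, given by its (conditionally) convergent series for Re s > 0.\<close>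
definition dirichlet_eta :: "complex \<Rightarrow> complex" where
  "dirichlet_eta s = (\<Sum>n. (-1) ^ n * (of_nat (Suc n)) powr (-s))"

text \<open>Riemann zeta on the half plane Re s > 0 (s /= 1) via its analytic continuation
  zeta(s) = eta(s) / (1 - 2^(1-s)).\<close>
definition riemann_zeta :: "complex \<Rightarrow> complex" where
  "riemann_zeta s = dirichlet_eta s / (1 - 2 powr (1 - s))"

definition riemann_hypothesis :: bool where
  "riemann_hypothesis \<longleftrightarrow>
     (\<forall>s. 0 < Re s \<and> Re s < 1 \<and> riemann_zeta s = 0 \<longrightarrow> Re s = 1/2)"

definition liouville_short_sum :: "real \<Rightarrow> real \<Rightarrow> int" where
  "liouville_short_sum x h =
     (\<Sum>n\<in>{n::nat. 1 \<le> n \<and> x \<le> real n \<and> real n \<le> x + h}. liouville n)"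

end

theory Submission
  imports Defs "HOL-Complex_Analysis.Complex_Analysis"
    "HOL-Probability.Sinc_Integral" "HOL-Probability.Characteristic_Functions"
    "HOL-Number_Theory.Prime_Powers" "HOL-Real_Asymp.Real_Asymp"
begin

text \<open>
  Let \<open>H\<close> be the largest admissible value of \<open>h\<close>.  Since \<open>log H\<close> is just below
  \<open>sqrt (log X log log X / 2)\<close>, Rankin's method gives only \<open>O (X / H)\<close> many \<open>n \<le> X\<close> that are
  \<open>H\<close>-smooth, and the \<open>n\<close> divisible by the square of a prime \<open>> H\<close> are as rare.  Their
  contribution to the mean square is trivially \<open>O (h X)\<close>.  For all other \<open>n\<close>, Ramare's identity
  writes \<open>\<lambda>(n)\<close> as a sum of \<open>b (n / p)\<close> over the prime divisors \<open>p > H\<close> of \<open>n\<close>, with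
  \<open>\<bar>b\<bar> \<le> 1\<close>.  A partition of unity in \<open>log p\<close> separates the variables, so that the
  Mellin transform becomes a sum of \<open>O (log X)\<close> products \<open>P (it) M (it)\<close>.  Under the Riemann
  hypothesis \<open>P\<close>, which has length about \<open>e\<^sup>y\<close>, is \<open>O (exp (y / 2) log\<^sup>2 X)\<close> apart from a
  term concentrated at small \<open>t\<close>; this square root saving, together with the mean value of \<open>M\<close>,
  yields the bound; the number of blocks times the loss in the pointwise bound gives \<open>(log X)\<^sup>6\<close> after squaring.
  Small \<open>t\<close> are suppressed by subtracting a rescaled window of length \<open>X powr (-1/240)\<close>, for which
  the Riemann hypothesis gives a power saving directly.  All this is done for multiplicative windows
  \<open>(x, x exp \<delta>]\<close>, and the passage to additive ones is an averaging argument of Saffari and Vaughan.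

  The bound for \<open>P\<close> needs no zero counting: Borel--Caratheodory bounds \<open>\<zeta>'/\<zeta>\<close> on the line
  \<open>Re s = 1/2 + 1/y\<close>, and a triangular weight makes the Perron integral converge absolutely.
\<close>

section \<open>The zeta function\<close>

text \<open>The constant 1/2 comes from Rankin's method. With u = log X / log H there are about X
  u^(-u) integers up to X that are H-smooth. They may be discarded when this is at most X / H, that
  is, when u log u exceeds log H; as log u is close to (log log X) / 2, this means (log H)^2 < (1/2)
  log X log log X, and \<open>\<eta>\<close> absorbs lower order terms. Density 1 / H is what is
  needed, since such a set contributes about X h (1 + h) / H to the mean square.

  The condition p > H leaves a cofactor m of size at most about X / H. A window of relative length h
  / X then contains O(1) such m, because h is at most H, and the mean value over m costs no more
  than its diagonal. The cutoff at p = H is the obstacle to using few blocks: smooth weights are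
  needed for the bound on P, hence the blocks shrink geometrically towards log H. The pole of zeta
  costs powers of H there. As H is smaller than every power of X, the power of X saved by the
  compensated window pays for them.\<close>

definition zeta_term :: "nat \<Rightarrow> complex \<Rightarrow> complex" where
  "zeta_term n s = (s - 1) * of_nat n powr (-s) - of_nat n powr (1 - s) + of_nat (Suc n) powr (1 - s)"

text \<open>This is \<open>(s - 1) \<zeta>(s)\<close>: the telescoping terms \<open>(n + 1) powr (1 - s) - n powr (1 - s)\<close> extend the
  convergence to \<open>Re s > 0\<close>.\<close>
definition zeta_entire :: "complex \<Rightarrow> complex" where
  "zeta_entire s = 1 + (\<Sum>n. zeta_term (Suc n) s)"

lemma norm_of_nat_powr: "n > 0 \<Longrightarrow> norm (of_nat n powr s :: complex) = real n powr Re s"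
  by (simp add: norm_powr_real_powr)

text \<open>\<open>zeta_term n s\<close> is the remainder at \<open>n + 1\<close> of the first order
  Taylor expansion of \<open>z powr (1 - s)\<close> at \<open>n\<close>. Two applications of the
  mean value inequality, to \<open>z powr (-s)\<close> and then to \<open>g\<close>, bound it by a
  second derivative; the power of \<open>n\<close> so gained carries convergence down to
  \<open>Re s > 0\<close>.\<close>

lemma zeta_term_bound:
  assumes "Re s > -1" "n > 0"
  shows "norm (zeta_term n s) \<le> norm s * norm (s - 1) * real n powr (- Re s - 1)"
proof -
  define a b :: complex where "a = of_nat n" and "b = of_nat (Suc n)"
  define S where "S = closed_segment a b"
  have aS: "a \<in> S" and bS: "b \<in> S" by (auto simp: S_def)
  have S: "\<exists>x. z = of_real x \<and> real n \<le> x \<and> x \<le> real n + 1" if "z \<in> S" for z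
  proof -
    have "S = of_real ` closed_segment (real n) (real (Suc n))"
      unfolding S_def a_def b_def using closed_segment_of_real[of "real n" "real (Suc n)"] by simp
    then show ?thesis using that by (auto simp: closed_segment_eq_real_ivl)
  qed
  have conv: "convex S" by (simp add: S_def)
  have ab: "norm (b - a) = 1" by (simp add: a_def b_def)
  have pos: "z \<notin> \<real>\<^sub>\<le>\<^sub>0" if "z \<in> S" for z
    using S[OF that] assms(2) by (auto simp: complex_nonpos_Reals_iff)
  have dist: "norm (z - a) \<le> 1" if "z \<in> S" for z
  proof -
    obtain x where x: "z = of_real x" "real n \<le> x" "x \<le> real n + 1" using S[OF \<open>z \<in> S\<close>] by blast
    have "z - a = of_real (x - real n)" by (simp add: x a_def)
    then have "norm (z - a) = \<bar>x - real n\<bar>" by (simp only: norm_of_real)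
    then show ?thesis using x by linarith
  qed
  have inner: "norm (z powr (-s) - a powr (-s)) \<le> norm s * real n powr (- Re s - 1)" if z: "z \<in> S" for z
  proof -
    have "norm (z powr (-s) - a powr (-s)) \<le> (norm s * real n powr (- Re s - 1)) * norm (z - a)"
    proof (rule field_differentiable_bound[OF conv _ _ z aS])
      fix w assume w: "w \<in> S"
      show "((\<lambda>w. w powr (-s)) has_field_derivative (-s) * w powr (-s-1)) (at w within S)"
        by (rule has_field_derivative_at_within[OF has_field_derivative_powr[OF pos[OF w]]])
      obtain x where x: "w = of_real x" "real n \<le> x" using S[OF w] by blast
      have "norm (w powr (-s-1)) = x powr (- Re s - 1)"
        using x assms by (simp add: norm_powr_real_powr)
      also have "\<dots> \<le> real n powr (- Re s - 1)"
        using x assms by (intro powr_mono2') auto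
      finally show "norm ((-s) * w powr (-s-1)) \<le> norm s * real n powr (- Re s - 1)"
        by (simp add: norm_mult mult_left_mono)
    qed
    also have "\<dots> \<le> (norm s * real n powr (- Re s - 1)) * 1"
      using dist[OF z] by (intro mult_left_mono) auto
    finally show ?thesis by simp
  qed
  define g where "g = (\<lambda>z. z powr (1 - s) - (1 - s) * a powr (-s) * z)"
  have "norm (g b - g a) \<le> (norm (s - 1) * (norm s * real n powr (- Re s - 1))) * norm (b - a)"
  proof (rule field_differentiable_bound[OF conv _ _ bS aS])
    fix w assume w: "w \<in> S"
    show "(g has_field_derivative (1 - s) * (w powr (-s) - a powr (-s))) (at w within S)"
    proof -
      have "((\<lambda>z. z powr (1 - s)) has_field_derivative (1 - s) * w powr (1 - s - 1)) (at w)"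
        by (rule has_field_derivative_powr[OF pos[OF w]])
      then have "(g has_field_derivative (1 - s) * w powr (1 - s - 1) - (1 - s) * a powr (-s)) (at w)"
        unfolding g_def by (rule DERIV_diff[OF _ DERIV_cmult_Id])
      then show ?thesis by (simp add: algebra_simps has_field_derivative_at_within)
    qed
    show "norm ((1 - s) * (w powr (-s) - a powr (-s))) \<le> norm (s - 1) * (norm s * real n powr (- Re s - 1))"
      using inner[OF w] by (simp add: norm_mult mult_left_mono norm_minus_commute)
  qed
  moreover have "g b - g a = zeta_term n s"
    by (simp add: g_def zeta_term_def a_def b_def algebra_simps)
  ultimately show ?thesis using ab by (simp add: mult_ac)
qed

lemma summable_real_powr_Suc: "a > 1 \<Longrightarrow> summable (\<lambda>n. real (Suc n) powr (-a))"
  using summable_real_powr_iff[of "-a"] by (subst summable_Suc_iff) simp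

lemma zeta_term_summable:
  assumes "Re s > 0" shows "summable (\<lambda>n. zeta_term (Suc n) s)"
proof (rule summable_comparison_test'[where N=0])
  show "summable (\<lambda>n. norm s * norm (s-1) * real (Suc n) powr (-(Re s + 1)))"
    using assms by (intro summable_mult summable_real_powr_Suc) auto
  show "norm (zeta_term (Suc n) s) \<le> norm s * norm (s-1) * real (Suc n) powr (-(Re s + 1))" for n
    using zeta_term_bound[of s "Suc n"] assms by simp
qed

lemma zeta_term_differentiable: "n > 0 \<Longrightarrow> zeta_term n field_differentiable at s"
proof -
  assume n: "n > 0"
  have "zeta_term n holomorphic_on UNIV"
    unfolding zeta_term_def using n by (intro holomorphic_intros) (auto simp: complex_nonpos_Reals_iff)
  then show ?thesis by (simp add: holomorphic_on_def)
qed

lemma LIMSEQ_even_odd: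
  fixes f :: "nat \<Rightarrow> 'a :: metric_space"
  assumes "(\<lambda>n. f (2*n)) \<longlonglongrightarrow> L" "(\<lambda>n. f (2*n+1)) \<longlonglongrightarrow> L"
  shows "f \<longlonglongrightarrow> L"
proof (rule metric_LIMSEQ_I)
  fix r :: real assume "r > 0"
  then obtain M N where MN: "\<And>n. n \<ge> M \<Longrightarrow> dist (f (2*n)) L < r" "\<And>n. n \<ge> N \<Longrightarrow> dist (f (2*n+1)) L < r"
    using metric_LIMSEQ_D[OF assms(1)] metric_LIMSEQ_D[OF assms(2)] by meson
  have "dist (f n) L < r" if "n \<ge> 2 * (M + N)" for n
  proof (cases "even n")
    case True
    then obtain k where "n = 2 * k" by (rule evenE)
    then show ?thesis using MN(1)[of k] that by simp
  next
    case False
    then obtain k where "n = 2 * k + 1" by (rule oddE)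
    then show ?thesis using MN(2)[of k] that by simp
  qed
  then show "\<exists>no. \<forall>n\<ge>no. dist (f n) L < r" by blast
qed

lemma zeta_entire_holomorphic: "zeta_entire holomorphic_on {s. Re s > 0}"
proof -
  have op: "open {s. Re s > 0}" by (simp add: open_halfspace_Re_gt)
  obtain g where g: "\<forall>x\<in>{s. Re s > 0}. (\<lambda>n. zeta_term (Suc n) x) sums g x \<and> g field_differentiable at x"
  proof (rule series_differentiable_comparison_complex[OF op, of "\<lambda>n. zeta_term (Suc n)"])
    show "zeta_term (Suc n) field_differentiable at x" for n x by (rule zeta_term_differentiable) simp
    fix x :: complex assume x: "x \<in> {s. Re s > 0}"
    define d where "d = Re x / 2"
    have d: "d > 0" using x by (simp add: d_def)
    define B where "B = (norm x + d) * (norm x + d + 1)"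
    define h where "h = (\<lambda>n. complex_of_real (B * real (Suc n) powr (-(d+1))))"
    have B0: "B \<ge> 0" using d by (simp add: B_def)
    have "summable (\<lambda>n. B * real (Suc n) powr (-(d+1)))"
      using d by (intro summable_mult summable_real_powr_Suc) auto
    then have "summable h" unfolding h_def by (subst summable_of_real_iff)
    moreover have "range h \<subseteq> \<real>\<^sub>\<ge>\<^sub>0" using B0 by (auto simp: h_def nonneg_Reals_of_real_iff simp del: of_real_mult)
    moreover have "norm (zeta_term (Suc n) y) \<le> norm (h n)" if y: "y \<in> ball x d" for n y
    proof -
      have ny: "norm (y - x) < d" using y by (simp add: dist_norm norm_minus_commute)
      have "norm y \<le> norm x + d" using ny norm_triangle_sub[of y x] by linarith
      moreover have "norm (y - 1) \<le> norm y + 1" using norm_triangle_ineq4[of y 1] by simp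
      ultimately have 1: "norm y * norm (y - 1) \<le> B"
        unfolding B_def using d by (intro mult_mono) auto
      have "\<bar>Re (y - x)\<bar> \<le> norm (y - x)" by (rule abs_Re_le_cmod)
      then have "Re y \<ge> d" using ny by (simp add: d_def abs_le_iff)
      then have 2: "real (Suc n) powr (- Re y - 1) \<le> real (Suc n) powr (-(d+1))"
        by (intro powr_mono) auto
      have "norm (zeta_term (Suc n) y) \<le> norm y * norm (y-1) * real (Suc n) powr (- Re y - 1)"
        using \<open>Re y \<ge> d\<close> d by (intro zeta_term_bound) auto
      also have "\<dots> \<le> B * real (Suc n) powr (-(d+1))"
        using 1 2 B0 by (intro mult_mono) auto
      also have "\<dots> = norm (h n)" unfolding h_def by (simp only: norm_of_real) (simp add: B0)
      finally show ?thesis .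
    qed
    ultimately show "\<exists>d (h :: nat \<Rightarrow> complex). 0 < d \<and> summable h \<and> range h \<subseteq> \<real>\<^sub>\<ge>\<^sub>0 \<and>
       (\<forall>\<^sub>F n in sequentially. \<forall>y\<in>ball x d \<inter> {s. Re s > 0}. norm (zeta_term (Suc n) y) \<le> norm (h n))"
      using d by (intro exI[of _ d] exI[of _ h] conjI) (simp_all add: always_eventually)
  qed blast
  have eq: "1 + g s = zeta_entire s" if "s \<in> {s. Re s > 0}" for s
    using g that by (auto simp: zeta_entire_def sums_iff)
  have "(\<lambda>s. 1 + g s) holomorphic_on {s. Re s > 0}"
    using g by (intro holomorphic_intros) (auto simp: holomorphic_on_def intro: field_differentiable_at_within)
  then show ?thesis using eq holomorphic_cong by (metis (no_types, lifting))
qed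

lemma zeta_entire_1 [simp]: "zeta_entire 1 = 1"
proof -
  have "zeta_term (Suc n) 1 = 0" for n
    using of_nat_neq_0[of n, where ?'a = complex] of_nat_neq_0[of "Suc n", where ?'a = complex]
    unfolding zeta_term_def by (simp del: of_nat_Suc)
  then show ?thesis by (simp add: zeta_entire_def)
qed

text \<open>For the logarithmic derivative only the logarithm of this bound matters. In
  \<open>inverse_zeta_bound\<close> the exponent 2 is used: divided by the size of
  \<open>zeta_entire\<close> at the centre of a disc, it leaves a factor linear in the imaginary
  part.\<close>

lemma zeta_entire_growth:
  obtains C where "C \<ge> 1" "\<And>s. Re s \<ge> 1/2 \<Longrightarrow> norm (zeta_entire s) \<le> C * (norm s + 1)\<^sup>2"
proof
  define B where "B = (\<Sum>n. real (Suc n) powr (-(3/2)))"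
  have sm: "summable (\<lambda>n. real (Suc n) powr (-(3/2)))" by (rule summable_real_powr_Suc) simp
  have B: "B \<ge> 0" unfolding B_def by (intro suminf_nonneg sm) auto
  show "1 + B \<ge> 1" using B by simp
  fix s :: complex assume s: "Re s \<ge> 1/2"
  have le: "norm (zeta_term (Suc n) s) \<le> norm s * norm (s-1) * real (Suc n) powr (-(3/2))" for n
  proof -
    have "norm (zeta_term (Suc n) s) \<le> norm s * norm (s-1) * real (Suc n) powr (- Re s - 1)"
      using s by (intro zeta_term_bound) auto
    also have "\<dots> \<le> norm s * norm (s-1) * real (Suc n) powr (-(3/2))"
      using s by (intro mult_left_mono powr_mono) auto
    finally show ?thesis .
  qed
  have "norm (\<Sum>n. zeta_term (Suc n) s) \<le> (\<Sum>n. norm s * norm (s-1) * real (Suc n) powr (-(3/2)))"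
    by (rule norm_suminf_le) (use le sm in \<open>auto intro: summable_mult\<close>)
  also have "\<dots> = norm s * norm (s-1) * B" unfolding B_def by (rule suminf_mult[OF sm])
  finally have "norm (zeta_entire s) \<le> 1 + norm s * norm (s-1) * B"
    unfolding zeta_entire_def by (intro order.trans[OF norm_triangle_ineq]) simp
  also have "norm s * norm (s-1) \<le> (norm s + 1) * (norm s + 1)"
    using norm_triangle_ineq4[of s 1] by (intro mult_mono) auto
  then have "norm s * norm (s-1) * B \<le> (norm s + 1)^2 * B"
    using B by (intro mult_right_mono) (auto simp: power2_eq_square)
  then have "1 + norm s * norm (s-1) * B \<le> (norm s + 1)^2 + (norm s + 1)^2 * B"
    using one_le_power[of "norm s + 1" 2] by (intro add_mono) auto
  finally show "norm (zeta_entire s) \<le> (1 + B) * (norm s + 1)\<^sup>2" by (simp add: algebra_simps)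
qed

lemma zeta_partial_sum:
  "(s - 1) * (\<Sum>k<N. of_nat (Suc k) powr (-s)) = 1 + (\<Sum>k<N. zeta_term (Suc k) s) - of_nat (Suc N) powr (1 - s)"
  by (induction N) (simp_all add: zeta_term_def algebra_simps)

lemma of_nat_powr_tendsto_0:
  assumes "Re s < 0" shows "(\<lambda>n. complex_of_nat (Suc n) powr s) \<longlonglongrightarrow> 0"
proof -
  have "(\<lambda>n. norm (complex_of_nat (Suc n) powr s)) \<longlonglongrightarrow> 0"
  proof -
    have "(\<lambda>n. real (Suc n) powr Re s) \<longlonglongrightarrow> 0" using assms by real_asymp
    then show ?thesis by (subst norm_of_nat_powr) auto
  qed
  then show ?thesis by (rule tendsto_norm_zero_cancel)
qed

lemma zeta_entire_eq_series:
  assumes "Re s > 1"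
  shows "(\<lambda>k. of_nat (Suc k) powr (-s)) sums (zeta_entire s / (s - 1))"
proof -
  have s1: "s \<noteq> 1" using assms by auto
  have "(\<lambda>N. 1 + (\<Sum>k<N. zeta_term (Suc k) s) - of_nat (Suc N) powr (1 - s)) \<longlonglongrightarrow> zeta_entire s - 0"
    unfolding zeta_entire_def using assms
    by (intro tendsto_intros of_nat_powr_tendsto_0 summable_LIMSEQ zeta_term_summable) auto
  then have "(\<lambda>N. (s - 1) * (\<Sum>k<N. of_nat (Suc k) powr (-s))) \<longlonglongrightarrow> zeta_entire s"
    unfolding zeta_partial_sum by simp
  then have "(\<lambda>N. (s - 1) * (\<Sum>k<N. of_nat (Suc k) powr (-s)) / (s - 1)) \<longlonglongrightarrow> zeta_entire s / (s - 1)"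
    using s1 by (intro tendsto_intros) auto
  then show ?thesis using s1 by (simp add: sums_def)
qed

section \<open>Agreement with the alternating series and absence of zeros in the open strip\<close>

lemma eta_partial_sum:
  "(\<Sum>n<2*N. (-1) ^ n * of_nat (Suc n) powr (-s)) =
   (\<Sum>n<2*N. of_nat (Suc n) powr (-s)) - 2 powr (1 - s) * (\<Sum>n<N. complex_of_nat (Suc n) powr (-s))"
proof (induction N)
  case (Suc N)
  have "complex_of_nat (2 * Suc N) powr (-s) = 2 powr (-s) * of_nat (Suc N) powr (-s)"
    by (simp only: of_nat_mult of_nat_numeral) (rule powr_times_real, auto)
  then have e: "complex_of_nat (Suc (Suc (2*N))) powr (-s) = 2 powr (-s) * of_nat (Suc N) powr (-s)" by simp
  have p: "(2::complex) powr (1 - s) = 2 * 2 powr (-s)" by (simp add: powr_diff powr_minus divide_simps)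
  have "2 * Suc N = Suc (Suc (2*N))" by simp
  then show ?case
    by (simp only: sum.lessThan_Suc Suc.IH e p) (simp add: algebra_simps)
qed simp

text \<open>This transfers the hypothesis, which is stated through the alternating series, to
  \<open>zeta_entire\<close>. For \<open>Re s < 1\<close> the boundary terms
  \<open>of_nat (Suc N) powr (1 - s)\<close> of the partial sums grow, so the limit is first taken
  along even partial sums, where only the difference of two consecutive boundary terms
  survives.\<close>

lemma zeta_entire_eq_eta:
  assumes "Re s > 0" "Re s \<noteq> 1"
  shows "(s - 1) * dirichlet_eta s = (1 - 2 powr (1 - s)) * zeta_entire s"
proof -
  have s1: "s \<noteq> 1" using assms by auto
  define L where "L = (1 - 2 powr (1 - s)) * zeta_entire s"
  define P where "P = (\<lambda>N. \<Sum>n<N. (-1) ^ n * complex_of_nat (Suc n) powr (-s))"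
  define q where "q = (\<lambda>N. complex_of_nat (Suc N) powr (1 - s))"
  define Z where "Z = (\<lambda>N. 1 + (\<Sum>k<N. zeta_term (Suc k) s))"
  have Z: "Z \<longlonglongrightarrow> zeta_entire s" unfolding Z_def zeta_entire_def
    using assms by (intro tendsto_intros summable_LIMSEQ zeta_term_summable) auto
  have Z2: "(\<lambda>N. Z (2*N)) \<longlonglongrightarrow> zeta_entire s"
    using LIMSEQ_subseq_LIMSEQ[OF Z, of "\<lambda>N. 2*N"] by (auto simp: strict_mono_def o_def)
  have eqP: "(s - 1) * P (2*N) = Z (2*N) - 2 powr (1-s) * Z N + (2 powr (1-s) * q N - q (2*N))" for N
  proof -
    have "(s-1) * P (2*N) = (s-1) * (\<Sum>n<2*N. of_nat (Suc n) powr (-s)) - 2 powr (1 - s) * ((s-1) * (\<Sum>n<N. complex_of_nat (Suc n) powr (-s)))"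
      unfolding P_def eta_partial_sum by (simp add: algebra_simps)
    also have "\<dots> = (Z (2*N) - q (2*N)) - 2 powr (1-s) * (Z N - q N)"
      unfolding zeta_partial_sum Z_def q_def by simp
    finally show ?thesis by (simp add: algebra_simps)
  qed
  have q2: "2 powr (1-s) * q N = q (2*N+1)" for N
    unfolding q_def using powr_times_real[of 2 "of_nat (Suc N)" "1-s"] by (simp add: mult.commute algebra_simps)
  \<comment> \<open>This difference is a \<open>zeta_term\<close> up to a multiple of
    \<open>of_nat n powr (-s)\<close>, and both tend to 0.\<close>
  have qd: "(\<lambda>N. q (2*N+1) - q (2*N)) \<longlonglongrightarrow> 0"
  proof -
    have A: "q (2*N+1) - q (2*N) = zeta_term (Suc (2*N)) s - (s-1) * of_nat (Suc (2*N)) powr (-s)" for N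
      by (simp add: q_def zeta_term_def)
    have B: "(\<lambda>n. zeta_term (Suc n) s - (s-1) * of_nat (Suc n) powr (-s)) \<longlonglongrightarrow> 0 - (s-1) * 0"
      using assms by (intro tendsto_intros summable_LIMSEQ_zero zeta_term_summable of_nat_powr_tendsto_0) auto
    show ?thesis unfolding A using LIMSEQ_subseq_LIMSEQ[OF B, of "\<lambda>N. 2*N"]
      by (auto simp: strict_mono_def o_def)
  qed
  have "(\<lambda>N. (s-1) * P (2*N)) \<longlonglongrightarrow> zeta_entire s - 2 powr (1-s) * zeta_entire s + 0"
    unfolding eqP q2 by (intro tendsto_intros Z Z2 qd)
  then have "(\<lambda>N. (s-1) * P (2*N) / (s-1)) \<longlonglongrightarrow> L / (s-1)"
    using s1 by (intro tendsto_intros) (auto simp: L_def algebra_simps)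
  then have ev: "(\<lambda>N. P (2*N)) \<longlonglongrightarrow> L / (s-1)" using s1 by simp
  have "(\<lambda>n. (-1) ^ n * complex_of_nat (Suc n) powr (-s)) \<longlonglongrightarrow> 0"
    by (rule tendsto_norm_zero_cancel)
       (use tendsto_norm_zero[OF of_nat_powr_tendsto_0[of "-s"]] assms in \<open>simp add: norm_mult norm_power\<close>)
  then have t0: "(\<lambda>N. (-1) ^ (2*N) * complex_of_nat (Suc (2*N)) powr (-s)) \<longlonglongrightarrow> 0"
    using LIMSEQ_subseq_LIMSEQ[of _ 0 "\<lambda>N. 2*N"] by (fastforce simp: strict_mono_def o_def)
  have od: "(\<lambda>N. P (2*N+1)) \<longlonglongrightarrow> L / (s-1)"
    using tendsto_add[OF ev t0] by (simp add: P_def)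
  have "P \<longlonglongrightarrow> L / (s-1)"
    by (rule LIMSEQ_even_odd) (use ev od in \<open>simp_all\<close>)
  then have "(\<lambda>n. (-1) ^ n * complex_of_nat (Suc n) powr (-s)) sums (L/(s-1))"
    by (simp add: sums_def P_def)
  then have "dirichlet_eta s = L / (s-1)" by (simp add: dirichlet_eta_def sums_iff)
  then show ?thesis using s1 by (simp add: L_def)
qed

lemma zeta_entire_nonzero_RH:
  assumes "riemann_hypothesis" "1/2 < Re s" "Re s < 1"
  shows "zeta_entire s \<noteq> 0"
proof
  assume "zeta_entire s = 0"
  then have "(s - 1) * dirichlet_eta s = 0" using zeta_entire_eq_eta[of s] assms by simp
  then have "riemann_zeta s = 0" using assms by (auto simp: riemann_zeta_def)
  then show False using assms unfolding riemann_hypothesis_def by force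
qed

section \<open>Dirichlet series\<close>

text \<open>The index starts at 0, but the term for \<open>n = 0\<close> vanishes since \<open>0 powr s = 0\<close>.\<close>
definition dser :: "(nat \<Rightarrow> complex) \<Rightarrow> complex \<Rightarrow> complex" where
  "dser a s = (\<Sum>n. a n * of_nat n powr (-s))"

definition dconv :: "(nat \<Rightarrow> complex) \<Rightarrow> real \<Rightarrow> bool" where
  "dconv a c \<longleftrightarrow> summable (\<lambda>n. norm (a n) * real n powr (-c))"

lemma norm_dser_term: "norm (a n * of_nat n powr (-s) :: complex) = norm (a n) * real n powr (- Re s)"
  by (cases "n = 0") (simp_all add: norm_mult norm_of_nat_powr)

lemma dser_summable: "dconv a (Re s) \<Longrightarrow> summable (\<lambda>n. norm (a n * of_nat n powr (-s)))"
  unfolding norm_dser_term dconv_def .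

lemma dser_sums: "dconv a (Re s) \<Longrightarrow> (\<lambda>n. a n * of_nat n powr (-s)) sums dser a s"
  unfolding dser_def by (rule summable_sums[OF summable_norm_cancel[OF dser_summable]])

lemma norm_dser_le: "dconv a (Re s) \<Longrightarrow> norm (dser a s) \<le> (\<Sum>n. norm (a n) * real n powr (- Re s))"
  unfolding dser_def norm_dser_term[symmetric] by (intro summable_norm dser_summable)

lemma dconv_bounded:
  assumes "\<And>n. norm (a n) \<le> B" "c > 1"
  shows "dconv a c"
  unfolding dconv_def
proof (rule summable_comparison_test'[where N=0])
  show "summable (\<lambda>n. B * real n powr (-c))"
    using assms by (intro summable_mult) (simp add: summable_real_powr_iff)
  show "norm (norm (a n) * real n powr (-c)) \<le> B * real n powr (-c)" for n
    using assms(1)[of n] by (simp add: mult_right_mono)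
qed

lemma dconv_ln:
  assumes "c > 1" "\<And>n. norm (a n) \<le> ln (real n)"
  shows "dconv a c"
  unfolding dconv_def
proof (rule summable_comparison_test'[where N=1])
  define e where "e = (c - 1) / 2"
  have e: "e > 0" using assms by (simp add: e_def)
  show "summable (\<lambda>n. (1/e) * real n powr (-(1+e)))"
    using e by (intro summable_mult) (simp add: summable_real_powr_iff)
  fix n :: nat assume n: "n \<ge> 1"
  have "ln (real n) \<le> real n powr e / e" using ln_powr_bound[of "real n" e] n e by simp
  then have "norm (a n) * real n powr (-c) \<le> real n powr e / e * real n powr (-c)"
    using assms(2)[of n] by (intro mult_right_mono) auto
  also have "\<dots> = (1/e) * real n powr (e - c)" using n by (simp add: powr_diff powr_minus field_simps)
  also have "e - c = -(1+e)" by (simp add: e_def field_simps)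
  finally show "norm (norm (a n) * real n powr (-c)) \<le> (1/e) * real n powr (-(1+e))" by simp
qed

text \<open>Absolute convergence makes the family over pairs summable in every order, so it may be
  regrouped along \<open>n = d * e\<close>. The condition \<open>n > 0\<close> in the coefficient is
  there because every \<open>d\<close> divides 0, which would give an infinite index set.\<close>

lemma dser_mult:
  assumes a: "dconv a (Re s)" and b: "dconv b (Re s)"
  shows "dser a s * dser b s = dser (\<lambda>n. \<Sum>d | d dvd n \<and> n > 0. a d * b (n div d)) s"
proof -
  define A where "A = (\<lambda>n. a n * complex_of_nat n powr (-s))"
  define B where "B = (\<lambda>n. b n * complex_of_nat n powr (-s))"
  define D where "D = (\<lambda>n::nat. {d. d dvd n \<and> n > 0})"
  define P where "P = {0::nat<..} \<times> {0::nat<..}"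
  define sB where "sB = (\<Sum>n. norm (B n))"
  define sA where "sA = (\<Sum>n. norm (A n))"
  have hnA: "((\<lambda>n. norm (A n)) has_sum sA) UNIV" and hnB: "((\<lambda>n. norm (B n)) has_sum sB) UNIV"
    using dser_summable[OF a] dser_summable[OF b] unfolding A_def B_def sA_def sB_def
    by (intro norm_summable_imp_has_sum summable_sums; simp)+
  have hA: "(A has_sum dser a s) UNIV" and hB: "(B has_sum dser b s) UNIV"
    using dser_summable[OF a] dser_summable[OF b] dser_sums[OF a] dser_sums[OF b]
    unfolding A_def B_def by (intro norm_summable_imp_has_sum; simp)+
  have z: "A 0 = 0" "B 0 = 0" by (simp_all add: A_def B_def)
  have "(\<lambda>i. norm (A i) * sB) summable_on UNIV"
    by (rule has_sum_imp_summable[OF has_sum_cmult_left[OF hnA]])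
  then have "(\<lambda>(i,j). norm (A i) * norm (B j)) summable_on UNIV \<times> UNIV"
  proof (rule summable_on_SigmaI[rotated])
    show "((\<lambda>j. case (i, j) of (i, j) \<Rightarrow> norm (A i) * norm (B j)) has_sum (norm (A i) * sB)) UNIV" for i
      using has_sum_cmult_right[OF hnB, of "norm (A i)"] by simp
  qed simp
  then have absP: "(\<lambda>(i,j). A i * B j) summable_on UNIV \<times> UNIV"
    by (rule_tac abs_summable_summable) (simp add: case_prod_unfold norm_mult)
  have "((\<lambda>(i,j). A i * B j) has_sum (dser a s * dser b s)) (UNIV \<times> UNIV)"
  proof (rule has_sum_SigmaI[where g = "\<lambda>i. A i * dser b s"])
    show "((\<lambda>j. case (i, j) of (i, j) \<Rightarrow> A i * B j) has_sum (A i * dser b s)) UNIV" for i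
      using has_sum_cmult_right[OF hB, of "A i"] by simp
    show "((\<lambda>i. A i * dser b s) has_sum (dser a s * dser b s)) UNIV" by (rule has_sum_cmult_left[OF hA])
  qed (rule absP)
  moreover have "((\<lambda>(i,j). A i * B j) has_sum (dser a s * dser b s)) P \<longleftrightarrow>
      ((\<lambda>(i,j). A i * B j) has_sum (dser a s * dser b s)) (UNIV \<times> UNIV)"
  proof (rule has_sum_cong_neutral)
    fix x assume "x \<in> UNIV \<times> UNIV - P"
    then have "fst x = 0 \<or> snd x = 0" by (auto simp: P_def mem_Times_iff)
    then show "(case x of (i,j) \<Rightarrow> A i * B j) = 0" using z by (auto simp: case_prod_unfold)
  qed auto
  moreover have "((\<lambda>(n,d). A d * B (n div d)) has_sum (dser a s * dser b s)) (Sigma UNIV D) \<longleftrightarrow>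
      ((\<lambda>(i,j). A i * B j) has_sum (dser a s * dser b s)) P"
  proof (rule has_sum_reindex_bij_witness[where i = "\<lambda>(i,j). (i*j, i)" and j = "\<lambda>(n,d). (d, n div d)"])
    fix x assume x: "x \<in> Sigma UNIV D"
    obtain n d where nd: "x = (n, d)" "d dvd n" "n > 0" using x by (auto simp: D_def)
    then have "d > 0" "n div d > 0" by (auto intro: Nat.gr0I simp: dvd_div_eq_0_iff)
    then show "(case x of (n, d) \<Rightarrow> (d, n div d)) \<in> P" by (simp add: nd P_def)
  next
    fix x assume "x \<in> P"
    then obtain i j where ij: "x = (i, j)" "i > 0" "j > 0" by (auto simp: P_def)
    then show "(case x of (i, j) \<Rightarrow> (i * j, i)) \<in> Sigma UNIV D"
      "(case case x of (i, j) \<Rightarrow> (i * j, i) of (n, d) \<Rightarrow> (d, n div d)) = x" by (simp_all add: D_def)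
  qed (auto simp: D_def)
  ultimately have "((\<lambda>(n,d). A d * B (n div d)) has_sum (dser a s * dser b s)) (Sigma UNIV D)"
    by simp
  then have "((\<lambda>n. \<Sum>d\<in>D n. A d * B (n div d)) has_sum (dser a s * dser b s)) UNIV"
  proof (rule has_sum_Sigma')
    fix n :: nat
    have "finite (D n)" by (cases "n = 0") (simp_all add: D_def)
    from has_sum_finite[OF this]
    show "((\<lambda>d. case (n, d) of (n, d) \<Rightarrow> A d * B (n div d)) has_sum (\<Sum>d\<in>D n. A d * B (n div d))) (D n)"
      by simp
  qed
  then have "(\<lambda>n. \<Sum>d\<in>D n. A d * B (n div d)) sums (dser a s * dser b s)" by (rule has_sum_imp_sums)
  moreover have "(\<Sum>d\<in>D n. A d * B (n div d)) = (\<Sum>d | d dvd n \<and> n > 0. a d * b (n div d)) * of_nat n powr (-s)" for n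
    unfolding D_def sum_distrib_right
  proof (intro sum.cong refl)
    fix d assume "d \<in> {d. d dvd n \<and> n > 0}"
    then have d: "d dvd n" "n > 0" by auto
    have "complex_of_nat n = of_nat d * of_nat (n div d)" using d by (simp flip: of_nat_mult)
    then have "complex_of_nat n powr (-s) = of_nat d powr (-s) * of_nat (n div d) powr (-s)"
      using powr_times_real[of "of_nat d" "of_nat (n div d)" "-s"] by simp
    then show "A d * B (n div d) = a d * b (n div d) * of_nat n powr (-s)"
      by (simp add: A_def B_def mult_ac)
  qed
  ultimately show ?thesis by (simp add: dser_def sums_iff)
qed

lemma dser_one:
  assumes "Re s > 1" shows "dser (\<lambda>_. 1) s = zeta_entire s / (s - 1)"
proof -
  have "(\<lambda>n. 1 * complex_of_nat n powr (-s)) sums (zeta_entire s / (s - 1))"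
    using zeta_entire_eq_series[OF assms] by (subst (asm) sums_Suc_iff) simp
  then show ?thesis by (simp add: dser_def sums_iff)
qed

text \<open>The term 1/4 is split off and the rest is compared with a telescoping series of sum 1/2.
  What counts is a bound below 1, which keeps \<open>dser (\<lambda>_. 1)\<close> away from 0 for
  \<open>Re s \<ge> 2\<close>.\<close>

lemma inverse_squares_tail: "(\<Sum>n. 1 / real (n + 2)^2) \<le> 3/4" "summable (\<lambda>n. 1 / real (n + 2)^2)"
proof -
  have sm: "summable (\<lambda>n. 1 / real n ^ 2)"
    using inverse_power_summable[of 2, where ?'a = real] by (simp add: field_simps)
  show sm2: "summable (\<lambda>n. 1 / real (n + 2)^2)" using sm summable_iff_shift[of "\<lambda>n. 1 / real n ^ 2" 2] by simp
  have sm3: "summable (\<lambda>n. 1 / real (n + 3)^2)" using sm summable_iff_shift[of "\<lambda>n. 1 / real n ^ 2" 3] by simp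
  have tl: "(\<lambda>n. 1 / real (Suc (Suc n)) - 1 / real (Suc (Suc (Suc n)))) sums (1 / real (Suc (Suc 0)) - 0)"
    by (rule telescope_sums') real_asymp
  have "(\<Sum>n. 1 / real (n + 3)^2) \<le> (\<Sum>n. 1 / real (Suc (Suc n)) - 1 / real (Suc (Suc (Suc n))))"
  proof (intro suminf_le sm3)
    show "summable (\<lambda>n. 1 / real (Suc (Suc n)) - 1 / real (Suc (Suc (Suc n))))" using tl by (simp add: sums_iff)
    fix n
    have "1 / real (n + 3)^2 \<le> 1 / (real (n + 2) * real (n + 3))"
      by (intro divide_left_mono) (auto simp: power2_eq_square)
    also have "\<dots> = 1 / real (Suc (Suc n)) - 1 / real (Suc (Suc (Suc n)))" by (simp add: field_simps)
    finally show "1 / real (n + 3)^2 \<le> 1 / real (Suc (Suc n)) - 1 / real (Suc (Suc (Suc n)))" .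
  qed
  also have "\<dots> = 1/2" using tl by (simp add: sums_iff)
  finally have "(\<Sum>n. 1 / real (n + 3)^2) \<le> 1/2" .
  moreover have "(\<Sum>n. 1 / real (n + 2)^2) = 1/4 + (\<Sum>n. 1 / real (n + 3)^2)"
    using suminf_split_head[OF sm2] by (simp add: numeral_3_eq_3)
  ultimately show "(\<Sum>n. 1 / real (n + 2)^2) \<le> 3/4" by simp
qed

lemma dser_one_near_1:
  assumes "Re s \<ge> 2" shows "norm (dser (\<lambda>_. 1) s - 1) \<le> 3/4"
proof -
  have c: "dconv (\<lambda>_. 1) (Re s)" using assms by (intro dconv_bounded[of _ 1]) auto
  define f where "f = (\<lambda>n. 1 * complex_of_nat n powr (-s))"
  have sm: "f sums dser (\<lambda>_. 1) s" unfolding f_def by (rule dser_sums[OF c])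
  have "(\<lambda>n. f (n + 2)) sums (dser (\<lambda>_. 1) s - (\<Sum>i<2. f i))" using sm by (subst sums_iff_shift) simp
  moreover have "(\<Sum>i<2. f i) = 1" by (simp add: f_def numeral_2_eq_2)
  ultimately have "dser (\<lambda>_. 1) s - 1 = (\<Sum>n. f (n + 2))" by (simp add: sums_iff)
  also have "norm \<dots> \<le> (\<Sum>n. 1 / real (n + 2)^2)"
  proof (rule norm_suminf_le[OF _ inverse_squares_tail(2)])
    fix n
    have "norm (f (n + 2)) = real (n+2) powr (- Re s)"
      using norm_of_nat_powr[of "n+2" "-s"] by (simp add: f_def)
    also have "\<dots> \<le> real (n+2) powr (-2)" using assms by (intro powr_mono) auto
    also have "\<dots> = 1 / real (n+2)^2" by (simp add: powr_minus divide_inverse powr_numeral del: of_nat_add)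
    finally show "norm (f (n + 2)) \<le> 1 / real (n + 2)^2" .
  qed
  finally show ?thesis using inverse_squares_tail(1) by linarith
qed

lemma dser_one_lower: "Re s \<ge> 2 \<Longrightarrow> norm (dser (\<lambda>_. 1) s) \<ge> 1/4"
  using dser_one_near_1[of s] norm_triangle_ineq3[of "dser (\<lambda>_. 1) s" 1] by (simp add: abs_le_iff)

section \<open>The Liouville function and its Dirichlet series\<close>

lemma liouville_mult: "m > 0 \<Longrightarrow> n > 0 \<Longrightarrow> liouville (m * n) = liouville m * liouville n"
  by (simp add: liouville_def prime_factorization_mult power_add)

lemma liouville_prime: "prime p \<Longrightarrow> liouville p = -1"
  by (simp add: liouville_def prime_factorization_prime)

lemma liouville_1 [simp]: "liouville (Suc 0) = 1"
  by (simp add: liouville_def)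

lemma abs_liouville [simp]: "\<bar>liouville n\<bar> = 1"
  by (simp add: liouville_def power_abs)

text \<open>Multiplying or dividing by \<open>p\<close> is a sign-reversing involution on the divisors with
  \<open>p\<close>-multiplicity below the maximum when the multiplicity of \<open>p\<close> in \<open>n\<close> is even, and on
  all divisors when it is odd.\<close>
lemma liouville_divisor_sum_aux:
  assumes p: "prime p" and m: "m > 0" "\<not> p dvd m"
  shows "(\<Sum>d | d dvd p ^ k * m. liouville d) = (if even k then (\<Sum>d | d dvd m. liouville d) else 0)"
proof -
  have cop: "coprime (p ^ i) m" for i using p m by (simp add: prime_imp_coprime)
  have p0: "p > 0" using p prime_gt_0_nat by blast
  have bij: "bij_betw (\<lambda>(i, e). p ^ i * e) ({..k} \<times> {e. e dvd m}) {d. d dvd p ^ k * m}"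
      unfolding bij_betw_def
    proof
      show "inj_on (\<lambda>(i, e). p ^ i * e) ({..k} \<times> {e. e dvd m})"
      proof (rule inj_onI, clarsimp)
        fix i e i' e' assume h: "e dvd m" "e' dvd m" "p ^ i * e = p ^ i' * e'"
        have nd: "\<not> p dvd e" "\<not> p dvd e'" using h m by (auto dest: dvd_trans)
        have e0: "e \<noteq> 0" "e' \<noteq> 0" using h m by auto
        have "multiplicity p (p ^ i * e) = i" "multiplicity p (p ^ i' * e') = i'"
          using p nd e0 p0 by (auto simp: prime_elem_multiplicity_mult_distrib not_dvd_imp_multiplicity_0)
        then have "i = i'" using h by simp
        then show "i = i' \<and> e = e'" using h p0 by simp
      qed
      show "(\<lambda>(i, e). p ^ i * e) ` ({..k} \<times> {e. e dvd m}) = {d. d dvd p ^ k * m}"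
      proof safe
        fix i e assume "i \<le> k" "e dvd m"
        then show "p ^ i * e dvd p ^ k * m" by (intro mult_dvd_mono le_imp_power_dvd)
      next
        fix d assume "d dvd p ^ k * m"
        then obtain b c where bc: "d = b * c" "b dvd p ^ k" "c dvd m" using division_decomp by blast
        then obtain i where "i \<le> k" "b = p ^ i" using divides_primepow_nat[OF p] by auto
        then show "d \<in> (\<lambda>(i, e). p ^ i * e) ` ({..k} \<times> {e. e dvd m})" using bc by force
      qed
    qed
  have "(\<Sum>d | d dvd p ^ k * m. liouville d) = (\<Sum>(i,e)\<in>{..k} \<times> {e. e dvd m}. liouville (p ^ i * e))"
    using sum.reindex_bij_betw[OF bij, of liouville] by (simp add: case_prod_unfold)
  also have "\<dots> = (\<Sum>(i,e)\<in>{..k} \<times> {e. e dvd m}. (-1)^i * liouville e)"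
  proof (intro sum.cong refl, clarsimp)
    fix i e assume "e dvd m"
    then have "e > 0" using m by (auto intro: Nat.gr0I)
    moreover have "liouville (p ^ i) = (-1) ^ i"
      using p p0 by (induction i) (simp_all add: liouville_mult liouville_prime)
    ultimately show "liouville (p ^ i * e) = (-1)^i * liouville e" using p0 by (simp add: liouville_mult)
  qed
  also have "\<dots> = (\<Sum>i\<le>k. (-1)^i) * (\<Sum>e | e dvd m. liouville e)"
    by (simp add: sum_product sum.cartesian_product)
  also have "(\<Sum>i\<le>k. (-1)^i) = (if even k then 1 else (0::int))" by (induction k) auto
  finally show ?thesis by simp
qed

text \<open>Induction strips the full power of one prime: an odd exponent makes the sum vanish, and
  an even exponent changes neither the sum nor whether the number is a square.\<close>

lemma liouville_divisor_sum:
  assumes "n > 0"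
  shows "(\<Sum>d | d dvd n. liouville d) = (if \<exists>m. n = m\<^sup>2 then 1 else 0)"
  using assms
proof (induction n rule: less_induct)
  case (less n)
  show ?case
  proof (cases "n = 1")
    case True
    have "\<exists>m. (1::nat) = m\<^sup>2" by (intro exI[of _ 1]) simp
    then show ?thesis using True by simp
  next
    case False
    then obtain p where p: "prime p" "p dvd n" using prime_factor_nat by blast
    obtain m where km: "n = p ^ multiplicity p n * m" "\<not> p dvd m"
      using multiplicity_decompose'[of n p] less.prems p by (metis gr_implies_not0 not_prime_unit)
    define k where "k = multiplicity p n"
    have k: "n = p ^ k * m" using km by (simp add: k_def)
    have p1: "p > 1" using p prime_gt_1_nat by blast
    have m0: "m > 0" using k less.prems by (auto intro: Nat.gr0I)
    have "k \<noteq> 0" using p k km(2) by (auto intro: Nat.gr0I)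
    then have "p ^ k > 1" using one_less_power[OF p1] by blast
    then have "m < n" using k m0 by simp
    then have IH: "(\<Sum>d | d dvd m. liouville d) = (if \<exists>l. m = l\<^sup>2 then 1 else 0)"
      using less.IH m0 by blast
    have sum: "(\<Sum>d | d dvd n. liouville d) = (if even k then (\<Sum>d | d dvd m. liouville d) else 0)"
      unfolding k by (rule liouville_divisor_sum_aux[OF p(1) m0 km(2)])
    show ?thesis
    proof (cases "even k")
      case True
      then obtain j where j: "k = 2 * j" by (rule evenE)
      have nj: "n = (p ^ j)\<^sup>2 * m" by (simp add: k j power_mult mult.commute)
      have "(\<exists>l. n = l\<^sup>2) \<longleftrightarrow> (\<exists>l. m = l\<^sup>2)"
      proof
        assume "\<exists>l. n = l\<^sup>2"
        then obtain l where l: "n = l\<^sup>2" by blast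
        then have "(p ^ j)\<^sup>2 dvd l\<^sup>2" using nj by (metis dvd_triv_left)
        then have "p ^ j dvd l" by (simp only: pow_divides_pow_iff[of 2])
        then obtain q where "l = p ^ j * q" by (rule dvdE)
        then have "(p ^ j)\<^sup>2 * m = (p ^ j)\<^sup>2 * q\<^sup>2" using nj l by (metis power_mult_distrib)
        moreover have "(p ^ j)\<^sup>2 \<noteq> 0" using p1 by simp
        ultimately have "m = q\<^sup>2" by (metis mult_left_cancel)
        then show "\<exists>l. m = l\<^sup>2" by blast
      next
        assume "\<exists>l. m = l\<^sup>2"
        then show "\<exists>l. n = l\<^sup>2" using nj by (metis power_mult_distrib)
      qed
      then show ?thesis using sum IH True by simp
    next
      case False
      have "\<not> (\<exists>l. n = l\<^sup>2)"
      proof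
        assume "\<exists>l. n = l\<^sup>2"
        then obtain l where l: "n = l\<^sup>2" by blast
        then have "k = 2 * multiplicity p l"
          using p less.prems by (simp add: k_def prime_elem_multiplicity_power_distrib)
        then show False using False by simp
      qed
      then show ?thesis using sum False by simp
    qed
  qed
qed

text \<open>The divisor sums of \<open>liouville\<close> form the indicator of the squares, whose
  series is that of \<open>1\<close> at \<open>2 * s\<close>. This does the work of the infinite
  Euler product: it excludes zeros of zeta for \<open>Re s > 1\<close>, bounds zeta from below
  there, and presents the series of \<open>liouville\<close> as zeta(2s) / zeta(s).\<close>

lemma liouville_dser:
  assumes "Re s > 1"
  shows "dser (\<lambda>n. of_int (liouville n)) s * dser (\<lambda>_. 1) s = dser (\<lambda>_. 1) (2 * s)"
proof -
  have cl: "dconv (\<lambda>n. of_int (liouville n)) (Re s)"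
    using assms by (intro dconv_bounded[of _ 1]) (auto simp flip: of_int_abs)
  have c1: "dconv (\<lambda>_. 1) (Re s)" "dconv (\<lambda>_. 1) (Re (2 * s))"
    using assms by (intro dconv_bounded[of _ 1]; simp)+
  have eq: "(\<Sum>d | d dvd n \<and> n > 0. of_int (liouville d) * (1::complex)) = of_bool (n > 0 \<and> (\<exists>m. n = m\<^sup>2))" for n
  proof (cases "n > 0")
    case True
    have "(\<Sum>d | d dvd n. of_int (liouville d) :: complex) = of_int (\<Sum>d | d dvd n. liouville d)" by simp
    also have "\<dots> = of_bool (\<exists>m. n = m\<^sup>2)" unfolding liouville_divisor_sum[OF True] by simp
    finally show ?thesis using True by simp
  qed simp
  define f where "f = (\<lambda>n. of_bool (n > 0 \<and> (\<exists>m. n = m\<^sup>2)) * complex_of_nat n powr (-s))"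
  define g where "g = (\<lambda>n::nat. 1 * complex_of_nat n powr (-(2 * s)))"
  define w where "w = dser (\<lambda>_. 1) (2 * s)"
  have "(g has_sum w) UNIV"
    unfolding g_def w_def by (intro norm_summable_imp_has_sum dser_summable dser_sums c1)
  then have "(g has_sum w) {0<..}"
    by (subst has_sum_cong_neutral[where T = UNIV and g = g]) (auto simp: g_def)
  moreover have inj: "inj_on (\<lambda>m::nat. m\<^sup>2) {0<..}" by (auto intro!: inj_onI simp: power2_eq_iff_nonneg)
  moreover have "f (m\<^sup>2) = g m" if "m \<in> {0<..}" for m :: nat
  proof -
    have "complex_of_nat (m\<^sup>2) powr (-s) = of_nat m powr (-(2 * s))"
    proof -
      have "complex_of_nat (m\<^sup>2) powr (-s) = of_nat m powr (-s) * of_nat m powr (-s)"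
        using powr_times_real[of "of_nat m" "of_nat m" "-s"] by (simp add: power2_eq_square)
      also have "\<dots> = of_nat m powr (-s + -s)" by (rule powr_add[symmetric])
      also have "-s + -s = -(2 * s)" by simp
      finally show ?thesis .
    qed
    moreover have "\<exists>l. m\<^sup>2 = l\<^sup>2" by blast
    ultimately show ?thesis using that by (simp add: f_def g_def)
  qed
  ultimately have "(f has_sum w) ((\<lambda>m. m\<^sup>2) ` {0<..})"
    using has_sum_cong[of "{0<..}" "\<lambda>m. f (m\<^sup>2)" g w] by (subst has_sum_reindex) (simp_all add: o_def)
  moreover have "(f has_sum w) ((\<lambda>m. m\<^sup>2) ` {0<..}) \<longleftrightarrow> (f has_sum w) UNIV"
    by (rule has_sum_cong_neutral) (auto simp: f_def)
  ultimately have "(f has_sum w) UNIV" by simp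
  then have "f sums dser (\<lambda>_. 1) (2 * s)" unfolding w_def by (rule has_sum_imp_sums)
  then have 1: "suminf f = dser (\<lambda>_. 1) (2 * s)" using sums_unique by metis
  have "dser (\<lambda>n. of_bool (n > 0 \<and> (\<exists>m. n = m\<^sup>2))) s = suminf f"
    by (simp only: f_def dser_def)
  also note 1
  finally have 2: "dser (\<lambda>n. of_bool (n > 0 \<and> (\<exists>m. n = m\<^sup>2))) s = dser (\<lambda>_. 1) (2 * s)" .
  have "dser (\<lambda>n. of_int (liouville n)) s * dser (\<lambda>_. 1) s = dser (\<lambda>n. of_bool (n > 0 \<and> (\<exists>m. n = m\<^sup>2))) s"
    unfolding dser_mult[OF cl c1(1)] eq ..
  with 2 show ?thesis by (rule trans[rotated])
qed

lemma dser_one_nonzero: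
  assumes "Re s > 1" shows "dser (\<lambda>_. 1) s \<noteq> 0"
  using liouville_dser[OF assms] dser_one_lower[of "2 * s"] assms by auto

text \<open>By \<open>liouville_dser\<close> the value is
  \<open>dser (\<lambda>_. 1) (2 * s)\<close> divided by the Liouville series. The former is at
  least 1/4 in modulus because \<open>Re (2 * s) \<ge> 2\<close>, the latter is at most the sum of
  \<open>n powr (-c)\<close>.\<close>

lemma dser_one_lower':
  assumes "c > 1"
  obtains B where "B > 0" "\<And>s. Re s \<ge> c \<Longrightarrow> norm (dser (\<lambda>_. 1) s) \<ge> B"
proof
  define A where "A = (\<Sum>n. real n powr (-c)) + 1"
  have sm: "summable (\<lambda>n. real n powr (-c))" using assms by (simp add: summable_real_powr_iff)
  have A: "A > 0" unfolding A_def using suminf_nonneg[OF sm] by force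
  then show "1 / (4 * A) > 0" by simp
  fix s :: complex assume s: "Re s \<ge> c"
  have cl: "dconv (\<lambda>n. of_int (liouville n)) (Re s)"
    using assms s by (intro dconv_bounded[of _ 1]) (auto simp flip: of_int_abs)
  have "norm (dser (\<lambda>n. of_int (liouville n)) s) \<le> (\<Sum>n. norm (of_int (liouville n) :: complex) * real n powr (- Re s))"
    by (rule norm_dser_le[OF cl])
  also have "\<dots> \<le> (\<Sum>n. real n powr (-c))"
  proof (rule suminf_le[OF _ _ sm])
    show "norm (of_int (liouville n) :: complex) * real n powr (- Re s) \<le> real n powr (-c)" for n
      using s by (cases "n = 0") (auto intro!: powr_mono simp flip: of_int_abs)
    show "summable (\<lambda>n. norm (of_int (liouville n) :: complex) * real n powr (- Re s))" using cl by (simp add: dconv_def)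
  qed
  finally have le: "norm (dser (\<lambda>n. of_int (liouville n)) s) \<le> A" by (simp add: A_def)
  have "1/4 \<le> norm (dser (\<lambda>_. 1) (2 * s))" using assms s by (intro dser_one_lower) auto
  also have "\<dots> = norm (dser (\<lambda>n. of_int (liouville n)) s) * norm (dser (\<lambda>_. 1) s)"
    using liouville_dser[of s] assms s by (simp flip: norm_mult)
  also have "\<dots> \<le> A * norm (dser (\<lambda>_. 1) s)" using le by (intro mult_right_mono) auto
  finally show "1 / (4 * A) \<le> norm (dser (\<lambda>_. 1) s)" using A by (simp add: field_simps)
qed

section \<open>The logarithmic derivative of zeta\<close>

lemma dser_one_deriv:
  assumes "Re s > 1"
  shows "(dser (\<lambda>_. 1) has_field_derivative - dser (\<lambda>n. of_real (ln (real n))) s) (at s)"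
proof -
  define S where "S = {s :: complex. Re s > 1}"
  have op: "open S" by (simp add: S_def open_halfspace_Re_gt)
  define f where "f = (\<lambda>n s. 1 * complex_of_nat n powr (-s))"
  define f' where "f' = (\<lambda>n s. - (of_real (ln (real n)) * complex_of_nat n powr (-s)))"
  have "\<exists>g g'. \<forall>x\<in>S. (\<lambda>n. f n x) sums g x \<and> (\<lambda>n. f' n x) sums g' x \<and> (g has_field_derivative g' x) (at x)"
  proof (rule series_and_derivative_comparison_complex[OF op])
    fix n x assume "x \<in> S"
    show "(f n has_field_derivative f' n x) (at x)"
    proof (cases "n = 0")
      case False
      then have "((\<lambda>s. complex_of_nat n powr (-s)) has_field_derivative
          Ln (of_nat n) * of_nat n powr (-x) * (-1)) (at x)"
        by (intro DERIV_chain2[OF has_field_derivative_powr_right]) (auto intro!: derivative_eq_intros)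
      then show ?thesis using False unfolding f_def f'_def by (simp add: Ln_of_nat)
    qed (simp add: f_def f'_def)
  next
    fix x assume "x \<in> S"
    then have x: "Re x > 1" by (simp add: S_def)
    define d where "d = (Re x - 1) / 2"
    have d: "d > 0" using x by (simp add: d_def)
    define h where "h = (\<lambda>n. complex_of_real (real n powr (-(1+d))))"
    have "summable (\<lambda>n. real n powr (-(1+d)))" using d by (subst summable_real_powr_iff) auto
    then have "summable h" unfolding h_def by (subst summable_of_real_iff)
    moreover have "range h \<subseteq> \<real>\<^sub>\<ge>\<^sub>0" by (auto simp: h_def nonneg_Reals_of_real_iff)
    moreover have "norm (f n y) \<le> norm (h n)" if y: "y \<in> ball x d" for n y
    proof (cases "n = 0")
      case False
      have "\<bar>Re (y - x)\<bar> \<le> norm (y - x)" by (rule abs_Re_le_cmod)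
      then have "Re y \<ge> 1 + d" using y by (auto simp: d_def abs_le_iff dist_norm norm_minus_commute field_simps)
      then have "real n powr (- Re y) \<le> real n powr (-(1+d))" using False by (intro powr_mono) auto
      then show ?thesis using False unfolding h_def norm_of_real f_def by (simp add: norm_of_nat_powr)
    qed (simp add: f_def h_def)
    ultimately show "\<exists>d (h :: nat \<Rightarrow> complex). 0 < d \<and> summable h \<and> range h \<subseteq> \<real>\<^sub>\<ge>\<^sub>0 \<and>
       (\<forall>\<^sub>F n in sequentially. \<forall>y\<in>ball x d \<inter> S. norm (f n y) \<le> norm (h n))"
      using d by (intro exI[of _ d] exI[of _ h] conjI) (simp_all add: always_eventually)
  qed
  then obtain g g' where g: "\<And>x. x \<in> S \<Longrightarrow> (\<lambda>n. f n x) sums g x" "\<And>x. x \<in> S \<Longrightarrow> (\<lambda>n. f' n x) sums g' x"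
     "\<And>x. x \<in> S \<Longrightarrow> (g has_field_derivative g' x) (at x)" by blast
  have s: "s \<in> S" using assms by (simp add: S_def)
  have cln: "dconv (\<lambda>n. of_real (ln (real n))) (Re s)" if "s \<in> S" for s
  proof (rule dconv_ln)
    show "norm (complex_of_real (ln (real n))) \<le> ln (real n)" for n
      by (cases "n = 0") (simp_all only: norm_of_real, auto)
  qed (use that in \<open>simp add: S_def\<close>)
  have "g x = dser (\<lambda>_. 1) x" if "x \<in> S" for x
    using g(1)[OF that] by (simp add: dser_def f_def sums_iff)
  moreover have "g' s = - dser (\<lambda>n. of_real (ln (real n))) s"
    using g(2)[OF s] sums_minus[OF dser_sums[OF cln[OF s]]] unfolding f'_def by (rule sums_unique2)
  ultimately show ?thesis
    using has_field_derivative_transform_within_open[OF g(3)[OF s] op s, of "dser (\<lambda>_. 1)"] by simp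
qed

lemma dconv_mangoldt: "c > 1 \<Longrightarrow> dconv mangoldt c"
proof (rule dconv_ln)
  fix n :: nat
  show "norm (mangoldt n :: complex) \<le> ln (real n)"
  proof (cases "n = 0")
    case False
    have "mangoldt n \<le> (\<Sum>d | d dvd n. mangoldt d :: real)"
      by (rule member_le_sum[of n "{d. d dvd n}" mangoldt]) (use False in \<open>simp_all add: mangoldt_nonneg\<close>)
    then show ?thesis using mangoldt_sum[OF False, where ?'a = real] by simp
  qed simp
qed

text \<open>The convolution of \<open>mangoldt\<close> with 1 is the logarithm, whose series is
  minus the derivative of zeta. Writing zeta as \<open>zeta_entire s / (s - 1)\<close> separates the
  pole from a term that is holomorphic away from the zeros; in \<open>mangoldt_hat_bound\<close> the
  two are integrated along different lines.\<close>

lemma mangoldt_dser: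
  assumes "Re s > 1"
  shows "dser mangoldt s = 1 / (s - 1) - deriv zeta_entire s / zeta_entire s"
proof -
  have s1: "s \<noteq> 1" using assms by auto
  have c1: "dconv (\<lambda>_. 1) (Re s)" using assms by (intro dconv_bounded[of _ 1]) auto
  have ln: "dser (\<lambda>n. of_real (ln (real n))) s = dser mangoldt s * dser (\<lambda>_. 1) s"
  proof -
    have "(\<Sum>d | d dvd n \<and> n > 0. mangoldt d * 1) * of_nat n powr (-s) = complex_of_real (ln (real n)) * of_nat n powr (-s)" for n
      using mangoldt_sum[of n, where ?'a = complex] by (cases "n = 0") simp_all
    then show ?thesis by (subst dser_mult[OF dconv_mangoldt[OF assms] c1]) (simp only: dser_def)
  qed
  have nz: "dser (\<lambda>_. 1) s \<noteq> 0" by (rule dser_one_nonzero[OF assms])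
  have Zs: "zeta_entire s \<noteq> 0" using nz dser_one[OF assms] by auto
  have op: "open {s. Re s > 1}" by (simp add: open_halfspace_Re_gt)
  have "(zeta_entire has_field_derivative deriv zeta_entire s) (at s)"
    using assms by (intro holomorphic_derivI[OF zeta_entire_holomorphic]) (auto simp: open_halfspace_Re_gt)
  then have "((\<lambda>s. zeta_entire s / (s - 1)) has_field_derivative
      (deriv zeta_entire s * (s - 1) - zeta_entire s) / ((s - 1) * (s - 1))) (at s)"
    using s1 by (auto intro!: derivative_eq_intros)
  then have "(dser (\<lambda>_. 1) has_field_derivative
      (deriv zeta_entire s * (s - 1) - zeta_entire s) / ((s - 1) * (s - 1))) (at s)"
    by (rule has_field_derivative_transform_within_open[OF _ op]) (use assms dser_one in auto)
  then have "(deriv zeta_entire s * (s - 1) - zeta_entire s) / ((s - 1) * (s - 1)) = - (dser mangoldt s * (zeta_entire s / (s - 1)))"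
    using DERIV_unique[OF dser_one_deriv[OF assms]] ln dser_one[OF assms] by simp
  then have "(deriv zeta_entire s * (s - 1) - zeta_entire s) = - (dser mangoldt s * (zeta_entire s / (s - 1))) * ((s - 1) * (s - 1))"
    using s1 by (simp add: nonzero_divide_eq_eq)
  also have "\<dots> = - (dser mangoldt s * zeta_entire s * (s - 1))" using s1 by simp
  finally have "dser mangoldt s * (zeta_entire s * (s - 1)) = zeta_entire s - deriv zeta_entire s * (s - 1)"
    by (simp add: algebra_simps)
  then have "dser mangoldt s = (zeta_entire s - deriv zeta_entire s * (s - 1)) / (zeta_entire s * (s - 1))"
    using Zs s1 by (subst nonzero_eq_divide_eq) auto
  then show ?thesis using Zs s1 by (simp add: diff_divide_distrib)
qed

section \<open>Zero-free region and bounds for the logarithm of zeta\<close>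

text \<open>\<open>Re u < M\<close> says that \<open>u\<close> is closer to 0 than to
  \<open>2 * M\<close>, so \<open>g / (2 * M - g)\<close> maps the disc into the unit disc and
  vanishes at the centre. The Schwarz lemma bounds this quotient, and solving for \<open>g\<close>
  gives the claim.\<close>

lemma borel_caratheodory:
  assumes hol: "g holomorphic_on ball a R" and less: "\<And>w. w \<in> ball a R \<Longrightarrow> Re (g w) < M"
    and ga: "g a = 0" and z: "dist a z \<le> r" and r: "r < R"
  shows "norm (g z) \<le> 2 * M * r / (R - r)"
proof -
  have r0: "0 \<le> r" using z zero_le_dist[of a z] by linarith
  have R: "R > 0" using r r0 by simp
  have M: "M > 0" using less[of a] R ga by simp
  define \<phi> where "\<phi> = (\<lambda>w. g (a + of_real R * w) / (2 * of_real M - g (a + of_real R * w)))"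
  have inb: "a + of_real R * w \<in> ball a R" if "norm w < 1" for w
    using that R by (simp add: dist_norm norm_mult)
  have ne: "2 * of_real M - g (a + of_real R * w) \<noteq> 0" if "norm w < 1" for w
  proof
    assume "2 * of_real M - g (a + of_real R * w) = 0"
    then have "Re (g (a + of_real R * w)) = 2 * M" by (simp add: complex_eq_iff)
    then show False using less[OF inb[OF that]] M by simp
  qed
  have hol\<phi>: "\<phi> holomorphic_on ball 0 1"
    unfolding \<phi>_def
  proof (intro holomorphic_intros)
    show "(\<lambda>w. g (a + of_real R * w)) holomorphic_on ball 0 1"
      using hol inb by (intro holomorphic_on_compose_gen[of "\<lambda>w. a + of_real R * w" _ g "ball a R", unfolded o_def]
          holomorphic_intros) auto
    then show "(\<lambda>w. g (a + of_real R * w)) holomorphic_on ball 0 1" .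
  qed (use ne in auto)
  have lt1: "norm (\<phi> w) < 1" if w: "norm w < 1" for w
  proof -
    define u where "u = g (a + of_real R * w)"
    have Re: "Re u < M" unfolding u_def by (rule less[OF inb[OF w]])
    have "(norm u)\<^sup>2 < (norm (2 * of_real M - u))\<^sup>2"
    proof -
      have "(norm (2 * of_real M - u))\<^sup>2 - (norm u)\<^sup>2 = 4 * M * (M - Re u)"
        unfolding cmod_power2 by (simp add: power2_eq_square algebra_simps)
      also have "\<dots> > 0" using Re M by simp
      finally show ?thesis by simp
    qed
    then have "norm u < norm (2 * of_real M - u)" by (rule power2_less_imp_less) simp
    then show ?thesis unfolding \<phi>_def u_def[symmetric] by (simp add: norm_divide divide_less_eq_1)
  qed
  define w where "w = (z - a) / of_real R"
  have nw: "norm w = dist a z / R" using R by (simp add: w_def norm_divide dist_norm norm_minus_commute)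
  have w1: "norm w < 1" using nw z r R by simp
  have "norm (\<phi> w) \<le> norm w"
    by (rule Schwarz_Lemma(1)[OF hol\<phi> _ lt1 w1]) (simp_all add: \<phi>_def ga)
  moreover have "a + of_real R * w = z" using R by (simp add: w_def)
  ultimately have "norm (g z) \<le> norm w * norm (2 * of_real M - g z)"
    using ne[OF w1] by (simp add: \<phi>_def norm_divide divide_le_eq)
  also have "\<dots> \<le> (r / R) * (2 * M + norm (g z))"
  proof (rule mult_mono)
    show "norm w \<le> r / R" using nw z R by (simp add: divide_right_mono)
    show "norm (2 * of_real M - g z) \<le> 2 * M + norm (g z)"
      using norm_triangle_ineq4[of "2 * of_real M" "g z"] M by (simp add: norm_mult)
  qed (use r0 R in auto)
  finally have "norm (g z) * R \<le> r * (2 * M + norm (g z))" using R by (simp add: field_simps)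
  then have "norm (g z) * (R - r) \<le> 2 * M * r" by (simp add: algebra_simps)
  then show ?thesis using r by (simp add: pos_le_divide_eq)
qed

text \<open>Without zeros \<open>f w / f a\<close> has a logarithm \<open>G\<close> with
  \<open>G a = 0\<close>, and the growth of \<open>f\<close> bounds its real part from above.
  Borel--Caratheodory turns this into a bound for the modulus of \<open>G\<close>, hence a lower
  bound for \<open>f\<close>; Cauchy's inequality for \<open>G\<close> gives the logarithmic
  derivative.\<close>

lemma log_bounds_of_growth:
  assumes hol: "f holomorphic_on ball a R" and nz: "\<And>w. w \<in> ball a R \<Longrightarrow> f w \<noteq> 0"
    and le: "\<And>w. w \<in> ball a R \<Longrightarrow> norm (f w) < exp M * norm (f a)"
    and z: "dist a z \<le> r" and r: "r < R"
  shows "norm (f z) \<ge> norm (f a) * exp (- (2 * M * r / (R - r)))"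
    and "norm (deriv f z / f z) \<le> 8 * M * R / (R - r)\<^sup>2"
proof -
  have r0: "0 \<le> r" using z zero_le_dist[of a z] by linarith
  have R: "R > 0" using r r0 by simp
  have fa: "f a \<noteq> 0" using nz[of a] R by simp
  have "convex (ball a R)" "open (ball a R)" "a \<in> ball a R" using R by auto
  then obtain g where g: "g holomorphic_on ball a R" "\<And>w. w \<in> ball a R \<Longrightarrow> exp (g w) = f w"
    using holomorphic_logarithm_exists[OF _ _ hol nz] by (metis (no_types, lifting))
  define G where "G = (\<lambda>w. g w - g a)"
  have holG: "G holomorphic_on ball a R" unfolding G_def by (intro holomorphic_intros g)
  have expG: "exp (G w) = f w / f a" if "w \<in> ball a R" for w
    using that g(2)[of w] g(2)[of a] R by (simp add: G_def exp_diff)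
  have ReG: "Re (G w) < M" if w: "w \<in> ball a R" for w
  proof -
    have "exp (Re (G w)) = norm (f w) / norm (f a)"
      using expG[OF w] by (metis norm_divide norm_exp_eq_Re)
    also have "\<dots> < exp M" using le[OF w] fa by (simp add: divide_less_eq)
    finally show ?thesis by simp
  qed
  have Ga: "G a = 0" by (simp add: G_def)
  have M: "M > 0" using ReG[of a] R Ga by simp
  have bound: "norm (G w) \<le> 2 * M * \<rho> / (R - \<rho>)" if "dist a w \<le> \<rho>" "\<rho> < R" for w \<rho>
    by (rule borel_caratheodory[OF holG ReG Ga that])
  have zb: "z \<in> ball a R" using z r by simp
  have "norm (f z) = norm (f a) * exp (Re (G z))"
    using expG[OF zb] fa by (metis norm_divide norm_exp_eq_Re nonzero_mult_div_cancel_left norm_eq_zero times_divide_eq_right)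
  moreover have "Re (G z) \<ge> - (2 * M * r / (R - r))"
    using bound[OF z r] abs_Re_le_cmod[of "G z"] by linarith
  ultimately show "norm (f z) \<ge> norm (f a) * exp (- (2 * M * r / (R - r)))"
    by (simp add: mult_left_mono)
  \<comment> \<open>Half of the distance to the boundary: the circle around \<open>z\<close> then
    stays at distance at least \<open>\<rho>\<close> from it, and both losses combine to
    \<open>(R - r)\<^sup>2\<close>.\<close>
  define \<rho> where "\<rho> = (R - r) / 2"
  have \<rho>: "\<rho> > 0" using r by (simp add: \<rho>_def)
  have sub: "cball z \<rho> \<subseteq> ball a R"
  proof
    fix w assume "w \<in> cball z \<rho>"
    then have "dist a w \<le> r + \<rho>" using z dist_triangle[of a w z] by simp
    then show "w \<in> ball a R" using r by (simp add: \<rho>_def field_simps)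
  qed
  have "norm ((deriv ^^ 1) G z) \<le> fact 1 * (4 * M * R / (R - r)) / \<rho> ^ 1"
  proof (rule Cauchy_inequality[OF _ _ \<rho>])
    show "G holomorphic_on ball z \<rho>" by (rule holomorphic_on_subset[OF holG]) (use sub ball_subset_cball in blast)
    show "continuous_on (cball z \<rho>) G" using holG sub
      by (meson continuous_on_subset holomorphic_on_imp_continuous_on)
    fix w assume w: "norm (z - w) = \<rho>"
    have "dist a w \<le> (R + r) / 2" using z dist_triangle[of a w z] w by (simp add: dist_norm \<rho>_def field_simps)
    moreover have "(R + r) / 2 < R" using r by simp
    ultimately have "norm (G w) \<le> 2 * M * ((R + r) / 2) / (R - (R + r) / 2)" by (rule bound)
    also have "\<dots> = 2 * M * (R + r) / (R - r)" using r by (simp add: field_simps)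
    also have "\<dots> \<le> 4 * M * R / (R - r)" using r M by (intro divide_right_mono) (auto simp: algebra_simps)
    finally show "norm (G w) \<le> 4 * M * R / (R - r)" .
  qed
  also have "fact 1 * (4 * M * R / (R - r)) / \<rho> ^ 1 = 8 * M * R / (R - r)\<^sup>2"
    using r by (simp add: \<rho>_def power2_eq_square)
  finally have dG: "norm (deriv G z) \<le> 8 * M * R / (R - r)\<^sup>2" by simp
  have "(G has_field_derivative deriv G z) (at z)"
    by (rule holomorphic_derivI[OF holG _ zb]) simp
  then have "((\<lambda>w. f a * exp (G w)) has_field_derivative f a * (exp (G z) * deriv G z)) (at z)"
    by (auto intro!: derivative_eq_intros)
  then have "(f has_field_derivative f a * (exp (G z) * deriv G z)) (at z)"
    by (rule has_field_derivative_transform_within_open[OF _ open_ball zb]) (simp add: expG fa)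
  then have "deriv f z = f z * deriv G z" using expG[OF zb] fa by (simp add: DERIV_imp_deriv)
  then have "deriv f z / f z = deriv G z" using nz[OF zb] by simp
  then show "norm (deriv f z / f z) \<le> 8 * M * R / (R - r)\<^sup>2" using dG by simp
qed

section \<open>Non-vanishing on the line of real part 1\<close>

lemma Re_dser_mangoldt:
  assumes "\<sigma> > 1"
  shows "(\<lambda>n. mangoldt n * real n powr (-\<sigma>) * cos (t * ln (real n))) sums Re (dser mangoldt (Complex \<sigma> t))"
proof -
  have "(\<lambda>n. mangoldt n * of_nat n powr (- Complex \<sigma> t)) sums dser mangoldt (Complex \<sigma> t)"
    using assms by (intro dser_sums dconv_mangoldt) simp
  then have "(\<lambda>n. Re (mangoldt n * of_nat n powr (- Complex \<sigma> t))) sums Re (dser mangoldt (Complex \<sigma> t))"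
    by (rule sums_Re)
  moreover have "Re (mangoldt n * of_nat n powr (- Complex \<sigma> t)) = mangoldt n * real n powr (-\<sigma>) * cos (t * ln (real n))" for n
  proof (cases "n = 0")
    case False
    have "complex_of_nat n powr (- Complex \<sigma> t) = exp (of_real (- \<sigma> * ln (real n)) + \<i> * of_real (- t * ln (real n)))"
      using False by (simp add: powr_def Ln_of_nat complex_eq_iff Re_exp Im_exp)
    also have "Re \<dots> = real n powr (-\<sigma>) * cos (t * ln (real n))"
      using False by (simp add: Re_exp powr_def)
    finally have "Re (complex_of_nat n powr (- Complex \<sigma> t)) = real n powr (-\<sigma>) * cos (t * ln (real n))" .
    then show ?thesis by simp
  qed simp
  ultimately show ?thesis by (simp only:)
qed

text \<open>The classical inequality \<open>3 + 4 * cos x + cos (2 * x) = 2 * (1 + cos x)\<^sup>2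
  \<ge> 0\<close>, summed over \<open>x = t * ln n\<close> with nonnegative weights.\<close>

lemma mangoldt_3_4_1:
  assumes "\<sigma> > 1"
  shows "3 * Re (dser mangoldt (Complex \<sigma> 0)) + 4 * Re (dser mangoldt (Complex \<sigma> t)) + Re (dser mangoldt (Complex \<sigma> (2 * t))) \<ge> 0"
proof -
  define a where "a = (\<lambda>n. mangoldt n * real n powr (-\<sigma>))"
  have "(\<lambda>n. 3 * (a n * cos (0 * ln (real n))) + 4 * (a n * cos (t * ln (real n))) + a n * cos (2 * t * ln (real n))) sums
     (3 * Re (dser mangoldt (Complex \<sigma> 0)) + 4 * Re (dser mangoldt (Complex \<sigma> t)) + Re (dser mangoldt (Complex \<sigma> (2 * t))))"
    unfolding a_def by (intro sums_add sums_mult Re_dser_mangoldt assms)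
  moreover have "0 \<le> 3 * (a n * cos (0 * ln (real n))) + 4 * (a n * cos (t * ln (real n))) + a n * cos (2 * t * ln (real n))" for n
  proof -
    have "a n \<ge> 0" by (simp add: a_def mangoldt_nonneg)
    moreover have "3 * (a n * cos (0 * ln (real n))) + 4 * (a n * cos (t * ln (real n))) + a n * cos (2 * t * ln (real n)) = a n * (2 * (1 + cos (t * ln (real n)))\<^sup>2)"
    proof -
      have c: "cos (2 * t * ln (real n)) = 2 * (cos (t * ln (real n)))\<^sup>2 - 1"
        using cos_double_cos[of "t * ln (real n)"] by (simp only: mult.assoc)
      show ?thesis unfolding c by (simp add: power2_eq_square algebra_simps)
    qed
    ultimately show ?thesis by simp
  qed
  ultimately show ?thesis by (rule sums_le[OF _ sums_zero, rotated])
qed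

text \<open>The limit is the order of vanishing at \<open>Complex 1 t\<close>: in
  \<open>f w = (w - \<xi>) ^ n * g w\<close> the factor \<open>g\<close> contributes nothing after
  multiplication by \<open>\<sigma> - 1\<close>. Non-constancy makes the order finite.\<close>

lemma logderiv_at_zero_limit:
  assumes "f holomorphic_on S" "open S" "connected S" "Complex 1 t \<in> S" "\<not> f constant_on S"
  shows "\<exists>n::nat. (n > 0 \<longleftrightarrow> f (Complex 1 t) = 0) \<and>
    ((\<lambda>\<sigma>. of_real (\<sigma> - 1) * (deriv f (Complex \<sigma> t) / f (Complex \<sigma> t))) \<longlongrightarrow> of_nat n) (at_right 1)"
proof -
  define \<xi> where "\<xi> = Complex 1 t"
  have lim: "((\<lambda>\<sigma>. Complex \<sigma> t) \<longlongrightarrow> \<xi>) (at_right 1)"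
    unfolding \<xi>_def by (intro tendsto_Complex tendsto_intros)
  have lim0: "((\<lambda>\<sigma>. complex_of_real (\<sigma> - 1)) \<longlongrightarrow> of_real (1 - 1)) (at_right 1)"
    by (intro tendsto_intros)
  have key: "((\<lambda>\<sigma>. of_real (\<sigma> - 1) * (deriv g (Complex \<sigma> t) / g (Complex \<sigma> t))) \<longlongrightarrow> 0) (at_right 1)"
    if g: "g holomorphic_on ball \<xi> r" "r > 0" "g \<xi> \<noteq> 0" for g r
  proof -
    have hd: "deriv g holomorphic_on ball \<xi> r" using g by (intro holomorphic_deriv) auto
    have "isCont g \<xi>" "isCont (deriv g) \<xi>"
      using g hd by (auto intro!: continuous_on_interior[of "ball \<xi> r"] holomorphic_on_imp_continuous_on)
    then have "((\<lambda>\<sigma>. of_real (\<sigma> - 1) * (deriv g (Complex \<sigma> t) / g (Complex \<sigma> t))) \<longlongrightarrow> of_real (1-1) * (deriv g \<xi> / g \<xi>)) (at_right 1)"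
      using g by (intro tendsto_mult tendsto_divide lim0 isCont_tendsto_compose[OF _ lim]) auto
    then show ?thesis by simp
  qed
  show ?thesis
  proof (cases "f \<xi> = 0")
    case False
    obtain r where "r > 0" "ball \<xi> r \<subseteq> S" using assms(2,4) unfolding \<xi>_def by (meson openE)
    then have "((\<lambda>\<sigma>. of_real (\<sigma> - 1) * (deriv f (Complex \<sigma> t) / f (Complex \<sigma> t))) \<longlongrightarrow> 0) (at_right 1)"
      using False assms(1) by (intro key[of f r]) (auto intro: holomorphic_on_subset)
    then show ?thesis using False by (intro exI[of _ 0]) (auto simp: \<xi>_def)
  next
    case True
    show ?thesis
    proof (rule holomorphic_factor_zero_nonconstant[OF assms(1-3) assms(4)[folded \<xi>_def] True assms(5)])
    fix g r n assume g: "0 < n" "0 < r" "ball \<xi> r \<subseteq> S" "g holomorphic_on ball \<xi> r"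
       "\<And>w. w \<in> ball \<xi> r \<Longrightarrow> f w = (w - \<xi>)^n * g w" "\<And>w. w \<in> ball \<xi> r \<Longrightarrow> g w \<noteq> 0"
    have "((\<lambda>\<sigma>. of_nat n + of_real (\<sigma> - 1) * (deriv g (Complex \<sigma> t) / g (Complex \<sigma> t))) \<longlongrightarrow> of_nat n + 0) (at_right 1)"
      using g by (intro tendsto_add tendsto_const key[of g r]) auto
    moreover have "\<forall>\<^sub>F \<sigma> in at_right 1. of_real (\<sigma> - 1) * (deriv f (Complex \<sigma> t) / f (Complex \<sigma> t)) =
         of_nat n + of_real (\<sigma> - 1) * (deriv g (Complex \<sigma> t) / g (Complex \<sigma> t))"
    proof -
      have "\<forall>\<^sub>F \<sigma> in at_right 1. \<sigma> \<in> {1<..<1+r}" using g(2) by (intro eventually_at_right_real) simp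
      then show ?thesis
      proof eventually_elim
        case (elim \<sigma>)
        define w where "w = Complex \<sigma> t"
        have wx: "w - \<xi> = of_real (\<sigma> - 1)" by (simp add: w_def \<xi>_def complex_eq_iff)
        have wx0: "w - \<xi> \<noteq> 0" using elim unfolding wx by (simp add: complex_eq_iff)
        have wb: "w \<in> ball \<xi> r"
        proof -
          have "norm (w - \<xi>) = \<bar>\<sigma> - 1\<bar>" unfolding wx by (rule norm_of_real)
          then show ?thesis using elim by (simp add: dist_norm norm_minus_commute)
        qed
        have "(g has_field_derivative deriv g w) (at w)" by (rule holomorphic_derivI[OF g(4) _ wb]) simp
        then have "((\<lambda>w. (w - \<xi>)^n * g w) has_field_derivative
           of_nat n * (w - \<xi>)^(n-1) * g w + (w - \<xi>)^n * deriv g w) (at w)"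
          by (auto intro!: derivative_eq_intros)
        then have "(f has_field_derivative of_nat n * (w - \<xi>)^(n-1) * g w + (w - \<xi>)^n * deriv g w) (at w)"
          by (rule has_field_derivative_transform_within_open[OF _ open_ball wb]) (simp add: g(5))
        then have d: "deriv f w = of_nat n * (w - \<xi>)^(n-1) * g w + (w - \<xi>)^n * deriv g w" by (rule DERIV_imp_deriv)
        have pw: "(w - \<xi>)^n = (w - \<xi>) * (w - \<xi>)^(n-1)" using g(1) by (simp add: power_eq_if)
        have "(w - \<xi>) * deriv f w = (w - \<xi>)^n * (of_nat n * g w + (w - \<xi>) * deriv g w)"
          unfolding d pw by (simp add: algebra_simps)
        then have "(w - \<xi>) * (deriv f w / f w) = (of_nat n * g w + (w - \<xi>) * deriv g w) / g w"
          using g(5)[OF wb] g(6)[OF wb] wx0 by simp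
        also have "\<dots> = of_nat n + (w - \<xi>) * (deriv g w / g w)" using g(6)[OF wb] by (simp add: add_divide_distrib)
        finally show ?case unfolding wx unfolding w_def .
      qed
    qed
    ultimately have "((\<lambda>\<sigma>. of_real (\<sigma> - 1) * (deriv f (Complex \<sigma> t) / f (Complex \<sigma> t))) \<longlongrightarrow> of_nat n + 0) (at_right 1)"
      using tendsto_cong by fastforce
    then show ?thesis using g(1) True by (intro exI[of _ n]) (auto simp: \<xi>_def)
    qed
  qed
qed

text \<open>\<open>riemann_hypothesis\<close> speaks of the open strip only, so this line needs an
  unconditional argument. Multiplied by \<open>\<sigma> - 1\<close>, the series of
  \<open>mangoldt\<close> tends to minus the order of the zero, plus 1 at the pole. A zero at
  \<open>t\<close> would make the combination with weights 3, 4, 1 tend to at most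
  \<open>3 - 4 < 0\<close>; zeros at height 0 or \<open>2 * t\<close> only lower it further.\<close>

lemma zeta_entire_nonzero_line: "zeta_entire (Complex 1 t) \<noteq> 0"
proof
  assume z: "zeta_entire (Complex 1 t) = 0"
  have t0: "t \<noteq> 0" using z zeta_entire_1 by (auto simp: complex_eq_iff simp flip: one_complex.code)
  define S where "S = {s. Re s > 0}"
  have S: "zeta_entire holomorphic_on S" "open S" "connected S" unfolding S_def
    by (auto simp: zeta_entire_holomorphic open_halfspace_Re_gt convex_halfspace_Re_gt intro: convex_connected)
  have inS: "Complex 1 u \<in> S" for u by (simp add: S_def)
  have nc: "\<not> zeta_entire constant_on S"
  proof
    assume "zeta_entire constant_on S"
    then have "zeta_entire (Complex 1 t) = zeta_entire (Complex 1 0)" using inS by (auto simp: constant_on_def)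
    then show False using z zeta_entire_1 by (simp flip: one_complex.code)
  qed
  define L where "L = (\<lambda>u \<sigma>. of_real (\<sigma> - 1) * (deriv zeta_entire (Complex \<sigma> u) / zeta_entire (Complex \<sigma> u)))"
  have "\<exists>n::nat. (n > 0 \<longleftrightarrow> zeta_entire (Complex 1 u) = 0) \<and> (L u \<longlongrightarrow> of_nat n) (at_right 1)" for u
    unfolding L_def by (rule logderiv_at_zero_limit[OF S inS nc])
  then obtain N :: "real \<Rightarrow> nat" where N: "\<And>u. N u > 0 \<longleftrightarrow> zeta_entire (Complex 1 u) = 0"
     "\<And>u. (L u \<longlongrightarrow> of_nat (N u)) (at_right 1)" by metis
  have D: "((\<lambda>\<sigma>. (\<sigma> - 1) * Re (dser mangoldt (Complex \<sigma> u))) \<longlongrightarrow> (if u = 0 then 1 else 0) - real (N u)) (at_right 1)" for u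
  proof -
    have "((\<lambda>\<sigma>. of_real (\<sigma> - 1) / (Complex \<sigma> u - 1)) \<longlongrightarrow> of_real (if u = 0 then 1 else 0)) (at_right 1)"
    proof (cases "u = 0")
      case True
      have "\<forall>\<^sub>F \<sigma> in at_right 1. complex_of_real (\<sigma> - 1) / (Complex \<sigma> u - 1) = 1"
        using eventually_at_right_less[of "1::real"]
      proof eventually_elim
        case (elim \<sigma>)
        have "Complex \<sigma> u - 1 = of_real (\<sigma> - 1)" using True by (simp add: complex_eq_iff)
        moreover have "complex_of_real (\<sigma> - 1) \<noteq> 0" using elim by (subst of_real_eq_0_iff) simp
        ultimately show ?case by (metis divide_self)
      qed
      then show ?thesis using True by (simp add: tendsto_eventually)
    next
      case False
      have "((\<lambda>\<sigma>. complex_of_real (\<sigma> - 1) / (Complex \<sigma> u - 1)) \<longlongrightarrow> of_real (1 - 1) / (Complex 1 u - 1)) (at_right 1)"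
        using False by (intro tendsto_intros tendsto_Complex) (auto simp: complex_eq_iff)
      then show ?thesis using False by simp
    qed
    then have "((\<lambda>\<sigma>. Re (of_real (\<sigma> - 1) / (Complex \<sigma> u - 1) - L u \<sigma>)) \<longlongrightarrow>
        Re (of_real (if u = 0 then 1 else 0) - of_nat (N u))) (at_right 1)"
      by (intro tendsto_intros N)
    moreover have "\<forall>\<^sub>F \<sigma> in at_right 1. Re (of_real (\<sigma> - 1) / (Complex \<sigma> u - 1) - L u \<sigma>) = (\<sigma> - 1) * Re (dser mangoldt (Complex \<sigma> u))"
      using eventually_at_right_less[of "1::real"]
    proof eventually_elim
      case (elim \<sigma>)
      have "of_real (\<sigma> - 1) / (Complex \<sigma> u - 1) - L u \<sigma> = of_real (\<sigma> - 1) * dser mangoldt (Complex \<sigma> u)"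
        using mangoldt_dser[of "Complex \<sigma> u"] elim by (simp add: L_def right_diff_distrib)
      then have "Re (of_real (\<sigma> - 1) / (Complex \<sigma> u - 1) - L u \<sigma>) = Re (of_real (\<sigma> - 1) * dser mangoldt (Complex \<sigma> u))"
        by (rule arg_cong)
      then show ?case by simp
    qed
    ultimately show ?thesis by (subst (asm) tendsto_cong) auto
  qed
  have "((\<lambda>\<sigma>. 3 * ((\<sigma> - 1) * Re (dser mangoldt (Complex \<sigma> 0))) + 4 * ((\<sigma> - 1) * Re (dser mangoldt (Complex \<sigma> t))) + (\<sigma> - 1) * Re (dser mangoldt (Complex \<sigma> (2 * t))))
     \<longlongrightarrow> 3 * ((if 0 = (0::real) then 1 else 0) - real (N 0)) + 4 * ((if t = 0 then 1 else 0) - real (N t)) + ((if 2 * t = 0 then 1 else 0) - real (N (2 * t)))) (at_right 1)"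
    by (intro tendsto_intros D)
  moreover have "\<forall>\<^sub>F \<sigma> in at_right 1. 3 * ((\<sigma> - 1) * Re (dser mangoldt (Complex \<sigma> 0))) + 4 * ((\<sigma> - 1) * Re (dser mangoldt (Complex \<sigma> t))) + (\<sigma> - 1) * Re (dser mangoldt (Complex \<sigma> (2 * t))) \<ge> 0"
    using eventually_at_right_less[of "1::real"]
  proof eventually_elim
    case (elim \<sigma>)
    have "(\<sigma> - 1) * (3 * Re (dser mangoldt (Complex \<sigma> 0)) + 4 * Re (dser mangoldt (Complex \<sigma> t)) + Re (dser mangoldt (Complex \<sigma> (2 * t)))) \<ge> 0"
      using mangoldt_3_4_1[of \<sigma> t] elim by (intro mult_nonneg_nonneg) auto
    then show ?case by (simp add: algebra_simps)
  qed
  ultimately have "0 \<le> 3 * ((if 0 = (0::real) then 1 else 0) - real (N 0)) + 4 * ((if t = 0 then 1 else 0) - real (N t)) + ((if 2 * t = 0 then 1 else 0) - real (N (2 * t)))"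
    by (rule tendsto_lowerbound) simp
  moreover have "N t \<ge> 1" using N(1)[of t] z by simp
  ultimately show False using t0 by (simp split: if_splits)
qed

lemma zeta_entire_nonzero:
  assumes "riemann_hypothesis" "Re s > 1/2"
  shows "zeta_entire s \<noteq> 0"
proof -
  consider "Re s < 1" | "Re s = 1" | "Re s > 1" by linarith
  then show ?thesis
  proof cases
    case 2
    then show ?thesis using zeta_entire_nonzero_line[of "Im s"] by (metis complex.collapse)
  next
    case 3
    then show ?thesis using dser_one_nonzero[of s] dser_one[of s] by auto
  qed (use zeta_entire_nonzero_RH assms in auto)
qed

text \<open>The disc of radius 3/2 around \<open>Complex 2 t\<close> just reaches the line
  \<open>Re s = 1/2\<close> and is free of zeros under the hypothesis. The difference of the two
  radii is \<open>Re s - 1/2\<close>, which explains the square in the denominator.\<close>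

lemma zeta_logderiv_bound:
  assumes RH: "riemann_hypothesis"
  obtains C where "C > 0" "\<And>s. 1/2 < Re s \<Longrightarrow> Re s \<le> 2 \<Longrightarrow>
     norm (deriv zeta_entire s / zeta_entire s) \<le> C * ln (\<bar>Im s\<bar> + 3) / (Re s - 1/2)\<^sup>2"
proof -
  obtain C0 where C0: "C0 \<ge> 1" "\<And>s. Re s \<ge> 1/2 \<Longrightarrow> norm (zeta_entire s) \<le> C0 * (norm s + 1)\<^sup>2"
    using zeta_entire_growth by blast
  \<comment> \<open>The 4 undoes the lower bound 1/4 at the centre. As
    \<open>(\<bar>t\<bar> + 5)\<^sup>2 \<le> (\<bar>t\<bar> + 3) ^ 4\<close>, four logarithms
    suffice; the fifth makes the comparison strict.\<close>
  define C1 where "C1 = ln (4 * C0) + 5"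
  have C1: "C1 \<ge> 5" using C0 by (simp add: C1_def)
  show thesis
  proof (rule that[of "12 * C1"])
    show "12 * C1 > 0" using C1 by simp
    fix s :: complex assume s: "1/2 < Re s" "Re s \<le> 2"
    define t where "t = Im s"
    define a where "a = Complex 2 t"
    define M where "M = C1 * ln (\<bar>t\<bar> + 3)"
    have l3: "ln (\<bar>t\<bar> + 3) \<ge> 1"
    proof -
      have "exp 1 \<le> \<bar>t\<bar> + 3" using exp_le by linarith
      then show ?thesis by (simp add: ln_ge_iff)
    qed
    have inb: "Re w > 1/2" "norm w \<le> \<bar>t\<bar> + 4" if w: "w \<in> ball a (3/2)" for w
    proof -
      have n: "norm (w - a) < 3/2" using w by (simp add: dist_norm norm_minus_commute)
      have "\<bar>Re (w - a)\<bar> \<le> norm (w - a)" by (rule abs_Re_le_cmod)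
      then show "Re w > 1/2" using n by (simp add: a_def abs_le_iff)
      have "norm a \<le> 2 + \<bar>t\<bar>" using cmod_le[of a] by (simp add: a_def)
      then show "norm w \<le> \<bar>t\<bar> + 4" using n norm_triangle_sub[of w a] by linarith
    qed
    have Za: "norm (zeta_entire a) \<ge> 1/4"
    proof -
      have "Re a > 1" "a \<noteq> 1" by (auto simp: a_def complex_eq_iff)
      then have "zeta_entire a = dser (\<lambda>_. 1) a * (a - 1)" using dser_one[of a] by simp
      moreover have "norm (dser (\<lambda>_. 1) a) \<ge> 1/4" by (rule dser_one_lower) (simp add: a_def)
      moreover have "norm (a - 1) \<ge> 1" using abs_Re_le_cmod[of "a - 1"] by (simp add: a_def)
      ultimately show ?thesis using mult_mono[of "1/4" "norm (dser (\<lambda>_. 1) a)" 1 "norm (a - 1)"] by (simp add: norm_mult)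
    qed
    have less: "norm (zeta_entire w) < exp M * norm (zeta_entire a)" if w: "w \<in> ball a (3/2)" for w
    proof -
      have "norm (zeta_entire w) \<le> C0 * (norm w + 1)\<^sup>2" using inb[OF w] by (intro C0(2)) auto
      also have "\<dots> \<le> C0 * (\<bar>t\<bar> + 5)\<^sup>2" using inb[OF w] C0 by (intro mult_left_mono power_mono) auto
      also have "\<bar>t\<bar> + 5 \<le> (\<bar>t\<bar> + 3)\<^sup>2" by (simp add: power2_eq_square algebra_simps)
      then have "C0 * (\<bar>t\<bar> + 5)\<^sup>2 \<le> C0 * ((\<bar>t\<bar> + 3)\<^sup>2)\<^sup>2" using C0 by (intro mult_left_mono power_mono) auto
      also have "\<dots> = (4 * C0) * (\<bar>t\<bar> + 3)^4 * (1/4)" by (simp add: power_mult[symmetric])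
      also have "\<dots> < exp M * (1/4)"
      proof -
        have "(4 * C0) * (\<bar>t\<bar> + 3)^4 = exp (ln (4 * C0) + 4 * ln (\<bar>t\<bar> + 3))"
          using C0 by (simp add: exp_add exp_of_nat_mult[of 4, simplified])
        also have "ln (4 * C0) + 4 * ln (\<bar>t\<bar> + 3) < M"
        proof -
          have "ln (4 * C0) * 1 \<le> ln (4 * C0) * ln (\<bar>t\<bar> + 3)" using C0 l3 by (intro mult_left_mono) auto
          then show ?thesis using l3 by (simp add: M_def C1_def algebra_simps)
        qed
        finally show ?thesis by simp
      qed
      also have "\<dots> \<le> exp M * norm (zeta_entire a)" using Za by (intro mult_left_mono) auto
      finally show ?thesis .
    qed
    have "dist a s \<le> 2 - Re s"
    proof -
      have "a - s = of_real (2 - Re s)" by (simp add: a_def t_def complex_eq_iff)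
      then have "dist a s = \<bar>2 - Re s\<bar>" unfolding dist_norm by (simp only: norm_of_real)
      then show ?thesis using s by simp
    qed
    moreover have "2 - Re s < 3/2" using s by simp
    moreover have "zeta_entire holomorphic_on ball a (3/2)"
      using inb by (intro holomorphic_on_subset[OF zeta_entire_holomorphic]) force
    moreover have "zeta_entire w \<noteq> 0" if "w \<in> ball a (3/2)" for w
      using zeta_entire_nonzero[OF RH] inb[OF that] by simp
    ultimately have "norm (deriv zeta_entire s / zeta_entire s) \<le> 8 * M * (3/2) / (3/2 - (2 - Re s))\<^sup>2"
      using less by (intro log_bounds_of_growth(2)) auto
    also have "\<dots> = 12 * C1 * ln (\<bar>Im s\<bar> + 3) / (Re s - 1/2)\<^sup>2" by (simp add: M_def t_def)
    finally show "norm (deriv zeta_entire s / zeta_entire s) \<le> 12 * C1 * ln (\<bar>Im s\<bar> + 3) / (Re s - 1/2)\<^sup>2" .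
  qed
qed

text \<open>Bounds the reciprocal of zeta slightly to the left of 1. The power of the imaginary part
  must stay below 1 for integrals against the quadratic decay of \<open>hat_ker\<close> to converge,
  so the centre is placed close to the line: with \<open>r = 1/10\<close> and
  \<open>R = 11/20\<close> the factor \<open>2 * r / (R - r)\<close> is 4/9, and a relative growth
  linear in \<open>\<bar>t\<bar>\<close> costs less than a square root.\<close>

lemma inverse_zeta_bound:
  assumes RH: "riemann_hypothesis"
  obtains C where "C > 0" "\<And>s. 19/20 \<le> Re s \<Longrightarrow> Re s \<le> 21/20 \<Longrightarrow>
     norm ((s - 1) / zeta_entire s) \<le> C * sqrt (1 + \<bar>Im s\<bar>)"
proof -
  obtain C0 where C0: "C0 \<ge> 1" "\<And>s. Re s \<ge> 1/2 \<Longrightarrow> norm (zeta_entire s) \<le> C0 * (norm s + 1)\<^sup>2"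
    using zeta_entire_growth by blast
  obtain B where B: "B > 0" "\<And>s. Re s \<ge> 21/20 \<Longrightarrow> norm (dser (\<lambda>_. 1) s) \<ge> B"
    using dser_one_lower'[of "21/20"] by auto
  \<comment> \<open>Chosen so that \<open>exp M\<close> exceeds the quotient of the upper bound
    \<open>25 * C0 * (1 + \<bar>t\<bar>)\<^sup>2\<close> in the disc by the lower bound
    \<open>B * ((1 + \<bar>t\<bar>) / 21)\<close> at its centre.\<close>
  define C3 where "C3 = 21 * 25 * C0 / B + 1"
  have C3: "C3 \<ge> 1" using C0 B by (simp add: C3_def)
  show thesis
  proof (rule that[of "21 * sqrt C3 / B"])
    show "21 * sqrt C3 / B > 0" using C3 B by simp
    fix s :: complex assume s: "19/20 \<le> Re s" "Re s \<le> 21/20"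
    define t where "t = Im s"
    define a where "a = Complex (21/20) t"
    define M where "M = ln (C3 * (1 + \<bar>t\<bar>))"
    have M0: "M \<ge> 0" using C3 by (simp add: M_def mult_ge1_I)
    have expM: "exp M = C3 * (1 + \<bar>t\<bar>)" using C3 by (simp add: M_def)
    have inb: "Re w > 1/2" "norm w \<le> \<bar>t\<bar> + 4" if w: "w \<in> ball a (11/20)" for w
    proof -
      have n: "norm (w - a) < 11/20" using w by (simp add: dist_norm norm_minus_commute)
      have "\<bar>Re (w - a)\<bar> \<le> norm (w - a)" by (rule abs_Re_le_cmod)
      then show "Re w > 1/2" using n by (simp add: a_def abs_le_iff)
      have "norm a \<le> 21/20 + \<bar>t\<bar>" using cmod_le[of a] by (simp add: a_def)
      then show "norm w \<le> \<bar>t\<bar> + 4" using n norm_triangle_sub[of w a] by linarith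
    qed
    have Za: "norm (zeta_entire a) \<ge> B * ((1 + \<bar>t\<bar>) / 21)"
    proof -
      have "Re a > 1" "a \<noteq> 1" by (auto simp: a_def complex_eq_iff)
      then have "zeta_entire a = dser (\<lambda>_. 1) a * (a - 1)" using dser_one[of a] by simp
      moreover have "norm (dser (\<lambda>_. 1) a) \<ge> B" by (rule B) (simp add: a_def)
      moreover have "norm (a - 1) \<ge> (1 + \<bar>t\<bar>) / 21"
        using abs_Re_le_cmod[of "a - 1"] abs_Im_le_cmod[of "a - 1"] by (simp add: a_def)
      ultimately show ?thesis using B(1) by (simp only: norm_mult) (intro mult_mono; simp)
    qed
    have less: "norm (zeta_entire w) < exp M * norm (zeta_entire a)" if w: "w \<in> ball a (11/20)" for w
    proof -
      have "norm (zeta_entire w) \<le> C0 * (norm w + 1)\<^sup>2" using inb[OF w] by (intro C0(2)) auto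
      also have "\<dots> \<le> C0 * (5 * (1 + \<bar>t\<bar>))\<^sup>2" using inb[OF w] C0 by (intro mult_left_mono power_mono) auto
      also have "\<dots> = 25 * C0 * (1 + \<bar>t\<bar>) * (1 + \<bar>t\<bar>)" by (simp add: power2_eq_square algebra_simps)
      also have "\<dots> < C3 * (1 + \<bar>t\<bar>) * (B * ((1 + \<bar>t\<bar>) / 21))"
      proof -
        have "25 * C0 < C3 * B / 21" using B by (simp add: C3_def field_simps)
        then have "25 * C0 * ((1 + \<bar>t\<bar>) * (1 + \<bar>t\<bar>)) < C3 * B / 21 * ((1 + \<bar>t\<bar>) * (1 + \<bar>t\<bar>))"
          by (intro mult_strict_right_mono) (auto intro!: mult_pos_pos add_pos_nonneg)
        then show ?thesis by (simp add: mult_ac)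
      qed
      also have "\<dots> \<le> C3 * (1 + \<bar>t\<bar>) * norm (zeta_entire a)" using Za C3 by (intro mult_left_mono) auto
      finally show ?thesis unfolding expM .
    qed
    have ds: "dist a s \<le> 1/10"
    proof -
      have "a - s = of_real (21/20 - Re s)" by (simp add: a_def t_def complex_eq_iff)
      then have "dist a s = \<bar>21/20 - Re s\<bar>" unfolding dist_norm by (simp only: norm_of_real)
      then show ?thesis using s by simp
    qed
    have holb: "zeta_entire holomorphic_on ball a (11/20)"
      using inb by (intro holomorphic_on_subset[OF zeta_entire_holomorphic]) force
    have nz: "zeta_entire w \<noteq> 0" if "w \<in> ball a (11/20)" for w
      using zeta_entire_nonzero[OF RH] inb[OF that] by simp
    have "B * ((1 + \<bar>t\<bar>) / 21) * exp (- (M / 2)) \<le> norm (zeta_entire a) * exp (- (2 * M * (1/10) / (11/20 - 1/10)))"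
      using Za B M0 by (intro mult_mono) auto
    also have "\<dots> \<le> norm (zeta_entire s)"
      using less by (intro log_bounds_of_growth(1)[OF holb nz _ ds]) auto
    finally have low: "B * ((1 + \<bar>t\<bar>) / 21) * exp (- (M / 2)) \<le> norm (zeta_entire s)" .
    have "exp (M / 2) = sqrt (exp M)" by (rule real_sqrt_unique[symmetric]) (simp_all add: power2_eq_square flip: exp_add)
    then have eh: "exp (M / 2) = sqrt C3 * sqrt (1 + \<bar>t\<bar>)" by (simp add: expM real_sqrt_mult)
    have "norm (s - 1) \<le> 1 + \<bar>t\<bar>" using cmod_le[of "s - 1"] s by (simp add: t_def)
    then have "norm ((s - 1) / zeta_entire s) \<le> (1 + \<bar>t\<bar>) / (B * ((1 + \<bar>t\<bar>) / 21) * exp (- (M / 2)))"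
      unfolding norm_divide using low B by (intro frac_le) auto
    also have "\<dots> = 21 / B * exp (M / 2)"
    proof -
      define x where "x = 1 + \<bar>t\<bar>"
      have "x > 0" by (simp add: x_def add_pos_nonneg)
      then show ?thesis using B(1) unfolding x_def[symmetric] by (simp add: exp_minus field_simps)
    qed
    finally show "norm ((s - 1) / zeta_entire s) \<le> 21 * sqrt C3 / B * sqrt (1 + \<bar>Im s\<bar>)"
      unfolding eh by (simp add: t_def)
  qed
qed

section \<open>The triangular kernel\<close>

lemma has_bochner_integral_decay:
  assumes p: "p > (1::real)"
  shows "has_bochner_integral lborel (\<lambda>x. (1 + \<bar>x\<bar>) powr (-p)) (2 / (p - 1))"
proof -
  define F where "F = (\<lambda>x. (1 + x) powr (1 - p) / (1 - p))"
  have "(\<integral>\<^sup>+x. ennreal ((1 + \<bar>x\<bar>) powr (-p)) * indicator {0..} x \<partial>lborel) =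
      (\<integral>\<^sup>+x. ennreal ((1 + x) powr (-p)) * indicator {0..} x \<partial>lborel)"
    by (intro nn_integral_cong) (auto split: split_indicator)
  also have "\<dots> = ennreal (0 - F 0)"
  proof (rule nn_integral_FTC_atLeast[where F = F and T = 0])
    fix x :: real assume "x \<ge> 0"
    then show "(F has_real_derivative (1 + x) powr (-p)) (at x)"
      unfolding F_def using p by (auto intro!: derivative_eq_intros)
  next
    show "(F \<longlongrightarrow> 0) at_top" unfolding F_def using p by real_asymp
  qed auto
  also have "0 - F 0 = 1 / (p - 1)" using p by (simp add: F_def field_simps)
  finally have "has_bochner_integral lborel (\<lambda>x. indicator {0..} x *\<^sub>R (1 + \<bar>x\<bar>) powr (-p)) (1 / (p - 1))"
    using p by (intro has_bochner_integral_nn_integral) (auto simp: indicator_mult_ennreal mult.commute)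
  from has_bochner_integral_even_function[OF this] show ?thesis by simp
qed

lemma has_bochner_integral_decay_scaled:
  assumes p: "p > (1::real)" and w: "w > 0"
  shows "has_bochner_integral lborel (\<lambda>x. (1 + w * \<bar>x\<bar>) powr (-p)) (2 / (p - 1) / w)"
proof -
  have "has_bochner_integral lborel (\<lambda>x. (1 + \<bar>0 + w * x\<bar>) powr (-p)) (inverse \<bar>w\<bar> *\<^sub>R (2 / (p - 1)))"
    using has_bochner_integral_decay[OF p] lborel_has_bochner_integral_real_affine_iff[of w "\<lambda>x. (1 + \<bar>x\<bar>) powr (-p)" "2 / (p-1)" 0] w
    by (simp add: scaleR_conv_of_real)
  then show ?thesis using w by (simp add: abs_mult divide_inverse mult.commute)
qed

lemma has_bochner_integral_one_minus_cos_unit: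
  "has_bochner_integral lborel (\<lambda>t::real. (1 - cos t) / t\<^sup>2) pi"
proof -
  \<comment> \<open>Integration by parts gives this antiderivative; the limit \<open>pi / 2\<close>
    is that of the sine integral.\<close>
  define Q where "Q = (\<lambda>t. Si t - (1 - cos t) / t)"
  \<comment> \<open>At 0 the quotient is 0 by convention. The value 1/2 is its limit there and makes
    \<open>f\<close> the derivative of \<open>Q\<close> at 0 as well.\<close>
  define f where "f = (\<lambda>t::real. if t = 0 then 1/2 else (1 - cos t) / t\<^sup>2)"
  have [measurable]: "f \<in> borel_measurable borel" unfolding f_def by measurable
  have "(\<integral>\<^sup>+x. ennreal (f x) * indicator {0..} x \<partial>lborel) = ennreal (pi / 2 - Q 0)"
  proof (rule nn_integral_FTC_atLeast[where F = Q and T = "pi/2" and a = 0])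
    fix x :: real assume "x \<ge> 0"
    show "0 \<le> f x" by (simp add: f_def)
    show "(Q has_real_derivative f x) (at x)"
    proof (cases "x = 0")
      case True
      have "((\<lambda>t::real. (1 - cos t) / t) has_real_derivative 1/2) (at 0)"
        unfolding has_field_derivative_iff by simp real_asymp
      then have "(Q has_real_derivative sinc 0 - 1/2) (at 0)"
        unfolding Q_def by (intro DERIV_diff DERIV_Si)
      then show ?thesis using True by (simp add: f_def)
    next
      case False
      have "((\<lambda>t::real. (1 - cos t) / t) has_real_derivative (sin x * x - (1 - cos x)) / x\<^sup>2) (at x)"
        using False by (auto intro!: derivative_eq_intros simp: power2_eq_square)
      then have "(Q has_real_derivative sinc x - (sin x * x - (1 - cos x)) / x\<^sup>2) (at x)"
        unfolding Q_def by (intro DERIV_diff DERIV_Si)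
      also have "sinc x - (sin x * x - (1 - cos x)) / x\<^sup>2 = f x"
        using False by (simp add: f_def field_simps power2_eq_square)
      finally show ?thesis .
    qed
  next
    have "((\<lambda>t::real. (1 - cos t) / t) \<longlongrightarrow> 0) at_top"
    proof (rule Lim_null_comparison)
      show "\<forall>\<^sub>F t in at_top. norm ((1 - cos t) / t) \<le> 2 / t"
        using eventually_gt_at_top[of 0]
      proof eventually_elim
        case (elim t)
        have "\<bar>1 - cos t\<bar> \<le> 2" using cos_ge_minus_one[of t] cos_le_one[of t] by linarith
        then show ?case using elim by (simp add: divide_right_mono)
      qed
      show "((\<lambda>t::real. 2 / t) \<longlongrightarrow> 0) at_top" by real_asymp
    qed
    then have "(Q \<longlongrightarrow> pi / 2 - 0) at_top" unfolding Q_def by (intro tendsto_diff Si_at_top)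
    then show "(Q \<longlongrightarrow> pi / 2) at_top" by simp
  qed simp
  also have "Q 0 = 0" by (simp add: Q_def Si_def zero_ereal_def[symmetric])
  finally have "has_bochner_integral lborel (\<lambda>x. indicator {0..} x *\<^sub>R f x) (pi / 2)"
    by (intro has_bochner_integral_nn_integral) (auto simp: indicator_mult_ennreal mult.commute f_def)
  then have "has_bochner_integral lborel f (2 *\<^sub>R (pi/2))"
    by (rule has_bochner_integral_even_function) (simp add: f_def)
  moreover have "AE t in lborel. f t = (1 - cos t) / t\<^sup>2"
    using AE_lborel_singleton[of 0] by eventually_elim (simp add: f_def)
  ultimately show ?thesis
    by (subst (asm) has_bochner_integral_cong_AE[where g = "\<lambda>t. (1 - cos t) / t\<^sup>2"]) auto
qed

lemma has_bochner_integral_one_minus_cos: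
  "has_bochner_integral lborel (\<lambda>t::real. (1 - cos (a * t)) / t\<^sup>2) (pi * \<bar>a\<bar>)"
proof (cases "a = 0")
  case False
  have "has_bochner_integral lborel (\<lambda>t::real. (1 - cos (0 + a * t)) / (0 + a * t)\<^sup>2) (inverse \<bar>a\<bar> *\<^sub>R pi)"
    using has_bochner_integral_one_minus_cos_unit lborel_has_bochner_integral_real_affine_iff[of a "\<lambda>t. (1 - cos t) / t\<^sup>2" pi 0] False
    by simp
  then have "has_bochner_integral lborel (\<lambda>t::real. a\<^sup>2 * ((1 - cos (a * t)) / (a * t)\<^sup>2)) (a\<^sup>2 * (inverse \<bar>a\<bar> * pi))"
    by (intro has_bochner_integral_mult_right) simp
  moreover have "a\<^sup>2 * ((1 - cos (a * t)) / (a * t)\<^sup>2) = (1 - cos (a * t)) / t\<^sup>2" for t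
    using False by (simp add: power_mult_distrib)
  moreover have "a\<^sup>2 * (inverse \<bar>a\<bar> * pi) = pi * \<bar>a\<bar>"
    using False by (simp add: power2_eq_square field_simps abs_if)
  ultimately show ?thesis by simp
qed (simp add: has_bochner_integral_zero)

definition hat :: "real \<Rightarrow> real \<Rightarrow> real" where
  "hat w u = max 0 (1 - \<bar>u\<bar> / w)"

lemma hat_bounds: "w > 0 \<Longrightarrow> 0 \<le> hat w u" "w > 0 \<Longrightarrow> hat w u \<le> 1"
  by (auto simp: hat_def)

lemma hat_eq_0: "w > 0 \<Longrightarrow> \<bar>u\<bar> \<ge> w \<Longrightarrow> hat w u = 0"
  by (simp add: hat_def)

lemma hat_minus [simp]: "hat w (- u) = hat w u"
  by (simp add: hat_def)

text \<open>The product of cosines is a second difference, with step \<open>w\<close>, of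
  \<open>1 - cos (a * t)\<close> in \<open>a\<close>. The integral is therefore the second
  difference of \<open>pi * \<bar>a\<bar>\<close>, which is a triangle.\<close>

lemma hat_fourier_cos:
  assumes w: "w > 0"
  shows "has_bochner_integral lborel (\<lambda>t. (2 - 2 * cos (w * t)) / (w * t\<^sup>2) * cos (u * t)) (2 * pi * hat w u)"
proof -
  have "has_bochner_integral lborel (\<lambda>t. (1/w) * ((1 - cos ((u + w) * t)) / t\<^sup>2 + (1 - cos ((u - w) * t)) / t\<^sup>2 - 2 * ((1 - cos (u * t)) / t\<^sup>2)))
     ((1/w) * (pi * \<bar>u + w\<bar> + pi * \<bar>u - w\<bar> - 2 * (pi * \<bar>u\<bar>)))"
    by (intro has_bochner_integral_mult_right has_bochner_integral_add has_bochner_integral_diff has_bochner_integral_one_minus_cos)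
  moreover have "(1/w) * ((1 - cos ((u + w) * t)) / t\<^sup>2 + (1 - cos ((u - w) * t)) / t\<^sup>2 - 2 * ((1 - cos (u * t)) / t\<^sup>2))
     = (2 - 2 * cos (w * t)) / (w * t\<^sup>2) * cos (u * t)" for t
  proof (cases "t = 0")
    case False
    then show ?thesis using w by (simp add: distrib_right left_diff_distrib cos_add cos_diff field_simps)
  qed simp
  moreover have "(1/w) * (pi * \<bar>u + w\<bar> + pi * \<bar>u - w\<bar> - 2 * (pi * \<bar>u\<bar>)) = 2 * pi * hat w u"
    using w by (auto simp: hat_def abs_if max_def field_simps)
  ultimately show ?thesis by simp
qed

definition sinhc :: "complex \<Rightarrow> complex" where
  "sinhc z = (if z = 0 then 1 else sinh z / z)"

lemma sinhc_holomorphic: "sinhc holomorphic_on UNIV"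
proof (rule pole_theorem_open_0[where g = sinh and a = 0])
  show "(sinh :: complex \<Rightarrow> complex) holomorphic_on UNIV"
    unfolding sinh_def[abs_def] scaleR_conv_of_real by (intro holomorphic_intros)
  have "((sinh :: complex \<Rightarrow> complex) has_field_derivative cosh 0) (at 0)" by (auto intro!: derivative_eq_intros)
  then show "sinhc 0 = deriv sinh 0" by (simp add: sinhc_def DERIV_imp_deriv)
qed (auto simp: sinhc_def)

lemma norm_cosh_le: "norm (cosh z :: complex) \<le> exp \<bar>Re z\<bar>"
  and norm_sinh_le: "norm (sinh z :: complex) \<le> exp \<bar>Re z\<bar>"
proof -
  have e: "norm (exp z) \<le> exp \<bar>Re z\<bar>" "norm (exp (-z)) \<le> exp \<bar>Re z\<bar>" by (auto simp: norm_exp_eq_Re)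
  have "norm (exp z + exp (-z)) \<le> exp \<bar>Re z\<bar> * 2" using norm_triangle_ineq[of "exp z" "exp (-z)"] e by linarith
  then show "norm (cosh z) \<le> exp \<bar>Re z\<bar>" by (simp add: cosh_def)
  have "norm (exp z - exp (-z)) \<le> exp \<bar>Re z\<bar> * 2" using norm_triangle_ineq4[of "exp z" "exp (-z)"] e by linarith
  then show "norm (sinh z) \<le> exp \<bar>Re z\<bar>" by (simp add: sinh_def)
qed

lemma norm_sinh_le': "norm (sinh z :: complex) \<le> exp \<bar>Re z\<bar> * norm z"
proof -
  have "norm (sinh z - sinh 0) \<le> exp \<bar>Re z\<bar> * norm (z - 0)"
  proof (rule field_differentiable_bound[of "closed_segment 0 z" _ cosh])
    fix w assume "w \<in> closed_segment 0 z"
    then obtain u where u: "0 \<le> u" "u \<le> 1" "w = of_real u * z" by (auto simp: in_segment scaleR_conv_of_real)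
    have "norm (cosh w) \<le> exp \<bar>Re w\<bar>" by (rule norm_cosh_le)
    also have "\<bar>Re w\<bar> = u * \<bar>Re z\<bar>" using u by (simp add: abs_mult)
    also have "\<dots> \<le> \<bar>Re z\<bar>" using u by (simp add: mult_left_le_one_le)
    finally show "norm (cosh w) \<le> exp \<bar>Re z\<bar>" by simp
    show "(sinh has_field_derivative cosh w) (at w within closed_segment 0 z)"
      by (auto intro!: derivative_eq_intros)
  qed auto
  then show ?thesis by simp
qed

text \<open>The bound through the derivative of \<open>sinh\<close> is good near 0, the direct one
  for large imaginary part; adding the two gives both at once.\<close>

lemma norm_sinhc_le: "norm (sinhc z) \<le> 2 * exp \<bar>Re z\<bar> / (1 + \<bar>Im z\<bar>)"
proof (cases "z = 0")
  case False
  have 1: "norm (sinhc z) \<le> exp \<bar>Re z\<bar>"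
    using norm_sinh_le'[of z] False by (simp add: sinhc_def norm_divide divide_le_eq)
  have "norm (sinhc z) * norm z \<le> exp \<bar>Re z\<bar>"
    using norm_sinh_le[of z] False by (simp add: sinhc_def norm_divide)
  moreover have "norm (sinhc z) * \<bar>Im z\<bar> \<le> norm (sinhc z) * norm z"
    using abs_Im_le_cmod[of z] by (intro mult_left_mono) auto
  ultimately have "norm (sinhc z) * (1 + \<bar>Im z\<bar>) \<le> 2 * exp \<bar>Re z\<bar>" using 1 by (simp add: algebra_simps)
  then show ?thesis by (simp add: pos_le_divide_eq add_pos_nonneg)
qed (simp add: sinhc_def)

text \<open>The two-sided Laplace transform of \<open>hat w\<close>.\<close>
definition hat_ker :: "real \<Rightarrow> complex \<Rightarrow> complex" where
  "hat_ker w s = of_real w * (sinhc (of_real w * s / 2))\<^sup>2"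

lemma hat_ker_holomorphic: "hat_ker w holomorphic_on S"
proof -
  have "(\<lambda>s. of_real w * s / 2) holomorphic_on UNIV" by (intro holomorphic_intros) auto
  then have "(\<lambda>s. sinhc (of_real w * s / 2)) holomorphic_on UNIV"
    using holomorphic_on_compose_gen[of "\<lambda>s. of_real w * s / 2" UNIV sinhc UNIV] sinhc_holomorphic
    by (simp add: o_def)
  then have "(\<lambda>s. of_real w * (sinhc (of_real w * s / 2))\<^sup>2) holomorphic_on UNIV"
    by (intro holomorphic_intros)
  then show ?thesis unfolding hat_ker_def[abs_def] by (rule holomorphic_on_subset) simp
qed

lemma norm_hat_ker_le:
  assumes w: "w > 0"
  shows "norm (hat_ker w s) \<le> 16 * w * exp (w * \<bar>Re s\<bar>) * (1 + w * \<bar>Im s\<bar>) powr (-2)"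
proof -
  define z where "z = of_real w * s / 2"
  have z: "\<bar>Re z\<bar> = w * \<bar>Re s\<bar> / 2" "\<bar>Im z\<bar> = w * \<bar>Im s\<bar> / 2" using w by (simp_all add: z_def abs_mult)
  have pos: "1 + w * \<bar>Im s\<bar> > 0" using w by (simp add: add_pos_nonneg)
  have "norm (sinhc z) \<le> 2 * exp \<bar>Re z\<bar> / (1 + \<bar>Im z\<bar>)" by (rule norm_sinhc_le)
  also have "\<dots> \<le> 2 * exp \<bar>Re z\<bar> / ((1 + w * \<bar>Im s\<bar>) / 2)"
  proof (rule divide_left_mono)
    show "(1 + w * \<bar>Im s\<bar>) / 2 \<le> 1 + \<bar>Im z\<bar>" unfolding z by (simp add: add_divide_distrib)
    show "0 < (1 + \<bar>Im z\<bar>) * ((1 + w * \<bar>Im s\<bar>) / 2)" using pos by (intro mult_pos_pos) auto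
  qed auto
  finally have "norm (sinhc z) \<le> 4 * exp \<bar>Re z\<bar> / (1 + w * \<bar>Im s\<bar>)" by simp
  then have "(norm (sinhc z))\<^sup>2 \<le> (4 * exp \<bar>Re z\<bar> / (1 + w * \<bar>Im s\<bar>))\<^sup>2" by (intro power_mono) auto
  also have "\<dots> = 16 * (exp \<bar>Re z\<bar>)\<^sup>2 / (1 + w * \<bar>Im s\<bar>)\<^sup>2" by (simp add: power_divide power_mult_distrib)
  also have "(exp \<bar>Re z\<bar>)\<^sup>2 = exp (w * \<bar>Re s\<bar>)" by (simp add: z power2_eq_square flip: exp_add)
  also have "16 * exp (w * \<bar>Re s\<bar>) / (1 + w * \<bar>Im s\<bar>)\<^sup>2 = 16 * exp (w * \<bar>Re s\<bar>) * (1 + w * \<bar>Im s\<bar>) powr (-2)"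
    using pos by (simp add: powr_minus divide_inverse powr_numeral)
  finally have "w * (norm (sinhc z))\<^sup>2 \<le> w * (16 * exp (w * \<bar>Re s\<bar>) * (1 + w * \<bar>Im s\<bar>) powr (-2))"
    using w by (intro mult_left_mono) auto
  then show ?thesis using w by (simp add: hat_ker_def z_def norm_mult norm_power mult_ac)
qed

lemma hat_ker_imag:
  assumes "w > 0" "t \<noteq> 0"
  shows "hat_ker w (Complex 0 t) = of_real ((2 - 2 * cos (w * t)) / (w * t\<^sup>2))"
proof -
  define x where "x = w * t / 2"
  have x: "x \<noteq> 0" using assms by (simp add: x_def)
  have z: "of_real w * Complex 0 t / 2 = \<i> * of_real x" by (simp add: x_def complex_eq_iff)
  have "sinh (\<i> * of_real x) = \<i> * of_real (sin x)"
    by (simp add: sinh_def complex_eq_iff Re_exp Im_exp)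
  then have "sinhc (\<i> * of_real x) = of_real (sin x / x)" using x by (simp add: sinhc_def)
  then have "hat_ker w (Complex 0 t) = of_real (w * (sin x / x)\<^sup>2)" unfolding hat_ker_def z by simp
  also have "w * (sin x / x)\<^sup>2 = (2 - 2 * cos (w * t)) / (w * t\<^sup>2)"
  proof -
    have "cos (w * t) = 1 - 2 * (sin x)\<^sup>2" using cos_double_sin[of x] by (simp add: x_def)
    then show ?thesis using assms by (simp add: x_def field_simps power2_eq_square)
  qed
  finally show ?thesis .
qed

section \<open>Integrals along vertical lines\<close>

lemma tendsto_integral_symmetric:
  fixes f :: "real \<Rightarrow> complex"
  assumes "integrable lborel f"
  shows "(\<lambda>n. integral\<^sup>L lborel (\<lambda>x. indicator {- real n..real n} x *\<^sub>R f x)) \<longlonglongrightarrow> integral\<^sup>L lborel f"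
proof (rule integral_dominated_convergence[where w = "\<lambda>x. norm (f x)"])
  show "f \<in> borel_measurable lborel" using assms by auto
  then show "(\<lambda>x. indicator {- real n..real n} x *\<^sub>R f x) \<in> borel_measurable lborel" for n by measurable
  show "integrable lborel (\<lambda>x. norm (f x))" using assms by (rule integrable_norm)
  show "AE x in lborel. (\<lambda>n. indicator {- real n..real n} x *\<^sub>R f x) \<longlonglongrightarrow> f x"
  proof (rule AE_I2)
    fix x :: real
    obtain N :: nat where N: "\<bar>x\<bar> \<le> real N" using real_arch_simple by blast
    have "\<forall>\<^sub>F n in sequentially. indicator {- real n..real n} x *\<^sub>R f x = f x"
      using eventually_ge_at_top[of N]
    proof eventually_elim
      case (elim n)
      then have "\<bar>x\<bar> \<le> real n" using N by linarith
      then show ?case by (auto simp: indicator_def abs_le_iff)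
    qed
    then show "(\<lambda>n. indicator {- real n..real n} x *\<^sub>R f x) \<longlonglongrightarrow> f x" by (rule tendsto_eventually)
  qed
  show "AE x in lborel. norm (indicator {- real n..real n} x *\<^sub>R f x) \<le> norm (f x)" for n
    by (auto simp: indicator_def)
qed

lemma vertical_line_measurable:
  assumes "f holomorphic_on {s. l < Re s}" "l < a"
  shows "(\<lambda>t. f (Complex a t)) \<in> borel_measurable lborel" "continuous_on A (\<lambda>t. f (Complex a t))"
proof -
  have "continuous_on UNIV (\<lambda>t. f (Complex a t))"
    by (rule continuous_on_compose2[OF holomorphic_on_imp_continuous_on[OF assms(1)]])
       (use assms(2) in \<open>auto simp: Complex_eq intro!: continuous_intros\<close>)
  then show "(\<lambda>t. f (Complex a t)) \<in> borel_measurable lborel" "continuous_on A (\<lambda>t. f (Complex a t))"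
    by (auto simp: borel_measurable_continuous_onI intro: continuous_on_subset)
qed

text \<open>A primitive on the half-plane replaces the rectangular contour.\<close>
lemma vertical_line_shift:
  assumes hol: "f holomorphic_on {s. l < Re s}" and l: "l < a" and ab: "a \<le> b"
    and bound: "\<And>s. a \<le> Re s \<Longrightarrow> Re s \<le> b \<Longrightarrow> norm (f s) \<le> B * (1 + \<bar>Im s\<bar>) powr (-(5/4))"
  shows "integrable lborel (\<lambda>t. f (Complex a t))" "integrable lborel (\<lambda>t. f (Complex b t))"
    "integral\<^sup>L lborel (\<lambda>t. f (Complex a t)) = integral\<^sup>L lborel (\<lambda>t. f (Complex b t))"
proof -
  have intB: "integrable lborel (\<lambda>t. B * (1 + \<bar>t\<bar>) powr (-(5/4)))"
    using has_bochner_integral_decay[of "5/4"] by (intro integrable_mult_right) (auto simp: has_bochner_integral_iff)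
  have int: "integrable lborel (\<lambda>t. f (Complex c t))" if "a \<le> c" "c \<le> b" for c
  proof (rule Bochner_Integration.integrable_bound[OF intB])
    show "(\<lambda>t. f (Complex c t)) \<in> borel_measurable lborel"
      by (rule vertical_line_measurable[OF hol]) (use that l in auto)
    show "AE t in lborel. norm (f (Complex c t)) \<le> norm (B * (1 + \<bar>t\<bar>) powr (-(5/4)))"
      using bound[of "Complex c _"] that by (auto intro!: AE_I2 order.trans[OF _ abs_ge_self])
  qed
  show ia: "integrable lborel (\<lambda>t. f (Complex a t))" and ib: "integrable lborel (\<lambda>t. f (Complex b t))"
    using int ab by auto
  have conv: "convex {s. l < Re s}" and op: "open {s. l < Re s}"
    using convex_halfspace_Re_gt[of l] open_halfspace_Re_gt[of l] by simp_all
  have "\<exists>G. \<forall>x\<in>{s. l < Re s}. (G has_field_derivative f x) (at x within {s. l < Re s})"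
    by (rule holomorphic_convex_primitive'[OF conv op hol]) blast
  then obtain G where "\<forall>x\<in>{s. l < Re s}. (G has_field_derivative f x) (at x within {s. l < Re s})" by blast
  then have G: "(G has_field_derivative f x) (at x)" if "l < Re x" for x
    using that op by (metis (mono_tags, lifting) at_within_open mem_Collect_eq)
  have seg: "integral\<^sup>L lborel (\<lambda>x. indicator {- real n..real n} x *\<^sub>R f (Complex c x)) =
      - \<i> * G (Complex c (real n)) + \<i> * G (Complex c (- real n))" if "l < c" for c n
  proof -
    have "integral\<^sup>L lborel (\<lambda>x. indicator {- real n..real n} x *\<^sub>R f (Complex c x)) =
       - \<i> * G (Complex c (real n)) - - \<i> * G (Complex c (- real n))"
    proof (rule integral_FTC_atLeastAtMost)
      fix x
      have "((\<lambda>x. Complex c x) has_vector_derivative \<i>) (at x within {- real n..real n})"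
        unfolding Complex_eq by (auto intro!: derivative_eq_intros)
      moreover have "(G has_field_derivative f (Complex c x)) (at (Complex c x))" by (rule G) (use that in simp)
      ultimately have "((G \<circ> (\<lambda>x. Complex c x)) has_vector_derivative \<i> * f (Complex c x)) (at x within {- real n..real n})"
        by (rule field_vector_diff_chain_within[OF _ has_field_derivative_at_within])
      from has_vector_derivative_mult_right[OF this, of "-\<i>"]
      show "((\<lambda>x. - \<i> * G (Complex c x)) has_vector_derivative f (Complex c x)) (at x within {- real n..real n})"
        by (simp add: o_def mult.assoc[symmetric])
    qed (use vertical_line_measurable(2)[OF hol that] in auto)
    then show ?thesis by simp
  qed
  \<comment> \<open>The primitive takes almost the same value at both ends of a high horizontal
    edge, so these edges disappear in the limit.\<close>
  have horiz: "norm (G (Complex b u) - G (Complex a u)) \<le> B * (1 + \<bar>u\<bar>) powr (-(5/4)) * (b - a)" for u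
  proof -
    have "norm (G (Complex b u) - G (Complex a u)) \<le> B * (1 + \<bar>u\<bar>) powr (-(5/4)) * norm (Complex b u - Complex a u)"
    proof (rule field_differentiable_bound[of "closed_segment (Complex a u) (Complex b u)"])
      fix w assume "w \<in> closed_segment (Complex a u) (Complex b u)"
      then obtain v where v: "0 \<le> v" "v \<le> 1" "w = (1 - v) *\<^sub>R Complex a u + v *\<^sub>R Complex b u" by (auto simp: in_segment)
      have "Im w = (1 - v) * u + v * u" "Re w = (1 - v) * a + v * b" unfolding v(3) by simp_all
      then have Im: "Im w = u" and Re: "Re w = a + v * (b - a)" by (simp_all add: algebra_simps)
      have "0 \<le> v * (b - a)" "v * (b - a) \<le> b - a" using v ab by (auto intro: mult_left_le_one_le)
      then have R: "a \<le> Re w" "Re w \<le> b" using Re by auto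
      show "norm (f w) \<le> B * (1 + \<bar>u\<bar>) powr (-(5/4))" using bound[OF R] Im by simp
      show "(G has_field_derivative f w) (at w within closed_segment (Complex a u) (Complex b u))"
        by (rule has_field_derivative_at_within[OF G]) (use R l in simp)
    qed auto
    moreover have "norm (Complex b u - Complex a u) = b - a"
    proof -
      have "Complex b u - Complex a u = of_real (b - a)" by (simp add: complex_eq_iff)
      then have "norm (Complex b u - Complex a u) = \<bar>b - a\<bar>" by (simp only: norm_of_real)
      then show ?thesis using ab by simp
    qed
    ultimately show ?thesis by simp
  qed
  have lim0: "(\<lambda>n. B * (1 + \<bar>real n\<bar>) powr (-(5/4)) * (b - a)) \<longlonglongrightarrow> 0"
  proof -
    have "(\<lambda>n. B * (1 + real n) powr (-(5/4)) * (b - a)) \<longlonglongrightarrow> B * 0 * (b - a)"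
      by (intro tendsto_intros) real_asymp
    then show ?thesis by simp
  qed
  have d1: "(\<lambda>n. G (Complex b (real n)) - G (Complex a (real n))) \<longlonglongrightarrow> 0"
    by (rule Lim_null_comparison[OF _ lim0]) (intro always_eventually allI horiz)
  have d2: "(\<lambda>n. G (Complex b (- real n)) - G (Complex a (- real n))) \<longlonglongrightarrow> 0"
  proof (rule Lim_null_comparison[OF _ lim0], intro always_eventually allI)
    show "norm (G (Complex b (- real n)) - G (Complex a (- real n))) \<le> B * (1 + \<bar>real n\<bar>) powr (-(5/4)) * (b - a)" for n
      using horiz[of "- real n"] by simp
  qed
  have "(\<lambda>n. - \<i> * (G (Complex b (real n)) - G (Complex a (real n))) + \<i> * (G (Complex b (- real n)) - G (Complex a (- real n)))) \<longlonglongrightarrow> - \<i> * 0 + \<i> * 0"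
    by (intro tendsto_intros d1 d2)
  moreover have "(\<lambda>n. integral\<^sup>L lborel (\<lambda>x. indicator {- real n..real n} x *\<^sub>R f (Complex b x)) - integral\<^sup>L lborel (\<lambda>x. indicator {- real n..real n} x *\<^sub>R f (Complex a x)))
     \<longlonglongrightarrow> integral\<^sup>L lborel (\<lambda>t. f (Complex b t)) - integral\<^sup>L lborel (\<lambda>t. f (Complex a t))"
    by (intro tendsto_diff tendsto_integral_symmetric ia ib)
  moreover have "integral\<^sup>L lborel (\<lambda>x. indicator {- real n..real n} x *\<^sub>R f (Complex b x)) - integral\<^sup>L lborel (\<lambda>x. indicator {- real n..real n} x *\<^sub>R f (Complex a x))
    = - \<i> * (G (Complex b (real n)) - G (Complex a (real n))) + \<i> * (G (Complex b (- real n)) - G (Complex a (- real n)))" for n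
    using l ab by (subst (1 2) seg) (auto simp: algebra_simps)
  ultimately have "integral\<^sup>L lborel (\<lambda>t. f (Complex b t)) - integral\<^sup>L lborel (\<lambda>t. f (Complex a t)) = 0"
    using LIMSEQ_unique by fastforce
  then show "integral\<^sup>L lborel (\<lambda>t. f (Complex a t)) = integral\<^sup>L lborel (\<lambda>t. f (Complex b t))" by simp
qed

text \<open>On the imaginary axis \<open>hat_ker\<close> is real and even, so the cosine part is
  \<open>hat_fourier_cos\<close> and the sine part integrates to 0. As \<open>hat_ker\<close> is
  entire with quadratic decay in vertical strips, the line may be moved to any abscissa
  \<open>c\<close>, on either side of 0.\<close>

lemma hat_inversion:
  assumes w: "w > 0"
  shows "integrable lborel (\<lambda>t. hat_ker w (Complex c t) * exp (of_real u * Complex c t))"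
    "integral\<^sup>L lborel (\<lambda>t. hat_ker w (Complex c t) * exp (of_real u * Complex c t)) = of_real (2 * pi * hat w u)"
proof -
  define f where "f = (\<lambda>s. hat_ker w s * exp (of_real u * s))"
  define m where "m = \<bar>c\<bar>"
  define w1 where "w1 = min 1 w"
  have w1: "0 < w1" "w1 \<le> w" "w1 \<le> 1" using w by (auto simp: w1_def)
  have bound: "norm (f s) \<le> (16 * w * exp (w * m) * exp (\<bar>u\<bar> * m) * w1 powr (-2)) * (1 + \<bar>Im s\<bar>) powr (-(5/4))" if s: "\<bar>Re s\<bar> \<le> m" for s
  proof -
    have "norm (hat_ker w s) \<le> 16 * w * exp (w * \<bar>Re s\<bar>) * (1 + w * \<bar>Im s\<bar>) powr (-2)" by (rule norm_hat_ker_le[OF w])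
    also have "\<dots> \<le> 16 * w * exp (w * m) * (w1 powr (-2) * (1 + \<bar>Im s\<bar>) powr (-(5/4)))"
    proof (rule mult_mono)
      show "16 * w * exp (w * \<bar>Re s\<bar>) \<le> 16 * w * exp (w * m)" using s w by simp
      have "w1 * (1 + \<bar>Im s\<bar>) \<le> 1 + w * \<bar>Im s\<bar>" using w1 by (simp add: distrib_left add_mono mult_right_mono)
      then have "(1 + w * \<bar>Im s\<bar>) powr (-2) \<le> (w1 * (1 + \<bar>Im s\<bar>)) powr (-2)"
        using w1 by (intro powr_mono2') (auto intro!: mult_pos_pos add_pos_nonneg)
      also have "\<dots> = w1 powr (-2) * (1 + \<bar>Im s\<bar>) powr (-2)" by (rule powr_mult)
      also have "\<dots> \<le> w1 powr (-2) * (1 + \<bar>Im s\<bar>) powr (-(5/4))" by (intro mult_left_mono powr_mono) auto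
      finally show "(1 + w * \<bar>Im s\<bar>) powr (-2) \<le> w1 powr (-2) * (1 + \<bar>Im s\<bar>) powr (-(5/4))" .
    qed (use w in auto)
    finally have 1: "norm (hat_ker w s) \<le> 16 * w * exp (w * m) * (w1 powr (-2) * (1 + \<bar>Im s\<bar>) powr (-(5/4)))" .
    have "u * Re s \<le> \<bar>u\<bar> * \<bar>Re s\<bar>" by (metis abs_ge_self abs_mult)
    also have "\<dots> \<le> \<bar>u\<bar> * m" using s by (intro mult_left_mono) auto
    finally have "norm (exp (of_real u * s)) \<le> exp (\<bar>u\<bar> * m)" by (simp add: norm_exp_eq_Re)
    from mult_mono[OF 1 this] show ?thesis using w by (simp add: f_def norm_mult mult_ac)
  qed
  have hol: "f holomorphic_on {s. l < Re s}" for l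
    unfolding f_def by (intro holomorphic_intros hat_ker_holomorphic)
  have ex0: "has_bochner_integral lborel (\<lambda>t. f (Complex 0 t)) (of_real (2 * pi * hat w u))"
  proof -
    define A where "A = (\<lambda>t. (2 - 2 * cos (w * t)) / (w * t\<^sup>2))"
    have A: "has_bochner_integral lborel (\<lambda>t. A t * cos (u * t)) (2 * pi * hat w u)"
      unfolding A_def by (rule hat_fourier_cos[OF w])
    have A0: "integrable lborel A" using hat_fourier_cos[OF w, of 0] by (simp add: A_def has_bochner_integral_iff)
    have sn: "integrable lborel (\<lambda>t. A t * sin (u * t))"
    proof (rule Bochner_Integration.integrable_bound[OF A0])
      show "(\<lambda>t. A t * sin (u * t)) \<in> borel_measurable lborel" unfolding A_def by measurable
      show "AE t in lborel. norm (A t * sin (u * t)) \<le> norm (A t)"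
        by (auto simp: abs_mult intro!: AE_I2 mult_left_le)
    qed
    have "integral\<^sup>L lborel (\<lambda>t. A t * sin (u * t)) = 0"
    proof -
      have "integral\<^sup>L lborel (\<lambda>t. A t * sin (u * t)) = integral\<^sup>L lborel (\<lambda>t. A (0 + (-1) * t) * sin (u * (0 + (-1) * t)))"
        by (subst lborel_integral_real_affine[where c = "-1" and t = 0]) auto
      also have "\<dots> = - integral\<^sup>L lborel (\<lambda>t. A t * sin (u * t))" by (simp add: A_def)
      finally show ?thesis by simp
    qed
    then have S: "has_bochner_integral lborel (\<lambda>t. A t * sin (u * t)) 0" using sn by (simp add: has_bochner_integral_iff)
    have "has_bochner_integral lborel (\<lambda>t. complex_of_real (A t * cos (u * t)) + \<i> * of_real (A t * sin (u * t)))
        (of_real (2 * pi * hat w u) + \<i> * of_real 0)"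
      by (intro has_bochner_integral_add has_bochner_integral_mult_right has_bochner_integral_of_real A S)
    moreover have "AE t in lborel. complex_of_real (A t * cos (u * t)) + \<i> * of_real (A t * sin (u * t)) = f (Complex 0 t)"
      using AE_lborel_singleton[of 0]
    proof eventually_elim
      case (elim t)
      have "exp (of_real u * Complex 0 t) = of_real (cos (u * t)) + \<i> * of_real (sin (u * t))"
        by (simp add: complex_eq_iff Re_exp Im_exp)
      moreover have "hat_ker w (Complex 0 t) = of_real (A t)" unfolding A_def using w elim by (intro hat_ker_imag) auto
      ultimately show ?case by (simp add: f_def algebra_simps)
    qed
    moreover have "(\<lambda>t. f (Complex 0 t)) \<in> borel_measurable lborel"
      by (rule vertical_line_measurable[OF hol[of "-1"]]) simp
    ultimately show ?thesis
      by (subst (asm) has_bochner_integral_cong_AE[where g = "\<lambda>t. f (Complex 0 t)"]) (auto simp: A_def)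
  qed
  have "integrable lborel (\<lambda>t. f (Complex c t)) \<and> integral\<^sup>L lborel (\<lambda>t. f (Complex c t)) = of_real (2 * pi * hat w u)"
  proof (cases "c \<ge> 0")
    case True
    note * = vertical_line_shift[OF hol[of "-1"], of 0 c, OF _ True bound]
    show ?thesis using * ex0 by (auto simp: m_def has_bochner_integral_iff True)
  next
    case False
    note * = vertical_line_shift[OF hol[of "c - 1"], of c 0, OF _ _ bound]
    show ?thesis using * ex0 False by (auto simp: m_def has_bochner_integral_iff)
  qed
  then show "integrable lborel (\<lambda>t. hat_ker w (Complex c t) * exp (of_real u * Complex c t))"
    "integral\<^sup>L lborel (\<lambda>t. hat_ker w (Complex c t) * exp (of_real u * Complex c t)) = of_real (2 * pi * hat w u)"
    by (auto simp: f_def)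
qed

section \<open>Prime polynomials\<close>

text \<open>Series and kernel both converge absolutely, so integration is termwise. The triangular
  weight in \<open>ln n\<close> takes the place of a sharp cutoff, whose kernel would decay only to
  first order. The parameter \<open>z\<close> selects the point at which the weighted Dirichlet
  polynomial is evaluated.\<close>

lemma perron_hat:
  assumes w: "w > 0" and a: "dconv a (Re z + c)"
  shows "integral\<^sup>L lborel (\<lambda>t. dser a (z + Complex c t) * (hat_ker w (Complex c t) * exp (of_real y * Complex c t))) =
     of_real (2 * pi) * (\<Sum>n. a n * of_nat n powr (-z) * of_real (hat w (ln (real n) - y)))"
proof -
  define k where "k = (\<lambda>t. hat_ker w (Complex c t) * exp (of_real y * Complex c t))"
  define f where "f = (\<lambda>n t. a n * of_nat n powr (-(z + Complex c t)) * k t)"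
  have k: "integrable lborel k" unfolding k_def by (rule hat_inversion(1)[OF w])
  have fn: "integrable lborel (f n)" "integral\<^sup>L lborel (f n) = of_real (2 * pi) * (a n * of_nat n powr (-z) * of_real (hat w (ln (real n) - y)))" for n
  proof -
    have eq: "f n = (\<lambda>t. (a n * of_nat n powr (-z)) * (hat_ker w (Complex c t) * exp (of_real (y - ln (real n)) * Complex c t)))"
    proof (cases "n = 0")
      case False
      show ?thesis
      proof
        fix t
        have "complex_of_nat n powr (-(z + Complex c t)) = of_nat n powr (-z) * of_nat n powr (- Complex c t)"
          by (simp flip: powr_add)
        also have "complex_of_nat n powr (- Complex c t) = exp (- Complex c t * of_real (ln (real n)))"
          using False by (simp add: powr_def Ln_of_nat)
        finally have 1: "complex_of_nat n powr (-(z + Complex c t)) = of_nat n powr (-z) * exp (- Complex c t * of_real (ln (real n)))" .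
        have 2: "exp (of_real (y - ln (real n)) * Complex c t) = exp (of_real y * Complex c t) * exp (- Complex c t * of_real (ln (real n)))"
          by (simp add: algebra_simps flip: exp_add)
        show "f n t = (a n * of_nat n powr (-z)) * (hat_ker w (Complex c t) * exp (of_real (y - ln (real n)) * Complex c t))"
          unfolding f_def k_def 1 2 by (simp only: mult_ac)
      qed
    qed (simp add: f_def)
    show "integrable lborel (f n)" unfolding eq by (intro integrable_mult_right hat_inversion w)
    have "hat w (y - ln (real n)) = hat w (ln (real n) - y)" using hat_minus[of w "ln (real n) - y"] by simp
    then show "integral\<^sup>L lborel (f n) = of_real (2 * pi) * (a n * of_nat n powr (-z) * of_real (hat w (ln (real n) - y)))"
      unfolding eq integral_mult_right_zero hat_inversion(2)[OF w] by simp
  qed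
  have nf: "norm (f n t) = norm (a n) * real n powr (-(Re z + c)) * norm (k t)" for n t
    by (cases "n = 0") (simp_all add: f_def norm_mult norm_of_nat_powr)
  have sm: "summable (\<lambda>n. norm (a n) * real n powr (-(Re z + c)))" using a by (simp add: dconv_def)
  have "(\<lambda>n. integral\<^sup>L lborel (f n)) sums (integral\<^sup>L lborel (\<lambda>t. \<Sum>n. f n t))"
  proof (rule sums_integral)
    show "AE t in lborel. summable (\<lambda>n. norm (f n t))" unfolding nf by (intro AE_I2 summable_mult2 sm)
    show "summable (\<lambda>n. integral\<^sup>L lborel (\<lambda>t. norm (f n t)))"
      unfolding nf integral_mult_right_zero by (intro summable_mult2 sm)
  qed (rule fn)
  moreover have "(\<Sum>n. f n t) = dser a (z + Complex c t) * k t" for t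
  proof -
    have "(\<lambda>n. a n * of_nat n powr (-(z + Complex c t))) sums dser a (z + Complex c t)"
      by (rule dser_sums) (use a in simp)
    from sums_mult2[OF this, of "k t"] show ?thesis by (simp add: f_def sums_iff)
  qed
  ultimately have "(\<lambda>n. of_real (2 * pi) * (a n * of_nat n powr (-z) * of_real (hat w (ln (real n) - y)))) sums (integral\<^sup>L lborel (\<lambda>t. dser a (z + Complex c t) * k t))"
    unfolding fn by simp
  then have S: "(\<lambda>n. of_real (2 * pi) * (a n * of_nat n powr (-z) * of_real (hat w (ln (real n) - y))) / of_real (2 * pi)) sums (integral\<^sup>L lborel (\<lambda>t. dser a (z + Complex c t) * k t) / of_real (2 * pi))"
    by (rule sums_divide)
  have "(\<Sum>n. a n * of_nat n powr (-z) * of_real (hat w (ln (real n) - y))) = integral\<^sup>L lborel (\<lambda>t. dser a (z + Complex c t) * k t) / of_real (2 * pi)"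
    using S by (simp add: sums_iff)
  then show ?thesis by (simp add: k_def)
qed

text \<open>The logarithm at height \<open>t + \<tau>\<close> splits into logarithms of
  \<open>\<bar>t\<bar> + 3\<close>, of \<open>1 / w\<close> and of
  \<open>1 + w * \<bar>\<tau>\<bar>\<close>. The last is at most twice the square root of its
  argument and costs half a power of the decay.\<close>

lemma ln_shift_decay:
  fixes w t \<tau> :: real
  assumes w: "0 < w" "w \<le> 1"
  shows "ln (\<bar>t + \<tau>\<bar> + 3) * (1 + w * \<bar>\<tau>\<bar>) powr (-2) \<le>
     (ln (\<bar>t\<bar> + 3) + ln (1 / w) + 2) * (1 + w * \<bar>\<tau>\<bar>) powr (-(3/2))"
proof -
  define x where "x = 1 + w * \<bar>\<tau>\<bar>"
  have x: "x \<ge> 1" using w by (simp add: x_def)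
  have "\<bar>t + \<tau>\<bar> + 3 \<le> \<bar>t\<bar> + \<bar>\<tau>\<bar> + 3" by linarith
  also have "\<dots> \<le> (\<bar>t\<bar> + 3) * (1 + \<bar>\<tau>\<bar>)" by (simp add: algebra_simps)
  also have "\<dots> \<le> (\<bar>t\<bar> + 3) * ((1 / w) * x)"
    using w by (intro mult_left_mono) (auto simp: x_def field_simps)
  finally have "ln (\<bar>t + \<tau>\<bar> + 3) \<le> ln ((\<bar>t\<bar> + 3) * ((1 / w) * x))"
    using w x by (subst ln_le_cancel_iff) (auto intro!: mult_pos_pos divide_pos_pos add_nonneg_pos)
  also have "\<dots> = ln (\<bar>t\<bar> + 3) + ln (1 / w) + ln x"
    using w x by (simp add: ln_mult ln_div)
  also have "ln x \<le> x powr (1/2) / (1/2)" using x by (intro ln_powr_bound) auto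
  also have "\<dots> = 2 * x powr (1/2)" by simp
  finally have 1: "ln (\<bar>t + \<tau>\<bar> + 3) \<le> ln (\<bar>t\<bar> + 3) + ln (1 / w) + 2 * x powr (1/2)" by simp
  have A: "ln (\<bar>t\<bar> + 3) + ln (1 / w) \<ge> 0" using w by (intro add_nonneg_nonneg ln_ge_zero) auto
  have "1 \<le> x powr (1/2)" using x by (intro ge_one_powr_ge_zero) auto
  from mult_left_mono[OF this A]
  have "ln (\<bar>t + \<tau>\<bar> + 3) \<le> (ln (\<bar>t\<bar> + 3) + ln (1 / w) + 2) * x powr (1/2)"
    using 1 by (simp add: distrib_right)
  then have "ln (\<bar>t + \<tau>\<bar> + 3) * x powr (-2) \<le> (ln (\<bar>t\<bar> + 3) + ln (1 / w) + 2) * x powr (1/2) * x powr (-2)"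
    by (intro mult_right_mono) auto
  also have "\<dots> = (ln (\<bar>t\<bar> + 3) + ln (1 / w) + 2) * (x powr (1/2) * x powr (-2))" by simp
  also have "x powr (1/2) * x powr (-2) = x powr (-(3/2))" by (simp flip: powr_add)
  finally show ?thesis by (simp add: x_def)
qed

lemma scaled_decay:
  fixes w p \<tau> :: real
  assumes w: "0 < w" "w \<le> 1" and p: "p \<ge> 0"
  shows "(1 + w * \<bar>\<tau>\<bar>) powr (-p) \<le> w powr (-p) * (1 + \<bar>\<tau>\<bar>) powr (-p)"
proof -
  have "w * (1 + \<bar>\<tau>\<bar>) \<le> 1 + w * \<bar>\<tau>\<bar>" using w by (simp add: distrib_left)
  then have "(1 + w * \<bar>\<tau>\<bar>) powr (-p) \<le> (w * (1 + \<bar>\<tau>\<bar>)) powr (-p)"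
    using w p by (intro powr_mono2') (auto intro!: mult_pos_pos add_pos_nonneg)
  also have "\<dots> = w powr (-p) * (1 + \<bar>\<tau>\<bar>) powr (-p)" by (rule powr_mult)
  finally show ?thesis .
qed

lemma hat_ker_exp_bound:
  assumes w: "0 < w" "w \<le> 1" and b: "\<bar>Re u\<bar> \<le> 2"
  shows "norm (hat_ker w u * exp (of_real y * u)) \<le> 16 * exp 2 * w * (1 + w * \<bar>Im u\<bar>) powr (-2) * exp (y * Re u)"
proof -
  have "norm (hat_ker w u) \<le> 16 * w * exp (w * \<bar>Re u\<bar>) * (1 + w * \<bar>Im u\<bar>) powr (-2)"
    by (rule norm_hat_ker_le[OF w(1)])
  also have "\<dots> \<le> 16 * w * exp 2 * (1 + w * \<bar>Im u\<bar>) powr (-2)"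
    using w b mult_mono[of w 1 "\<bar>Re u\<bar>" 2] by (intro mult_right_mono mult_left_mono) auto
  finally have "norm (hat_ker w u) * norm (exp (of_real y * u)) \<le> 16 * w * exp 2 * (1 + w * \<bar>Im u\<bar>) powr (-2) * exp (y * Re u)"
    using w by (intro mult_mono) (auto simp: norm_exp_eq_Re)
  then show ?thesis by (simp add: norm_mult mult_ac)
qed

text \<open>The pole term \<open>f1\<close> stays to the right of 1, where it has full size but
  decays in \<open>t\<close>; the term \<open>f2\<close> with the logarithmic derivative of
  \<open>zeta_entire\<close> is moved next to the critical line and gives the square root saving for
  every \<open>t\<close>. Uniformity in \<open>\<alpha>\<close> between 0 and 1 is needed to remove
  the weight \<open>ln p\<close> afterwards.\<close>

lemma mangoldt_hat_bound:
  assumes RH: "riemann_hypothesis"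
  obtains C where "C > 0" "\<And>\<alpha> t w y. 0 \<le> \<alpha> \<Longrightarrow> \<alpha> \<le> 1 \<Longrightarrow> 0 < w \<Longrightarrow> w \<le> 1 \<Longrightarrow> y \<ge> 2 \<Longrightarrow>
    norm (\<Sum>n. mangoldt n * of_nat n powr (- Complex \<alpha> t) * of_real (hat w (ln (real n) - y)))
     \<le> C * (exp (y * (1/2 - \<alpha>)) * y\<^sup>2 * (ln (\<bar>t\<bar> + 3) + ln (1 / w) + 2)
           + exp (y * (1 - \<alpha>)) * y / w * (1 + \<bar>t\<bar>) powr (-(3/4)))"
proof -
  obtain C0 where C0: "C0 > 0" "\<And>s. 1/2 < Re s \<Longrightarrow> Re s \<le> 2 \<Longrightarrow>
     norm (deriv zeta_entire s / zeta_entire s) \<le> C0 * ln (\<bar>Im s\<bar> + 3) / (Re s - 1/2)\<^sup>2"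
    using zeta_logderiv_bound[OF RH] by blast
  define C where "C = (64 * C0 + 256) * exp 3"
  have C: "C > 0" using C0 by (simp add: C_def)
  show thesis
  proof (rule that[OF C])
    fix \<alpha> t w y :: real
    assume h: "0 \<le> \<alpha>" "\<alpha> \<le> 1" "0 < w" "w \<le> 1" "y \<ge> 2"
    define z where "z = Complex \<alpha> t"
    \<comment> \<open>The lines lie \<open>1 / y\<close> to the right of 1/2 and of 1 in terms of
      \<open>z + u\<close>. This costs only a constant factor in \<open>exp (y * Re u)\<close>, and
      the bound for the logarithmic derivative loses \<open>y\<^sup>2\<close>.\<close>
    define a where "a = 1/2 + 1/y - \<alpha>"
    define c where "c = 1 + 1/y - \<alpha>"
    have y1: "0 < 1/y" "1/y \<le> 1/2" using h by (auto simp: field_simps)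
    define k where "k = (\<lambda>u. hat_ker w u * exp (of_real y * u))"
    define f1 where "f1 = (\<lambda>u. k u / (z + u - 1))"
    define f2 where "f2 = (\<lambda>u. deriv zeta_entire (z + u) / zeta_entire (z + u) * k u)"
    define A where "A = ln (\<bar>t\<bar> + 3) + ln (1 / w) + 2"
    have A: "A \<ge> 0" unfolding A_def using h by (intro add_nonneg_nonneg ln_ge_zero) auto
    have holk: "k holomorphic_on S" for S unfolding k_def by (intro holomorphic_intros hat_ker_holomorphic)
    have hol1: "f1 holomorphic_on {u. 1 - \<alpha> < Re u}"
      unfolding f1_def by (intro holomorphic_intros holk) (auto simp: z_def complex_eq_iff)
    have hol2: "f2 holomorphic_on {u. 1/2 - \<alpha> < Re u}"
    proof -
      have "zeta_entire holomorphic_on {s. 1/2 < Re s}"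
        by (rule holomorphic_on_subset[OF zeta_entire_holomorphic]) auto
      moreover have "deriv zeta_entire holomorphic_on {s. 1/2 < Re s}"
        by (rule holomorphic_deriv[OF calculation]) (rule open_halfspace_Re_gt)
      ultimately have o: "(\<lambda>s. deriv zeta_entire s / zeta_entire s) holomorphic_on {s. 1/2 < Re s}"
        using zeta_entire_nonzero[OF RH] by (intro holomorphic_on_divide) auto
      have "(\<lambda>u. z + u) holomorphic_on {u. 1/2 - \<alpha> < Re u}" by (intro holomorphic_intros)
      then have "((\<lambda>s. deriv zeta_entire s / zeta_entire s) \<circ> (\<lambda>u. z + u)) holomorphic_on {u. 1/2 - \<alpha> < Re u}"
        by (rule holomorphic_on_compose_gen[OF _ o]) (auto simp: z_def)
      then show ?thesis unfolding f2_def o_def by (intro holomorphic_on_mult holk)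
    qed
    have b2: "norm (f2 u) \<le> C0 * y\<^sup>2 * (A * (1 + w * \<bar>Im u\<bar>) powr (-(3/2))) * (16 * exp 2 * w * exp (y * Re u))"
      if u: "a \<le> Re u" "Re u \<le> c" for u
    proof -
      have "Re (z + u) = \<alpha> + Re u" by (simp add: z_def)
      then have r: "1/y \<le> Re (z + u) - 1/2" "Re (z + u) \<le> 2" using u y1 h unfolding a_def c_def by linarith+
      have ru: "\<bar>Re u\<bar> \<le> 2" using u y1 h unfolding a_def c_def by linarith
      have l0: "ln (\<bar>t + Im u\<bar> + 3) \<ge> 0" by (intro ln_ge_zero) auto
      have "norm (deriv zeta_entire (z + u) / zeta_entire (z + u)) \<le> C0 * ln (\<bar>Im (z + u)\<bar> + 3) / (Re (z + u) - 1/2)\<^sup>2"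
      proof (rule C0(2)[OF _ r(2)])
        show "1/2 < Re (z + u)" using r y1 by linarith
      qed
      also have "\<dots> \<le> C0 * ln (\<bar>t + Im u\<bar> + 3) / (1/y)\<^sup>2"
        using r(1) y1 C0(1) l0 by (intro frac_le power_mono) (auto simp: z_def)
      also have "\<dots> = C0 * y\<^sup>2 * ln (\<bar>t + Im u\<bar> + 3)" by (simp add: power_divide)
      finally have 1: "norm (deriv zeta_entire (z + u) / zeta_entire (z + u)) \<le> C0 * y\<^sup>2 * ln (\<bar>t + Im u\<bar> + 3)" .
      have "norm (k u) \<le> 16 * exp 2 * w * (1 + w * \<bar>Im u\<bar>) powr (-2) * exp (y * Re u)"
        unfolding k_def by (intro hat_ker_exp_bound h ru)
      with 1 have "norm (f2 u) \<le> (C0 * y\<^sup>2 * ln (\<bar>t + Im u\<bar> + 3)) * (16 * exp 2 * w * (1 + w * \<bar>Im u\<bar>) powr (-2) * exp (y * Re u))"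
        unfolding f2_def norm_mult using C0(1) l0 by (intro mult_mono) auto
      also have "\<dots> = C0 * y\<^sup>2 * (ln (\<bar>t + Im u\<bar> + 3) * (1 + w * \<bar>Im u\<bar>) powr (-2)) * (16 * exp 2 * w * exp (y * Re u))"
        by (simp only: mult_ac)
      also have "\<dots> \<le> C0 * y\<^sup>2 * (A * (1 + w * \<bar>Im u\<bar>) powr (-(3/2))) * (16 * exp 2 * w * exp (y * Re u))"
        unfolding A_def using ln_shift_decay[OF h(3,4), of t "Im u"] C0(1) h by (intro mult_right_mono mult_left_mono) auto
      finally show ?thesis .
    qed
    have shift: "integrable lborel (\<lambda>\<tau>. f2 (Complex a \<tau>))" "integrable lborel (\<lambda>\<tau>. f2 (Complex c \<tau>))"
        "integral\<^sup>L lborel (\<lambda>\<tau>. f2 (Complex a \<tau>)) = integral\<^sup>L lborel (\<lambda>\<tau>. f2 (Complex c \<tau>))"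
    proof -
      define B where "B = C0 * y\<^sup>2 * (A * w powr (-(3/2))) * (16 * exp 2 * w * exp (y * c))"
      have "norm (f2 u) \<le> B * (1 + \<bar>Im u\<bar>) powr (-(5/4))" if u: "a \<le> Re u" "Re u \<le> c" for u
      proof -
        have "(1 + w * \<bar>Im u\<bar>) powr (-(3/2)) \<le> w powr (-(3/2)) * (1 + \<bar>Im u\<bar>) powr (-(3/2))"
          using h by (intro scaled_decay) auto
        also have "\<dots> \<le> w powr (-(3/2)) * (1 + \<bar>Im u\<bar>) powr (-(5/4))" by (intro mult_left_mono powr_mono) auto
        finally have d: "(1 + w * \<bar>Im u\<bar>) powr (-(3/2)) \<le> w powr (-(3/2)) * (1 + \<bar>Im u\<bar>) powr (-(5/4))" .
        have "norm (f2 u) \<le> C0 * y\<^sup>2 * (A * (w powr (-(3/2)) * (1 + \<bar>Im u\<bar>) powr (-(5/4)))) * (16 * exp 2 * w * exp (y * c))"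
          using u h A C0(1) d by (intro order.trans[OF b2[OF u]] mult_mono mult_left_mono) auto
        then show ?thesis by (simp only: B_def mult_ac)
      qed
      note * = vertical_line_shift[OF hol2 _ _ this]
      have "1/2 - \<alpha> < a" "a \<le> c" using y1 by (auto simp: a_def c_def)
      from *[OF this] show "integrable lborel (\<lambda>\<tau>. f2 (Complex a \<tau>))" "integrable lborel (\<lambda>\<tau>. f2 (Complex c \<tau>))"
        "integral\<^sup>L lborel (\<lambda>\<tau>. f2 (Complex a \<tau>)) = integral\<^sup>L lborel (\<lambda>\<tau>. f2 (Complex c \<tau>))" by auto
    qed
    have I2: "norm (integral\<^sup>L lborel (\<lambda>\<tau>. f2 (Complex c \<tau>))) \<le> 64 * C0 * exp 3 * (exp (y * (1/2 - \<alpha>)) * y\<^sup>2 * A)"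
    proof -
      define D where "D = C0 * y\<^sup>2 * A * (16 * exp 2 * w * exp (y * a))"
      have hb: "has_bochner_integral lborel (\<lambda>\<tau>. D * (1 + w * \<bar>\<tau>\<bar>) powr (-(3/2))) (D * (2 / (3/2 - 1) / w))"
        using h by (intro has_bochner_integral_mult_right has_bochner_integral_decay_scaled) auto
      have "norm (integral\<^sup>L lborel (\<lambda>\<tau>. f2 (Complex a \<tau>))) \<le> integral\<^sup>L lborel (\<lambda>\<tau>. D * (1 + w * \<bar>\<tau>\<bar>) powr (-(3/2)))"
      proof (rule Bochner_Integration.integral_norm_bound_integral[OF shift(1)])
        show "integrable lborel (\<lambda>\<tau>. D * (1 + w * \<bar>\<tau>\<bar>) powr (-(3/2)))" using hb by (simp add: has_bochner_integral_iff)
        show "norm (f2 (Complex a \<tau>)) \<le> D * (1 + w * \<bar>\<tau>\<bar>) powr (-(3/2))" for \<tau>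
          using b2[of "Complex a \<tau>"] y1 by (simp add: a_def c_def D_def mult_ac)
      qed
      also have "\<dots> = D * (2 / (3/2 - 1) / w)" using hb by (simp add: has_bochner_integral_iff)
      also have "\<dots> = 64 * C0 * (exp 2 * exp (y * a)) * (y\<^sup>2 * A)" using h by (simp add: D_def)
      also have "exp 2 * exp (y * a) = exp 3 * exp (y * (1/2 - \<alpha>))"
        using h by (simp add: a_def algebra_simps flip: exp_add)
      finally show ?thesis unfolding shift(3) by (simp only: mult_ac)
    qed
    have b1: "norm (f1 (Complex c \<tau>)) \<le> (32 * exp 3 * (exp (y * (1 - \<alpha>)) * y / w * (1 + \<bar>t\<bar>) powr (-(3/4)))) * (1 + \<bar>\<tau>\<bar>) powr (-(5/4))" for \<tau>
    proof -
      define s where "s = z + Complex c \<tau> - 1"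
      have s: "Re s = 1/y" "Im s = t + \<tau>" by (simp_all add: s_def z_def c_def)
      have "1/y \<le> norm s" "\<bar>t + \<tau>\<bar> \<le> norm s" using abs_Re_le_cmod[of s] abs_Im_le_cmod[of s] y1 by (auto simp: s)
      then have "1 \<le> y * norm s" "\<bar>t + \<tau>\<bar> \<le> y * norm s"
        using h mult_right_mono[of 1 y "norm s"] by (auto simp: field_simps)
      then have s2: "1 + \<bar>t + \<tau>\<bar> \<le> 2 * y * norm s" by linarith
      have ns: "norm s > 0" using \<open>1/y \<le> norm s\<close> y1 by linarith
      have p: "1 + \<bar>t + \<tau>\<bar> > 0" by linarith
      have "1 / norm s \<le> 2 * y * (1 / (1 + \<bar>t + \<tau>\<bar>))" using s2 ns p by (simp add: field_simps)
      \<comment> \<open>A quarter of the decay in \<open>t\<close> is given up: moving the first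
        power from \<open>t + \<tau>\<close> to \<open>t\<close> would leave only
        \<open>(1 + \<bar>\<tau>\<bar>) powr (-1)\<close>, which is not integrable, whereas the
        power 3/4 leaves \<open>-(5/4)\<close>.\<close>
      also have "1 / (1 + \<bar>t + \<tau>\<bar>) \<le> ((1 + \<bar>\<tau>\<bar>) / (1 + \<bar>t\<bar>)) powr (3/4)"
      proof -
        have "1 / (1 + \<bar>t + \<tau>\<bar>) \<le> (1 / (1 + \<bar>t + \<tau>\<bar>)) powr (3/4)"
          using powr_mono'[of "3/4" 1 "1 / (1 + \<bar>t + \<tau>\<bar>)"] p by (simp add: divide_le_eq)
        also have "\<dots> \<le> ((1 + \<bar>\<tau>\<bar>) / (1 + \<bar>t\<bar>)) powr (3/4)"
        proof (intro powr_mono2)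
          have "1 + \<bar>t\<bar> \<le> 1 + \<bar>\<tau>\<bar> + \<bar>t + \<tau>\<bar>" by linarith
          also have "\<dots> \<le> (1 + \<bar>\<tau>\<bar>) * (1 + \<bar>t + \<tau>\<bar>)" by (simp add: algebra_simps)
          finally show "1 / (1 + \<bar>t + \<tau>\<bar>) \<le> (1 + \<bar>\<tau>\<bar>) / (1 + \<bar>t\<bar>)"
            using p by (subst frac_le_eq) (auto simp: field_simps add_pos_nonneg intro!: divide_nonpos_pos mult_pos_pos)
        qed (use p in auto)
        finally show ?thesis .
      qed
      also have "((1 + \<bar>\<tau>\<bar>) / (1 + \<bar>t\<bar>)) powr (3/4) = (1 + \<bar>\<tau>\<bar>) powr (3/4) * (1 + \<bar>t\<bar>) powr (-(3/4))"
        by (simp only: powr_divide powr_minus_divide times_divide_eq_right mult_1_right)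
      finally have 1: "1 / norm s \<le> 2 * y * ((1 + \<bar>\<tau>\<bar>) powr (3/4) * (1 + \<bar>t\<bar>) powr (-(3/4)))"
        using h by simp
      have "norm (k (Complex c \<tau>)) \<le> 16 * exp 2 * w * (1 + w * \<bar>\<tau>\<bar>) powr (-2) * exp (y * c)"
      proof -
        have "\<bar>c\<bar> \<le> 2" using y1 h unfolding c_def by linarith
        then show ?thesis using hat_ker_exp_bound[of w "Complex c \<tau>" y] h by (simp add: k_def)
      qed
      also have "\<dots> \<le> 16 * exp 2 * w * (w powr (-2) * (1 + \<bar>\<tau>\<bar>) powr (-2)) * exp (y * c)"
        using h scaled_decay[of w 2 \<tau>] by (intro mult_right_mono mult_left_mono) auto
      also have "\<dots> = 16 * (exp 2 * exp (y * c)) * (w * w powr (-2)) * (1 + \<bar>\<tau>\<bar>) powr (-2)" by (simp only: mult_ac)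
      also have "w * w powr (-2) = 1 / w" using h by (simp add: powr_minus powr_numeral power2_eq_square field_simps)
      also have "exp 2 * exp (y * c) = exp 3 * exp (y * (1 - \<alpha>))"
        using h by (simp add: c_def algebra_simps flip: exp_add)
      finally have 2: "norm (k (Complex c \<tau>)) \<le> 16 * (exp 3 * exp (y * (1 - \<alpha>))) * (1/w) * (1 + \<bar>\<tau>\<bar>) powr (-2)" .
      have "norm (f1 (Complex c \<tau>)) = norm (k (Complex c \<tau>)) * (1 / norm s)" by (simp add: f1_def s_def norm_divide)
      also have "\<dots> \<le> (16 * (exp 3 * exp (y * (1 - \<alpha>))) * (1/w) * (1 + \<bar>\<tau>\<bar>) powr (-2)) * (2 * y * ((1 + \<bar>\<tau>\<bar>) powr (3/4) * (1 + \<bar>t\<bar>) powr (-(3/4))))"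
        using h by (intro mult_mono 1 2) auto
      also have "\<dots> = (32 * exp 3 * (exp (y * (1 - \<alpha>)) * y / w * (1 + \<bar>t\<bar>) powr (-(3/4)))) * ((1 + \<bar>\<tau>\<bar>) powr (3/4) * (1 + \<bar>\<tau>\<bar>) powr (-2))"
        by (simp add: mult_ac)
      also have "(1 + \<bar>\<tau>\<bar>) powr (3/4) * (1 + \<bar>\<tau>\<bar>) powr (-2) = (1 + \<bar>\<tau>\<bar>) powr (-(5/4))" by (simp flip: powr_add)
      finally show ?thesis .
    qed
    define D1 where "D1 = 32 * exp 3 * (exp (y * (1 - \<alpha>)) * y / w * (1 + \<bar>t\<bar>) powr (-(3/4)))"
    have hb1: "has_bochner_integral lborel (\<lambda>\<tau>. D1 * (1 + \<bar>\<tau>\<bar>) powr (-(5/4))) (D1 * (2 / (5/4 - 1)))"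
      by (intro has_bochner_integral_mult_right has_bochner_integral_decay) auto
    have i1: "integrable lborel (\<lambda>\<tau>. f1 (Complex c \<tau>))"
    proof (rule Bochner_Integration.integrable_bound)
      show "integrable lborel (\<lambda>\<tau>. D1 * (1 + \<bar>\<tau>\<bar>) powr (-(5/4)))" using hb1 by (simp add: has_bochner_integral_iff)
      show "(\<lambda>\<tau>. f1 (Complex c \<tau>)) \<in> borel_measurable lborel"
        by (rule vertical_line_measurable(1)[OF hol1]) (use y1 in \<open>simp add: c_def\<close>)
      show "AE \<tau> in lborel. norm (f1 (Complex c \<tau>)) \<le> norm (D1 * (1 + \<bar>\<tau>\<bar>) powr (-(5/4)))"
        by (intro AE_I2 order.trans[OF b1[folded D1_def]]) (simp only: real_norm_def abs_ge_self)
    qed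
    have I1: "norm (integral\<^sup>L lborel (\<lambda>\<tau>. f1 (Complex c \<tau>))) \<le> 256 * exp 3 * (exp (y * (1 - \<alpha>)) * y / w * (1 + \<bar>t\<bar>) powr (-(3/4)))"
    proof -
      have "norm (integral\<^sup>L lborel (\<lambda>\<tau>. f1 (Complex c \<tau>))) \<le> integral\<^sup>L lborel (\<lambda>\<tau>. D1 * (1 + \<bar>\<tau>\<bar>) powr (-(5/4)))"
        using hb1 by (intro Bochner_Integration.integral_norm_bound_integral i1 b1[folded D1_def]) (simp add: has_bochner_integral_iff)
      also have "\<dots> = D1 * 8" using hb1 by (simp add: has_bochner_integral_iff)
      finally show ?thesis by (simp add: D1_def)
    qed
    have int_eq: "dser mangoldt (z + Complex c \<tau>) * k (Complex c \<tau>) = f1 (Complex c \<tau>) - f2 (Complex c \<tau>)" for \<tau>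
      using mangoldt_dser[of "z + Complex c \<tau>"] y1 by (simp add: z_def c_def f1_def f2_def left_diff_distrib)
    have "of_real (2 * pi) * (\<Sum>n. mangoldt n * of_nat n powr (-z) * of_real (hat w (ln (real n) - y))) =
        integral\<^sup>L lborel (\<lambda>\<tau>. dser mangoldt (z + Complex c \<tau>) * k (Complex c \<tau>))"
      unfolding k_def using h y1 by (intro perron_hat[symmetric] dconv_mangoldt) (auto simp: z_def c_def)
    also have "\<dots> = integral\<^sup>L lborel (\<lambda>\<tau>. f1 (Complex c \<tau>)) - integral\<^sup>L lborel (\<lambda>\<tau>. f2 (Complex c \<tau>))"
      unfolding int_eq by (rule Bochner_Integration.integral_diff[OF i1 shift(2)])
    finally have fe: "of_real (2 * pi) * (\<Sum>n. mangoldt n * of_nat n powr (-z) * of_real (hat w (ln (real n) - y))) =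
        integral\<^sup>L lborel (\<lambda>\<tau>. f1 (Complex c \<tau>)) - integral\<^sup>L lborel (\<lambda>\<tau>. f2 (Complex c \<tau>))" .
    have "norm (of_real (2 * pi) * (\<Sum>n. mangoldt n * of_nat n powr (-z) * of_real (hat w (ln (real n) - y)))) \<le>
        256 * exp 3 * (exp (y * (1 - \<alpha>)) * y / w * (1 + \<bar>t\<bar>) powr (-(3/4))) + 64 * C0 * exp 3 * (exp (y * (1/2 - \<alpha>)) * y\<^sup>2 * A)"
      unfolding fe using norm_triangle_ineq4[of "integral\<^sup>L lborel (\<lambda>\<tau>. f1 (Complex c \<tau>))" "integral\<^sup>L lborel (\<lambda>\<tau>. f2 (Complex c \<tau>))"] I1 I2 by linarith
    also have "\<dots> \<le> C * (exp (y * (1 - \<alpha>)) * y / w * (1 + \<bar>t\<bar>) powr (-(3/4))) + C * (exp (y * (1/2 - \<alpha>)) * y\<^sup>2 * A)"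
      using h A C0(1) by (intro add_mono mult_right_mono) (auto simp: C_def)
    finally have fin: "2 * pi * norm (\<Sum>n. mangoldt n * of_nat n powr (-z) * of_real (hat w (ln (real n) - y))) \<le>
        C * (exp (y * (1/2 - \<alpha>)) * y\<^sup>2 * A + exp (y * (1 - \<alpha>)) * y / w * (1 + \<bar>t\<bar>) powr (-(3/4)))"
      by (simp add: norm_mult distrib_left)
    have "1 * norm (\<Sum>n. mangoldt n * of_nat n powr (-z) * of_real (hat w (ln (real n) - y))) \<le> 2 * pi * norm (\<Sum>n. mangoldt n * of_nat n powr (-z) * of_real (hat w (ln (real n) - y)))"
      using pi_ge_two by (intro mult_right_mono) auto
    with fin show "norm (\<Sum>n. mangoldt n * of_nat n powr (- Complex \<alpha> t) * of_real (hat w (ln (real n) - y)))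
     \<le> C * (exp (y * (1/2 - \<alpha>)) * y\<^sup>2 * (ln (\<bar>t\<bar> + 3) + ln (1 / w) + 2)
           + exp (y * (1 - \<alpha>)) * y / w * (1 + \<bar>t\<bar>) powr (-(3/4)))"
      by (simp add: A_def z_def)
  qed
qed

section \<open>From the von Mangoldt function to unweighted sums over primes\<close>

lemma finite_near_exp: "finite {n::nat. P n \<and> \<bar>ln (real n) - y\<bar> < w}"
proof (rule finite_subset)
  show "{n::nat. P n \<and> \<bar>ln (real n) - y\<bar> < w} \<subseteq> {..nat \<lfloor>exp (y + w)\<rfloor>}"
  proof
    fix n assume "n \<in> {n::nat. P n \<and> \<bar>ln (real n) - y\<bar> < w}"
    then have n: "ln (real n) < y + w" by (auto simp: abs_less_iff)
    have "real n \<le> exp (y + w)"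
    proof (cases "n = 0")
      case False
      then show ?thesis using exp_less_mono[OF n] by simp
    qed simp
    then show "n \<in> {..nat \<lfloor>exp (y + w)\<rfloor>}" by (simp add: le_nat_floor)
  qed
qed simp

lemma near_exp_bounds:
  assumes "\<bar>ln (real n) - y\<bar> < w" "w \<le> 1" "n > 0"
  shows "exp (y - 1) \<le> real n" "real n \<le> exp (y + 1)"
proof -
  have "y - 1 \<le> ln (real n)" "ln (real n) \<le> y + 1" using assms by linarith+
  then have "exp (y - 1) \<le> exp (ln (real n))" "exp (ln (real n)) \<le> exp (y + 1)" by simp_all
  then show "exp (y - 1) \<le> real n" "real n \<le> exp (y + 1)" using assms by simp_all
qed

text \<open>A proper prime power up to \<open>X\<close> is determined by a base at most
  \<open>sqrt X\<close> and an exponent at most \<open>ln X / ln 2\<close>, and its weight is at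
  most \<open>ln X\<close>.\<close>

lemma nonprime_primepow_sum_bound:
  assumes "X \<ge> 2"
  shows "(\<Sum>n | primepow n \<and> \<not> prime n \<and> real n \<le> X. mangoldt n) \<le> 2 * sqrt X * (ln X)\<^sup>2"
    "finite {n. primepow n \<and> \<not> prime n \<and> real n \<le> X}"
proof -
  define A where "A = {n. primepow n \<and> \<not> prime n \<and> real n \<le> X}"
  define S where "S = {1..nat \<lfloor>sqrt X\<rfloor>} \<times> {1..nat \<lfloor>ln X / ln 2\<rfloor>}"
  have lnX: "ln X > 0" using assms by simp
  have sub: "A \<subseteq> (\<lambda>(p,k). p ^ k) ` S"
  proof
    fix n assume n: "n \<in> A"
    then obtain p k where pk: "prime p" "k > 0" "n = p ^ k" by (auto simp: A_def primepow_def)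
    have k2: "k \<ge> 2" using n pk by (cases "k = 1") (auto simp: A_def)
    have p2: "p \<ge> 2" using pk prime_ge_2_nat by blast
    have nX: "real p ^ k \<le> X" using n pk by (simp add: A_def)
    have "real p ^ 2 \<le> real p ^ k" using p2 k2 by (intro power_increasing) auto
    then have "real p ^ 2 \<le> X" using nX by linarith
    then have "real p \<le> sqrt X" by (intro real_le_rsqrt)
    then have 1: "p \<in> {1..nat \<lfloor>sqrt X\<rfloor>}" using p2 by (simp add: le_nat_floor)
    have "2 ^ k \<le> real p ^ k" using p2 by (intro power_mono) auto
    then have "(2::real) ^ k \<le> X" using nX by linarith
    then have "ln ((2::real) ^ k) \<le> ln X" using assms by (subst ln_le_cancel_iff) auto
    then have "real k \<le> ln X / ln 2" by (simp add: ln_realpow field_simps)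
    then have "k \<in> {1..nat \<lfloor>ln X / ln 2\<rfloor>}" using k2 by (simp add: le_nat_floor)
    then show "n \<in> (\<lambda>(p,k). p ^ k) ` S" using 1 pk by (auto simp: S_def)
  qed
  have finS: "finite S" by (simp add: S_def)
  show fin: "finite {n. primepow n \<and> \<not> prime n \<and> real n \<le> X}" using finite_subset[OF sub] finS by (simp add: A_def)
  have cS: "real (card S) \<le> sqrt X * (ln X / ln 2)"
  proof -
    have "real (card S) = real (nat \<lfloor>sqrt X\<rfloor>) * real (nat \<lfloor>ln X / ln 2\<rfloor>)" by (simp add: S_def)
    also have "\<dots> \<le> sqrt X * (ln X / ln 2)" using assms lnX by (intro mult_mono) (auto intro!: of_nat_floor)
    finally show ?thesis .
  qed
  have cA: "real (card A) \<le> real (card S)" using surj_card_le[OF finS sub] by simp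
  have "mangoldt n \<le> ln X" if "n \<in> A" for n
  proof -
    have n0: "n > 0" using that primepow_gt_0_nat by (auto simp: A_def)
    have "mangoldt n \<le> (\<Sum>d | d dvd n. mangoldt d :: real)"
      by (rule member_le_sum[of n "{d. d dvd n}" mangoldt]) (use n0 in \<open>simp_all add: mangoldt_nonneg\<close>)
    also have "\<dots> = ln (real n)" using mangoldt_sum[of n, where ?'a = real] n0 by simp
    also have "\<dots> \<le> ln X" using n0 that by (simp add: A_def)
    finally show ?thesis .
  qed
  then have "(\<Sum>n\<in>A. mangoldt n) \<le> real (card A) * ln X" by (intro sum_bounded_above) auto
  also have "\<dots> \<le> (sqrt X * (ln X / ln 2)) * ln X" using cA cS lnX by (intro mult_right_mono) auto
  also have "\<dots> = sqrt X * (ln X)\<^sup>2 * (1 / ln 2)" by (simp add: power2_eq_square)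
  also have "\<dots> \<le> sqrt X * (ln X)\<^sup>2 * 2"
  proof (intro mult_left_mono)
    have "ln 2 \<ge> (1/2::real)" using ln2_ge_two_thirds by simp
    then show "1 / ln 2 \<le> (2::real)" by (simp add: divide_le_eq)
  qed (use assms in auto)
  finally show "(\<Sum>n | primepow n \<and> \<not> prime n \<and> real n \<le> X. mangoldt n) \<le> 2 * sqrt X * (ln X)\<^sup>2"
    by (simp add: A_def mult_ac)
qed

definition prime_poly :: "real \<Rightarrow> real \<Rightarrow> complex \<Rightarrow> complex" where
  "prime_poly w y s = (\<Sum>p | prime p \<and> \<bar>ln (real p) - y\<bar> < w. of_real (hat w (ln (real p) - y)) * of_nat p powr (-s))"

text \<open>Proper prime powers near \<open>exp y\<close> contribute at most about
  \<open>exp (y / 2) * y\<^sup>2\<close>, the size of a term that is present anyway. The factor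
  \<open>exp (- (\<alpha> * y))\<close> is displayed because \<open>\<alpha>\<close> is about to be
  integrated.\<close>

lemma log_prime_poly_bound:
  assumes RH: "riemann_hypothesis"
  obtains C where "C > 0" "\<And>\<alpha> t w y. 0 \<le> \<alpha> \<Longrightarrow> \<alpha> \<le> 1 \<Longrightarrow> 0 < w \<Longrightarrow> w \<le> 1 \<Longrightarrow> y \<ge> 2 \<Longrightarrow>
    norm (\<Sum>p | prime p \<and> \<bar>ln (real p) - y\<bar> < w. of_real (ln (real p) * hat w (ln (real p) - y)) * of_nat p powr (- Complex \<alpha> t))
     \<le> C * exp (- (\<alpha> * y)) * (exp (y / 2) * y\<^sup>2 * (ln (\<bar>t\<bar> + 3) + ln (1 / w) + 2)
           + exp y * y / w * (1 + \<bar>t\<bar>) powr (-(3/4)))"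
proof -
  obtain C0 where C0: "C0 > 0" "\<And>\<alpha> t w y. 0 \<le> \<alpha> \<Longrightarrow> \<alpha> \<le> 1 \<Longrightarrow> 0 < w \<Longrightarrow> w \<le> 1 \<Longrightarrow> y \<ge> 2 \<Longrightarrow>
    norm (\<Sum>n. mangoldt n * of_nat n powr (- Complex \<alpha> t) * of_real (hat w (ln (real n) - y)))
     \<le> C0 * (exp (y * (1/2 - \<alpha>)) * y\<^sup>2 * (ln (\<bar>t\<bar> + 3) + ln (1 / w) + 2)
           + exp (y * (1 - \<alpha>)) * y / w * (1 + \<bar>t\<bar>) powr (-(3/4)))"
    using mangoldt_hat_bound[OF RH] by blast
  define C where "C = C0 + 9 * exp 2"
  show thesis
  proof (rule that[of C])
    show "C > 0" using C0 by (simp add: C_def add_pos_pos)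
    fix \<alpha> t w y :: real
    assume h: "0 \<le> \<alpha>" "\<alpha> \<le> 1" "0 < w" "w \<le> 1" "y \<ge> 2"
    define f where "f = (\<lambda>n. mangoldt n * complex_of_nat n powr (- Complex \<alpha> t) * of_real (hat w (ln (real n) - y)))"
    define A where "A = {n. primepow n \<and> \<bar>ln (real n) - y\<bar> < w}"
    define Ap where "Ap = {n. prime n \<and> \<bar>ln (real n) - y\<bar> < w}"
    define L where "L = ln (\<bar>t\<bar> + 3) + ln (1 / w) + 2"
    have L: "L \<ge> 2" unfolding L_def using h ln_ge_zero[of "\<bar>t\<bar> + 3"] ln_ge_zero[of "1/w"] by (auto simp: field_simps)
    have finA: "finite A" unfolding A_def by (rule finite_near_exp)
    have sub: "Ap \<subseteq> A" by (auto simp: A_def Ap_def)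
    have "(\<Sum>n. f n) = sum f A"
    proof (rule suminf_finite[OF finA])
      fix n assume "n \<notin> A"
      then have "mangoldt n = (0::complex) \<or> hat w (ln (real n) - y) = 0"
        using h hat_eq_0[of w "ln (real n) - y"] by (auto simp: A_def mangoldt_def)
      then show "f n = 0" by (auto simp: f_def)
    qed
    also have "\<dots> = sum f (A - Ap) + sum f Ap" by (rule sum.subset_diff[OF sub finA])
    finally have split: "sum f Ap = (\<Sum>n. f n) - sum f (A - Ap)" by simp
    have "norm (sum f (A - Ap)) \<le> (\<Sum>n\<in>A - Ap. exp (- (\<alpha> * (y - 1))) * mangoldt n)"
    proof (rule sum_norm_le)
      fix n assume n: "n \<in> A - Ap"
      then have n0: "n > 0" using primepow_gt_0_nat by (auto simp: A_def)
      have "exp (y - 1) \<le> real n" using n h n0 by (intro near_exp_bounds(1)[of n y w]) (auto simp: A_def)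
      then have "real n powr (-\<alpha>) \<le> exp (y - 1) powr (-\<alpha>)" using h by (intro powr_mono2') auto
      also have "\<dots> = exp (- (\<alpha> * (y - 1)))" by (simp add: powr_def)
      finally have 1: "real n powr (-\<alpha>) \<le> exp (- (\<alpha> * (y - 1)))" .
      have "norm (f n) = mangoldt n * real n powr (-\<alpha>) * hat w (ln (real n) - y)"
        using hat_bounds[OF h(3)] n0 by (simp add: f_def norm_mult norm_of_nat_powr)
      also have "\<dots> \<le> mangoldt n * exp (- (\<alpha> * (y - 1))) * 1"
        using 1 hat_bounds[OF h(3)] by (intro mult_mono mult_left_mono) (auto simp: mangoldt_nonneg)
      finally show "norm (f n) \<le> exp (- (\<alpha> * (y - 1))) * mangoldt n" by (simp add: mult.commute)
    qed
    also have "\<dots> = exp (- (\<alpha> * (y - 1))) * (\<Sum>n\<in>A - Ap. mangoldt n)" by (simp add: sum_distrib_left)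
    also have "\<dots> \<le> (exp 1 * exp (- (\<alpha> * y))) * (2 * sqrt (exp (y + 1)) * (ln (exp (y + 1)))\<^sup>2)"
    proof (rule mult_mono)
      have "exp (- (\<alpha> * (y - 1))) = exp \<alpha> * exp (- (\<alpha> * y))" by (simp add: algebra_simps flip: exp_add)
      also have "\<dots> \<le> exp 1 * exp (- (\<alpha> * y))" using h by (intro mult_right_mono) auto
      finally show "exp (- (\<alpha> * (y - 1))) \<le> exp 1 * exp (- (\<alpha> * y))" .
      have e2: "exp (y + 1) \<ge> 2" using exp_ge_add_one_self[of "y+1"] h by linarith
      have "A - Ap \<subseteq> {n. primepow n \<and> \<not> prime n \<and> real n \<le> exp (y + 1)}"
        using near_exp_bounds(2) h primepow_gt_0_nat by (auto simp: A_def Ap_def)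
      then have "(\<Sum>n\<in>A - Ap. mangoldt n :: real) \<le> (\<Sum>n | primepow n \<and> \<not> prime n \<and> real n \<le> exp (y + 1). mangoldt n)"
        using nonprime_primepow_sum_bound(2)[OF e2] by (intro sum_mono2) (auto simp: mangoldt_nonneg)
      also have "\<dots> \<le> 2 * sqrt (exp (y + 1)) * (ln (exp (y + 1)))\<^sup>2" by (rule nonprime_primepow_sum_bound(1)[OF e2])
      finally show "(\<Sum>n\<in>A - Ap. mangoldt n) \<le> 2 * sqrt (exp (y + 1)) * (ln (exp (y + 1)))\<^sup>2" .
    qed (auto intro!: sum_nonneg mangoldt_nonneg)
    also have "sqrt (exp (y + 1)) = exp (1/2) * exp (y / 2)"
      by (rule real_sqrt_unique) (simp_all add: power2_eq_square flip: exp_add)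
    also have "(exp 1 * exp (- (\<alpha> * y))) * (2 * (exp (1/2) * exp (y/2)) * (ln (exp (y + 1)))\<^sup>2) =
       exp (- (\<alpha> * y)) * exp (y/2) * (2 * (exp 1 * exp (1/2)) * (y + 1)\<^sup>2)" by (simp add: mult_ac)
    also have "\<dots> \<le> exp (- (\<alpha> * y)) * exp (y/2) * (2 * exp 2 * ((3/2 * y)\<^sup>2))"
      using h by (intro mult_left_mono mult_mono power_mono) (auto simp flip: exp_add)
    also have "\<dots> = exp (- (\<alpha> * y)) * (exp (y/2) * y\<^sup>2) * (9/2 * exp 2)" by (simp add: power_mult_distrib power2_eq_square)
    also have "\<dots> \<le> exp (- (\<alpha> * y)) * (exp (y/2) * y\<^sup>2) * (9 * exp 2 * L)"
      using L by (intro mult_left_mono) auto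
    finally have 1: "norm (sum f (A - Ap)) \<le> 9 * exp 2 * exp (- (\<alpha> * y)) * (exp (y/2) * y\<^sup>2 * L)"
      by (simp only: mult_ac)
    have e: "exp (y * (1/2 - \<alpha>)) = exp (- (\<alpha> * y)) * exp (y / 2)" "exp (y * (1 - \<alpha>)) = exp (- (\<alpha> * y)) * exp y"
      by (simp_all add: algebra_simps flip: exp_add)
    define M where "M = exp y * y / w * (1 + \<bar>t\<bar>) powr (-(3/4))"
    have M: "M \<ge> 0" using h by (simp add: M_def)
    have 2: "norm (\<Sum>n. f n) \<le> C0 * exp (- (\<alpha> * y)) * (exp (y/2) * y\<^sup>2 * L + M)"
      using C0(2)[OF h, of t] unfolding f_def e L_def M_def by (simp add: algebra_simps)
    have "norm (sum f Ap) \<le> C0 * exp (- (\<alpha> * y)) * (exp (y/2) * y\<^sup>2 * L + M) + 9 * exp 2 * exp (- (\<alpha> * y)) * (exp (y/2) * y\<^sup>2 * L)"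
      unfolding split using norm_triangle_ineq4[of "\<Sum>n. f n" "sum f (A - Ap)"] 1 2 by linarith
    also have "\<dots> \<le> C0 * exp (- (\<alpha> * y)) * (exp (y/2) * y\<^sup>2 * L + M) + 9 * exp 2 * exp (- (\<alpha> * y)) * (exp (y/2) * y\<^sup>2 * L + M)"
      using M by (intro add_left_mono mult_left_mono) auto
    also have "\<dots> = C * exp (- (\<alpha> * y)) * (exp (y/2) * y\<^sup>2 * L + M)" by (simp add: C_def algebra_simps)
    also have "sum f Ap = (\<Sum>p | prime p \<and> \<bar>ln (real p) - y\<bar> < w. of_real (ln (real p) * hat w (ln (real p) - y)) * of_nat p powr (- Complex \<alpha> t))"
      unfolding Ap_def by (intro sum.cong refl) (simp add: f_def mult_ac)
    finally show "norm (\<Sum>p | prime p \<and> \<bar>ln (real p) - y\<bar> < w. of_real (ln (real p) * hat w (ln (real p) - y)) * of_nat p powr (- Complex \<alpha> t))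
     \<le> C * exp (- (\<alpha> * y)) * (exp (y / 2) * y\<^sup>2 * (ln (\<bar>t\<bar> + 3) + ln (1 / w) + 2)
           + exp y * y / w * (1 + \<bar>t\<bar>) powr (-(3/4)))" by (simp only: L_def M_def)
  qed
qed

text \<open>The weight \<open>ln p\<close> is removed without partial summation: the integral of
  \<open>ln p * p powr (-\<alpha>)\<close> over \<open>\<alpha>\<close> from 0 to 1 is
  \<open>1 - 1 / p\<close>. The factor \<open>exp (- (\<alpha> * y))\<close> integrates to at most
  \<open>1 / y\<close>, which saves one power of \<open>y\<close>.\<close>

lemma prime_poly_bound:
  assumes RH: "riemann_hypothesis"
  obtains C where "C > 0" "\<And>t w y. 0 < w \<Longrightarrow> w \<le> 1 \<Longrightarrow> y \<ge> 2 \<Longrightarrow>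
    norm (prime_poly w y (Complex 0 t)) \<le> C * (exp (y / 2) * y * (ln (\<bar>t\<bar> + 3) + ln (1 / w) + 2)
           + exp y / w * (1 + \<bar>t\<bar>) powr (-(3/4)))"
proof -
  obtain C0 where C0: "C0 > 0" "\<And>\<alpha> t w y. 0 \<le> \<alpha> \<Longrightarrow> \<alpha> \<le> 1 \<Longrightarrow> 0 < w \<Longrightarrow> w \<le> 1 \<Longrightarrow> y \<ge> 2 \<Longrightarrow>
    norm (\<Sum>p | prime p \<and> \<bar>ln (real p) - y\<bar> < w. of_real (ln (real p) * hat w (ln (real p) - y)) * of_nat p powr (- Complex \<alpha> t))
     \<le> C0 * exp (- (\<alpha> * y)) * (exp (y / 2) * y\<^sup>2 * (ln (\<bar>t\<bar> + 3) + ln (1 / w) + 2)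
           + exp y * y / w * (1 + \<bar>t\<bar>) powr (-(3/4)))"
    using log_prime_poly_bound[OF RH] by blast
  show thesis
  proof (rule that[of "C0 + exp 2 + 1"])
    show "C0 + exp 2 + 1 > 0" using C0(1) by (simp add: add_pos_pos)
    fix t w y :: real
    assume h: "0 < w" "w \<le> 1" "y \<ge> 2"
    define L where "L = ln (\<bar>t\<bar> + 3) + ln (1 / w) + 2"
    have L: "L \<ge> 2" unfolding L_def using h ln_ge_zero[of "\<bar>t\<bar> + 3"] ln_ge_zero[of "1/w"] by (auto simp: field_simps)
    define Ap where "Ap = {p. prime p \<and> \<bar>ln (real p) - y\<bar> < w}"
    have finAp: "finite Ap" unfolding Ap_def by (rule finite_near_exp)
    define S where "S = (\<lambda>\<alpha>. \<Sum>p\<in>Ap. of_real (ln (real p) * hat w (ln (real p) - y)) * of_nat p powr (- Complex \<alpha> t))"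
    define D where "D = C0 * (exp (y / 2) * y\<^sup>2 * L + exp y * y / w * (1 + \<bar>t\<bar>) powr (-(3/4)))"
    have D: "D \<ge> 0" using C0(1) h L by (simp add: D_def)
    have Sb: "norm (S \<alpha>) \<le> D * exp (- (\<alpha> * y))" if "0 \<le> \<alpha>" "\<alpha> \<le> 1" for \<alpha>
      using C0(2)[OF that h, of t] by (simp add: S_def Ap_def D_def L_def mult_ac)
    have pp: "prime_poly w y (Complex \<alpha> t) = (\<Sum>p\<in>Ap. of_real (hat w (ln (real p) - y)) * of_nat p powr (- Complex \<alpha> t))" for \<alpha>
      by (simp add: prime_poly_def Ap_def)
    have der: "((\<lambda>\<alpha>. - prime_poly w y (Complex \<alpha> t)) has_vector_derivative S \<alpha>) (at \<alpha> within {0..1})" for \<alpha>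
    proof -
      have "((\<lambda>\<alpha>. - (\<Sum>p\<in>Ap. of_real (hat w (ln (real p) - y)) * of_nat p powr (- Complex \<alpha> t))) has_vector_derivative
         - (\<Sum>p\<in>Ap. of_real (hat w (ln (real p) - y)) * (- (Ln (of_nat p) * of_nat p powr (- Complex \<alpha> t))))) (at \<alpha> within {0..1})"
      proof (intro has_vector_derivative_minus has_vector_derivative_sum has_vector_derivative_mult_right)
        fix p assume "p \<in> Ap"
        then have p: "complex_of_nat p \<noteq> 0" using prime_gt_0_nat[of p] by (auto simp: Ap_def)
        have "((\<lambda>\<alpha>. Complex \<alpha> t) has_vector_derivative 1) (at \<alpha> within {0..1})"
          unfolding Complex_eq by (auto intro!: derivative_eq_intros)
        moreover have "((\<lambda>s. complex_of_nat p powr (-s)) has_field_derivative Ln (of_nat p) * of_nat p powr (- Complex \<alpha> t) * (-1)) (at (Complex \<alpha> t))"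
          using p by (intro DERIV_chain2[OF has_field_derivative_powr_right]) (auto intro!: derivative_eq_intros)
        ultimately have "(((\<lambda>s. complex_of_nat p powr (-s)) \<circ> (\<lambda>\<alpha>. Complex \<alpha> t)) has_vector_derivative 1 * (Ln (of_nat p) * of_nat p powr (- Complex \<alpha> t) * (-1))) (at \<alpha> within {0..1})"
          by (rule field_vector_diff_chain_within[OF _ has_field_derivative_at_within])
        then show "((\<lambda>\<alpha>. complex_of_nat p powr (- Complex \<alpha> t)) has_vector_derivative - (Ln (of_nat p) * of_nat p powr (- Complex \<alpha> t))) (at \<alpha> within {0..1})"
          by (simp add: o_def)
      qed
      moreover have "- (\<Sum>p\<in>Ap. of_real (hat w (ln (real p) - y)) * (- (Ln (of_nat p) * of_nat p powr (- Complex \<alpha> t)))) = S \<alpha>"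
        unfolding S_def sum_negf[symmetric]
        by (intro sum.cong refl) (auto simp: Ap_def Ln_of_nat prime_gt_0_nat mult_ac)
      ultimately show ?thesis unfolding pp by simp
    qed
    have SI: "(S has_integral (- prime_poly w y (Complex 1 t) - - prime_poly w y (Complex 0 t))) {0..1}"
      by (rule fundamental_theorem_of_calculus) (use der in auto)
    have BI: "((\<lambda>\<alpha>. D * exp (- (\<alpha> * y))) has_integral (- D / y * exp (- (1 * y)) - (- D / y * exp (- (0 * y))))) {0..1}"
    proof (rule fundamental_theorem_of_calculus)
      fix \<alpha> :: real
      show "((\<lambda>\<alpha>. - D / y * exp (- (\<alpha> * y))) has_vector_derivative D * exp (- (\<alpha> * y))) (at \<alpha> within {0..1})"
        using h unfolding has_real_derivative_iff_has_vector_derivative[symmetric]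
        by (auto intro!: derivative_eq_intros)
    qed simp
    have "norm (integral {0..1} S) \<le> integral {0..1} (\<lambda>\<alpha>. D * exp (- (\<alpha> * y)))"
      using SI BI Sb by (intro Henstock_Kurzweil_Integration.integral_norm_bound_integral) (auto simp: has_integral_iff)
    then have "norm (prime_poly w y (Complex 0 t) - prime_poly w y (Complex 1 t)) \<le> D / y - D / y * exp (-y)"
      using SI BI by (simp add: has_integral_iff)
    also have "\<dots> \<le> D / y" using D h by simp
    also have "D / y = C0 * (exp (y / 2) * y * L + exp y / w * (1 + \<bar>t\<bar>) powr (-(3/4)))"
      using h by (simp add: D_def power2_eq_square field_simps)
    finally have 1: "norm (prime_poly w y (Complex 0 t) - prime_poly w y (Complex 1 t)) \<le> C0 * (exp (y / 2) * y * L + exp y / w * (1 + \<bar>t\<bar>) powr (-(3/4)))" .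
    \<comment> \<open>The end point \<open>\<alpha> = 1\<close> is trivial: there are at most about
      \<open>exp (y + 1)\<close> terms, each at most \<open>exp (1 - y)\<close>.\<close>
    have "norm (prime_poly w y (Complex 1 t)) \<le> (\<Sum>p\<in>Ap. exp (1 - y))"
      unfolding pp
    proof (rule sum_norm_le)
      fix p assume p: "p \<in> Ap"
      then have p0: "p > 0" by (auto simp: Ap_def intro: prime_gt_0_nat)
      have "exp (y - 1) \<le> real p" using p h p0 by (intro near_exp_bounds(1)[of p y w]) (auto simp: Ap_def)
      then have "1 / real p \<le> 1 / exp (y - 1)" using p0 by (intro divide_left_mono) auto
      also have "\<dots> = exp (1 - y)" by (simp add: exp_diff)
      finally have "real p powr (-1) \<le> exp (1 - y)" using p0 by (simp add: powr_minus divide_inverse)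
      moreover have "hat w (ln (real p) - y) * real p powr (-1) \<le> 1 * real p powr (-1)"
        using hat_bounds[OF h(1)] by (intro mult_right_mono) auto
      moreover have "norm (of_real (hat w (ln (real p) - y)) * of_nat p powr (- Complex 1 t) :: complex) = hat w (ln (real p) - y) * real p powr (-1)"
        using hat_bounds[OF h(1)] p0 by (simp add: norm_mult norm_of_nat_powr)
      ultimately show "norm (of_real (hat w (ln (real p) - y)) * of_nat p powr (- Complex 1 t) :: complex) \<le> exp (1 - y)" by linarith
    qed
    also have "\<dots> = real (card Ap) * exp (1 - y)" by simp
    also have "real (card Ap) \<le> exp (y + 1) + 1"
    proof -
      have "Ap \<subseteq> {m::nat. 0 < real m \<and> real m \<le> exp (y + 1)}"
      proof
        fix p assume "p \<in> Ap"
        then have "p > 0" "\<bar>ln (real p) - y\<bar> < w" by (auto simp: Ap_def intro: prime_gt_0_nat)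
        then show "p \<in> {m. 0 < real m \<and> real m \<le> exp (y + 1)}" using near_exp_bounds(2)[of p y w] h by simp
      qed
      moreover have "finite {m::nat. 0 < real m \<and> real m \<le> exp (y + 1)}"
        by (rule finite_subset[of _ "{..nat \<lfloor>exp (y + 1)\<rfloor>}"]) (auto simp: le_nat_floor)
      ultimately have "card Ap \<le> card {m::nat. 0 < real m \<and> real m \<le> exp (y + 1)}" by (rule card_mono[rotated])
      also have "\<dots> = nat \<lfloor>exp (y + 1)\<rfloor>"
      proof -
        have "{m::nat. 0 < real m \<and> real m \<le> exp (y + 1)} = {1..nat \<lfloor>exp (y + 1)\<rfloor>}"
          by (auto simp: le_nat_floor le_nat_iff le_floor_iff)
        then show ?thesis by simp
      qed
      finally have "real (card Ap) \<le> real (nat \<lfloor>exp (y + 1)\<rfloor>)" by (simp only: of_nat_le_iff)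
      also have "\<dots> \<le> exp (y + 1)" by (rule of_nat_floor) simp
      finally show ?thesis by simp
    qed
    then have "real (card Ap) * exp (1 - y) \<le> (exp (y + 1) + 1) * exp (1 - y)" by (intro mult_right_mono) auto
    also have "\<dots> = exp 2 + exp (1 - y)" by (simp add: distrib_right flip: exp_add)
    also have "\<dots> \<le> exp 2 + 1" using h by simp
    also have "\<dots> \<le> (exp 2 + 1) * (exp (y / 2) * y * L + exp y / w * (1 + \<bar>t\<bar>) powr (-(3/4)))"
    proof -
      have "1 * 1 * 1 \<le> exp (y / 2) * y * L" using h L by (intro mult_mono) auto
      moreover have "0 \<le> exp y / w * (1 + \<bar>t\<bar>) powr (-(3/4))" using h by simp
      ultimately show ?thesis using mult_left_mono[of 1 "exp (y / 2) * y * L + exp y / w * (1 + \<bar>t\<bar>) powr (-(3/4))" "exp 2 + 1"] by simp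
    qed
    finally have 2: "norm (prime_poly w y (Complex 1 t)) \<le> (exp 2 + 1) * (exp (y / 2) * y * L + exp y / w * (1 + \<bar>t\<bar>) powr (-(3/4)))" .
    have "norm (prime_poly w y (Complex 0 t)) \<le> C0 * (exp (y / 2) * y * L + exp y / w * (1 + \<bar>t\<bar>) powr (-(3/4))) + (exp 2 + 1) * (exp (y / 2) * y * L + exp y / w * (1 + \<bar>t\<bar>) powr (-(3/4)))"
      using norm_triangle_sub[of "prime_poly w y (Complex 0 t)" "prime_poly w y (Complex 1 t)"] 1 2 by linarith
    then show "norm (prime_poly w y (Complex 0 t)) \<le> (C0 + exp 2 + 1) * (exp (y / 2) * y * (ln (\<bar>t\<bar> + 3) + ln (1 / w) + 2)
           + exp y / w * (1 + \<bar>t\<bar>) powr (-(3/4)))"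
      unfolding L_def by (simp only: distrib_right add.assoc)
  qed
qed

section \<open>Windows and their mean squares\<close>

text \<open>Both integrals are evaluated explicitly and give the same quadratic form in
  \<open>\<bar>y i - y j\<bar>\<close>, so Plancherel's identity for step functions follows without
  any theory of the Fourier transform. The condition on the sum of the \<open>a i\<close> makes the
  step function vanish far to the left and removes the constant terms.\<close>

lemma step_function_plancherel:
  fixes a y :: "'i \<Rightarrow> real"
  assumes fin: "finite I" and sum0: "(\<Sum>i\<in>I. a i) = 0"
  shows "has_bochner_integral lborel (\<lambda>v. (\<Sum>i\<in>I. a i * of_bool (v < y i))\<^sup>2) (- (\<Sum>i\<in>I. \<Sum>j\<in>I. a i * a j * \<bar>y i - y j\<bar>) / 2)"
    and "has_bochner_integral lborel (\<lambda>t. (norm (\<Sum>i\<in>I. of_real (a i) * cis (t * y i)))\<^sup>2 / t\<^sup>2) (- pi * (\<Sum>i\<in>I. \<Sum>j\<in>I. a i * a j * \<bar>y i - y j\<bar>))"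
proof -
  \<comment> \<open>Any lower bound of the jump points serves: to its left all indicators are 1 and
    the coefficients cancel.\<close>
  define L where "L = Min (insert 0 (y ` I))"
  have L: "L \<le> y i" if "i \<in> I" for i using fin that by (auto simp: L_def intro!: Min_le)
  have F: "(\<Sum>i\<in>I. a i * of_bool (v < y i)) = (\<Sum>i\<in>I. a i * indicator {L..<y i} v)" for v
  proof (cases "v < L")
    case True
    then have "(\<Sum>i\<in>I. a i * of_bool (v < y i)) = (\<Sum>i\<in>I. a i)"
      using L by (intro sum.cong) (auto dest: less_le_trans)
    also have "\<dots> = (\<Sum>i\<in>I. a i * indicator {L..<y i} v)" unfolding sum0 using True by (simp add: indicator_def)
    finally show ?thesis .
  qed (auto simp: indicator_def intro!: sum.cong)
  have sq: "(\<Sum>i\<in>I. a i * of_bool (v < y i))\<^sup>2 = (\<Sum>i\<in>I. \<Sum>j\<in>I. a i * a j * indicator {L..<min (y i) (y j)} v)" for v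
    unfolding F power2_eq_square sum_product by (intro sum.cong refl) (auto simp: indicator_def)
  have "has_bochner_integral lborel (\<lambda>v. \<Sum>i\<in>I. \<Sum>j\<in>I. a i * a j * indicator {L..<min (y i) (y j)} v) (\<Sum>i\<in>I. \<Sum>j\<in>I. a i * a j * (min (y i) (y j) - L))"
  proof (intro has_bochner_integral_sum has_bochner_integral_mult_right)
    fix i j assume "i \<in> I" "j \<in> I"
    then have "L \<le> min (y i) (y j)" using L by simp
    then show "has_bochner_integral lborel (indicator {L..<min (y i) (y j)}) (min (y i) (y j) - L)"
      using has_bochner_integral_real_indicator[of "{L..<min (y i) (y j)}" lborel] by simp
  qed
  moreover have "(\<Sum>i\<in>I. \<Sum>j\<in>I. a i * a j * (min (y i) (y j) - L)) = - (\<Sum>i\<in>I. \<Sum>j\<in>I. a i * a j * \<bar>y i - y j\<bar>) / 2"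
  proof -
    have "(\<Sum>i\<in>I. \<Sum>j\<in>I. a i * a j * (min (y i) (y j) - L)) =
       (\<Sum>i\<in>I. \<Sum>j\<in>I. (a i * (y i / 2 - L)) * a j + a i * (a j * (y j / 2)) - a i * a j * \<bar>y i - y j\<bar> / 2)"
      by (intro sum.cong refl) (auto simp: min_def abs_if field_simps)
    also have "\<dots> = (\<Sum>i\<in>I. a i * (y i / 2 - L)) * (\<Sum>j\<in>I. a j) + (\<Sum>i\<in>I. a i) * (\<Sum>j\<in>I. a j * (y j / 2)) - (\<Sum>i\<in>I. \<Sum>j\<in>I. a i * a j * \<bar>y i - y j\<bar> / 2)"
      by (simp only: sum.distrib sum_subtractf sum_product)
    also have "\<dots> = - (\<Sum>i\<in>I. \<Sum>j\<in>I. a i * a j * \<bar>y i - y j\<bar>) / 2"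
      unfolding sum0 by (simp add: sum_divide_distrib)
    finally show ?thesis .
  qed
  ultimately show "has_bochner_integral lborel (\<lambda>v. (\<Sum>i\<in>I. a i * of_bool (v < y i))\<^sup>2) (- (\<Sum>i\<in>I. \<Sum>j\<in>I. a i * a j * \<bar>y i - y j\<bar>) / 2)"
    unfolding sq by simp
  have sq2: "(norm (\<Sum>i\<in>I. of_real (a i) * cis (t * y i)))\<^sup>2 / t\<^sup>2 = (\<Sum>i\<in>I. \<Sum>j\<in>I. (- (a i * a j)) * ((1 - cos ((y i - y j) * t)) / t\<^sup>2))" for t
  proof -
    have "(norm (\<Sum>i\<in>I. of_real (a i) * cis (t * y i)))\<^sup>2 = (\<Sum>i\<in>I. a i * cos (t * y i))\<^sup>2 + (\<Sum>i\<in>I. a i * sin (t * y i))\<^sup>2"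
      by (simp add: cmod_power2)
    also have "\<dots> = (\<Sum>i\<in>I. \<Sum>j\<in>I. a i * a j * cos ((y i - y j) * t))"
      unfolding power2_eq_square sum_product sum.distrib[symmetric]
      by (intro sum.cong refl) (simp add: left_diff_distrib cos_diff algebra_simps)
    also have "\<dots> = (\<Sum>i\<in>I. \<Sum>j\<in>I. (- (a i * a j)) * (1 - cos ((y i - y j) * t))) + (\<Sum>i\<in>I. a i) * (\<Sum>j\<in>I. a j)"
      unfolding sum_product sum.distrib[symmetric] by (intro sum.cong refl) (simp add: algebra_simps)
    finally show ?thesis unfolding sum0 by (simp add: sum_divide_distrib)
  qed
  have "has_bochner_integral lborel (\<lambda>t. \<Sum>i\<in>I. \<Sum>j\<in>I. (- (a i * a j)) * ((1 - cos ((y i - y j) * t)) / t\<^sup>2)) (\<Sum>i\<in>I. \<Sum>j\<in>I. (- (a i * a j)) * (pi * \<bar>y i - y j\<bar>))"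
    by (intro has_bochner_integral_sum has_bochner_integral_mult_right has_bochner_integral_one_minus_cos)
  moreover have "(\<Sum>i\<in>I. \<Sum>j\<in>I. (- (a i * a j)) * (pi * \<bar>y i - y j\<bar>)) = - pi * (\<Sum>i\<in>I. \<Sum>j\<in>I. a i * a j * \<bar>y i - y j\<bar>)"
    by (simp add: sum_distrib_left sum_negf mult_ac)
  ultimately show "has_bochner_integral lborel (\<lambda>t. (norm (\<Sum>i\<in>I. of_real (a i) * cis (t * y i)))\<^sup>2 / t\<^sup>2) (- pi * (\<Sum>i\<in>I. \<Sum>j\<in>I. a i * a j * \<bar>y i - y j\<bar>))"
    unfolding sq2 by simp
qed

text \<open>A short window with a rescaled long window subtracted, so that low frequencies cancel.\<close>
definition win :: "real \<Rightarrow> real \<Rightarrow> real \<Rightarrow> real" where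
  "win \<delta> \<Delta> u = of_bool (0 < u \<and> u \<le> \<delta>) - \<delta> / \<Delta> * of_bool (0 < u \<and> u \<le> \<Delta>)"

text \<open>Divided by \<open>i t\<close> this is the Fourier transform of
  \<open>win \<delta> \<Delta>\<close>; the division by \<open>t\<close> is kept apart and reappears
  as the weight \<open>1 / t\<^sup>2\<close>.\<close>

definition win_ker :: "real \<Rightarrow> real \<Rightarrow> real \<Rightarrow> complex" where
  "win_ker \<delta> \<Delta> t = (1 - cis (- \<delta> * t)) - of_real (\<delta> / \<Delta>) * (1 - cis (- \<Delta> * t))"

lemma win_plancherel:
  fixes c x :: "'i \<Rightarrow> real"
  assumes fin: "finite I" and \<delta>: "0 < \<delta>" "0 < \<Delta>"
  shows "\<exists>J. has_bochner_integral lborel (\<lambda>v. (\<Sum>i\<in>I. c i * win \<delta> \<Delta> (x i - v))\<^sup>2) J \<and>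
    has_bochner_integral lborel (\<lambda>t. (norm (\<Sum>i\<in>I. of_real (c i) * cis (t * x i)))\<^sup>2 * (norm (win_ker \<delta> \<Delta> t))\<^sup>2 / t\<^sup>2) (2 * pi * J)"
proof -
  \<comment> \<open>A window attached to the point \<open>x i\<close> has three jumps, at
    \<open>x i\<close>, \<open>x i - \<delta>\<close> and \<open>x i - \<Delta>\<close>, whose
    heights cancel.\<close>
  define K where "K = I \<times> {0,1,2::nat}"
  define a where "a = (\<lambda>(i,k::nat). c i * (if k = 0 then 1 - \<delta> / \<Delta> else if k = 1 then -1 else \<delta> / \<Delta>))"
  define y where "y = (\<lambda>(i,k::nat). x i - (if k = 0 then 0 else if k = 1 then \<delta> else \<Delta>))"
  have finK: "finite K" using fin by (simp add: K_def)
  have split: "(\<Sum>p\<in>K. f p) = (\<Sum>i\<in>I. f (i,0) + f (i,1) + f (i,2))" for f :: "'i \<times> nat \<Rightarrow> 'b :: comm_monoid_add"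
  proof -
    have "(\<Sum>p\<in>K. f p) = (\<Sum>i\<in>I. \<Sum>k\<in>{0,1,2}. f (i, k))"
      unfolding K_def by (simp only: sum.cartesian_product prod.case_distrib[symmetric] case_prod_eta)
    then show ?thesis by (simp add: add.assoc)
  qed
  have sum0: "(\<Sum>p\<in>K. a p) = 0" unfolding split by (intro sum.neutral) (auto simp: a_def algebra_simps)
  define J where "J = - (\<Sum>i\<in>K. \<Sum>j\<in>K. a i * a j * \<bar>y i - y j\<bar>) / 2"
  have 1: "(\<Sum>p\<in>K. a p * of_bool (v < y p)) = (\<Sum>i\<in>I. c i * win \<delta> \<Delta> (x i - v))" for v
    unfolding split by (intro sum.cong refl) (use \<delta> in \<open>auto simp: a_def y_def win_def algebra_simps\<close>)
  have 2: "(\<Sum>p\<in>K. of_real (a p) * cis (t * y p)) = (\<Sum>i\<in>I. of_real (c i) * cis (t * x i)) * win_ker \<delta> \<Delta> t" for t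
    unfolding split sum_distrib_right
  proof (intro sum.cong refl)
    fix i
    have s: "cis (t * (x i - d)) = cis (t * x i) * cis (- d * t)" for d by (simp add: cis_mult algebra_simps)
    show "of_real (a (i,0)) * cis (t * y (i,0)) + of_real (a (i,1)) * cis (t * y (i,1)) + of_real (a (i,2)) * cis (t * y (i,2)) = of_real (c i) * cis (t * x i) * win_ker \<delta> \<Delta> t"
      unfolding a_def y_def win_ker_def using s[of 0] s[of \<delta>] s[of \<Delta>] by (simp add: algebra_simps)
  qed
  have "has_bochner_integral lborel (\<lambda>v. (\<Sum>i\<in>I. c i * win \<delta> \<Delta> (x i - v))\<^sup>2) J"
    using step_function_plancherel(1)[OF finK sum0, of y] unfolding 1 J_def .
  moreover have "has_bochner_integral lborel (\<lambda>t. (norm (\<Sum>i\<in>I. of_real (c i) * cis (t * x i)))\<^sup>2 * (norm (win_ker \<delta> \<Delta> t))\<^sup>2 / t\<^sup>2) (2 * pi * J)"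
    using step_function_plancherel(2)[OF finK sum0, of y] unfolding 2 norm_mult power_mult_distrib by (simp add: J_def)
  ultimately show ?thesis by blast
qed

lemma norm_one_minus_cis: "norm (1 - cis x) \<le> \<bar>x\<bar>" "norm (1 - cis x + \<i> * of_real x) \<le> x\<^sup>2 / 2"
proof -
  have e: "cis x = iexp x" by (simp add: cis_conv_exp)
  show "norm (1 - cis x) \<le> \<bar>x\<bar>" using iexp_approx1[of x 0] by (simp add: e norm_minus_commute)
  have "norm (iexp x - (1 + \<i> * of_real x)) \<le> x\<^sup>2 / 2"
    using iexp_approx1[of x 1] by (simp add: numeral_2_eq_2)
  moreover have "iexp x - (1 + \<i> * of_real x) = - (1 - cis x + \<i> * of_real x)" by (simp add: e)
  ultimately show "norm (1 - cis x + \<i> * of_real x) \<le> x\<^sup>2 / 2" by (metis norm_minus_cancel)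
qed

text \<open>The third bound expresses the purpose of the compensation: both windows have the same
  total mass, so the linear terms of the two exponentials cancel and a second order zero at
  \<open>t = 0\<close> remains.\<close>

lemma win_ker_bounds:
  assumes \<delta>: "0 < \<delta>" "\<delta> \<le> \<Delta>"
  shows "norm (win_ker \<delta> \<Delta> t) \<le> 4" "norm (win_ker \<delta> \<Delta> t) \<le> 2 * \<delta> * \<bar>t\<bar>" "norm (win_ker \<delta> \<Delta> t) \<le> \<delta> * \<Delta> * t\<^sup>2"
proof -
  have \<Delta>: "\<Delta> > 0" using \<delta> by simp
  have r: "norm (of_real (\<delta> / \<Delta>) :: complex) = \<delta> / \<Delta>" "\<delta> / \<Delta> \<le> 1" using \<delta> by (auto simp: norm_divide)
  have tri: "norm (win_ker \<delta> \<Delta> t) \<le> norm (1 - cis (- \<delta> * t)) + \<delta> / \<Delta> * norm (1 - cis (- \<Delta> * t))"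
    unfolding win_ker_def by (rule order.trans[OF norm_triangle_ineq4]) (simp only: norm_mult r)
  have two: "norm (1 - cis x) \<le> 2" for x using norm_triangle_ineq4[of 1 "cis x"] by simp
  have "\<delta> / \<Delta> * norm (1 - cis (- \<Delta> * t)) \<le> 1 * 2" using r(2) \<delta> \<Delta> two by (intro mult_mono) auto
  then show "norm (win_ker \<delta> \<Delta> t) \<le> 4" using tri two[of "- \<delta> * t"] by simp
  have "\<delta> / \<Delta> * norm (1 - cis (- \<Delta> * t)) \<le> \<delta> / \<Delta> * \<bar>- \<Delta> * t\<bar>"
    using \<delta> by (intro mult_left_mono norm_one_minus_cis) auto
  also have "\<dots> = \<delta> * \<bar>t\<bar>" using \<Delta> by (simp add: abs_mult)
  finally show "norm (win_ker \<delta> \<Delta> t) \<le> 2 * \<delta> * \<bar>t\<bar>"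
    using tri norm_one_minus_cis(1)[of "- \<delta> * t"] \<delta> by (simp add: abs_mult)
  define e where "e = (\<lambda>x. 1 - cis x + \<i> * of_real x)"
  have "win_ker \<delta> \<Delta> t = e (- \<delta> * t) - of_real (\<delta> / \<Delta>) * e (- \<Delta> * t)"
    using \<Delta> by (simp add: win_ker_def e_def algebra_simps)
  then have "norm (win_ker \<delta> \<Delta> t) \<le> norm (e (- \<delta> * t)) + \<delta> / \<Delta> * norm (e (- \<Delta> * t))"
    using norm_triangle_ineq4[of "e (- \<delta> * t)" "of_real (\<delta> / \<Delta>) * e (- \<Delta> * t)"] by (simp only: norm_mult r)
  also have "\<dots> \<le> (- \<delta> * t)\<^sup>2 / 2 + \<delta> / \<Delta> * ((- \<Delta> * t)\<^sup>2 / 2)"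
    unfolding e_def using \<delta> by (intro add_mono mult_left_mono norm_one_minus_cis) auto
  also have "\<dots> = \<delta> * \<delta> * t\<^sup>2 / 2 + \<delta> * \<Delta> * t\<^sup>2 / 2" using \<Delta> by (simp add: power2_eq_square field_simps)
  also have "\<delta> * \<delta> * t\<^sup>2 / 2 \<le> \<delta> * \<Delta> * t\<^sup>2 / 2" using \<delta> by (intro divide_right_mono mult_right_mono mult_left_mono) auto
  finally show "norm (win_ker \<delta> \<Delta> t) \<le> \<delta> * \<Delta> * t\<^sup>2" by (simp add: mult_ac)
qed

section \<open>Mean squares of short window sums\<close>

lemma card_nat_interval:
  assumes "a \<le> b" shows "real (card {m::nat. a < real m \<and> real m \<le> b}) \<le> b - a + 1"
proof -
  have "{m::nat. a < real m \<and> real m \<le> b} \<subseteq> nat ` {\<lfloor>a\<rfloor><..\<lfloor>b\<rfloor>}"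
  proof
    fix m :: nat assume "m \<in> {m. a < real m \<and> real m \<le> b}"
    then have "\<lfloor>a\<rfloor> < int m" "int m \<le> \<lfloor>b\<rfloor>" by (auto simp: floor_less_iff le_floor_iff)
    then show "m \<in> nat ` {\<lfloor>a\<rfloor><..\<lfloor>b\<rfloor>}" by (intro image_eqI[of _ _ "int m"]) auto
  qed
  then have "card {m::nat. a < real m \<and> real m \<le> b} \<le> card {\<lfloor>a\<rfloor><..\<lfloor>b\<rfloor>}"
    by (meson card_image_le card_mono finite_greaterThanAtMost_int finite_imageI order_trans)
  also have "\<dots> = nat (\<lfloor>b\<rfloor> - \<lfloor>a\<rfloor>)" by simp
  finally have "real (card {m::nat. a < real m \<and> real m \<le> b}) \<le> real_of_int (\<lfloor>b\<rfloor> - \<lfloor>a\<rfloor>)"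
    using floor_mono[OF assms] by (simp add: nat_le_iff le_diff_eq of_nat_le_iff)
  also have "\<dots> \<le> b - a + 1" by linarith
  finally show ?thesis .
qed

lemma window_sum_abs_le:
  fixes b :: "nat \<Rightarrow> real"
  assumes N: "finite N" "\<And>m. m \<in> N \<Longrightarrow> 0 < m \<and> real m \<le> B" and b: "\<And>m. m \<in> N \<Longrightarrow> \<bar>b m\<bar> \<le> 1"
    and \<delta>: "0 < \<delta>" "\<delta> \<le> 1" and B: "B \<ge> 0"
  shows "(\<Sum>m\<in>N. of_bool (0 < ln (real m) - v \<and> ln (real m) - v \<le> \<delta>)) \<le> 2 * \<delta> * B + 1"
    "\<bar>\<Sum>m\<in>N. b m * of_bool (0 < ln (real m) - v \<and> ln (real m) - v \<le> \<delta>)\<bar> \<le> (\<Sum>m\<in>N. of_bool (0 < ln (real m) - v \<and> ln (real m) - v \<le> \<delta>))"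
proof -
  define W where "W = {m\<in>N. 0 < ln (real m) - v \<and> ln (real m) - v \<le> \<delta>}"
  have eq: "(\<Sum>m\<in>N. of_bool (0 < ln (real m) - v \<and> ln (real m) - v \<le> \<delta>)) = real (card W)"
    unfolding W_def using N(1) by (simp add: Int_def)
  show "(\<Sum>m\<in>N. of_bool (0 < ln (real m) - v \<and> ln (real m) - v \<le> \<delta>)) \<le> 2 * \<delta> * B + 1"
  proof (cases "W = {}")
    case False
    then obtain m where m: "m \<in> W" by blast
    then have "m \<in> N" "v < ln (real m)" by (auto simp: W_def)
    then have "exp v < real m" using N(2)[of m] exp_less_mono[of v "ln (real m)"] by simp
    then have vB: "exp v \<le> B" using N(2)[OF \<open>m \<in> N\<close>] by linarith
    have "W \<subseteq> {m::nat. exp v < real m \<and> real m \<le> exp (v + \<delta>)}"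
    proof
      fix m assume "m \<in> W"
      then have "m > 0" "v < ln (real m)" "ln (real m) \<le> v + \<delta>" using N(2) by (auto simp: W_def)
      then show "m \<in> {m. exp v < real m \<and> real m \<le> exp (v + \<delta>)}"
        using exp_less_mono[of v "ln (real m)"] exp_le_cancel_iff[of "ln (real m)" "v + \<delta>"] by simp
    qed
    moreover have "finite {m::nat. exp v < real m \<and> real m \<le> exp (v + \<delta>)}"
      by (rule finite_subset[of _ "{..nat \<lfloor>exp (v + \<delta>)\<rfloor>}"]) (auto simp: le_nat_floor)
    ultimately have "real (card W) \<le> real (card {m::nat. exp v < real m \<and> real m \<le> exp (v + \<delta>)})"
      by (simp add: card_mono)
    also have "\<dots> \<le> exp (v + \<delta>) - exp v + 1" using \<delta> by (intro card_nat_interval) auto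
    also have "exp (v + \<delta>) - exp v = exp v * (exp \<delta> - 1)" by (simp add: exp_add algebra_simps)
    also have "\<dots> \<le> B * (2 * \<delta>)"
    proof (rule mult_mono[OF vB])
      have "exp \<delta> \<le> 1 + \<delta> + \<delta>\<^sup>2" using \<delta> by (intro exp_bound) auto
      also have "\<delta>\<^sup>2 \<le> \<delta>" using \<delta> by (simp add: power2_eq_square mult_left_le)
      finally show "exp \<delta> - 1 \<le> 2 * \<delta>" by simp
    qed (use B \<delta> in auto)
    finally show ?thesis unfolding eq by (simp add: mult_ac)
  next
    case True
    show ?thesis unfolding eq True using B \<delta> by simp
  qed
  show "\<bar>\<Sum>m\<in>N. b m * of_bool (0 < ln (real m) - v \<and> ln (real m) - v \<le> \<delta>)\<bar> \<le> (\<Sum>m\<in>N. of_bool (0 < ln (real m) - v \<and> ln (real m) - v \<le> \<delta>))"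
    by (rule order.trans[OF sum_abs]) (intro sum_mono, use b in \<open>auto simp: abs_mult\<close>)
qed

text \<open>The square is bounded by the maximal number of elements in a window times the number
  actually present. The former is at most \<open>2 * \<delta> * B + 1\<close>, and the latter
  integrates to \<open>\<delta>\<close> for each element of \<open>N\<close>.\<close>

lemma window_l2_bound:
  fixes b :: "nat \<Rightarrow> real"
  assumes N: "finite N" "\<And>m. m \<in> N \<Longrightarrow> 0 < m \<and> real m \<le> B" and b: "\<And>m. m \<in> N \<Longrightarrow> \<bar>b m\<bar> \<le> 1"
    and \<delta>: "0 < \<delta>" "\<delta> \<le> 1" and B: "B \<ge> 0"
  shows "integrable lborel (\<lambda>v. (\<Sum>m\<in>N. b m * of_bool (0 < ln (real m) - v \<and> ln (real m) - v \<le> \<delta>))\<^sup>2)"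
    "integral\<^sup>L lborel (\<lambda>v. (\<Sum>m\<in>N. b m * of_bool (0 < ln (real m) - v \<and> ln (real m) - v \<le> \<delta>))\<^sup>2) \<le> (2 * \<delta> * B + 1) * (\<delta> * real (card N))"
proof -
  have ind: "of_bool (0 < ln (real m) - v \<and> ln (real m) - v \<le> \<delta>) = (indicator {ln (real m) - \<delta>..<ln (real m)} v :: real)" for m v
    by (auto simp: indicator_def)
  have hb: "has_bochner_integral lborel (\<lambda>v. (2 * \<delta> * B + 1) * (\<Sum>m\<in>N. of_bool (0 < ln (real m) - v \<and> ln (real m) - v \<le> \<delta>))) ((2 * \<delta> * B + 1) * (\<Sum>m\<in>N. \<delta>))"
    unfolding ind
  proof (intro has_bochner_integral_mult_right has_bochner_integral_sum)
    show "has_bochner_integral lborel (indicator {ln (real m) - \<delta>..<ln (real m)}) \<delta>" for m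
      using has_bochner_integral_real_indicator[of "{ln (real m) - \<delta>..<ln (real m)}" lborel] \<delta> by simp
  qed
  have le: "(\<Sum>m\<in>N. b m * of_bool (0 < ln (real m) - v \<and> ln (real m) - v \<le> \<delta>))\<^sup>2 \<le> (2 * \<delta> * B + 1) * (\<Sum>m\<in>N. of_bool (0 < ln (real m) - v \<and> ln (real m) - v \<le> \<delta>))" for v
  proof -
    define S T where "S = (\<Sum>m\<in>N. b m * of_bool (0 < ln (real m) - v \<and> ln (real m) - v \<le> \<delta>))"
      and "T = (\<Sum>m\<in>N. of_bool (0 < ln (real m) - v \<and> ln (real m) - v \<le> \<delta>) :: real)"
    have "\<bar>S\<bar> \<le> T" "T \<le> 2 * \<delta> * B + 1"
      unfolding S_def T_def by (rule window_sum_abs_le[OF N b \<delta> B]; assumption)+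
    then have "\<bar>S\<bar> * \<bar>S\<bar> \<le> (2 * \<delta> * B + 1) * T" by (intro mult_mono) auto
    then show ?thesis unfolding S_def[symmetric] T_def[symmetric] by (simp add: power2_eq_square)
  qed
  show int: "integrable lborel (\<lambda>v. (\<Sum>m\<in>N. b m * of_bool (0 < ln (real m) - v \<and> ln (real m) - v \<le> \<delta>))\<^sup>2)"
  proof (rule Bochner_Integration.integrable_bound)
    show "integrable lborel (\<lambda>v. (2 * \<delta> * B + 1) * (\<Sum>m\<in>N. of_bool (0 < ln (real m) - v \<and> ln (real m) - v \<le> \<delta>)))"
      using hb by (simp add: has_bochner_integral_iff)
    show "(\<lambda>v. (\<Sum>m\<in>N. b m * of_bool (0 < ln (real m) - v \<and> ln (real m) - v \<le> \<delta>))\<^sup>2) \<in> borel_measurable lborel"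
      unfolding ind by measurable
    show "AE v in lborel. norm ((\<Sum>m\<in>N. b m * of_bool (0 < ln (real m) - v \<and> ln (real m) - v \<le> \<delta>))\<^sup>2) \<le> norm ((2 * \<delta> * B + 1) * (\<Sum>m\<in>N. of_bool (0 < ln (real m) - v \<and> ln (real m) - v \<le> \<delta>)))"
      using le by (intro AE_I2) (simp add: order.trans[OF _ abs_ge_self])
  qed
  have "integral\<^sup>L lborel (\<lambda>v. (\<Sum>m\<in>N. b m * of_bool (0 < ln (real m) - v \<and> ln (real m) - v \<le> \<delta>))\<^sup>2) \<le> integral\<^sup>L lborel (\<lambda>v. (2 * \<delta> * B + 1) * (\<Sum>m\<in>N. of_bool (0 < ln (real m) - v \<and> ln (real m) - v \<le> \<delta>)))"
    by (rule integral_mono[OF int _ le]) (use hb in \<open>simp add: has_bochner_integral_iff\<close>)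
  also have "\<dots> = (2 * \<delta> * B + 1) * (\<Sum>m\<in>N. \<delta>)" using hb by (rule has_bochner_integral_integral_eq)
  finally show "integral\<^sup>L lborel (\<lambda>v. (\<Sum>m\<in>N. b m * of_bool (0 < ln (real m) - v \<and> ln (real m) - v \<le> \<delta>))\<^sup>2) \<le> (2 * \<delta> * B + 1) * (\<delta> * real (card N))"
    by (simp add: mult.commute)
qed

section \<open>Long windows of the Liouville function\<close>

lemma hat_eq_pos_part: "w > 0 \<Longrightarrow> hat w u = (max 0 (u + w) - 2 * max 0 u + max 0 (u - w)) / w"
  by (auto simp: hat_def max_def abs_if field_simps)

text \<open>By \<open>hat_eq_pos_part\<close> each hat is a second difference, so the sum telescopes
  to a trapezoid: 1 for \<open>u\<close> between 0 and \<open>K * w\<close>, with slopes of width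
  \<open>w\<close> on both sides.\<close>

lemma sum_hat:
  assumes "w > 0"
  shows "(\<Sum>k\<le>K. hat w (u - real k * w)) =
    (max 0 (u + w) - max 0 u - max 0 (u - real K * w) + max 0 (u - real (Suc K) * w)) / w"
proof (induction K)
  case (Suc K)
  have "hat w (u - real (Suc K) * w) = (max 0 (u - real K * w) - 2 * max 0 (u - real (Suc K) * w) + max 0 (u - real (Suc (Suc K)) * w)) / w"
    unfolding hat_eq_pos_part[OF assms] by (simp add: algebra_simps)
  then show ?case by (simp only: sum.atMost_Suc Suc.IH) (simp add: add_divide_distrib diff_divide_distrib)
qed (simp add: hat_eq_pos_part[OF assms])

text \<open>The generating function is zeta(2u) / zeta(u). On \<open>Re u = 19/20\<close> the
  numerator is bounded by an absolutely convergent series and the reciprocal of zeta grows at most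
  like a square root, so the shifted integral converges. The factor
  \<open>of_nat n powr (-0)\<close> is 1 for \<open>n > 0\<close> but 0 for \<open>n = 0\<close>,
  where the convention \<open>ln 0 = 0\<close> would let a spurious term in.\<close>

lemma liouville_hat_bound:
  assumes RH: "riemann_hypothesis"
  obtains C where "C > 0" "\<And>w y. 0 < w \<Longrightarrow> w \<le> 1 \<Longrightarrow>
    norm (\<Sum>n. of_int (liouville n) * of_nat n powr (-0) * of_real (hat w (ln (real n) - y)) :: complex) \<le> C / w * exp (19/20 * y)"
proof -
  obtain C0 where C0: "C0 > 0" "\<And>s. 19/20 \<le> Re s \<Longrightarrow> Re s \<le> 21/20 \<Longrightarrow>
     norm ((s - 1) / zeta_entire s) \<le> C0 * sqrt (1 + \<bar>Im s\<bar>)"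
    using inverse_zeta_bound[OF RH] by blast
  define A where "A = (\<Sum>n. real n powr (-(19/10))) + 1"
  have smA: "summable (\<lambda>n. real n powr (-(19/10)))" by (simp add: summable_real_powr_iff)
  have A: "A > 0" unfolding A_def using suminf_nonneg[OF smA] by force
  have z2: "norm (zeta_entire (2 * u) / (2 * u - 1)) \<le> A" if u: "19/20 \<le> Re u" for u
  proof -
    have c: "dconv (\<lambda>_. 1) (Re (2 * u))" using u by (intro dconv_bounded[of _ 1]) auto
    have "norm (dser (\<lambda>_. 1) (2 * u)) \<le> (\<Sum>n. norm (1::complex) * real n powr (- Re (2 * u)))" by (rule norm_dser_le[OF c])
    also have "\<dots> \<le> (\<Sum>n. real n powr (-(19/10)))"
    proof (rule suminf_le[OF _ _ smA])
      show "norm (1::complex) * real n powr (- Re (2 * u)) \<le> real n powr (-(19/10))" for n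
        using u by (cases "n = 0") (auto intro!: powr_mono)
      show "summable (\<lambda>n. norm (1::complex) * real n powr (- Re (2 * u)))" using c by (simp add: dconv_def)
    qed
    finally show ?thesis using dser_one[of "2 * u"] u by (simp add: A_def)
  qed
  define C where "C = 128 * exp 2 * A * C0"
  show thesis
  proof (rule that[of C])
    show "C > 0" using A C0(1) by (simp add: C_def)
    fix w y :: real assume h: "0 < w" "w \<le> 1"
    define k where "k = (\<lambda>u. hat_ker w u * exp (of_real y * u))"
    define f where "f = (\<lambda>u. zeta_entire (2 * u) / (2 * u - 1) * ((u - 1) / zeta_entire u) * k u)"
    have holk: "k holomorphic_on S" for S unfolding k_def by (intro holomorphic_intros hat_ker_holomorphic)
    have hol: "f holomorphic_on {u. 1/2 < Re u}"
    proof -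
      have z: "zeta_entire holomorphic_on {s. 1/2 < Re s}"
        by (rule holomorphic_on_subset[OF zeta_entire_holomorphic]) auto
      have "(\<lambda>u. 2 * u) holomorphic_on {u. 1/2 < Re u}" by (intro holomorphic_intros)
      then have "(zeta_entire \<circ> (\<lambda>u. 2 * u)) holomorphic_on {u. 1/2 < Re u}"
        by (rule holomorphic_on_compose_gen[OF _ zeta_entire_holomorphic]) auto
      then have z2: "(\<lambda>u. zeta_entire (2 * u)) holomorphic_on {u. 1/2 < Re u}" by (simp add: o_def)
      show ?thesis unfolding f_def
        by (intro holomorphic_on_mult holomorphic_on_divide z z2 holk holomorphic_intros)
           (use zeta_entire_nonzero[OF RH] in \<open>auto simp: complex_eq_iff\<close>)
    qed
    define D where "D = A * C0 * (16 * exp 2 * (1 / w))"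
    have D: "D > 0" using A C0(1) h by (simp add: D_def)
    have bd: "norm (f u) \<le> D * exp (y * Re u) * (1 + \<bar>Im u\<bar>) powr (-(5/4))" if u: "19/20 \<le> Re u" "Re u \<le> 21/20" for u
    proof -
      have "norm (k u) \<le> 16 * exp 2 * w * (1 + w * \<bar>Im u\<bar>) powr (-2) * exp (y * Re u)"
        unfolding k_def using u by (intro hat_ker_exp_bound h) auto
      also have "\<dots> \<le> 16 * exp 2 * w * (w powr (-2) * (1 + \<bar>Im u\<bar>) powr (-2)) * exp (y * Re u)"
        using h scaled_decay[of w 2 "Im u"] by (intro mult_right_mono mult_left_mono) auto
      also have "\<dots> = 16 * exp 2 * (w * w powr (-2)) * (1 + \<bar>Im u\<bar>) powr (-2) * exp (y * Re u)" by (simp only: mult_ac)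
      also have "w * w powr (-2) = 1 / w" using h by (simp add: powr_minus powr_numeral power2_eq_square field_simps)
      finally have k: "norm (k u) \<le> 16 * exp 2 * (1 / w) * (1 + \<bar>Im u\<bar>) powr (-2) * exp (y * Re u)" .
      have "norm (f u) \<le> A * (C0 * sqrt (1 + \<bar>Im u\<bar>)) * (16 * exp 2 * (1 / w) * (1 + \<bar>Im u\<bar>) powr (-2) * exp (y * Re u))"
        unfolding f_def norm_mult using A C0(1) by (intro mult_mono z2 C0(2) u k mult_nonneg_nonneg) auto
      also have "sqrt (1 + \<bar>Im u\<bar>) = (1 + \<bar>Im u\<bar>) powr (1/2)" by (simp add: powr_half_sqrt)
      also have "A * (C0 * (1 + \<bar>Im u\<bar>) powr (1/2)) * (16 * exp 2 * (1 / w) * (1 + \<bar>Im u\<bar>) powr (-2) * exp (y * Re u))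
        = D * exp (y * Re u) * ((1 + \<bar>Im u\<bar>) powr (1/2) * (1 + \<bar>Im u\<bar>) powr (-2))" by (simp add: D_def mult_ac)
      also have "(1 + \<bar>Im u\<bar>) powr (1/2) * (1 + \<bar>Im u\<bar>) powr (-2) = (1 + \<bar>Im u\<bar>) powr (-(3/2))" by (simp flip: powr_add)
      also have "D * exp (y * Re u) * (1 + \<bar>Im u\<bar>) powr (-(3/2)) \<le> D * exp (y * Re u) * (1 + \<bar>Im u\<bar>) powr (-(5/4))"
        using D by (intro mult_left_mono powr_mono) auto
      finally show ?thesis .
    qed
    define E where "E = D * exp (\<bar>y\<bar> * 2)"
    have bd2: "norm (f u) \<le> E * (1 + \<bar>Im u\<bar>) powr (-(5/4))" if u: "19/20 \<le> Re u" "Re u \<le> 21/20" for u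
    proof -
      have "y * Re u \<le> \<bar>y\<bar> * \<bar>Re u\<bar>" by (metis abs_ge_self abs_mult)
      also have "\<dots> \<le> \<bar>y\<bar> * 2" using u by (intro mult_left_mono) auto
      finally have "D * exp (y * Re u) * (1 + \<bar>Im u\<bar>) powr (-(5/4)) \<le> E * (1 + \<bar>Im u\<bar>) powr (-(5/4))"
        unfolding E_def using D by (intro mult_right_mono mult_left_mono) auto
      then show ?thesis using bd[OF u] by linarith
    qed
    have sh: "integrable lborel (\<lambda>t. f (Complex (19/20) t))" "integral\<^sup>L lborel (\<lambda>t. f (Complex (19/20) t)) = integral\<^sup>L lborel (\<lambda>t. f (Complex (21/20) t))"
      using vertical_line_shift(1,3)[OF hol, of "19/20" "21/20" E] bd2 by auto
    have hb: "has_bochner_integral lborel (\<lambda>t. D * exp (y * (19/20)) * (1 + \<bar>t\<bar>) powr (-(5/4))) (D * exp (y * (19/20)) * (2 / (5/4 - 1)))"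
      by (intro has_bochner_integral_mult_right has_bochner_integral_decay) auto
    have "norm (integral\<^sup>L lborel (\<lambda>t. f (Complex (19/20) t))) \<le> integral\<^sup>L lborel (\<lambda>t. D * exp (y * (19/20)) * (1 + \<bar>t\<bar>) powr (-(5/4)))"
    proof (rule Bochner_Integration.integral_norm_bound_integral[OF sh(1)])
      show "integrable lborel (\<lambda>t. D * exp (y * (19/20)) * (1 + \<bar>t\<bar>) powr (-(5/4)))" using hb by (simp add: has_bochner_integral_iff)
      show "norm (f (Complex (19/20) t)) \<le> D * exp (y * (19/20)) * (1 + \<bar>t\<bar>) powr (-(5/4))" for t
        using bd[of "Complex (19/20) t"] by simp
    qed
    also have "\<dots> = C / w * exp (19/20 * y)" using hb by (simp add: has_bochner_integral_iff D_def C_def mult_ac)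
    finally have I: "norm (integral\<^sup>L lborel (\<lambda>t. f (Complex (21/20) t))) \<le> C / w * exp (19/20 * y)" unfolding sh(2) .
    have fe: "f (Complex (21/20) t) = dser (\<lambda>n. of_int (liouville n)) (0 + Complex (21/20) t) * k (Complex (21/20) t)" for t
    proof -
      define u where "u = Complex (21/20) t"
      have u: "Re u > 1" "u \<noteq> 1" by (auto simp: u_def complex_eq_iff)
      have nz: "zeta_entire u \<noteq> 0" using zeta_entire_nonzero[OF RH, of u] u by simp
      have e: "dser (\<lambda>n. of_int (liouville n)) u * (zeta_entire u / (u - 1)) = zeta_entire (2 * u) / (2 * u - 1)"
        using liouville_dser[of u] dser_one[of u] dser_one[of "2 * u"] u by simp
      have "zeta_entire (2 * u) / (2 * u - 1) * ((u - 1) / zeta_entire u) = dser (\<lambda>n. of_int (liouville n)) u"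
        unfolding e[symmetric] using nz u by simp
      then show ?thesis by (simp only: f_def u_def add_0)
    qed
    define S where "S = (\<Sum>n. of_int (liouville n) * of_nat n powr (-0) * of_real (hat w (ln (real n) - y)) :: complex)"
    have "of_real (2 * pi) * S = integral\<^sup>L lborel (\<lambda>t. f (Complex (21/20) t))"
      unfolding fe k_def S_def
      by (rule perron_hat[symmetric, OF h(1)]) (rule dconv_bounded[of _ 1], auto simp flip: of_int_abs)
    then have "norm (of_real (2 * pi) * S) \<le> C / w * exp (19/20 * y)" using I by (simp only:)
    then have e: "2 * pi * norm S \<le> C / w * exp (19/20 * y)" by (simp add: norm_mult)
    have "1 * norm S \<le> 2 * pi * norm S" using pi_ge_two by (intro mult_right_mono) auto
    with e show "norm (\<Sum>n. of_int (liouville n) * of_nat n powr (-0) * of_real (hat w (ln (real n) - y)) :: complex) \<le> C / w * exp (19/20 * y)"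
      unfolding S_def by linarith
  qed
qed

text \<open>The window starts just after \<open>exp v\<close> and has relative length
  \<open>exp \<Delta>\<close>. Since \<open>ln 0 = 0\<close>, the index \<open>n = 0\<close> is
  excluded exactly when \<open>v \<ge> 0\<close> or \<open>- v > \<Delta>\<close>; all uses have
  \<open>v \<ge> 0\<close>.\<close>

definition lwin :: "real \<Rightarrow> real \<Rightarrow> real" where
  "lwin v \<Delta> = (\<Sum>n | 0 < ln (real n) - v \<and> ln (real n) - v \<le> \<Delta>. real_of_int (liouville n))"

lemma finite_ln_interval: "finite {n::nat. P n \<and> ln (real n) \<le> b}"
proof (rule finite_subset)
  show "{n::nat. P n \<and> ln (real n) \<le> b} \<subseteq> {..nat \<lfloor>exp b\<rfloor>}"
  proof
    fix n assume n: "n \<in> {n::nat. P n \<and> ln (real n) \<le> b}"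
    have "real n \<le> exp b"
    proof (cases "n = 0")
      case False
      then have "exp (ln (real n)) \<le> exp b" using n by (simp del: exp_ln)
      then show ?thesis using False by simp
    qed simp
    then show "n \<in> {..nat \<lfloor>exp b\<rfloor>}" by (simp add: le_nat_floor)
  qed
qed simp

lemma card_ln_window:
  assumes "0 \<le> d" "d \<le> 1"
  shows "real (card {n::nat. n > 0 \<and> v < ln (real n) \<and> ln (real n) \<le> v + d}) \<le> 2 * d * exp v + 1"
proof -
  have "{n::nat. n > 0 \<and> v < ln (real n) \<and> ln (real n) \<le> v + d} \<subseteq> {m::nat. exp v < real m \<and> real m \<le> exp (v + d)}"
  proof
    fix m :: nat assume "m \<in> {n. n > 0 \<and> v < ln (real n) \<and> ln (real n) \<le> v + d}"
    then show "m \<in> {m. exp v < real m \<and> real m \<le> exp (v + d)}"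
      using exp_less_mono[of v "ln (real m)"] exp_le_cancel_iff[of "ln (real m)" "v + d"] by simp
  qed
  moreover have "finite {m::nat. exp v < real m \<and> real m \<le> exp (v + d)}"
    by (rule finite_subset[of _ "{..nat \<lfloor>exp (v + d)\<rfloor>}"]) (auto simp: le_nat_floor)
  ultimately have "real (card {n::nat. n > 0 \<and> v < ln (real n) \<and> ln (real n) \<le> v + d}) \<le> real (card {m::nat. exp v < real m \<and> real m \<le> exp (v + d)})"
    by (simp add: card_mono)
  also have "\<dots> \<le> exp (v + d) - exp v + 1" using assms by (intro card_nat_interval) auto
  also have "exp (v + d) - exp v = exp v * (exp d - 1)" by (simp add: exp_add algebra_simps)
  also have "\<dots> \<le> exp v * (2 * d)"
  proof (rule mult_left_mono)
    have "exp d \<le> 1 + d + d\<^sup>2" using assms by (intro exp_bound) auto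
    also have "d\<^sup>2 \<le> d" using assms by (simp add: power2_eq_square mult_left_le)
    finally show "exp d - 1 \<le> 2 * d" by simp
  qed auto
  finally show ?thesis by (simp add: mult_ac)
qed

text \<open>The sharp window is compared with the trapezoid of \<open>sum_hat\<close>. The trapezoid
  is a sum of at most \<open>2 / w\<close> hats, each bounded by \<open>liouville_hat_bound\<close>;
  the difference lives on the two slopes \<open>V1\<close> and \<open>V2\<close>, which contain
  \<open>O (w * exp v + 1)\<close> integers.\<close>

lemma lwin_bound_w:
  assumes RH: "riemann_hypothesis"
  obtains C where "C > 0" "\<And>K w v. 0 < w \<Longrightarrow> real K * w \<le> 1 \<Longrightarrow> w \<le> 1 \<Longrightarrow> v \<ge> 0 \<Longrightarrow>
    \<bar>lwin v (real K * w)\<bar> \<le> C * (exp (19/20 * v) / w\<^sup>2 + w * exp v + 1)"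
proof -
  obtain C0 where C0: "C0 > 0" "\<And>w y. 0 < w \<Longrightarrow> w \<le> 1 \<Longrightarrow>
    norm (\<Sum>n. of_int (liouville n) * of_nat n powr (-0) * of_real (hat w (ln (real n) - y)) :: complex) \<le> C0 / w * exp (19/20 * y)"
    using liouville_hat_bound[OF RH] by blast
  define C where "C = 2 * C0 * exp 1 + 8 * exp 1"
  show thesis
  proof (rule that[of C])
    show "C > 0" using C0(1) by (simp add: C_def add_pos_pos)
    fix K :: nat and w v :: real
    assume h: "0 < w" "real K * w \<le> 1" "w \<le> 1" "v \<ge> 0"
    define \<Delta> where "\<Delta> = real K * w"
    have \<Delta>0: "0 \<le> \<Delta>" using h by (simp add: \<Delta>_def)
    define U where "U = {n::nat. n > 0 \<and> ln (real n) \<le> v + \<Delta> + w}"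
    have finU: "finite U" unfolding U_def by (rule finite_ln_interval)
    define T where "T = (\<lambda>n. \<Sum>k\<le>K. hat w (ln (real n) - v - real k * w))"
    have Tf: "T n = (max 0 (ln (real n) - v + w) - max 0 (ln (real n) - v) - max 0 (ln (real n) - v - \<Delta>) + max 0 (ln (real n) - v - \<Delta> - w)) / w" for n
      unfolding T_def sum_hat[OF h(1)] by (simp add: \<Delta>_def algebra_simps)
    have hs: "(\<Sum>n\<in>U. real_of_int (liouville n) * hat w (ln (real n) - (v + real k * w))) \<le> C0 / w * exp (19/20 * (v + 1))"
             "- (\<Sum>n\<in>U. real_of_int (liouville n) * hat w (ln (real n) - (v + real k * w))) \<le> C0 / w * exp (19/20 * (v + 1))" if k: "k \<le> K" for k
    proof -
      have kw: "0 \<le> real k * w" "real k * w \<le> \<Delta>" using k h by (auto simp: \<Delta>_def mult_right_mono)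
      define y where "y = v + real k * w"
      have "(\<Sum>n. of_int (liouville n) * of_nat n powr (-0) * of_real (hat w (ln (real n) - y)) :: complex) =
        (\<Sum>n\<in>U. of_int (liouville n) * of_nat n powr (-0) * of_real (hat w (ln (real n) - y)))"
      proof (rule suminf_finite[OF finU])
        fix n assume "n \<notin> U"
        then have "n = 0 \<or> ln (real n) - y \<ge> w" using kw by (auto simp: U_def y_def)
        then show "of_int (liouville n) * of_nat n powr (-0) * of_real (hat w (ln (real n) - y)) = (0::complex)"
          using hat_eq_0[OF h(1), of "ln (real n) - y"] h by auto
      qed
      also have "\<dots> = of_real (\<Sum>n\<in>U. real_of_int (liouville n) * hat w (ln (real n) - y))"
        unfolding of_real_sum by (intro sum.cong refl) (auto simp: U_def)
      finally have "\<bar>\<Sum>n\<in>U. real_of_int (liouville n) * hat w (ln (real n) - y)\<bar> \<le> C0 / w * exp (19/20 * y)"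
        using C0(2)[OF h(1,3), of y] by (simp only: norm_of_real)
      also have "\<dots> \<le> C0 / w * exp (19/20 * (v + 1))"
      proof (rule mult_left_mono)
        have "y \<le> v + 1" using kw h(2) unfolding y_def \<Delta>_def by linarith
        then show "exp (19/20 * y) \<le> exp (19/20 * (v + 1))" by simp
      qed (use C0(1) h in auto)
      finally show "(\<Sum>n\<in>U. real_of_int (liouville n) * hat w (ln (real n) - (v + real k * w))) \<le> C0 / w * exp (19/20 * (v + 1))"
             "- (\<Sum>n\<in>U. real_of_int (liouville n) * hat w (ln (real n) - (v + real k * w))) \<le> C0 / w * exp (19/20 * (v + 1))"
        by (simp_all add: y_def abs_le_iff)
    qed
    have "(\<Sum>n\<in>U. real_of_int (liouville n) * T n) = (\<Sum>k\<le>K. \<Sum>n\<in>U. real_of_int (liouville n) * hat w (ln (real n) - (v + real k * w)))"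
      unfolding T_def sum_distrib_left by (subst sum.swap) (simp add: diff_diff_eq)
    also have "\<bar>\<dots>\<bar> \<le> (\<Sum>k\<le>K. C0 / w * exp (19/20 * (v + 1)))"
      by (rule order.trans[OF sum_abs], rule sum_mono) (use hs in \<open>auto intro!: abs_leI\<close>)
    also have "\<dots> = real (Suc K) * (C0 / w * exp (19/20 * (v + 1)))" by simp
    also have "\<dots> \<le> (2 / w) * (C0 / w * (exp 1 * exp (19/20 * v)))"
    proof (rule mult_mono)
      show "real (Suc K) \<le> 2 / w" using h by (simp add: field_simps)
      have "exp (19/20 * (v + 1)) \<le> exp (1 + 19/20 * v)" by simp
      then show "C0 / w * exp (19/20 * (v + 1)) \<le> C0 / w * (exp 1 * exp (19/20 * v))"
        using C0(1) h unfolding exp_add by (intro mult_left_mono) auto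
    qed (use h C0(1) in auto)
    also have "\<dots> = 2 * C0 * exp 1 * (exp (19/20 * v) / w\<^sup>2)" by (simp add: power2_eq_square mult_ac)
    finally have 1: "\<bar>\<Sum>n\<in>U. real_of_int (liouville n) * T n\<bar> \<le> 2 * C0 * exp 1 * (exp (19/20 * v) / w\<^sup>2)" .
    define I where "I = (\<lambda>n::nat. of_bool (0 < ln (real n) - v \<and> ln (real n) - v \<le> \<Delta>) :: real)"
    define V1 V2 where "V1 = {n::nat. n > 0 \<and> v - w < ln (real n) \<and> ln (real n) \<le> v - w + w}"
      and "V2 = {n::nat. n > 0 \<and> v + \<Delta> < ln (real n) \<and> ln (real n) \<le> v + \<Delta> + w}"
    have fV: "finite V1" "finite V2" unfolding V1_def V2_def by (rule finite_subset[OF _ finU], use \<Delta>0 h in \<open>auto simp: U_def\<close>)+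
    have lw: "lwin v \<Delta> = (\<Sum>n\<in>U. real_of_int (liouville n) * I n)"
    proof -
      have "{n::nat. 0 < ln (real n) - v \<and> ln (real n) - v \<le> \<Delta>} \<subseteq> U"
        using h by (auto simp: U_def intro!: Nat.gr0I)
      then show ?thesis unfolding lwin_def I_def
        by (intro sum.mono_neutral_cong_left finU) auto
    qed
    have dI: "\<bar>I n - T n\<bar> \<le> of_bool (n \<in> V1) + of_bool (n \<in> V2)" if n: "n \<in> U" for n
    proof -
      define u where "u = ln (real n) - v"
      have T: "T n = (max 0 (u + w) - max 0 u - max 0 (u - \<Delta>) + max 0 (u - \<Delta> - w)) / w" unfolding Tf u_def ..
      have Iu: "I n = of_bool (0 < u \<and> u \<le> \<Delta>)" by (simp add: I_def u_def)
      have uU: "u \<le> \<Delta> + w" using n by (simp add: U_def u_def)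
      have n0: "n > 0" using n by (simp add: U_def)
      consider "u \<le> -w" | "-w < u" "u \<le> 0" | "0 < u" "u \<le> \<Delta>" | "\<Delta> < u" "0 < u" using \<Delta>0 by linarith
      then show ?thesis
      proof cases
        case 1
        then have "T n = 0" "I n = 0" using h \<Delta>0 by (auto simp: T Iu)
        then show ?thesis by simp
      next
        case 2
        then have "T n = (u + w) / w" "I n = 0" using h \<Delta>0 by (auto simp: T Iu)
        moreover have "n \<in> V1" using 2 n0 by (auto simp: V1_def u_def)
        moreover have "0 \<le> (u + w) / w" "(u + w) / w \<le> 1" using 2 h by auto
        ultimately have "0 \<le> T n" "T n \<le> 1" "I n = 0" "n \<in> V1" by simp_all
        then show ?thesis by simp
      next
        case 3
        then have "T n = 1" "I n = 1" using h \<Delta>0 by (auto simp: T Iu)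
        then show ?thesis by simp
      next
        case 4
        then have "T n = (w - (u - \<Delta>)) / w" "I n = 0" using h \<Delta>0 uU by (auto simp: T Iu)
        moreover have "n \<in> V2" using 4 n0 uU by (auto simp: V2_def u_def)
        moreover have "0 \<le> (w - (u - \<Delta>)) / w" "(w - (u - \<Delta>)) / w \<le> 1" using 4 h uU by auto
        ultimately have "0 \<le> T n" "T n \<le> 1" "I n = 0" "n \<in> V2" by simp_all
        then show ?thesis by simp
      qed
    qed
    have "\<bar>lwin v \<Delta> - (\<Sum>n\<in>U. real_of_int (liouville n) * T n)\<bar> = \<bar>\<Sum>n\<in>U. real_of_int (liouville n) * (I n - T n)\<bar>"
      unfolding lw by (simp add: sum_subtractf algebra_simps)
    also have "\<dots> \<le> (\<Sum>n\<in>U. of_bool (n \<in> V1) + of_bool (n \<in> V2))"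
    proof (intro order.trans[OF sum_abs] sum_mono)
      fix n assume "n \<in> U"
      then show "\<bar>real_of_int (liouville n) * (I n - T n)\<bar> \<le> of_bool (n \<in> V1) + of_bool (n \<in> V2)"
        using dI[of n] by (simp add: abs_mult flip: of_int_abs)
    qed
    also have "\<dots> = real (card (U \<inter> V1)) + real (card (U \<inter> V2))" using finU by (simp add: sum.distrib Int_def)
    also have "\<dots> \<le> real (card V1) + real (card V2)" using fV by (intro add_mono of_nat_mono card_mono) auto
    also have "\<dots> \<le> (2 * w * exp (v - w) + 1) + (2 * w * exp (v + \<Delta>) + 1)"
      unfolding V1_def V2_def using h by (intro add_mono card_ln_window) auto
    also have "\<dots> \<le> (2 * w * (exp 1 * exp v) + exp 1) + (2 * w * (exp 1 * exp v) + exp 1)"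
    proof -
      have "exp (v - w) \<le> exp (1 + v)" "exp (v + \<Delta>) \<le> exp (1 + v)" using h by (auto simp: \<Delta>_def)
      then show ?thesis using h exp_ge_add_one_self[of 1] unfolding exp_add by (intro add_mono mult_left_mono) auto
    qed
    also have "\<dots> \<le> 8 * exp 1 * (w * exp v + 1)" using h by (simp add: algebra_simps)
    finally have 2: "\<bar>lwin v \<Delta> - (\<Sum>n\<in>U. real_of_int (liouville n) * T n)\<bar> \<le> 8 * exp 1 * (w * exp v + 1)" .
    have "\<bar>lwin v \<Delta>\<bar> \<le> 2 * C0 * exp 1 * (exp (19/20 * v) / w\<^sup>2) + 8 * exp 1 * (w * exp v + 1)" using 1 2 by linarith
    also have "\<dots> \<le> C * (exp (19/20 * v) / w\<^sup>2) + C * (w * exp v + 1)"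
      using C0(1) h by (intro add_mono mult_right_mono) (auto simp: C_def)
    finally show "\<bar>lwin v (real K * w)\<bar> \<le> C * (exp (19/20 * v) / w\<^sup>2 + w * exp v + 1)"
      by (simp add: \<Delta>_def algebra_simps)
  qed
qed

lemma lwin_bound:
  assumes RH: "riemann_hypothesis"
  obtains C where "C > 0" "\<And>X v. X \<ge> 1 \<Longrightarrow> ln X \<le> v \<Longrightarrow> v \<le> ln (3 * X) \<Longrightarrow>
    \<bar>lwin v (X powr (-(1/240)))\<bar> \<le> C * X powr (59/60)"
proof -
  obtain C0 where C0: "C0 > 0" "\<And>K w v. 0 < w \<Longrightarrow> real K * w \<le> 1 \<Longrightarrow> w \<le> 1 \<Longrightarrow> v \<ge> 0 \<Longrightarrow>
    \<bar>lwin v (real K * w)\<bar> \<le> C0 * (exp (19/20 * v) / w\<^sup>2 + w * exp v + 1)"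
    using lwin_bound_w[OF RH] by blast
  show thesis
  proof (rule that[of "C0 * 16"])
    show "C0 * 16 > 0" using C0(1) by simp
    fix X v :: real assume h: "X \<ge> 1" "ln X \<le> v" "v \<le> ln (3 * X)"
    define \<Delta> where "\<Delta> = X powr (-(1/240))"
    \<comment> \<open>With \<open>w\<close> near \<open>1 / r\<close>, the terms
      \<open>exp (19/20 * v) / w\<^sup>2\<close> and \<open>w * exp v\<close> both have size
      \<open>X powr (59/60)\<close>, because \<open>19/20 + 2/60 = 1 - 1/60\<close>.\<close>
    define r where "r = X powr (1/60)"
    have \<Delta>: "0 < \<Delta>" "\<Delta> \<le> 1" using h powr_mono[of "-(1/240)" 0 X] by (auto simp: \<Delta>_def)
    have r: "r \<ge> 1" using h by (simp add: r_def ge_one_powr_ge_zero)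
    have r\<Delta>: "\<Delta> * r \<ge> 1" using h by (simp add: r_def \<Delta>_def ge_one_powr_ge_zero flip: powr_add)
    \<comment> \<open>Rounding up makes the window length an exact multiple of \<open>w\<close> and
      changes \<open>w\<close> by at most a factor 2.\<close>
    define K where "K = nat \<lceil>\<Delta> * r\<rceil>"
    have K: "real K \<ge> \<Delta> * r" "real K \<le> \<Delta> * r + 1" "real K \<ge> 1"
      using r\<Delta> unfolding K_def by linarith+
    define w where "w = \<Delta> / real K"
    have Kw: "real K * w = \<Delta>" using K by (simp add: w_def)
    have w: "0 < w" "w \<le> 1 / r" "w \<ge> 1 / (2 * r)"
    proof -
      show "0 < w" using K \<Delta> by (simp add: w_def)
      show "w \<le> 1 / r" using K \<Delta> r by (simp add: w_def field_simps)
      have "real K \<le> 2 * (\<Delta> * r)" using K r\<Delta> by linarith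
      then show "w \<ge> 1 / (2 * r)" using K \<Delta> r by (simp add: w_def field_simps)
    qed
    have v0: "v \<ge> 0" using h ln_ge_zero[of X] by linarith
    have ev: "exp v \<le> 3 * X"
    proof -
      have "exp v \<le> exp (ln (3 * X))" using h(3) by (simp only: exp_le_cancel_iff)
      then show ?thesis using h by simp
    qed
    have w1: "w \<le> 1" using w r by (auto intro: order.trans simp: divide_le_eq)
    have "\<bar>lwin v (real K * w)\<bar> \<le> C0 * (exp (19/20 * v) / w\<^sup>2 + w * exp v + 1)"
      using w w1 v0 \<Delta> by (intro C0(2)) (auto simp: Kw)
    also have "\<dots> \<le> C0 * (12 * X powr (59/60) + 3 * X powr (59/60) + X powr (59/60))"
    proof (intro mult_left_mono add_mono)
      have "exp (19/20 * v) = exp v powr (19/20)" by (simp add: powr_def)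
      also have "\<dots> \<le> (3 * X) powr (19/20)" using ev by (intro powr_mono2) auto
      also have "\<dots> = 3 powr (19/20) * X powr (19/20)" by (rule powr_mult)
      also have "\<dots> \<le> 3 powr 1 * X powr (19/20)" by (intro mult_right_mono powr_mono) auto
      finally have e: "exp (19/20 * v) \<le> 3 * X powr (19/20)" by simp
      have "(1 / (2 * r))\<^sup>2 \<le> w\<^sup>2" using w r by (intro power_mono) auto
      then have "exp (19/20 * v) / w\<^sup>2 \<le> (3 * X powr (19/20)) / (1 / (2 * r))\<^sup>2"
        using e r w by (intro frac_le) auto
      also have "\<dots> = 12 * (X powr (19/20) * (r * r))" using r by (simp add: power2_eq_square field_simps)
      also have "X powr (19/20) * (r * r) = X powr (59/60)" by (simp add: r_def flip: powr_add)
      finally show "exp (19/20 * v) / w\<^sup>2 \<le> 12 * X powr (59/60)" .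
      have "w * exp v \<le> (1 / r) * (3 * X)" using w ev r by (intro mult_mono) auto
      also have "\<dots> = 3 * X powr (59/60)"
      proof -
        have "X powr (59/60) * r = X" using h by (simp add: r_def flip: powr_add)
        then show ?thesis using r by (simp add: field_simps)
      qed
      finally show "w * exp v \<le> 3 * X powr (59/60)" .
      show "1 \<le> X powr (59/60)" using h by (simp add: ge_one_powr_ge_zero)
    qed (use C0(1) in auto)
    also have "\<dots> = C0 * 16 * X powr (59/60)" by simp
    finally show "\<bar>lwin v (X powr (-(1/240)))\<bar> \<le> C0 * 16 * X powr (59/60)" unfolding Kw \<Delta>_def .
  qed
qed

section \<open>Smooth numbers\<close>

definition smooth_numbers :: "nat set \<Rightarrow> nat set" where
  "smooth_numbers S = {n. n > 0 \<and> (\<forall>p. prime p \<longrightarrow> p dvd n \<longrightarrow> p \<in> S)}"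

text \<open>A finite Euler product: adding a prime \<open>q\<close> to \<open>S\<close> corresponds
  to the unique decomposition \<open>n = q ^ k * m\<close> with \<open>m\<close> composed of primes
  in \<open>S\<close>, and the sum over \<open>k\<close> is geometric.\<close>

lemma smooth_numbers_has_sum:
  assumes fin: "finite S" and pr: "\<And>p. p \<in> S \<Longrightarrow> prime p" and s: "s > (0::real)"
  shows "((\<lambda>n. real n powr (-s)) has_sum (\<Prod>p\<in>S. 1 / (1 - real p powr (-s)))) (smooth_numbers S)"
  using fin pr
proof (induction S rule: finite_induct)
  case empty
  have "smooth_numbers {} = {1}"
  proof -
    have "n = 1" if "n > 0" "\<forall>p. prime p \<longrightarrow> \<not> p dvd n" for n :: nat
      using that prime_factor_nat[of n] by auto
    then show ?thesis by (auto simp: smooth_numbers_def)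
  qed
  then show ?case using has_sum_finite[of "{1::nat}" "\<lambda>n. real n powr (-s)"] by simp
next
  case (insert q S)
  have q: "prime q" using insert.prems by simp
  then have q1: "real q > 1" using prime_gt_1_nat[of q] by simp
  define x where "x = real q powr (-s)"
  have x: "0 < x" "x < 1" using q1 s powr_less_mono[of "-s" 0 "real q"] by (auto simp: x_def)
  define P where "P = (\<Prod>p\<in>S. 1 / (1 - real p powr (-s)))"
  have IH: "((\<lambda>n. real n powr (-s)) has_sum P) (smooth_numbers S)"
    unfolding P_def using insert.IH insert.prems by simp
  have geo: "((\<lambda>k. x ^ k) has_sum (1 / (1 - x))) UNIV"
    using x by (intro norm_summable_imp_has_sum geometric_sums) (auto intro: summable_geometric)
  have geoP: "((\<lambda>k. x ^ k * P) has_sum (1 / (1 - x) * P)) UNIV"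
    by (rule has_sum_cmult_left[OF geo])
  have inner: "((\<lambda>m. case (k, m) of (k, m) \<Rightarrow> x ^ k * real m powr (-s)) has_sum (x ^ k * P)) (smooth_numbers S)" for k :: nat
    using has_sum_cmult_right[OF IH, of "x ^ k"] by simp
  have sm: "(\<lambda>(k,m). x ^ k * real m powr (-s)) summable_on (UNIV \<times> smooth_numbers S)"
    by (rule summable_on_SigmaI[OF inner]) (use x has_sum_imp_summable[OF geoP] in auto)
  have "((\<lambda>(k,m). x ^ k * real m powr (-s)) has_sum (1 / (1 - x) * P)) (UNIV \<times> smooth_numbers S)"
    by (rule has_sum_SigmaI[OF inner geoP sm])
  also have "((\<lambda>(k,m). x ^ k * real m powr (-s)) has_sum (1 / (1 - x) * P)) (UNIV \<times> smooth_numbers S) \<longleftrightarrow>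
     ((\<lambda>n. real n powr (-s)) has_sum (1 / (1 - x) * P)) (smooth_numbers (insert q S))"
  proof (rule has_sum_reindex_bij_witness[where i = "\<lambda>n. (multiplicity q n, n div q ^ multiplicity q n)" and j = "\<lambda>(k,m). q ^ k * m"])
    fix a :: "nat \<times> nat" assume "a \<in> UNIV \<times> smooth_numbers S"
    then obtain k m where a: "a = (k, m)" "m \<in> smooth_numbers S" by auto
    have m: "m > 0" "\<not> q dvd m" using a(2) insert.hyps(2) q by (auto simp: smooth_numbers_def)
    have mult: "multiplicity q (q ^ k * m) = k"
      using q m by (simp add: prime_elem_multiplicity_mult_distrib not_dvd_imp_multiplicity_0)
    have q0: "q > 0" using q prime_gt_0_nat by blast
    show "(multiplicity q (case a of (k,m) \<Rightarrow> q ^ k * m), (case a of (k,m) \<Rightarrow> q ^ k * m) div q ^ multiplicity q (case a of (k,m) \<Rightarrow> q ^ k * m)) = a"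
      using mult q0 by (simp add: a)
    show "(case a of (k,m) \<Rightarrow> q ^ k * m) \<in> smooth_numbers (insert q S)"
    proof -
      have "p \<in> insert q S" if p: "prime p" "p dvd q ^ k * m" for p
      proof -
        have "p dvd q ^ k \<or> p dvd m" using p by (simp add: prime_dvd_mult_iff)
        then show ?thesis
        proof
          assume "p dvd q ^ k"
          then have "p dvd q" using p prime_dvd_power by blast
          then show ?thesis using p q primes_dvd_imp_eq by blast
        qed (use a(2) p in \<open>auto simp: smooth_numbers_def\<close>)
      qed
      then show ?thesis using q0 m by (simp add: a smooth_numbers_def)
    qed
    have "real (q ^ k * m) powr (-s) = (real q ^ k) powr (-s) * real m powr (-s)" by (simp add: powr_mult)
    also have "(real q ^ k) powr (-s) = x ^ k"
      unfolding x_def using q1 by (induction k) (simp_all add: powr_mult)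
    finally show "real (case a of (k,m) \<Rightarrow> q ^ k * m) powr (-s) = (case a of (k,m) \<Rightarrow> x ^ k * real m powr (-s))"
      by (simp add: a)
  next
    fix n assume n: "n \<in> smooth_numbers (insert q S)"
    then have n0: "n > 0" by (simp add: smooth_numbers_def)
    define k m where "k = multiplicity q n" and "m = n div q ^ k"
    have dvd: "q ^ k dvd n" unfolding k_def by (rule multiplicity_dvd)
    then have nm: "n = q ^ k * m" by (simp add: m_def)
    show "(case (multiplicity q n, n div q ^ multiplicity q n) of (k,m) \<Rightarrow> q ^ k * m) = n"
      using dvd by (simp add: k_def)
    have m0: "m > 0" using nm n0 by (auto intro: Nat.gr0I)
    have nq: "\<not> q dvd m"
      unfolding m_def k_def using multiplicity_decompose[of n q] n0 q by (metis not_prime_unit gr_implies_not0)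
    have "p \<in> S" if "prime p" "p dvd m" for p
      using that n nq nm by (auto simp: smooth_numbers_def)
    then show "(multiplicity q n, n div q ^ multiplicity q n) \<in> UNIV \<times> smooth_numbers S"
      using m0 by (simp add: smooth_numbers_def m_def k_def)
  qed simp
  finally show ?case using insert.hyps by (simp add: P_def x_def)
qed

lemma dser_one_real_bound:
  obtains C where "C \<ge> 1" "\<And>s::real. 1 < s \<Longrightarrow> s \<le> 2 \<Longrightarrow> (\<Sum>n. real n powr (-s)) \<le> C / (s - 1)"
proof -
  obtain C0 where C0: "C0 \<ge> 1" "\<And>s. Re s \<ge> 1/2 \<Longrightarrow> norm (zeta_entire s) \<le> C0 * (norm s + 1)\<^sup>2"
    using zeta_entire_growth by blast
  show thesis
  proof (rule that[of "9 * C0"])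
    show "9 * C0 \<ge> 1" using C0 by simp
    fix s :: real assume s: "1 < s" "s \<le> 2"
    have c: "dconv (\<lambda>_. 1) (Re (of_real s))" using s by (intro dconv_bounded[of _ 1]) auto
    have "(\<lambda>n. 1 * complex_of_nat n powr (- of_real s)) sums dser (\<lambda>_. 1) (of_real s)" by (rule dser_sums[OF c])
    moreover have "1 * complex_of_nat n powr (- of_real s) = of_real (real n powr (-s))" for n
      using powr_of_real[of "real n" "-s"] by simp
    ultimately have "(\<lambda>n. complex_of_real (real n powr (-s))) sums dser (\<lambda>_. 1) (of_real s)" by simp
    then have "dser (\<lambda>_. 1) (of_real s) = of_real (\<Sum>n. real n powr (-s))"
      using s by (metis sums_of_real summable_sums sums_unique2 summable_real_powr_iff neg_less_iff_less)
    then have "(\<Sum>n. real n powr (-s)) \<le> norm (dser (\<lambda>_. 1) (of_real s))" by (simp only: norm_of_real abs_ge_self)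
    also have "\<dots> = norm (zeta_entire (of_real s)) / norm (of_real (s - 1) :: complex)"
      using s by (subst dser_one) (auto simp: norm_divide)
    also have "\<dots> \<le> 9 * C0 / (s - 1)"
    proof -
      have "norm (zeta_entire (of_real s)) \<le> C0 * (norm (of_real s :: complex) + 1)\<^sup>2" using s by (intro C0(2)) auto
      also have "\<dots> \<le> C0 * 3\<^sup>2" using s C0(1) by (intro mult_left_mono power_mono) auto
      finally have z: "norm (zeta_entire (of_real s)) \<le> 9 * C0" by simp
      have "norm (of_real (s - 1) :: complex) = \<bar>s - 1\<bar>" by (simp only: norm_of_real)
      then have "norm (of_real (s - 1) :: complex) = s - 1" using s by simp
      then show ?thesis using z s by (metis divide_right_mono diff_ge_0_iff_ge less_imp_le)
    qed
    finally show "(\<Sum>n. real n powr (-s)) \<le> 9 * C0 / (s - 1)" .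
  qed
qed

lemma inverse_one_minus_bounds:
  assumes "0 \<le> x" "x \<le> (2/3::real)"
  shows "1 / (1 - x) \<le> exp (3 * x)" "exp x \<le> 1 / (1 - x)"
proof -
  have "1 - x \<le> exp (-x)" using exp_ge_add_one_self[of "-x"] by simp
  then have "1 / exp (-x) \<le> 1 / (1 - x)" using assms by (intro divide_left_mono) auto
  then show "exp x \<le> 1 / (1 - x)" by (simp add: exp_minus field_simps)
  have "1 / (1 - x) = 1 + x / (1 - x)" using assms by (simp add: field_simps)
  also have "\<dots> \<le> exp (x / (1 - x))" by (rule exp_ge_add_one_self)
  also have "x / (1 - x) \<le> x / (1/3)" using assms by (intro divide_left_mono) auto
  then have "exp (x / (1 - x)) \<le> exp (3 * x)" by simp
  finally show "1 / (1 - x) \<le> exp (3 * x)" .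
qed

text \<open>Rankin's method: each counted \<open>n\<close> satisfies
  \<open>(X / n) powr \<sigma> \<ge> 1\<close>, and the sum of \<open>n powr (-\<sigma>)\<close> is
  a finite Euler product. The primes are controlled by a weak form of Mertens' theorem, namely the
  Euler product at \<open>s\<close> compared with zeta at the same point. The restriction
  \<open>\<sigma> \<ge> 3/4\<close> keeps all \<open>p powr (-\<sigma>)\<close> below 2/3.\<close>

lemma smooth_count:
  obtains C where "C \<ge> 1" "\<And>H \<sigma> X. H \<ge> exp 1 \<Longrightarrow> 3/4 \<le> \<sigma> \<Longrightarrow> \<sigma> \<le> 1 \<Longrightarrow> X \<ge> 1 \<Longrightarrow>
     real (card {n::nat. n > 0 \<and> real n \<le> X \<and> (\<forall>p. prime p \<longrightarrow> p dvd n \<longrightarrow> real p \<le> H)})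
       \<le> X powr \<sigma> * exp (9 * H powr (1 - \<sigma>) * ln (C * ln H))"
proof -
  obtain C where C: "C \<ge> 1" "\<And>s::real. 1 < s \<Longrightarrow> s \<le> 2 \<Longrightarrow> (\<Sum>n. real n powr (-s)) \<le> C / (s - 1)"
    using dser_one_real_bound by blast
  show thesis
  proof (rule that[of C])
    show "C \<ge> 1" by fact
    fix H \<sigma> X :: real
    assume h: "H \<ge> exp 1" "3/4 \<le> \<sigma>" "\<sigma> \<le> 1" "X \<ge> 1"
    have H0: "H > 0" using h(1) exp_gt_zero[of "1::real"] by linarith
    have lH: "ln H \<ge> 1" using h H0 by (simp add: ln_ge_iff)
    define S where "S = {p::nat. prime p \<and> real p \<le> H}"
    have finS: "finite S" unfolding S_def
      by (rule finite_subset[of _ "{..nat \<lfloor>H\<rfloor>}"]) (auto simp: le_nat_floor)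
    have prS: "prime p" if "p \<in> S" for p using that by (simp add: S_def)
    have pS: "real p \<ge> 2" "real p \<le> H" if "p \<in> S" for p using that prime_ge_2_nat[of p] by (auto simp: S_def)
    define N where "N = {n::nat. n > 0 \<and> real n \<le> X \<and> (\<forall>p. prime p \<longrightarrow> p dvd n \<longrightarrow> real p \<le> H)}"
    have finN: "finite N" unfolding N_def
      by (rule finite_subset[of _ "{..nat \<lfloor>X\<rfloor>}"]) (auto simp: le_nat_floor)
    have NS: "N \<subseteq> smooth_numbers S" by (auto simp: N_def S_def smooth_numbers_def)
    have sub: "real p powr (-a) \<le> 2/3" if "p \<in> S" "a \<ge> 3/4" for p a
    proof -
      have "real p powr (-a) \<le> real p powr (-(3/4))" using that pS[of p] by (intro powr_mono) auto
      also have "\<dots> \<le> 2 powr (-(3/4))" using that pS[of p] by (intro powr_mono2') auto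
      also have "\<dots> \<le> 2/3"
      proof -
        have "(2 powr (3/4)) ^ 4 = (8::real)" by (simp add: powr_power)
        then have "(3/2) ^ 4 \<le> (2 powr (3/4) :: real) ^ 4" by (simp add: power_divide)
        then have "3/2 \<le> 2 powr (3/4::real)"
          using power_strict_mono[of "2 powr (3/4::real)" "3/2" 4] by (meson not_le powr_ge_zero zero_less_numeral)
        then show ?thesis by (simp add: powr_minus field_simps)
      qed
      finally show ?thesis .
    qed
    \<comment> \<open>At this point \<open>p powr (s - 1) \<le> exp 1\<close> for
      \<open>p \<le> H\<close>, so passing to the exponent \<open>s\<close> costs a constant, while
      zeta is only \<open>O (ln H)\<close>.\<close>
    define s where "s = 1 + 1 / ln H"
    have s: "1 < s" "s \<le> 2" using lH by (auto simp: s_def)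
    have sumS: "(\<Sum>p\<in>S. real p powr (-s)) \<le> ln (C * ln H)"
    proof -
      have hs: "((\<lambda>n. real n powr (-s)) has_sum (\<Prod>p\<in>S. 1 / (1 - real p powr (-s)))) (smooth_numbers S)"
        using s by (intro smooth_numbers_has_sum finS prS) auto
      have sm: "summable (\<lambda>n. real n powr (-s))" using s by (simp add: summable_real_powr_iff)
      then have hs2: "((\<lambda>n. real n powr (-s)) has_sum (\<Sum>n. real n powr (-s))) UNIV"
        by (intro norm_summable_imp_has_sum summable_sums) auto
      have "exp (\<Sum>p\<in>S. real p powr (-s)) = (\<Prod>p\<in>S. exp (real p powr (-s)))" by (rule exp_sum[OF finS])
      also have "\<dots> \<le> (\<Prod>p\<in>S. 1 / (1 - real p powr (-s)))"
        using sub s by (intro prod_mono conjI inverse_one_minus_bounds(2)) auto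
      also have "\<dots> \<le> (\<Sum>n. real n powr (-s))" by (rule has_sum_mono2[OF hs hs2]) auto
      also have "\<dots> \<le> C / (s - 1)" using s by (intro C(2)) auto
      also have "\<dots> = C * ln H" using lH by (simp add: s_def)
      finally have "ln (exp (\<Sum>p\<in>S. real p powr (-s))) \<le> ln (C * ln H)"
        using C(1) lH by (subst ln_le_cancel_iff) auto
      then show ?thesis by simp
    qed
    have pw: "real p powr (-\<sigma>) \<le> 3 * H powr (1 - \<sigma>) * real p powr (-s)" if p: "p \<in> S" for p
    proof -
      have "real p powr (-\<sigma>) = real p powr (s - \<sigma>) * real p powr (-s)" using pS[OF p] by (simp flip: powr_add)
      also have "real p powr (s - \<sigma>) \<le> H powr (s - \<sigma>)" using pS[OF p] s h by (intro powr_mono2) auto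
      also have "H powr (s - \<sigma>) = H powr (1 - \<sigma>) * H powr (1 / ln H)"
      proof -
        have "s - \<sigma> = (1 - \<sigma>) + 1 / ln H" by (simp add: s_def)
        then show ?thesis by (simp only: powr_add)
      qed
      also have "H powr (1 / ln H) = exp 1" using lH H0 by (auto simp: powr_def)
      also have "\<dots> \<le> (3::real)" by (rule exp_le)
      finally show ?thesis by (simp add: mult_ac mult_right_mono)
    qed
    have "(\<Sum>p\<in>S. real p powr (-\<sigma>)) \<le> (\<Sum>p\<in>S. 3 * H powr (1 - \<sigma>) * real p powr (-s))" by (intro sum_mono pw)
    also have "\<dots> = 3 * H powr (1 - \<sigma>) * (\<Sum>p\<in>S. real p powr (-s))" by (simp add: sum_distrib_left)
    also have "\<dots> \<le> 3 * H powr (1 - \<sigma>) * ln (C * ln H)" using sumS by (intro mult_left_mono) auto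
    finally have sum\<sigma>: "(\<Sum>p\<in>S. real p powr (-\<sigma>)) \<le> 3 * H powr (1 - \<sigma>) * ln (C * ln H)" .
    have hs: "((\<lambda>n. real n powr (-\<sigma>)) has_sum (\<Prod>p\<in>S. 1 / (1 - real p powr (-\<sigma>)))) (smooth_numbers S)"
      using h by (intro smooth_numbers_has_sum finS prS) auto
    have "real (card N) * X powr (-\<sigma>) = (\<Sum>n\<in>N. X powr (-\<sigma>))" by simp
    also have "\<dots> \<le> (\<Sum>n\<in>N. real n powr (-\<sigma>))"
      using h by (intro sum_mono powr_mono2') (auto simp: N_def)
    also have "\<dots> \<le> (\<Prod>p\<in>S. 1 / (1 - real p powr (-\<sigma>)))"
      by (rule has_sum_mono2[OF has_sum_finite[OF finN] hs NS]) auto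
    also have "\<dots> \<le> (\<Prod>p\<in>S. exp (3 * real p powr (-\<sigma>)))"
    proof (intro prod_mono conjI)
      fix p assume p: "p \<in> S"
      show "1 / (1 - real p powr (-\<sigma>)) \<le> exp (3 * real p powr (-\<sigma>))"
        using sub[OF p h(2)] by (intro inverse_one_minus_bounds) auto
      show "0 \<le> 1 / (1 - real p powr (-\<sigma>))" using sub[OF p h(2)] by simp
    qed
    also have "\<dots> = exp (\<Sum>p\<in>S. 3 * real p powr (-\<sigma>))" by (rule exp_sum[OF finS, symmetric])
    also have "\<dots> \<le> exp (9 * H powr (1 - \<sigma>) * ln (C * ln H))" using sum\<sigma> by (simp add: mult_ac flip: sum_distrib_left)
    finally have "real (card N) * X powr (-\<sigma>) * X powr \<sigma> \<le> exp (9 * H powr (1 - \<sigma>) * ln (C * ln H)) * X powr \<sigma>"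
      by (intro mult_right_mono) auto
    then have "real (card N) * (X powr (-\<sigma>) * X powr \<sigma>) \<le> exp (9 * H powr (1 - \<sigma>) * ln (C * ln H)) * X powr \<sigma>"
      by (simp only: mult.assoc)
    moreover have "X powr (-\<sigma>) * X powr \<sigma> = 1" using h by (simp flip: powr_add)
    ultimately show "real (card {n::nat. n > 0 \<and> real n \<le> X \<and> (\<forall>p. prime p \<longrightarrow> p dvd n \<longrightarrow> real p \<le> H)})
       \<le> X powr \<sigma> * exp (9 * H powr (1 - \<sigma>) * ln (C * ln H))"
      unfolding N_def by (simp only: mult_1_right mult.commute)
  qed
qed

section \<open>Mean squares of bilinear sums\<close>

text \<open>Scaling by \<open>\<delta> / \<Delta>\<close> makes the long window no worse than the
  short one: its mean square is of order
  \<open>\<delta>\<^sup>2 * B + \<delta>\<^sup>2 / \<Delta>\<close> per element, and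
  \<open>\<delta> \<le> \<Delta>\<close>.\<close>

lemma window_win_bound:
  fixes b :: "nat \<Rightarrow> real"
  assumes N: "finite N" "\<And>m. m \<in> N \<Longrightarrow> 0 < m \<and> real m \<le> B" and b: "\<And>m. m \<in> N \<Longrightarrow> \<bar>b m\<bar> \<le> 1"
    and \<delta>: "0 < \<delta>" "\<delta> \<le> \<Delta>" "\<Delta> \<le> 1" and B: "B \<ge> 0"
  shows "integral\<^sup>L lborel (\<lambda>v. (\<Sum>m\<in>N. b m * win \<delta> \<Delta> (ln (real m) - v))\<^sup>2) \<le> 4 * \<delta> * (2 * \<delta> * B + 1) * real (card N)"
proof -
  have \<Delta>: "0 < \<Delta>" using \<delta> by simp
  define G where "G = (\<lambda>d v. (\<Sum>m\<in>N. b m * of_bool (0 < ln (real m) - v \<and> ln (real m) - v \<le> d)))"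
  have eq: "(\<Sum>m\<in>N. b m * win \<delta> \<Delta> (ln (real m) - v)) = G \<delta> v - \<delta> / \<Delta> * G \<Delta> v" for v
    by (simp add: G_def win_def right_diff_distrib sum_subtractf sum_distrib_left mult_ac)
  have g: "integrable lborel (\<lambda>v. (G d v)\<^sup>2)" "integral\<^sup>L lborel (\<lambda>v. (G d v)\<^sup>2) \<le> (2 * d * B + 1) * (d * real (card N))" if "0 < d" "d \<le> 1" for d
    unfolding G_def by (rule window_l2_bound[OF N b that B]; assumption)+
  have hb: "has_bochner_integral lborel (\<lambda>v. 2 * (G \<delta> v)\<^sup>2 + 2 * (\<delta> / \<Delta>)\<^sup>2 * (G \<Delta> v)\<^sup>2)
     (2 * integral\<^sup>L lborel (\<lambda>v. (G \<delta> v)\<^sup>2) + 2 * (\<delta> / \<Delta>)\<^sup>2 * integral\<^sup>L lborel (\<lambda>v. (G \<Delta> v)\<^sup>2))"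
    using g[of \<delta>] g[of \<Delta>] \<delta> \<Delta> by (intro has_bochner_integral_add has_bochner_integral_mult_right) (auto simp: has_bochner_integral_iff)
  obtain J where J: "has_bochner_integral lborel (\<lambda>v. (\<Sum>m\<in>N. b m * win \<delta> \<Delta> (ln (real m) - v))\<^sup>2) J"
    using win_plancherel[OF N(1) \<delta>(1) \<Delta>, of b "\<lambda>m. ln (real m)"] by blast
  have "integral\<^sup>L lborel (\<lambda>v. (\<Sum>m\<in>N. b m * win \<delta> \<Delta> (ln (real m) - v))\<^sup>2) \<le> integral\<^sup>L lborel (\<lambda>v. 2 * (G \<delta> v)\<^sup>2 + 2 * (\<delta> / \<Delta>)\<^sup>2 * (G \<Delta> v)\<^sup>2)"
  proof (rule integral_mono)
    show "integrable lborel (\<lambda>v. (\<Sum>m\<in>N. b m * win \<delta> \<Delta> (ln (real m) - v))\<^sup>2)" using J by (simp add: has_bochner_integral_iff)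
    show "integrable lborel (\<lambda>v. 2 * (G \<delta> v)\<^sup>2 + 2 * (\<delta> / \<Delta>)\<^sup>2 * (G \<Delta> v)\<^sup>2)" using hb by (rule integrable.intros)
    fix v
    have "(x - a * y)\<^sup>2 \<le> 2 * x\<^sup>2 + 2 * a\<^sup>2 * y\<^sup>2" for x a y :: real
      using zero_le_power2[of "x + a * y"] by (simp add: power2_eq_square algebra_simps)
    then show "(\<Sum>m\<in>N. b m * win \<delta> \<Delta> (ln (real m) - v))\<^sup>2 \<le> 2 * (G \<delta> v)\<^sup>2 + 2 * (\<delta> / \<Delta>)\<^sup>2 * (G \<Delta> v)\<^sup>2"
      unfolding eq .
  qed
  also have "\<dots> = 2 * integral\<^sup>L lborel (\<lambda>v. (G \<delta> v)\<^sup>2) + 2 * (\<delta> / \<Delta>)\<^sup>2 * integral\<^sup>L lborel (\<lambda>v. (G \<Delta> v)\<^sup>2)"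
    using hb by (rule has_bochner_integral_integral_eq)
  also have "\<dots> \<le> 2 * ((2 * \<delta> * B + 1) * (\<delta> * real (card N))) + 2 * (\<delta> / \<Delta>)\<^sup>2 * ((2 * \<Delta> * B + 1) * (\<Delta> * real (card N)))"
    using g[of \<delta>] g[of \<Delta>] \<delta> \<Delta> by (intro add_mono mult_left_mono) auto
  also have "\<dots> = (4 * \<delta>\<^sup>2 * B + 2 * \<delta> + (4 * \<delta>\<^sup>2 * B + 2 * \<delta> * (\<delta> / \<Delta>))) * real (card N)"
    using \<Delta> by (simp add: power2_eq_square field_simps)
  also have "\<dots> \<le> (4 * \<delta>\<^sup>2 * B + 2 * \<delta> + (4 * \<delta>\<^sup>2 * B + 2 * \<delta> * 1)) * real (card N)"
    using \<delta> \<Delta> by (intro mult_right_mono add_mono mult_left_mono) auto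
  also have "\<dots> = 4 * \<delta> * (2 * \<delta> * B + 1) * real (card N)" by (simp add: power2_eq_square algebra_simps)
  finally show ?thesis .
qed

text \<open>The first bound interpolates between \<open>4 * \<delta>\<^sup>2\<close> and
  \<open>\<delta>\<^sup>2 * (\<Delta> * t)\<^sup>2\<close>. The exponent 1/4 gains
  \<open>\<Delta> powr (1/4)\<close> at a cost that the squared pole term, of decay 3/2, can afford.
  The second bound serves large \<open>t\<close>, where one part of the quadratic decay yields a
  small constant and the rest remains integrable.\<close>

lemma win_ker_weight_bounds:
  assumes \<delta>: "0 < \<delta>" "\<delta> \<le> \<Delta>"
  defines "W \<equiv> \<lambda>t. (norm (win_ker \<delta> \<Delta> t))\<^sup>2 / t\<^sup>2"
  shows "W t \<le> 4 * \<delta>\<^sup>2 * \<Delta> powr (1/4) * (1 + \<bar>t\<bar>) powr (1/4)"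
    and "\<bar>t\<bar> \<ge> T \<Longrightarrow> T \<ge> 1 \<Longrightarrow> W t \<le> 64 * (1 + T) powr (-(3/4)) * (1 + \<bar>t\<bar>) powr (-(5/4))"
proof -
  have \<Delta>: "\<Delta> > 0" using \<delta> by simp
  show "W t \<le> 4 * \<delta>\<^sup>2 * \<Delta> powr (1/4) * (1 + \<bar>t\<bar>) powr (1/4)"
  proof (cases "t = 0")
    case False
    have 1: "W t \<le> 4 * \<delta>\<^sup>2"
    proof -
      have "(norm (win_ker \<delta> \<Delta> t))\<^sup>2 \<le> (2 * \<delta> * \<bar>t\<bar>)\<^sup>2" by (intro power_mono win_ker_bounds \<delta>) auto
      then show ?thesis using False by (simp add: W_def power_mult_distrib divide_le_eq)
    qed
    have 2: "W t \<le> \<delta>\<^sup>2 * (\<Delta> * \<bar>t\<bar>)\<^sup>2"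
    proof -
      have "(norm (win_ker \<delta> \<Delta> t))\<^sup>2 \<le> (\<delta> * \<Delta> * t\<^sup>2)\<^sup>2" by (intro power_mono win_ker_bounds \<delta>) auto
      also have "\<dots> = \<delta>\<^sup>2 * (\<Delta> * \<bar>t\<bar>)\<^sup>2 * t\<^sup>2" by (simp add: power2_eq_square)
      finally show ?thesis using False by (simp add: W_def divide_le_eq)
    qed
    define x where "x = \<Delta> * \<bar>t\<bar>"
    have x0: "x > 0" using \<Delta> False by (simp add: x_def)
    have A: "W t \<le> \<delta>\<^sup>2 * (4 * x powr (1/4))"
    proof (cases "x \<le> 1")
      case True
      have "x\<^sup>2 = x powr 2" using x0 by (simp add: powr_numeral)
      also have "\<dots> \<le> x powr (1/4)" using True x0 by (intro powr_mono') auto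
      also have "\<dots> \<le> 4 * x powr (1/4)" by simp
      finally have "\<delta>\<^sup>2 * x\<^sup>2 \<le> \<delta>\<^sup>2 * (4 * x powr (1/4))" by (intro mult_left_mono) auto
      then show ?thesis using 2 by (simp add: x_def)
    next
      case False
      then have "1 \<le> x powr (1/4)" by (intro ge_one_powr_ge_zero) auto
      then have "\<delta>\<^sup>2 * 4 \<le> \<delta>\<^sup>2 * (4 * x powr (1/4))" by (intro mult_left_mono) auto
      then show ?thesis using 1 by simp
    qed
    have "x powr (1/4) \<le> \<Delta> powr (1/4) * (1 + \<bar>t\<bar>) powr (1/4)"
      unfolding x_def powr_mult by (intro mult_left_mono powr_mono2) auto
    then have "\<delta>\<^sup>2 * (4 * x powr (1/4)) \<le> \<delta>\<^sup>2 * (4 * (\<Delta> powr (1/4) * (1 + \<bar>t\<bar>) powr (1/4)))"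
      by (intro mult_left_mono) auto
    with A show ?thesis by (simp add: mult_ac)
  qed (simp add: W_def)
  assume t: "\<bar>t\<bar> \<ge> T" "T \<ge> 1"
  have "(norm (win_ker \<delta> \<Delta> t))\<^sup>2 \<le> 4\<^sup>2" by (intro power_mono win_ker_bounds \<delta>) auto
  then have "W t \<le> 16 / t\<^sup>2" unfolding W_def by (intro divide_right_mono) auto
  also have "\<dots> \<le> 16 / ((1 + \<bar>t\<bar>) / 2)\<^sup>2"
  proof (intro divide_left_mono)
    have "((1 + \<bar>t\<bar>) / 2)\<^sup>2 \<le> \<bar>t\<bar>\<^sup>2" using t by (intro power_mono) auto
    then show "((1 + \<bar>t\<bar>) / 2)\<^sup>2 \<le> t\<^sup>2" by simp
    have "t \<noteq> 0" "1 + \<bar>t\<bar> \<noteq> 0" using t by auto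
    then show "0 < t\<^sup>2 * ((1 + \<bar>t\<bar>) / 2)\<^sup>2" by (simp add: zero_less_mult_iff)
  qed auto
  also have "\<dots> = 64 * (1 + \<bar>t\<bar>) powr (-2)"
  proof -
    have "16 / (x / 2)\<^sup>2 = 64 * x powr (-2)" if "x > 0" for x :: real
      using that by (simp add: powr_minus_divide powr_numeral power_divide)
    then show ?thesis using t by simp
  qed
  finally have A: "W t \<le> 64 * (1 + \<bar>t\<bar>) powr (-2)" .
  have "(1 + \<bar>t\<bar>) powr (-(3/4)) \<le> (1 + T) powr (-(3/4))" using t by (intro powr_mono2') auto
  then have "(1 + \<bar>t\<bar>) powr (-(3/4)) * (1 + \<bar>t\<bar>) powr (-(5/4)) \<le> (1 + T) powr (-(3/4)) * (1 + \<bar>t\<bar>) powr (-(5/4))"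
    by (intro mult_right_mono) auto
  moreover have "(1 + \<bar>t\<bar>) powr (-(3/4)) * (1 + \<bar>t\<bar>) powr (-(5/4)) = (1 + \<bar>t\<bar>) powr (-2)" by (simp flip: powr_add)
  ultimately show "W t \<le> 64 * (1 + T) powr (-(3/4)) * (1 + \<bar>t\<bar>) powr (-(5/4))" using A by linarith
qed

lemma weighted_cauchy_schwarz:
  fixes \<beta> e x :: "'i \<Rightarrow> real"
  assumes "\<And>i. i \<in> I \<Longrightarrow> \<beta> i \<ge> 0" "\<And>i. i \<in> I \<Longrightarrow> e i > 0"
  shows "(\<Sum>i\<in>I. \<beta> i * x i)\<^sup>2 \<le> (\<Sum>i\<in>I. \<beta> i / e i) * (\<Sum>i\<in>I. \<beta> i * e i * (x i)\<^sup>2)"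
proof -
  have "(\<Sum>i\<in>I. \<beta> i * x i) = (\<Sum>i\<in>I. sqrt (\<beta> i / e i) * (sqrt (\<beta> i * e i) * x i))"
  proof (intro sum.cong refl)
    fix i assume i: "i \<in> I"
    have "sqrt (\<beta> i / e i) * sqrt (\<beta> i * e i) = sqrt (\<beta> i * \<beta> i)"
      using assms(2)[OF i] by (simp flip: real_sqrt_mult)
    also have "\<dots> = \<beta> i" using assms(1)[OF i] by simp
    finally show "\<beta> i * x i = sqrt (\<beta> i / e i) * (sqrt (\<beta> i * e i) * x i)" by (simp add: mult.assoc[symmetric])
  qed
  also have "\<dots>\<^sup>2 \<le> (\<Sum>i\<in>I. (sqrt (\<beta> i / e i))\<^sup>2) * (\<Sum>i\<in>I. (sqrt (\<beta> i * e i) * x i)\<^sup>2)"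
    by (rule Cauchy_Schwarz_ineq_sum)
  also have "(\<Sum>i\<in>I. (sqrt (\<beta> i / e i))\<^sup>2) = (\<Sum>i\<in>I. \<beta> i / e i)"
    using assms by (intro sum.cong refl) (simp add: less_imp_le)
  also have "(\<Sum>i\<in>I. (sqrt (\<beta> i * e i) * x i)\<^sup>2) = (\<Sum>i\<in>I. \<beta> i * e i * (x i)\<^sup>2)"
    using assms by (intro sum.cong refl) (simp add: less_imp_le power_mult_distrib)
  finally show ?thesis .
qed

text \<open>The mean square of a bilinear sum: a pointwise bound for the polynomials \<open>P i\<close> is combined
  with the mean value of the polynomials \<open>M i\<close>, the latter being evaluated in physical space.\<close>
lemma bilinear_l2_bound:
  fixes I :: "'i set" and y \<beta> \<mu> :: "'i \<Rightarrow> real" and h :: "'i \<Rightarrow> nat \<Rightarrow> real" and b :: "nat \<Rightarrow> real"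
  assumes fin: "finite I" "finite Q"
    and \<delta>: "0 < \<delta>" "\<delta> \<le> \<Delta>" "\<Delta> \<le> 1" and T: "T \<ge> 1" and Y: "Y \<ge> 0"
    and b: "\<And>m. \<bar>b m\<bar> \<le> 1"
  defines "B \<equiv> \<lambda>i. Y * exp (- y i)"
  defines "N \<equiv> \<lambda>i. {m::nat. m > 0 \<and> real m \<le> B i}"
  defines "P \<equiv> \<lambda>i t. \<Sum>p\<in>Q. of_real (h i p) * cis (t * ln (real p))"
  assumes pos: "\<And>i. i \<in> I \<Longrightarrow> \<beta> i \<ge> 0" "\<And>i. i \<in> I \<Longrightarrow> \<mu> i \<ge> 0"
    and bd: "\<And>i t. i \<in> I \<Longrightarrow> \<bar>t\<bar> \<le> T \<Longrightarrow> norm (P i t) \<le> \<beta> i + \<mu> i * (1 + \<bar>t\<bar>) powr (-(3/4))"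
    and triv: "\<And>i t. i \<in> I \<Longrightarrow> norm (P i t) * B i \<le> \<tau>"
    and L: "\<And>i. i \<in> I \<Longrightarrow> 2 * \<delta> * B i \<le> L"
  shows "integral\<^sup>L lborel (\<lambda>v. (\<Sum>(i,p,m)\<in>Sigma I (\<lambda>i. Q \<times> N i). h i p * b m * win \<delta> \<Delta> (ln (real p) + ln (real m) - v))\<^sup>2)
    \<le> 8 * (L + 1) * \<delta> * Y * (\<Sum>i\<in>I. \<beta> i / exp (y i / 2))\<^sup>2
      + 16 * \<delta>\<^sup>2 * \<Delta> powr (1/4) * (\<Sum>i\<in>I. \<mu> i * B i)\<^sup>2 + 128 * (real (card I) * \<tau>)\<^sup>2 * (1 + T) powr (-(3/4))"
    and "integrable lborel (\<lambda>v. (\<Sum>(i,p,m)\<in>Sigma I (\<lambda>i. Q \<times> N i). h i p * b m * win \<delta> \<Delta> (ln (real p) + ln (real m) - v))\<^sup>2)"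
proof -
  have \<Delta>0: "\<Delta> > 0" using \<delta> by simp
  have B0: "B i \<ge> 0" for i using Y by (simp add: B_def)
  have finN: "finite (N i)" for i
    unfolding N_def by (rule finite_subset[of _ "{..nat \<lfloor>B i\<rfloor>}"]) (auto simp: le_nat_floor)
  have cardN: "real (card (N i)) \<le> B i" for i
  proof -
    have "N i \<subseteq> {1..nat \<lfloor>B i\<rfloor>}" by (auto simp: N_def le_nat_floor)
    then have "card (N i) \<le> nat \<lfloor>B i\<rfloor>" using card_mono[of "{1..nat \<lfloor>B i\<rfloor>}" "N i"] by simp
    then have "real (card (N i)) \<le> real (nat \<lfloor>B i\<rfloor>)" by (simp only: of_nat_le_iff)
    also have "\<dots> \<le> B i" by (rule of_nat_floor[OF B0])
    finally show ?thesis .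
  qed
  define M where "M = (\<lambda>i t. \<Sum>m\<in>N i. of_real (b m) * cis (t * ln (real m)))"
  have normM: "norm (M i t) \<le> B i" for i t
  proof -
    have "norm (M i t) \<le> (\<Sum>m\<in>N i. 1)" unfolding M_def
      by (rule sum_norm_le) (use b in \<open>simp add: norm_mult\<close>)
    then show ?thesis using cardN[of i] by simp
  qed
  define W where "W = (\<lambda>t. (norm (win_ker \<delta> \<Delta> t))\<^sup>2 / t\<^sup>2)"
  have W0: "W t \<ge> 0" for t by (simp add: W_def)
  define K where "K = Sigma I (\<lambda>i. Q \<times> N i)"
  define c x where "c = (\<lambda>(i,p,m). h i p * b m)" and "x = (\<lambda>(i::'i,p::nat,m::nat). ln (real p) + ln (real m))"
  have finK: "finite K" unfolding K_def using fin finN by auto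
  have fact: "(\<Sum>k\<in>K. of_real (c k) * cis (t * x k)) = (\<Sum>i\<in>I. P i t * M i t)" for t
  proof -
    have "(\<Sum>k\<in>K. of_real (c k) * cis (t * x k)) = (\<Sum>i\<in>I. \<Sum>k\<in>Q \<times> N i. of_real (c (i,k)) * cis (t * x (i,k)))"
      unfolding K_def using fin finN by (subst sum.Sigma) auto
    also have "\<dots> = (\<Sum>i\<in>I. P i t * M i t)"
    proof (intro sum.cong refl)
      fix i
      have "(\<Sum>k\<in>Q \<times> N i. of_real (c (i,k)) * cis (t * x (i,k))) = (\<Sum>(p,m)\<in>Q \<times> N i. (of_real (h i p) * cis (t * ln (real p))) * (of_real (b m) * cis (t * ln (real m))))"
        by (intro sum.cong refl) (auto simp: c_def x_def distrib_left cis_mult[symmetric] mult_ac)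
      also have "\<dots> = P i t * M i t" unfolding P_def M_def sum_product sum.cartesian_product ..
      finally show "(\<Sum>k\<in>Q \<times> N i. of_real (c (i,k)) * cis (t * x (i,k))) = P i t * M i t" .
    qed
    finally show ?thesis .
  qed
  obtain J where J: "has_bochner_integral lborel (\<lambda>v. (\<Sum>k\<in>K. c k * win \<delta> \<Delta> (x k - v))\<^sup>2) J"
    "has_bochner_integral lborel (\<lambda>t. (norm (\<Sum>k\<in>K. of_real (c k) * cis (t * x k)))\<^sup>2 * (norm (win_ker \<delta> \<Delta> t))\<^sup>2 / t\<^sup>2) (2 * pi * J)"
    using win_plancherel[OF finK \<delta>(1) \<Delta>0, of c x] by blast
  have J2: "has_bochner_integral lborel (\<lambda>t. (norm (\<Sum>i\<in>I. P i t * M i t))\<^sup>2 * W t) (2 * pi * J)"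
    using J(2) unfolding fact W_def by simp
  have "\<exists>j. has_bochner_integral lborel (\<lambda>t. (norm (M i t))\<^sup>2 * W t) (2 * pi * j) \<and> j \<le> 4 * \<delta> * (L + 1) * B i" if i: "i \<in> I" for i
  proof -
    obtain j where j: "has_bochner_integral lborel (\<lambda>v. (\<Sum>m\<in>N i. b m * win \<delta> \<Delta> (ln (real m) - v))\<^sup>2) j"
      "has_bochner_integral lborel (\<lambda>t. (norm (\<Sum>m\<in>N i. of_real (b m) * cis (t * ln (real m))))\<^sup>2 * (norm (win_ker \<delta> \<Delta> t))\<^sup>2 / t\<^sup>2) (2 * pi * j)"
      using win_plancherel[OF finN[of i] \<delta>(1) \<Delta>0, of b "\<lambda>m. ln (real m)"] by blast
    have "j = integral\<^sup>L lborel (\<lambda>v. (\<Sum>m\<in>N i. b m * win \<delta> \<Delta> (ln (real m) - v))\<^sup>2)" using j(1) by (simp add: has_bochner_integral_iff)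
    also have "\<dots> \<le> 4 * \<delta> * (2 * \<delta> * B i + 1) * real (card (N i))"
      by (rule window_win_bound[OF finN _ b \<delta> B0]) (simp add: N_def)
    also have "\<dots> \<le> 4 * \<delta> * (L + 1) * B i"
    proof -
      have "0 \<le> 2 * \<delta> * B i" using \<delta> B0[of i] by simp
      then have "0 \<le> L" using L[OF i] by linarith
      then show ?thesis using L[OF i] \<delta> B0[of i] cardN[of i] by (intro mult_mono mult_left_mono) auto
    qed
    finally have "j \<le> 4 * \<delta> * (L + 1) * B i" .
    moreover have "has_bochner_integral lborel (\<lambda>t. (norm (M i t))\<^sup>2 * W t) (2 * pi * j)"
      using j(2) unfolding M_def W_def by simp
    ultimately show ?thesis by blast
  qed
  then have "\<forall>i. \<exists>j. i \<in> I \<longrightarrow> has_bochner_integral lborel (\<lambda>t. (norm (M i t))\<^sup>2 * W t) (2 * pi * j) \<and> j \<le> 4 * \<delta> * (L + 1) * B i"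
    by blast
  from choice[OF this] obtain j where j: "\<And>i. i \<in> I \<Longrightarrow> has_bochner_integral lborel (\<lambda>t. (norm (M i t))\<^sup>2 * W t) (2 * pi * j i)"
    "\<And>i. i \<in> I \<Longrightarrow> j i \<le> 4 * \<delta> * (L + 1) * B i" by blast
  \<comment> \<open>The Cauchy--Schwarz weights are \<open>exp (y i / 2)\<close>. The mean value of
    \<open>M i\<close> is proportional to \<open>exp (- y i)\<close>, so that after integration both
    factors are this same sum \<open>S\<close>.\<close>
  define S where "S = (\<Sum>i\<in>I. \<beta> i / exp (y i / 2))"
  have S0: "S \<ge> 0" unfolding S_def using pos by (intro sum_nonneg) auto
  define D where "D = (\<Sum>i\<in>I. \<mu> i * B i)"
  have D0: "D \<ge> 0" unfolding D_def using pos B0 by (intro sum_nonneg) auto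
  define q where "q = (\<lambda>t::real. (1 + \<bar>t\<bar>) powr (-(5/4)))"
  \<comment> \<open>\<open>E1\<close> comes from the pole terms for
    \<open>\<bar>t\<bar> \<le> T\<close>, and \<open>E2\<close> from the range
    \<open>\<bar>t\<bar> > T\<close>, where only the trivial bound \<open>\<tau>\<close> is used;
    both multiply the same integrable function \<open>q\<close>.\<close>
  define E1 where "E1 = 8 * \<delta>\<^sup>2 * \<Delta> powr (1/4) * D\<^sup>2"
  define E2 where "E2 = 64 * (real (card I) * \<tau>)\<^sup>2 * (1 + T) powr (-(3/4))"
  have E0: "E1 \<ge> 0" "E2 \<ge> 0" by (auto simp: E1_def E2_def)
  have q0: "q t \<ge> 0" for t by (simp add: q_def)
  define R where "R = (\<lambda>t. 2 * S * (\<Sum>i\<in>I. \<beta> i * exp (y i / 2) * ((norm (M i t))\<^sup>2 * W t)) + (E1 + E2) * q t)"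
  have hbR: "has_bochner_integral lborel R (2 * S * (\<Sum>i\<in>I. \<beta> i * exp (y i / 2) * (2 * pi * j i)) + (E1 + E2) * (2 / (5/4 - 1)))"
    unfolding R_def q_def
    by (intro has_bochner_integral_add has_bochner_integral_mult_right has_bochner_integral_sum has_bochner_integral_decay j) auto
  have sumM0: "0 \<le> (\<Sum>i\<in>I. \<beta> i * exp (y i / 2) * ((norm (M i t))\<^sup>2 * W t))" for t
    using pos W0 by (intro sum_nonneg) auto
  have ptw: "(norm (\<Sum>i\<in>I. P i t * M i t))\<^sup>2 * W t \<le> R t" for t
  proof (cases "\<bar>t\<bar> \<le> T")
    case True
    have "norm (\<Sum>i\<in>I. P i t * M i t) \<le> (\<Sum>i\<in>I. \<beta> i * norm (M i t) + \<mu> i * B i * (1 + \<bar>t\<bar>) powr (-(3/4)))"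
    proof (rule sum_norm_le)
      fix i assume i: "i \<in> I"
      have "norm (P i t * M i t) \<le> (\<beta> i + \<mu> i * (1 + \<bar>t\<bar>) powr (-(3/4))) * norm (M i t)"
        unfolding norm_mult using bd[OF i True] by (intro mult_right_mono) auto
      also have "\<dots> \<le> \<beta> i * norm (M i t) + (\<mu> i * (1 + \<bar>t\<bar>) powr (-(3/4))) * B i"
        using normM[of i t] pos[OF i] by (simp add: distrib_right mult_left_mono)
      finally show "norm (P i t * M i t) \<le> \<beta> i * norm (M i t) + \<mu> i * B i * (1 + \<bar>t\<bar>) powr (-(3/4))" by (simp add: mult_ac)
    qed
    also have "\<dots> = (\<Sum>i\<in>I. \<beta> i * norm (M i t)) + D * (1 + \<bar>t\<bar>) powr (-(3/4))"
      by (simp add: sum.distrib D_def sum_distrib_right)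
    finally have "(norm (\<Sum>i\<in>I. P i t * M i t))\<^sup>2 \<le> ((\<Sum>i\<in>I. \<beta> i * norm (M i t)) + D * (1 + \<bar>t\<bar>) powr (-(3/4)))\<^sup>2"
      by (intro power_mono) auto
    also have "\<dots> \<le> 2 * (\<Sum>i\<in>I. \<beta> i * norm (M i t))\<^sup>2 + 2 * (D * (1 + \<bar>t\<bar>) powr (-(3/4)))\<^sup>2"
    proof -
      have "(a + d)\<^sup>2 \<le> 2 * a\<^sup>2 + 2 * d\<^sup>2" for a d :: real
        using zero_le_power2[of "a - d"] by (simp add: power2_eq_square algebra_simps)
      then show ?thesis .
    qed
    also have "2 * (\<Sum>i\<in>I. \<beta> i * norm (M i t))\<^sup>2 \<le> 2 * (S * (\<Sum>i\<in>I. \<beta> i * exp (y i / 2) * (norm (M i t))\<^sup>2))"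
      unfolding S_def using pos by (intro mult_left_mono weighted_cauchy_schwarz) auto
    also have "(D * (1 + \<bar>t\<bar>) powr (-(3/4)))\<^sup>2 = D\<^sup>2 * (1 + \<bar>t\<bar>) powr (-(3/2))"
      by (simp add: power_mult_distrib power2_eq_square flip: powr_add)
    finally have "(norm (\<Sum>i\<in>I. P i t * M i t))\<^sup>2 * W t \<le>
       (2 * (S * (\<Sum>i\<in>I. \<beta> i * exp (y i / 2) * (norm (M i t))\<^sup>2)) + 2 * (D\<^sup>2 * (1 + \<bar>t\<bar>) powr (-(3/2)))) * W t"
      using W0 by (intro mult_right_mono) auto
    also have "\<dots> = 2 * S * (\<Sum>i\<in>I. \<beta> i * exp (y i / 2) * ((norm (M i t))\<^sup>2 * W t)) + 2 * D\<^sup>2 * (1 + \<bar>t\<bar>) powr (-(3/2)) * W t"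
    proof -
      have "(\<Sum>i\<in>I. \<beta> i * exp (y i / 2) * (norm (M i t))\<^sup>2) * W t = (\<Sum>i\<in>I. \<beta> i * exp (y i / 2) * ((norm (M i t))\<^sup>2 * W t))"
        by (simp add: sum_distrib_right mult.assoc)
      from this[symmetric] show ?thesis by (simp only:) (simp add: distrib_right)
    qed
    also have "\<dots> \<le> 2 * S * (\<Sum>i\<in>I. \<beta> i * exp (y i / 2) * ((norm (M i t))\<^sup>2 * W t)) + E1 * q t"
    proof (intro add_left_mono)
      have "2 * D\<^sup>2 * (1 + \<bar>t\<bar>) powr (-(3/2)) * W t \<le> 2 * D\<^sup>2 * (1 + \<bar>t\<bar>) powr (-(3/2)) * (4 * \<delta>\<^sup>2 * \<Delta> powr (1/4) * (1 + \<bar>t\<bar>) powr (1/4))"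
        unfolding W_def by (intro mult_left_mono win_ker_weight_bounds \<delta>) auto
      also have "\<dots> = E1 * ((1 + \<bar>t\<bar>) powr (-(3/2)) * (1 + \<bar>t\<bar>) powr (1/4))" by (simp add: E1_def mult_ac)
      also have "(1 + \<bar>t\<bar>) powr (-(3/2)) * (1 + \<bar>t\<bar>) powr (1/4) = q t" by (simp add: q_def flip: powr_add)
      finally show "2 * D\<^sup>2 * (1 + \<bar>t\<bar>) powr (-(3/2)) * W t \<le> E1 * q t" .
    qed
    also have "\<dots> \<le> R t" using E0 q0[of t] by (simp add: R_def distrib_right)
    finally show ?thesis .
  next
    case False
    have "norm (\<Sum>i\<in>I. P i t * M i t) \<le> (\<Sum>i\<in>I. \<tau>)"
    proof (rule sum_norm_le)
      fix i assume i: "i \<in> I"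
      have "norm (P i t * M i t) \<le> norm (P i t) * B i" unfolding norm_mult by (intro mult_left_mono normM) auto
      then show "norm (P i t * M i t) \<le> \<tau>" using triv[OF i, of t] by linarith
    qed
    then have "norm (\<Sum>i\<in>I. P i t * M i t) \<le> real (card I) * \<tau>" by simp
    then have "(norm (\<Sum>i\<in>I. P i t * M i t))\<^sup>2 \<le> (real (card I) * \<tau>)\<^sup>2" by (intro power_mono) auto
    then have "(norm (\<Sum>i\<in>I. P i t * M i t))\<^sup>2 * W t \<le> (real (card I) * \<tau>)\<^sup>2 * (64 * (1 + T) powr (-(3/4)) * (1 + \<bar>t\<bar>) powr (-(5/4)))"
      unfolding W_def using False T by (intro mult_mono win_ker_weight_bounds(2) \<delta>) auto
    also have "\<dots> = E2 * q t" by (simp add: E2_def q_def mult_ac)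
    also have "\<dots> \<le> R t" using S0 sumM0[of t] E0 q0[of t] by (simp add: R_def distrib_right)
    finally show ?thesis .
  qed
  have "2 * pi * J = integral\<^sup>L lborel (\<lambda>t. (norm (\<Sum>i\<in>I. P i t * M i t))\<^sup>2 * W t)" using J2 by (simp add: has_bochner_integral_iff)
  also have "\<dots> \<le> integral\<^sup>L lborel R"
    using J2 hbR ptw by (intro integral_mono) (auto simp: has_bochner_integral_iff)
  also have "\<dots> = 2 * S * (\<Sum>i\<in>I. \<beta> i * exp (y i / 2) * (2 * pi * j i)) + (E1 + E2) * (2 / (5/4 - 1))"
    using hbR by (rule has_bochner_integral_integral_eq)
  also have "\<dots> = 2 * pi * (2 * S * (\<Sum>i\<in>I. \<beta> i * exp (y i / 2) * j i)) + (E1 + E2) * 8"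
    by (simp add: sum_distrib_left mult_ac)
  also have "\<dots> \<le> 2 * pi * (2 * S * (4 * \<delta> * (L + 1) * Y * S)) + (E1 + E2) * (2 * pi * 2)"
  proof (intro add_mono mult_left_mono)
    have "(\<Sum>i\<in>I. \<beta> i * exp (y i / 2) * j i) \<le> (\<Sum>i\<in>I. \<beta> i * exp (y i / 2) * (4 * \<delta> * (L + 1) * B i))"
      using pos j(2) by (intro sum_mono mult_left_mono) auto
    also have "\<dots> = (\<Sum>i\<in>I. 4 * \<delta> * (L + 1) * Y * (\<beta> i / exp (y i / 2)))"
    proof (intro sum.cong refl)
      fix i
      have "exp (y i / 2) * exp (- y i) = 1 / exp (y i / 2)" 
      proof -
        have "exp (y i / 2) * exp (- y i) = exp (- (y i / 2))" by (simp flip: exp_add)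
        also have "\<dots> = 1 / exp (y i / 2)" by (simp only: exp_minus inverse_eq_divide)
        finally show ?thesis .
      qed
      then show "\<beta> i * exp (y i / 2) * (4 * \<delta> * (L + 1) * B i) = 4 * \<delta> * (L + 1) * Y * (\<beta> i / exp (y i / 2))"
      proof -
        note e = \<open>exp (y i / 2) * exp (- y i) = 1 / exp (y i / 2)\<close>
        have "\<beta> i * exp (y i / 2) * (4 * \<delta> * (L + 1) * B i) = (4 * \<delta> * (L + 1) * Y * \<beta> i) * (exp (y i / 2) * exp (- y i))"
          unfolding B_def by (simp only: mult_ac)
        also have "\<dots> = 4 * \<delta> * (L + 1) * Y * (\<beta> i / exp (y i / 2))" unfolding e by simp
        finally show ?thesis .
      qed
    qed
    also have "\<dots> = 4 * \<delta> * (L + 1) * Y * S" by (simp add: S_def sum_distrib_left)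
    finally show "(\<Sum>i\<in>I. \<beta> i * exp (y i / 2) * j i) \<le> 4 * \<delta> * (L + 1) * Y * S" .
    show "8 \<le> 2 * pi * 2" using pi_ge_two by simp
  qed (use S0 E0 in auto)
  also have "\<dots> = 2 * pi * (8 * (L + 1) * \<delta> * Y * S\<^sup>2 + 2 * (E1 + E2))" by (simp add: power2_eq_square algebra_simps)
  finally have JJ: "J \<le> 8 * (L + 1) * \<delta> * Y * S\<^sup>2 + 2 * (E1 + E2)" using pi_gt_zero by (simp add: mult_le_cancel_left)
  have eqK: "(\<Sum>(i,p,m)\<in>Sigma I (\<lambda>i. Q \<times> N i). h i p * b m * win \<delta> \<Delta> (ln (real p) + ln (real m) - v)) = (\<Sum>k\<in>K. c k * win \<delta> \<Delta> (x k - v))" for v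
    unfolding K_def by (intro sum.cong refl) (auto simp: c_def x_def)
  show "integral\<^sup>L lborel (\<lambda>v. (\<Sum>(i,p,m)\<in>Sigma I (\<lambda>i. Q \<times> N i). h i p * b m * win \<delta> \<Delta> (ln (real p) + ln (real m) - v))\<^sup>2)
    \<le> 8 * (L + 1) * \<delta> * Y * (\<Sum>i\<in>I. \<beta> i / exp (y i / 2))\<^sup>2
      + 16 * \<delta>\<^sup>2 * \<Delta> powr (1/4) * (\<Sum>i\<in>I. \<mu> i * B i)\<^sup>2 + 128 * (real (card I) * \<tau>)\<^sup>2 * (1 + T) powr (-(3/4))"
    unfolding eqK using J(1) JJ by (simp add: has_bochner_integral_iff E1_def E2_def S_def D_def)
  show "integrable lborel (\<lambda>v. (\<Sum>(i,p,m)\<in>Sigma I (\<lambda>i. Q \<times> N i). h i p * b m * win \<delta> \<Delta> (ln (real p) + ln (real m) - v))\<^sup>2)"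
    unfolding eqK using J(1) by (rule integrable.intros)
qed

section \<open>The identity of Ramare\<close>

definition rough_count :: "real \<Rightarrow> nat \<Rightarrow> nat" where
  "rough_count H n = size (filter_mset (\<lambda>p. real p > H) (prime_factorization n))"

text \<open>For every prime \<open>p > H\<close> the denominator is the number of prime factors
  above \<open>H\<close> of \<open>p * m\<close>. Counting them with multiplicity makes this
  independent of whether \<open>p\<close> divides \<open>m\<close>, so the variables separate
  exactly. The sign comes from \<open>liouville (p * m) = - liouville m\<close>.\<close>

definition ramare_coeff :: "real \<Rightarrow> nat \<Rightarrow> real" where
  "ramare_coeff H m = - real_of_int (liouville m) / (real (rough_count H m) + 1)"

lemma abs_ramare_coeff: "\<bar>ramare_coeff H m\<bar> \<le> 1"
  by (simp add: ramare_coeff_def abs_divide divide_le_eq flip: of_int_abs)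

definition ramare_sum :: "real \<Rightarrow> nat \<Rightarrow> real" where
  "ramare_sum H n = (\<Sum>p | prime p \<and> p dvd n \<and> real p > H. ramare_coeff H (n div p))"

text \<open>All summands coincide, so the sum is \<open>liouville n\<close> times the ratio of the
  numbers of prime factors above \<open>H\<close> without and with multiplicity. This also bounds
  the sum by 1 for those \<open>n\<close> where the identity fails.\<close>

lemma ramare_sum_eq:
  fixes H :: real and n :: nat
  assumes n: "n > 0"
  defines "M \<equiv> filter_mset (\<lambda>p. real p > H) (prime_factorization n)"
  shows "ramare_sum H n = real (card (set_mset M)) * (real_of_int (liouville n) / real (size M))"
proof -
  have A: "{p. prime p \<and> p dvd n \<and> real p > H} = set_mset M"
    using n by (auto simp: M_def in_prime_factors_iff)
  have "ramare_coeff H (n div p) = real_of_int (liouville n) / real (size M)" if p: "p \<in> set_mset M" for p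
  proof -
    have pp: "prime p" "p dvd n" "real p > H" using p A by auto
    define m where "m = n div p"
    have nm: "n = p * m" using pp by (simp add: m_def)
    have m0: "m > 0" using nm n by (auto intro: Nat.gr0I)
    have p0: "p > 0" using pp prime_gt_0_nat by blast
    have "prime_factorization n = {#p#} + prime_factorization m"
      unfolding nm using pp m0 p0 by (subst prime_factorization_mult) (auto simp: prime_factorization_prime)
    then have "size M = rough_count H m + 1" using pp by (simp add: M_def rough_count_def)
    moreover have "liouville n = - liouville m" unfolding nm using pp m0 p0 by (simp add: liouville_mult liouville_prime)
    ultimately show ?thesis by (simp add: ramare_coeff_def m_def[symmetric] add.commute)
  qed
  then show ?thesis unfolding ramare_sum_def A by simp
qed

lemma card_set_mset_le_size: "card (set_mset M) \<le> size M"
  by (metis card_mono finite_set_mset size_multiset_overloaded_eq sum_mono count_greater_eq_one_iff card_eq_sum)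

lemma abs_ramare_sum: "n > 0 \<Longrightarrow> \<bar>ramare_sum H n\<bar> \<le> 1"
proof -
  assume n: "n > 0"
  define M where "M = filter_mset (\<lambda>p. real p > H) (prime_factorization n)"
  have "\<bar>ramare_sum H n\<bar> = real (card (set_mset M)) / real (size M)"
    unfolding ramare_sum_eq[OF n] M_def by (simp add: abs_mult abs_divide flip: of_int_abs)
  also have "\<dots> \<le> 1" using card_set_mset_le_size[of M] by (simp add: divide_le_eq)
  finally show ?thesis .
qed

text \<open>The ratio in \<open>ramare_sum_eq\<close> is 1 once there is a prime factor above
  \<open>H\<close> and none of these is repeated.\<close>

lemma ramare_identity:
  assumes n: "n > 0" and ex: "\<exists>p. prime p \<and> p dvd n \<and> real p > H"
    and sqf: "\<And>p. prime p \<Longrightarrow> real p > H \<Longrightarrow> \<not> p\<^sup>2 dvd n"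
  shows "ramare_sum H n = real_of_int (liouville n)"
proof -
  define M where "M = filter_mset (\<lambda>p. real p > H) (prime_factorization n)"
  have "count M p = 1" if "p \<in> set_mset M" for p
  proof -
    have pp: "prime p" "p dvd n" "real p > H" using that n by (auto simp: M_def in_prime_factors_iff)
    have "multiplicity p n < 2" using sqf[OF pp(1,3)] n pp(1)
      by (metis not_less power_dvd_iff_le_multiplicity gr_implies_not0 not_prime_unit)
    moreover have "count M p = multiplicity p n" using pp by (simp add: M_def count_prime_factorization)
    moreover have "count M p > 0" using that by (simp add: count_greater_zero_iff)
    ultimately show ?thesis by linarith
  qed
  then have "size M = card (set_mset M)" by (simp add: size_multiset_overloaded_eq)
  moreover have "set_mset M \<noteq> {}" using ex n by (auto simp: M_def in_prime_factors_iff)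
  ultimately show ?thesis unfolding ramare_sum_eq[OF n] M_def[symmetric] by auto
qed

section \<open>Integers not covered by the identity\<close>

definition ramare_bad :: "real \<Rightarrow> real \<Rightarrow> nat set" where
  "ramare_bad H Y = {n. n > 0 \<and> real n \<le> Y \<and> ((\<forall>p. prime p \<longrightarrow> p dvd n \<longrightarrow> real p \<le> H) \<or> (\<exists>p. prime p \<and> real p > H \<and> p\<^sup>2 dvd n))}"

lemma finite_nat_le: "finite {n::nat. P n \<and> real n \<le> Y}"
  by (rule finite_subset[of _ "{..nat \<lfloor>Y\<rfloor>}"]) (auto simp: le_nat_floor)

lemma card_multiples:
  assumes "d > 0" "Y \<ge> 0"
  shows "real (card {n::nat. n > 0 \<and> real n \<le> Y \<and> d dvd n}) \<le> Y / real d"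
proof -
  have "{n::nat. n > 0 \<and> real n \<le> Y \<and> d dvd n} \<subseteq> (\<lambda>k. d * k) ` {1..nat \<lfloor>Y / real d\<rfloor>}"
  proof
    fix n assume n: "n \<in> {n::nat. n > 0 \<and> real n \<le> Y \<and> d dvd n}"
    then obtain k where k: "n = d * k" by auto
    have "real k \<le> Y / real d" using n assms by (simp add: k field_simps)
    then have "k \<le> nat \<lfloor>Y / real d\<rfloor>" by (simp add: le_nat_floor)
    moreover have "k \<ge> 1" using n k by (cases k) auto
    ultimately show "n \<in> (\<lambda>k. d * k) ` {1..nat \<lfloor>Y / real d\<rfloor>}" using k by auto
  qed
  then have "card {n::nat. n > 0 \<and> real n \<le> Y \<and> d dvd n} \<le> card {1..nat \<lfloor>Y / real d\<rfloor>}"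
    by (rule surj_card_le[rotated]) simp
  then have "real (card {n::nat. n > 0 \<and> real n \<le> Y \<and> d dvd n}) \<le> real (nat \<lfloor>Y / real d\<rfloor>)" by simp
  also have "\<dots> \<le> Y / real d" using assms by (intro of_nat_floor) simp
  finally show ?thesis .
qed

lemma sum_inverse_squares_le:
  assumes "a > 0"
  shows "(\<Sum>k\<in>{a<..b}. 1 / real k ^ 2) \<le> 1 / real (a::nat)"
proof (cases "a \<le> b")
  case True
  have "(\<Sum>k\<in>{a<..b}. 1 / real k ^ 2) \<le> (1 / real a - 1 / real b)"
    using True
  proof (induction b rule: dec_induct)
    case (step b)
    have b: "b > 0" using step assms by simp
    have "{a<..Suc b} = insert (Suc b) {a<..b}" using step by auto
    then have "(\<Sum>k\<in>{a<..Suc b}. 1 / real k ^ 2) = 1 / real (Suc b) ^ 2 + (\<Sum>k\<in>{a<..b}. 1 / real k ^ 2)" by simp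
    also have "1 / real (Suc b) ^ 2 \<le> 1 / (real b * real (Suc b))"
      using b by (intro divide_left_mono) (auto simp: power2_eq_square intro!: mult_pos_pos)
    also have "\<dots> = 1 / real b - 1 / real (Suc b)" using b by (simp add: field_simps)
    finally show ?case using step.IH by linarith
  qed simp
  also have "\<dots> \<le> 1 / real a" by simp
  finally show ?thesis .
qed simp

text \<open>The primes \<open>p > H\<close> are replaced by all integers above the integer part
  \<open>a\<close> of \<open>H\<close>; the sum of their inverse squares is at most
  \<open>1 / a \<le> 2 / H\<close>.\<close>

lemma card_ramare_bad:
  assumes "H \<ge> 1" "Y \<ge> 0"
  shows "real (card (ramare_bad H Y)) \<le>
    real (card {n::nat. n > 0 \<and> real n \<le> Y \<and> (\<forall>p. prime p \<longrightarrow> p dvd n \<longrightarrow> real p \<le> H)}) + 2 * Y / H"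
proof -
  define S where "S = {n::nat. n > 0 \<and> real n \<le> Y \<and> (\<forall>p. prime p \<longrightarrow> p dvd n \<longrightarrow> real p \<le> H)}"
  define a b where "a = nat \<lfloor>H\<rfloor>" and "b = nat \<lfloor>Y\<rfloor>"
  define D where "D = (\<lambda>k::nat. {n::nat. n > 0 \<and> real n \<le> Y \<and> k\<^sup>2 dvd n})"
  have a: "a > 0" "real a \<ge> H / 2"
  proof -
    have "\<lfloor>H\<rfloor> \<ge> 1" using assms by simp
    then show "a > 0" by (simp add: a_def)
    have "real a = real_of_int \<lfloor>H\<rfloor>" using \<open>\<lfloor>H\<rfloor> \<ge> 1\<close> by (simp add: a_def)
    then show "real a \<ge> H / 2" using assms \<open>\<lfloor>H\<rfloor> \<ge> 1\<close> by linarith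
  qed
  have "ramare_bad H Y \<subseteq> S \<union> (\<Union>k\<in>{a<..b}. D k)"
  proof
    fix n assume n: "n \<in> ramare_bad H Y"
    show "n \<in> S \<union> (\<Union>k\<in>{a<..b}. D k)"
    proof (cases "n \<in> S")
      case False
      then obtain p where p: "prime p" "real p > H" "p\<^sup>2 dvd n" "n > 0" "real n \<le> Y" using n by (auto simp: ramare_bad_def S_def)
      have "a < p" using p(2) assms by (simp add: a_def nat_less_iff floor_less_iff)
      moreover have "p \<le> b"
      proof -
        have "p \<le> p\<^sup>2" by (simp add: power2_eq_square)
        also have "\<dots> \<le> n" using p by (intro dvd_imp_le) auto
        finally have "real p \<le> Y" using p by linarith
        then show ?thesis by (simp add: b_def le_nat_floor)
      qed
      ultimately show ?thesis using p by (auto simp: D_def)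
    qed simp
  qed
  moreover have fin: "finite S" "finite (D k)" for k
    unfolding S_def D_def using finite_nat_le[of "\<lambda>n. n > 0 \<and> _ n" Y]
    by (auto intro: finite_subset[OF _ finite_nat_le[of "\<lambda>_. True" Y]])
  ultimately have "card (ramare_bad H Y) \<le> card (S \<union> (\<Union>k\<in>{a<..b}. D k))" by (intro card_mono) auto
  also have "\<dots> \<le> card S + card (\<Union>k\<in>{a<..b}. D k)" by (rule card_Un_le)
  also have "card (\<Union>k\<in>{a<..b}. D k) \<le> (\<Sum>k\<in>{a<..b}. card (D k))" by (rule card_UN_le) simp
  finally have "real (card (ramare_bad H Y)) \<le> real (card S) + (\<Sum>k\<in>{a<..b}. real (card (D k)))"
    by (simp flip: of_nat_sum of_nat_add)
  also have "(\<Sum>k\<in>{a<..b}. real (card (D k))) \<le> (\<Sum>k\<in>{a<..b}. Y * (1 / real k ^ 2))"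
  proof (rule sum_mono)
    fix k assume "k \<in> {a<..b}"
    then have "k > 0" by auto
    then show "real (card (D k)) \<le> Y * (1 / real k ^ 2)"
      using card_multiples[of "k\<^sup>2" Y] assms by (simp add: D_def)
  qed
  also have "\<dots> = Y * (\<Sum>k\<in>{a<..b}. 1 / real k ^ 2)" by (simp add: sum_distrib_left)
  also have "\<dots> \<le> Y * (1 / real a)" using assms a by (intro mult_left_mono sum_inverse_squares_le) auto
  also have "\<dots> \<le> Y * (1 / (H / 2))" using assms a by (intro mult_left_mono divide_left_mono) auto
  finally show ?thesis by (simp add: S_def mult.commute)
qed

section \<open>A partition of unity on a half-line with a sharp edge\<close>

definition ramp :: "real \<Rightarrow> real \<Rightarrow> real" where
  "ramp w u = (max 0 u - max 0 (u - w)) / w"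

lemma ramp_bounds: "w > 0 \<Longrightarrow> 0 \<le> ramp w u" "w > 0 \<Longrightarrow> ramp w u \<le> 1"
  "w > 0 \<Longrightarrow> u \<le> 0 \<Longrightarrow> ramp w u = 0" "w > 0 \<Longrightarrow> u \<ge> w \<Longrightarrow> ramp w u = 1"
  by (auto simp: ramp_def max_def field_simps)

text \<open>Half a hat of centre and width \<open>w\<close> is the difference of the ramps of widths
  \<open>w\<close> and \<open>2 * w\<close>, so the sum over dyadic widths telescopes.\<close>

lemma sum_hat_dyadic:
  "(\<Sum>k\<in>{1..K}. 1/2 * hat (1 / 2 ^ k) (u - 1 / 2 ^ k)) = ramp (1 / 2 ^ K) u - ramp 1 u"
proof (induction K)
  case (Suc K)
  define w :: real where "w = 1 / 2 ^ Suc K"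
  have w: "w > 0" "1 / 2 ^ K = 2 * w" by (simp_all add: w_def)
  have "1/2 * hat w (u - w) = ramp w u - ramp (2 * w) u"
    unfolding hat_eq_pos_part[OF w(1)] ramp_def using w(1) by (simp add: field_simps)
  moreover have "(\<Sum>k\<in>{1..Suc K}. 1/2 * hat (1 / 2 ^ k) (u - 1 / 2 ^ k)) = (\<Sum>k\<in>{1..K}. 1/2 * hat (1 / 2 ^ k) (u - 1 / 2 ^ k)) + 1/2 * hat w (u - w)"
    by (simp add: w_def del: power_Suc)
  moreover have "(\<Sum>k\<in>{1..K}. 1/2 * hat (1 / 2 ^ k) (u - 1 / 2 ^ k)) = ramp (2 * w) u - ramp 1 u"
    using Suc.IH unfolding w(2) .
  ultimately show ?case unfolding w_def[symmetric] by linarith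
qed simp

text \<open>Starting the sum at 0 would give a ramp that begins at \<open>-1\<close>; without the
  hat centred at 0 it begins at 0. The falling edge of the trapezoid starts only at
  \<open>J\<close>.\<close>

lemma sum_hat_unit:
  assumes "u \<le> real J"
  shows "(\<Sum>k\<in>{1..J}. hat 1 (u - real k)) = ramp 1 u"
proof -
  have "(\<Sum>k\<le>J. hat 1 (u - real k * 1)) = (\<Sum>k\<in>{1..J}. hat 1 (u - real k)) + hat 1 u"
  proof -
    have "{..J} = insert 0 {1..J}" by auto
    then show ?thesis by simp
  qed
  moreover have "(\<Sum>k\<le>J. hat 1 (u - real k * 1)) = max 0 (u + 1) - max 0 u"
    using sum_hat[of 1 u J] assms by (simp add: max_def)
  ultimately show ?thesis using hat_eq_pos_part[of 1 u] by (simp add: ramp_def)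
qed

text \<open>The first component is the kind of block: 0 for the unit triangles, 1 for the dyadic
  ones, 2 for the remaining jump. One index set for all kinds lets a single application of
  \<open>bilinear_l2_bound\<close> cover them.\<close>

definition blocks :: "nat \<Rightarrow> nat \<Rightarrow> (nat \<times> nat) set" where
  "blocks J K = ({0} \<times> {1..J} \<union> {1} \<times> {1..K}) \<union> {(2, 0)}"

definition block_center :: "real \<Rightarrow> nat \<times> nat \<Rightarrow> real" where
  "block_center y0 = (\<lambda>(a, k). if a = 0 then y0 + real k else if a = 1 then y0 + 1 / 2 ^ k else y0)"

text \<open>A partition of unity of \<open>v > y0\<close> into triangles: of width \<open>1\<close> away from \<open>y0\<close>, and of
  widths \<open>2\<^sup>-\<^sup>k\<close> near \<open>y0\<close> down to \<open>2\<^sup>-\<^sup>K\<close>.  The last block \<open>(2, 0)\<close> is the remaining jump, which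
  is so short that the number of primes in it can be bounded trivially.\<close>
definition block_weight :: "real \<Rightarrow> nat \<Rightarrow> nat \<times> nat \<Rightarrow> real \<Rightarrow> real" where
  "block_weight y0 K = (\<lambda>(a, k) v. if a = 0 then hat 1 (v - (y0 + real k))
     else if a = 1 then 1/2 * hat (1 / 2 ^ k) (v - (y0 + 1 / 2 ^ k))
     else of_bool (0 < v - y0 \<and> v - y0 < 1 / 2 ^ K) * (1 - ramp (1 / 2 ^ K) (v - y0)))"

lemma finite_blocks [simp]: "finite (blocks J K)"
  by (simp add: blocks_def)

lemma sum_blocks: "(\<Sum>i\<in>blocks J K. f i) = (\<Sum>k\<in>{1..J}. f (0, k)) + (\<Sum>k\<in>{1..K}. f (1, k)) + f (2, 0 :: nat)"
proof -
  have "(\<Sum>i\<in>blocks J K. f i) = (\<Sum>i\<in>{0} \<times> {1..J} \<union> {1} \<times> {1..K}. f i) + f (2, 0)"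
    unfolding blocks_def by (subst sum.union_disjoint) auto
  also have "(\<Sum>i\<in>{0} \<times> {1..J} \<union> {1} \<times> {1..K}. f i) = (\<Sum>i\<in>{0} \<times> {1..J}. f i) + (\<Sum>i\<in>{1} \<times> {1..K}. f i)"
    by (subst sum.union_disjoint) auto
  also have "(\<Sum>i\<in>{0} \<times> {1..J}. f i) = (\<Sum>k\<in>{1..J}. f (0, k))"
    by (rule sum.reindex_bij_witness[of _ "\<lambda>k. (0, k)" snd]) auto
  also have "(\<Sum>i\<in>{1} \<times> {1..K}. f i) = (\<Sum>k\<in>{1..K}. f (1, k))"
    by (rule sum.reindex_bij_witness[of _ "\<lambda>k. (1, k)" snd]) auto
  finally show ?thesis .
qed

text \<open>The unit triangles add up to a ramp of width 1, the dyadic ones steepen it to width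
  \<open>1 / 2 ^ K\<close>, and the last block fills in what is missing to the sharp step. Beyond
  \<open>y0 + real J\<close> the last unit triangle falls off, hence the bound on
  \<open>v\<close>.\<close>

lemma block_partition:
  assumes "v \<le> y0 + real J"
  shows "(\<Sum>i\<in>blocks J K. block_weight y0 K i v) = of_bool (v > y0)"
proof -
  define u where "u = v - y0"
  have w: "(1 / 2 ^ K :: real) > 0" by simp
  have "(\<Sum>i\<in>blocks J K. block_weight y0 K i v) = (\<Sum>k\<in>{1..J}. hat 1 (u - real k)) + (\<Sum>k\<in>{1..K}. 1/2 * hat (1 / 2 ^ k) (u - 1 / 2 ^ k))
     + of_bool (0 < u \<and> u < 1 / 2 ^ K) * (1 - ramp (1 / 2 ^ K) u)"
    unfolding sum_blocks block_weight_def by (simp add: u_def algebra_simps)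
  also have "\<dots> = ramp (1 / 2 ^ K) u + of_bool (0 < u \<and> u < 1 / 2 ^ K) * (1 - ramp (1 / 2 ^ K) u)"
    unfolding sum_hat_dyadic using assms by (subst sum_hat_unit) (auto simp: u_def)
  also have "\<dots> = of_bool (u > 0)"
    using ramp_bounds(3)[OF w, of u] ramp_bounds(4)[OF w, of u] by (auto simp: not_less)
  finally show ?thesis by (simp add: u_def)
qed

lemma block_weight_bounds:
  assumes "i \<in> blocks J K"
  shows "0 \<le> block_weight y0 K i v" "block_weight y0 K i v \<le> 1"
    and "\<bar>v - block_center y0 i\<bar> \<ge> 1 \<Longrightarrow> block_weight y0 K i v = 0"
    and "y0 \<le> block_center y0 i" "block_center y0 i \<le> y0 + 1 + real J"
proof -
  obtain a k where i: "i = (a, k)" by (cases i)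
  have w: "(1 / 2 ^ k :: real) > 0" "(1 / 2 ^ k :: real) \<le> 1" "(1 / 2 ^ K :: real) > 0" "(1 / 2 ^ K :: real) \<le> 1" by auto
  show "0 \<le> block_weight y0 K i v" "block_weight y0 K i v \<le> 1"
    unfolding i block_weight_def using hat_bounds[of 1 "v - (y0 + real k)"] hat_bounds[OF w(1), of "v - (y0 + 1 / 2 ^ k)"] ramp_bounds(1,2)[OF w(3), of "v - y0"]
    by auto
  show "block_weight y0 K i v = 0" if v: "\<bar>v - block_center y0 i\<bar> \<ge> 1"
  proof -
    have "1 / 2 ^ k \<le> \<bar>v - (y0 + 1 / 2 ^ k)\<bar>" if "1 \<le> \<bar>v - (y0 + 1 / 2 ^ k)\<bar>"
      using that w(2) by linarith
    moreover have False if "1 \<le> \<bar>v - y0\<bar>" "0 < v - y0" "v - y0 < 1 / 2 ^ K"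
      using that w(4) by linarith
    ultimately show ?thesis using v hat_eq_0[of 1 "v - (y0 + real k)"] hat_eq_0[OF w(1), of "v - (y0 + 1 / 2 ^ k)"]
      unfolding i block_weight_def block_center_def by (auto split: if_splits)
  qed
  show "y0 \<le> block_center y0 i" "block_center y0 i \<le> y0 + 1 + real J"
    using assms w(1) order.trans[OF w(2), of "1 + real J"] unfolding i block_center_def blocks_def by auto
qed

section \<open>Assembling the mean square\<close>

definition block_poly :: "real \<Rightarrow> nat \<Rightarrow> nat \<Rightarrow> nat \<times> nat \<Rightarrow> real \<Rightarrow> complex" where
  "block_poly y0 J K i t = (\<Sum>p | prime p \<and> ln (real p) \<le> y0 + real J + 1.
     of_real (block_weight y0 K i (ln (real p))) * cis (t * ln (real p)))"

lemma finite_primes_ln: "finite {p::nat. prime p \<and> ln (real p) \<le> b}"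
  using finite_ln_interval[of prime b] .

lemma norm_weighted_cis_sum_le:
  fixes w :: "nat \<Rightarrow> real"
  assumes fin: "finite Q" "finite S" and w: "\<And>p. p \<in> Q \<Longrightarrow> 0 \<le> w p \<and> w p \<le> 1" and S: "\<And>p. p \<in> Q \<Longrightarrow> w p \<noteq> 0 \<Longrightarrow> p \<in> S"
  shows "norm (\<Sum>p\<in>Q. complex_of_real (w p) * cis (t * ln (real p))) \<le> real (card S)"
proof -
  have "norm (\<Sum>p\<in>Q. complex_of_real (w p) * cis (t * ln (real p))) \<le> (\<Sum>p\<in>Q. norm (complex_of_real (w p) * cis (t * ln (real p))))"
    by (rule norm_sum)
  also have "\<dots> \<le> (\<Sum>p\<in>Q. of_bool (p \<in> S))"
  proof (rule sum_mono)
    fix p assume p: "p \<in> Q"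
    have "norm (complex_of_real (w p) * cis (t * ln (real p))) = w p"
      using w[OF p] by (simp add: norm_mult)
    then show "norm (complex_of_real (w p) * cis (t * ln (real p))) \<le> of_bool (p \<in> S)"
      using w[OF p] S[OF p] by (cases "w p = 0") auto
  qed
  also have "\<dots> = real (card (Q \<inter> S))" 
  proof -
    have "(\<Sum>p\<in>Q. of_bool (p \<in> S) :: real) = (\<Sum>p\<in>Q \<inter> S. 1)" using fin by (intro sum.mono_neutral_cong_right) auto
    then show ?thesis by simp
  qed
  also have "\<dots> \<le> real (card S)" using fin by (intro of_nat_mono card_mono) auto
  finally show ?thesis .
qed

lemma norm_block_poly_le:
  assumes i: "i \<in> blocks J K"
  shows "norm (block_poly y0 J K i t) \<le> exp (block_center y0 i + 1)"
proof -
  define y where "y = block_center y0 i"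
  define S where "S = {p::nat. p > 0 \<and> real p \<le> exp (y + 1)}"
  have Ssub: "S \<subseteq> {1..nat \<lfloor>exp (y + 1)\<rfloor>}" by (auto simp: S_def le_nat_floor)
  have "norm (block_poly y0 J K i t) \<le> real (card S)"
    unfolding block_poly_def
  proof (rule norm_weighted_cis_sum_le)
    show "finite {p::nat. prime p \<and> ln (real p) \<le> y0 + real J + 1}" by (rule finite_primes_ln)
    show "finite S" using Ssub by (rule finite_subset) simp
    fix p assume p: "p \<in> {p::nat. prime p \<and> ln (real p) \<le> y0 + real J + 1}"
    show "0 \<le> block_weight y0 K i (ln (real p)) \<and> block_weight y0 K i (ln (real p)) \<le> 1"
      using block_weight_bounds(1,2)[OF i] by blast
    assume nz: "block_weight y0 K i (ln (real p)) \<noteq> 0"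
    have "\<bar>ln (real p) - y\<bar> < 1" using nz block_weight_bounds(3)[OF i, of "ln (real p)" y0] unfolding y_def by linarith
    moreover have "p > 0" using p prime_gt_0_nat by auto
    ultimately show "p \<in> S" using near_exp_bounds(2)[of p y 1] by (simp add: S_def)
  qed
  also have "real (card S) \<le> real (card {1..nat \<lfloor>exp (y + 1)\<rfloor>})" using Ssub by (intro of_nat_mono card_mono) auto
  also have "\<dots> \<le> exp (y + 1)" by simp
  finally show ?thesis by (simp add: y_def)
qed

lemma hat_sum_eq_prime_poly:
  assumes w: "0 < w" and b: "y + w \<le> b"
  shows "(\<Sum>p | prime p \<and> ln (real p) \<le> b. complex_of_real (hat w (ln (real p) - y)) * cis (t * ln (real p)))
    = prime_poly w y (Complex 0 (-t))"
proof -
  have "(\<Sum>p | prime p \<and> ln (real p) \<le> b. complex_of_real (hat w (ln (real p) - y)) * cis (t * ln (real p)))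
     = (\<Sum>p | prime p \<and> \<bar>ln (real p) - y\<bar> < w. complex_of_real (hat w (ln (real p) - y)) * cis (t * ln (real p)))"
  proof (rule sum.mono_neutral_right[OF finite_primes_ln])
    show "{p. prime p \<and> \<bar>ln (real p) - y\<bar> < w} \<subseteq> {p. prime p \<and> ln (real p) \<le> b}" using b by (auto simp: abs_less_iff)
    show "\<forall>p\<in>{p. prime p \<and> ln (real p) \<le> b} - {p. prime p \<and> \<bar>ln (real p) - y\<bar> < w}.
      complex_of_real (hat w (ln (real p) - y)) * cis (t * ln (real p)) = 0"
      using hat_eq_0[OF w] by (auto simp: not_less)
  qed
  also have "\<dots> = prime_poly w y (Complex 0 (-t))"
    unfolding prime_poly_def
  proof (intro sum.cong refl)
    fix p assume "p \<in> {p. prime p \<and> \<bar>ln (real p) - y\<bar> < w}"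
    then have p: "p > 0" using prime_gt_0_nat by auto
    have "of_nat p powr (- Complex 0 (- t)) = exp (- Complex 0 (-t) * of_real (ln (real p)))"
      using p by (simp add: powr_def Ln_of_nat)
    also have "- Complex 0 (-t) * of_real (ln (real p)) = \<i> * of_real (t * ln (real p))"
      by (simp add: complex_eq_iff)
    finally show "complex_of_real (hat w (ln (real p) - y)) * cis (t * ln (real p))
      = of_real (hat w (ln (real p) - y)) * of_nat p powr (- Complex 0 (-t))"
      by (simp add: cis_conv_exp)
  qed
  finally show ?thesis .
qed

text \<open>Taking \<open>K\<close> as the natural logarithm of \<open>H\<close>, rounded up, puts
  \<open>2 ^ K\<close> between \<open>sqrt H\<close> and \<open>2 * H\<close>. The lower bound makes
  the jump block so short that it meets \<open>O (sqrt H)\<close> integers, the upper bound limits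
  the loss \<open>1 / w\<close> in the pole term to \<open>2 * H\<close>.\<close>

lemma block_size_bounds:
  fixes X H :: real
  assumes X: "ln X \<ge> 10" and H: "exp 2 \<le> H" "H \<le> X"
  defines "J \<equiv> nat \<lceil>ln (9 * X)\<rceil>" and "K \<equiv> nat \<lceil>ln H\<rceil>"
  shows "real J \<le> ln X + 5" "ln (9 * X) \<le> real J" "real K \<le> ln X + 1" "ln H \<le> real K" "2 ^ K \<le> 2 * H" "1 / 2 ^ K \<le> exp (- (ln H / 2))"
proof -
  have X0: "X > 0" using H(1,2) exp_gt_zero[of "2::real"] by linarith
  have H0: "H > 0" using H(1) exp_gt_zero[of "2::real"] by linarith
  have y0: "ln H \<ge> 2" using H(1) H0 by (simp add: ln_ge_iff)
  have yX: "ln H \<le> ln X" using H H0 X0 by simp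
  have l9: "ln (9::real) \<le> 4"
  proof -
    have "ln (9::real) = 2 * ln 3" using ln_realpow[of 3 2] by simp
    also have "\<dots> \<le> 4" using ln_le_minus_one[of "3::real"] by simp
    finally show ?thesis .
  qed
  have l9X: "ln (9 * X) = ln 9 + ln X" using X0 by (simp add: ln_mult)
  have p9: "0 \<le> ln (9::real)" by simp
  show "real J \<le> ln X + 5" "ln (9 * X) \<le> real J" unfolding J_def l9X using l9 X p9 by linarith+
  show K: "real K \<le> ln X + 1" "ln H \<le> real K" unfolding K_def using y0 yX by linarith+
  have l2: "1/2 \<le> ln (2::real)" "ln (2::real) \<le> 1" using ln_le_minus_one[of "2::real"] ln_le_minus_one[of "1/2::real"] by (simp_all add: ln_div)
  have e: "2 ^ K = exp (real K * ln 2)" by (metis exp_of_nat_mult exp_ln zero_less_numeral)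
  have "real K \<le> ln H + 1" unfolding K_def using y0 by linarith
  then have A: "real K * ln 2 \<le> ln H + ln 2"
  proof -
    have "real K * ln 2 \<le> (ln H + 1) * ln 2" using \<open>real K \<le> ln H + 1\<close> l2 by (intro mult_right_mono) auto
    moreover have "ln H * ln 2 \<le> ln H * 1" using l2 y0 by (intro mult_left_mono) auto
    ultimately show ?thesis by (simp only: distrib_right)
  qed
  show "2 ^ K \<le> 2 * H"
  proof -
    from A have "exp (real K * ln 2) \<le> exp (ln H + ln 2)" by simp
    also have "\<dots> = 2 * H" using H0 by (simp add: exp_add)
    finally show ?thesis unfolding e .
  qed
  have le: "ln H / 2 \<le> real K * ln 2" using mult_mono[OF K(2) l2(1)] y0 by simp
  show "1 / 2 ^ K \<le> exp (- (ln H / 2))"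
  proof -
    have "1 / exp (real K * ln 2) = exp (- (real K * ln 2))" by (simp add: exp_minus divide_inverse)
    then show ?thesis unfolding e using le by simp
  qed
qed

text \<open>For the triangles this is \<open>prime_poly_bound\<close>, where \<open>y\<close>,
  \<open>ln (\<bar>t\<bar> + 3)\<close> and \<open>ln (1 / w)\<close> are all
  \<open>O (ln X)\<close>; two of these factors give \<open>(ln X)\<^sup>2\<close>. The bound is
  uniform over the blocks, so that their number enters only linearly.\<close>

lemma block_poly_bound:
  assumes RH: "riemann_hypothesis"
  obtains C where "C \<ge> 1" "\<And>X H i t. ln X \<ge> 10 \<Longrightarrow> exp 2 \<le> H \<Longrightarrow> H \<le> X \<Longrightarrow> \<bar>t\<bar> \<le> X ^ 4 \<Longrightarrow>
    i \<in> blocks (nat \<lceil>ln (9 * X)\<rceil>) (nat \<lceil>ln H\<rceil>) \<Longrightarrow>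
    norm (block_poly (ln H) (nat \<lceil>ln (9 * X)\<rceil>) (nat \<lceil>ln H\<rceil>) i t)
      \<le> C * exp (block_center (ln H) i / 2) * (ln X)\<^sup>2 + C * H * exp (block_center (ln H) i) * (1 + \<bar>t\<bar>) powr (-(3/4))"
proof -
  obtain C0 where C0: "C0 > 0" "\<And>t w y. 0 < w \<Longrightarrow> w \<le> 1 \<Longrightarrow> y \<ge> 2 \<Longrightarrow>
    norm (prime_poly w y (Complex 0 t)) \<le> C0 * (exp (y / 2) * y * (ln (\<bar>t\<bar> + 3) + ln (1 / w) + 2)
           + exp y / w * (1 + \<bar>t\<bar>) powr (-(3/4)))"
    using prime_poly_bound[OF RH] by blast
  define C where "C = 21 * C0 + 3"
  show thesis
  proof (rule that[of C])
    show "C \<ge> 1" using C0(1) by (simp add: C_def)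
    fix X H t :: real and i :: "nat \<times> nat"
    define y0 where "y0 = ln H"
    define J where "J = nat \<lceil>ln (9 * X)\<rceil>"
    define K where "K = nat \<lceil>y0\<rceil>"
    assume h: "ln X \<ge> 10" "exp 2 \<le> H" "H \<le> X" "\<bar>t\<bar> \<le> X ^ 4" "i \<in> blocks (nat \<lceil>ln (9 * X)\<rceil>) (nat \<lceil>ln H\<rceil>)"
    have i: "i \<in> blocks J K" using h(5) by (simp add: J_def K_def y0_def)
    have H0: "H > 0" using h(2) exp_gt_zero[of "2::real"] by linarith
    have H2: "H \<ge> 2" using h(2) exp_ge_add_one_self[of "2::real"] by linarith
    have X0: "X \<ge> 2" using H2 h(3) by linarith
    have bnds: "real J \<le> ln X + 5" "real K \<le> ln X + 1" "2 ^ K \<le> 2 * H" "1 / 2 ^ K \<le> exp (- (y0 / 2))"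
      using block_size_bounds[OF h(1-3)] by (auto simp: J_def K_def y0_def)
    have y0: "y0 \<ge> 2" "y0 \<le> ln X" using h(2,3) H0 X0 by (simp_all add: y0_def ln_ge_iff)
    define y where "y = block_center y0 i"
    have y: "y0 \<le> y" "y \<le> 3 * ln X" using block_weight_bounds(4,5)[OF i, of y0] bnds y0 h(1) by (auto simp: y_def)
    \<comment> \<open>The range of \<open>t\<close> is polynomial in \<open>X\<close> just so that
      this logarithm stays of order \<open>ln X\<close>.\<close>
    have lt: "ln (\<bar>t\<bar> + 3) \<le> 5 * ln X"
    proof -
      have "X ^ 4 + 3 \<le> X ^ 5"
      proof -
        have "X ^ 4 * 2 \<le> X ^ 4 * X" using X0 by (intro mult_left_mono) auto
        moreover have "X ^ 4 \<ge> 2 ^ 4" using X0 by (intro power_mono) auto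
        ultimately show ?thesis by (simp add: power_numeral_reduce mult_ac)
      qed
      then have "\<bar>t\<bar> + 3 \<le> X ^ 5" using h(4) by linarith
      then have "ln (\<bar>t\<bar> + 3) \<le> ln (X ^ 5)" by (subst ln_le_cancel_iff) (use X0 in auto)
      then show ?thesis using X0 by (simp add: ln_realpow)
    qed
    have key: "norm (prime_poly w y (Complex 0 (-t))) \<le> C * exp (y / 2) * (ln X)\<^sup>2 + C * H * exp y * (1 + \<bar>t\<bar>) powr (-(3/4))"
      if w: "0 < w" "w \<le> 1" "ln (1 / w) \<le> ln X + 1" "1 / w \<le> 2 * H" for w
    proof -
      have alg: "C0 * (a * (3 * l) * (7 * l) + b * (2 * H) * c) = (21 * C0) * a * l\<^sup>2 + (2 * C0) * H * b * c" for a b c l :: real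
        by (simp add: power2_eq_square algebra_simps)
      have "norm (prime_poly w y (Complex 0 (-t))) \<le> C0 * (exp (y / 2) * y * (ln (\<bar>-t\<bar> + 3) + ln (1 / w) + 2)
           + exp y / w * (1 + \<bar>-t\<bar>) powr (-(3/4)))"
        using w y y0 by (intro C0(2)) auto
      also have "\<dots> \<le> C0 * (exp (y / 2) * (3 * ln X) * (7 * ln X) + exp y * (2 * H) * (1 + \<bar>t\<bar>) powr (-(3/4)))"
      proof (intro mult_left_mono add_mono mult_mono mult_right_mono)
        show "ln (\<bar>-t\<bar> + 3) + ln (1 / w) + 2 \<le> 7 * ln X" using lt w(3) h(1) by simp
        show "0 \<le> ln (\<bar>- t\<bar> + 3) + ln (1 / w) + 2" using w by (intro add_nonneg_nonneg) (auto simp: field_simps)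
        show "exp y / w \<le> exp y * (2 * H)" using mult_left_mono[OF w(4), of "exp y"] by simp
      qed (use C0(1) y y0 h(1) H0 in auto)
      also have "\<dots> = (21 * C0) * exp (y / 2) * (ln X)\<^sup>2 + (2 * C0) * H * exp y * (1 + \<bar>t\<bar>) powr (-(3/4))"
        by (rule alg)
      also have "\<dots> \<le> C * exp (y / 2) * (ln X)\<^sup>2 + C * H * exp y * (1 + \<bar>t\<bar>) powr (-(3/4))"
        using C0(1) H0 by (intro add_mono mult_right_mono) (auto simp: C_def)
      finally show ?thesis .
    qed
    obtain a k where ik: "i = (a, k)" by (cases i)
    consider "a = 0" "1 \<le> k" "k \<le> J" | "a = 1" "1 \<le> k" "k \<le> K" | "a = 2" "k = 0"
      using i by (auto simp: ik blocks_def)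
    then have "norm (block_poly y0 J K i t) \<le> C * exp (y / 2) * (ln X)\<^sup>2 + C * H * exp y * (1 + \<bar>t\<bar>) powr (-(3/4))"
    proof cases
      case 1
      have yk: "y = y0 + real k" using 1 by (simp add: y_def ik block_center_def)
      have "block_poly y0 J K i t = prime_poly 1 y (Complex 0 (-t))"
        unfolding block_poly_def using hat_sum_eq_prime_poly[of 1 y "y0 + real J + 1" t] 1 by (simp add: yk ik block_weight_def)
      then show ?thesis using key[of 1] h(1) H2 by simp
    next
      case 2
      define w :: real where "w = 1 / 2 ^ k"
      have w: "0 < w" "w \<le> 1" by (auto simp: w_def)
      have yk: "y = y0 + w" using 2 by (simp add: y_def ik block_center_def w_def)
      have "block_poly y0 J K i t = 1/2 * (\<Sum>p | prime p \<and> ln (real p) \<le> y0 + real J + 1. complex_of_real (hat w (ln (real p) - y)) * cis (t * ln (real p)))"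
        unfolding block_poly_def sum_distrib_left using 2 by (intro sum.cong) (simp_all add: ik block_weight_def yk w_def)
      also have "\<dots> = 1/2 * prime_poly w y (Complex 0 (-t))"
      proof (subst hat_sum_eq_prime_poly[OF w(1)])
        have "ln (9 * X) \<le> real J" using block_size_bounds(2)[OF h(1-3)] by (simp add: J_def)
        moreover have "ln X \<le> ln (9 * X)" using X0 by simp
        ultimately show "y + w \<le> y0 + real J + 1" using h(1) w(2) by (simp add: yk)
      qed simp
      finally have "norm (block_poly y0 J K i t) = norm (1/2 * prime_poly w y (Complex 0 (-t)))" by (rule arg_cong)
      also have "\<dots> \<le> norm (prime_poly w y (Complex 0 (-t)))" by (simp only: norm_mult) simp
      also have "\<dots> \<le> C * exp (y / 2) * (ln X)\<^sup>2 + C * H * exp y * (1 + \<bar>t\<bar>) powr (-(3/4))"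
      proof (rule key[OF w])
        have "ln (2::real) \<le> 1" using ln_le_minus_one[of "2::real"] by simp
        then have "real k * ln 2 \<le> real K * 1" using 2 by (intro mult_mono) auto
        then show "ln (1 / w) \<le> ln X + 1" using bnds(2) by (simp add: w_def ln_realpow)
        have "(2::real) ^ k \<le> 2 ^ K" using 2 by (intro power_increasing) auto
        then have "2 ^ k \<le> 2 * H" using bnds(3) by linarith
        then show "1 / w \<le> 2 * H" by (simp add: w_def)
      qed
      finally show ?thesis .
    next
      case 3
      \<comment> \<open>The jump block is estimated by counting integers: an interval of relative
        length at most \<open>exp (- (y0 / 2))\<close> above \<open>exp y0\<close> contains at most
        three times \<open>exp (y0 / 2)\<close> of them, so no cancellation is required.\<close>
      have yk: "y = y0" using 3 by (simp add: y_def ik block_center_def)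
      define d :: real where "d = 1 / 2 ^ K"
      have d: "0 \<le> d" "d \<le> 1" by (auto simp: d_def)
      have "norm (block_poly y0 J K i t) \<le> real (card {n::nat. n > 0 \<and> y0 < ln (real n) \<and> ln (real n) \<le> y0 + d})"
        unfolding block_poly_def
      proof (rule norm_weighted_cis_sum_le)
        show "finite {n::nat. n > 0 \<and> y0 < ln (real n) \<and> ln (real n) \<le> y0 + d}"
          using finite_ln_interval[of "\<lambda>n. n > 0 \<and> y0 < ln (real n)"] by (simp add: conj_assoc)
        fix p assume "p \<in> {p::nat. prime p \<and> ln (real p) \<le> y0 + real J + 1}"
        then have p: "p > 0" using prime_gt_0_nat by auto
        show "0 \<le> block_weight y0 K i (ln (real p)) \<and> block_weight y0 K i (ln (real p)) \<le> 1"
          using block_weight_bounds(1,2)[OF i] by blast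
        assume "block_weight y0 K i (ln (real p)) \<noteq> 0"
        then show "p \<in> {n::nat. n > 0 \<and> y0 < ln (real n) \<and> ln (real n) \<le> y0 + d}"
          using p 3 by (auto simp: ik block_weight_def d_def)
      qed (rule finite_primes_ln)
      also have "\<dots> \<le> 2 * d * exp y0 + 1" by (rule card_ln_window[OF d])
      also have "\<dots> \<le> 2 * exp (- (y0 / 2)) * exp y0 + exp (y0 / 2)"
        using bnds(4) y0 by (intro add_mono mult_right_mono mult_left_mono) (auto simp: d_def)
      also have "\<dots> = 3 * exp (y / 2)" by (simp add: yk flip: exp_add)
      also have "\<dots> \<le> C * exp (y / 2) * (ln X)\<^sup>2"
      proof -
        have "3 * exp (y / 2) * 1 \<le> C * exp (y / 2) * (ln X)\<^sup>2"
          using C0(1) h(1) power_mono[of 1 "ln X" 2] by (intro mult_mono mult_right_mono) (auto simp: C_def)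
        then show ?thesis by simp
      qed
      also have "\<dots> \<le> C * exp (y / 2) * (ln X)\<^sup>2 + C * H * exp y * (1 + \<bar>t\<bar>) powr (-(3/4))"
        using C0(1) H0 by (simp add: C_def)
      finally show ?thesis .
    qed
    then show "norm (block_poly (ln H) (nat \<lceil>ln (9 * X)\<rceil>) (nat \<lceil>ln H\<rceil>) i t)
      \<le> C * exp (block_center (ln H) i / 2) * (ln X)\<^sup>2 + C * H * exp (block_center (ln H) i) * (1 + \<bar>t\<bar>) powr (-(3/4))"
      unfolding y_def y0_def J_def K_def .
  qed
qed

text \<open>Only those \<open>m\<close> with \<open>m \<le> e Z exp (- y\<^sub>i)\<close> are kept in block \<open>i\<close>; the others contribute
  \<open>0\<close> since then \<open>p m > Z\<close> on the support of the block weight.\<close>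

lemma block_sum_win:
  fixes Z y0 v :: real and p m :: nat
  assumes p: "p > 0" and m: "m > 0" and Z: "Z > 0" and J: "ln Z \<le> real J" and y0: "y0 \<ge> 0"
    and v: "v + 1 \<le> ln Z" and \<delta>: "0 < \<delta>" "\<delta> \<le> \<Delta>" "\<Delta> \<le> 1"
  shows "(\<Sum>i\<in>blocks J K. if real m \<le> exp 1 * Z * exp (- block_center y0 i)
            then block_weight y0 K i (ln (real p)) * b * win \<delta> \<Delta> (ln (real p) + ln (real m) - v) else 0)
    = of_bool (ln (real p) > y0 \<and> real (p * m) \<le> Z) * b * win \<delta> \<Delta> (ln (real (p * m)) - v)"
proof -
  have lpm: "ln (real p) + ln (real m) = ln (real (p * m))" using p m by (simp add: ln_mult)
  show ?thesis
  proof (cases "real (p * m) \<le> Z")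
    case False
    \<comment> \<open>The windows have length at most 1 and \<open>v + 1 \<le> ln Z\<close>, so
      products above \<open>Z\<close> lie outside them.\<close>
    have "ln Z < ln (real (p * m))" using False Z p m by (subst ln_less_cancel_iff) auto
    then have w0: "win \<delta> \<Delta> (ln (real (p * m)) - v) = 0" using v \<delta> by (simp add: win_def)
    show ?thesis unfolding lpm w0 by (simp cong: if_cong)
  next
    case True
    have "real p \<le> real (p * m)" using m by (subst of_nat_le_iff) simp
    then have "real p \<le> Z" using True by linarith
    then have "ln (real p) \<le> ln Z" using p Z by simp
    then have lp: "ln (real p) \<le> y0 + real J" using J y0 by linarith
    have "(if real m \<le> exp 1 * Z * exp (- block_center y0 i)
            then block_weight y0 K i (ln (real p)) * b * win \<delta> \<Delta> (ln (real p) + ln (real m) - v) else 0)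
       = block_weight y0 K i (ln (real p)) * (b * win \<delta> \<Delta> (ln (real (p * m)) - v))" if i: "i \<in> blocks J K" for i
    proof (cases "block_weight y0 K i (ln (real p)) = 0")
      case nz: False
      have "\<not> 1 \<le> \<bar>ln (real p) - block_center y0 i\<bar>" using nz block_weight_bounds(3)[OF i, of "ln (real p)" y0] by blast
      then have "block_center y0 i - 1 \<le> ln (real p)" by linarith
      then have "exp (block_center y0 i - 1) \<le> real p" using p by (simp add: ln_ge_iff)
      then have "exp (block_center y0 i - 1) * real m \<le> real p * real m" by (rule mult_right_mono) simp
      also have "\<dots> \<le> Z" using True by simp
      finally have "exp (block_center y0 i - 1) * real m \<le> Z" .
      then have "real m \<le> exp 1 * Z * exp (- block_center y0 i)"
        by (simp add: exp_diff exp_minus field_simps)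
      then show ?thesis unfolding lpm by simp
    qed simp
    then have "(\<Sum>i\<in>blocks J K. if real m \<le> exp 1 * Z * exp (- block_center y0 i)
            then block_weight y0 K i (ln (real p)) * b * win \<delta> \<Delta> (ln (real p) + ln (real m) - v) else 0)
       = (\<Sum>i\<in>blocks J K. block_weight y0 K i (ln (real p))) * (b * win \<delta> \<Delta> (ln (real (p * m)) - v))"
      unfolding sum_distrib_right by (intro sum.cong refl)
    then show ?thesis unfolding block_partition[OF lp] using True by (simp add: mult.assoc)
  qed
qed

text \<open>The block conditions on \<open>m\<close> are turned into a summand that may vanish, so
  that the sum over blocks can be carried out first, for fixed \<open>p\<close> and
  \<open>m\<close>. It leaves the conditions \<open>p > H\<close> and \<open>p * m \<le> Z\<close>,
  and regrouping by \<open>n = p * m\<close> produces \<open>ramare_sum\<close>.\<close>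

lemma triple_sum_eq_ramare:
  fixes Z y0 v H :: real
  assumes Z: "Z \<ge> 1" and J: "ln Z \<le> real J" and H: "H \<ge> 1" "y0 = ln H"
    and v: "v + 1 \<le> ln Z" and \<delta>: "0 < \<delta>" "\<delta> \<le> \<Delta>" "\<Delta> \<le> 1"
  defines "Q \<equiv> {p. prime p \<and> ln (real p) \<le> y0 + real J + 1}"
    and "N \<equiv> \<lambda>i. {m::nat. m > 0 \<and> real m \<le> exp 1 * Z * exp (- block_center y0 i)}"
  shows "(\<Sum>(i,p,m)\<in>Sigma (blocks J K) (\<lambda>i. Q \<times> N i). block_weight y0 K i (ln (real p)) * ramare_coeff H m * win \<delta> \<Delta> (ln (real p) + ln (real m) - v))
    = (\<Sum>n | n > 0 \<and> real n \<le> Z. ramare_sum H n * win \<delta> \<Delta> (ln (real n) - v))"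
proof -
  define M where "M = {m::nat. m > 0 \<and> real m \<le> exp 1 * Z}"
  define f where "f = (\<lambda>i p m. block_weight y0 K i (ln (real p)) * ramare_coeff H m * win \<delta> \<Delta> (ln (real p) + ln (real m) - v))"
  define g where "g = (\<lambda>n. win \<delta> \<Delta> (ln (real n) - v))"
  have y0: "y0 \<ge> 0" using H by simp
  have Q: "finite Q" unfolding Q_def by (rule finite_primes_ln)
  have M: "finite M" unfolding M_def by (rule finite_nat_le)
  have NM: "N i \<subseteq> M" if i: "i \<in> blocks J K" for i
  proof -
    have "exp 1 * Z * exp (- block_center y0 i) \<le> exp 1 * Z * 1"
      using Z y0 block_weight_bounds(4)[OF i, of y0] by (intro mult_left_mono) auto
    then have "real m \<le> exp 1 * Z" if "real m \<le> exp 1 * Z * exp (- block_center y0 i)" for m using that by linarith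
    then show ?thesis unfolding N_def M_def by blast
  qed
  have finN: "finite (N i)" if "i \<in> blocks J K" for i using NM[OF that] M by (rule finite_subset)
  have "(\<Sum>(i,p,m)\<in>Sigma (blocks J K) (\<lambda>i. Q \<times> N i). f i p m) = (\<Sum>i\<in>blocks J K. \<Sum>(p,m)\<in>Q \<times> N i. f i p m)"
    using Q finN by (subst sum.Sigma[symmetric]) auto
  also have "\<dots> = (\<Sum>i\<in>blocks J K. \<Sum>p\<in>Q. \<Sum>m\<in>M. if m \<in> N i then f i p m else 0)"
  proof (intro sum.cong refl)
    fix i assume i: "i \<in> blocks J K"
    have "(\<Sum>(p,m)\<in>Q \<times> N i. f i p m) = (\<Sum>p\<in>Q. \<Sum>m\<in>N i. f i p m)" by (simp add: sum.cartesian_product)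
    also have "\<dots> = (\<Sum>p\<in>Q. \<Sum>m\<in>M. if m \<in> N i then f i p m else 0)"
      using NM[OF i] M by (intro sum.cong refl sum.mono_neutral_cong_left) auto
    finally show "(\<Sum>(p,m)\<in>Q \<times> N i. f i p m) = (\<Sum>p\<in>Q. \<Sum>m\<in>M. if m \<in> N i then f i p m else 0)" .
  qed
  also have "\<dots> = (\<Sum>p\<in>Q. \<Sum>m\<in>M. \<Sum>i\<in>blocks J K. if m \<in> N i then f i p m else 0)"
    by (subst sum.swap) (intro sum.cong refl sum.swap)
  also have "\<dots> = (\<Sum>p\<in>Q. \<Sum>m\<in>M. of_bool (ln (real p) > y0 \<and> real (p * m) \<le> Z) * ramare_coeff H m * g (p * m))"
  proof (intro sum.cong refl)
    fix p m assume pm: "p \<in> Q" "m \<in> M"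
    then have p: "p > 0" and m: "m > 0" using prime_gt_0_nat by (auto simp: Q_def M_def)
    have "(\<Sum>i\<in>blocks J K. if m \<in> N i then f i p m else 0) = (\<Sum>i\<in>blocks J K. if real m \<le> exp 1 * Z * exp (- block_center y0 i)
            then block_weight y0 K i (ln (real p)) * ramare_coeff H m * win \<delta> \<Delta> (ln (real p) + ln (real m) - v) else 0)"
      unfolding f_def using m by (simp add: N_def)
    then show "(\<Sum>i\<in>blocks J K. if m \<in> N i then f i p m else 0) = of_bool (ln (real p) > y0 \<and> real (p * m) \<le> Z) * ramare_coeff H m * g (p * m)"
      using block_sum_win[OF p m _ J y0 v \<delta>, of K "ramare_coeff H m"] Z by (simp add: g_def)
  qed
  also have "\<dots> = (\<Sum>(p,m)\<in>Q \<times> M. of_bool (ln (real p) > y0 \<and> real (p * m) \<le> Z) * ramare_coeff H m * g (p * m))"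
    by (rule sum.cartesian_product)
  also have "\<dots> = (\<Sum>(p,m)\<in>{(p,m)\<in>Q \<times> M. ln (real p) > y0 \<and> real (p * m) \<le> Z}. ramare_coeff H m * g (p * m))"
    using Q M by (intro sum.mono_neutral_cong_right) auto
  also have "\<dots> = (\<Sum>(n,p)\<in>Sigma {n. n > 0 \<and> real n \<le> Z} (\<lambda>n. {p. prime p \<and> p dvd n \<and> real p > H}). ramare_coeff H (n div p) * g n)"
  proof (rule sum.reindex_bij_witness[where i = "\<lambda>(n,p). (p, n div p)" and j = "\<lambda>(p,m). (p * m, p)"])
    fix a assume "a \<in> {(p,m)\<in>Q \<times> M. ln (real p) > y0 \<and> real (p * m) \<le> Z}"
    then obtain p m where a: "a = (p, m)" and pm: "p \<in> Q" "m \<in> M" "ln (real p) > y0" "real (p * m) \<le> Z" by auto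
    have p: "prime p" "p > 0" "m > 0" using pm prime_gt_0_nat by (auto simp: Q_def M_def)
    show "(case case a of (p, m) \<Rightarrow> (p * m, p) of (n, p) \<Rightarrow> (p, n div p)) = a" using p by (simp add: a)
    have "real p > H" using pm(3) p H by simp
    then show "(case a of (p, m) \<Rightarrow> (p * m, p)) \<in> Sigma {n. n > 0 \<and> real n \<le> Z} (\<lambda>n. {p. prime p \<and> p dvd n \<and> real p > H})"
      using p pm(4) by (simp add: a)
    show "(case case a of (p, m) \<Rightarrow> (p * m, p) of (n, p) \<Rightarrow> ramare_coeff H (n div p) * g n) = (case a of (p, m) \<Rightarrow> ramare_coeff H m * g (p * m))"
      using p by (simp add: a)
  next
    fix a assume "a \<in> Sigma {n. n > 0 \<and> real n \<le> Z} (\<lambda>n. {p. prime p \<and> p dvd n \<and> real p > H})"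
    then obtain n p where a: "a = (n, p)" and np: "n > 0" "real n \<le> Z" "prime p" "p dvd n" "real p > H" by auto
    obtain m where m: "n = p * m" using np(4) by auto
    have p: "p > 0" "m > 0" using np m by auto
    show "(case case a of (n, p) \<Rightarrow> (p, n div p) of (p, m) \<Rightarrow> (p * m, p)) = a" using np by (simp add: a)
    have "real p \<le> Z" "real m \<le> Z"
    proof -
      have "p \<le> n" "m \<le> n" using p m by auto
      then have "real p \<le> real n" "real m \<le> real n" by simp_all
      then show "real p \<le> Z" "real m \<le> Z" using np(2) by linarith+
    qed
    have "ln (real p) \<le> ln Z" using \<open>real p \<le> Z\<close> p Z by simp
    then have "p \<in> Q" using J y0 np(3) by (simp add: Q_def)
    moreover have "m \<in> M"
    proof -
      have "1 * Z \<le> exp 1 * Z" using Z by (intro mult_right_mono) auto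
      then have "real m \<le> exp 1 * Z" using \<open>real m \<le> Z\<close> by linarith
      then show ?thesis using p by (simp add: M_def)
    qed
    moreover have "ln (real p) > y0" using np(5) H p by simp
    ultimately show "(case a of (n, p) \<Rightarrow> (p, n div p)) \<in> {(p,m)\<in>Q \<times> M. ln (real p) > y0 \<and> real (p * m) \<le> Z}"
      using p np(2) by (simp add: a m)
  qed
  also have "\<dots> = (\<Sum>n | n > 0 \<and> real n \<le> Z. \<Sum>p | prime p \<and> p dvd n \<and> real p > H. ramare_coeff H (n div p) * g n)"
  proof (subst sum.Sigma)
    show "finite {n. 0 < n \<and> real n \<le> Z}" by (rule finite_nat_le)
    show "\<forall>n\<in>{n. 0 < n \<and> real n \<le> Z}. finite {p. prime p \<and> p dvd n \<and> H < real p}"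
      by (auto intro: finite_subset[OF _ finite_divisors_nat])
  qed simp
  also have "\<dots> = (\<Sum>n | n > 0 \<and> real n \<le> Z. ramare_sum H n * g n)"
    by (simp add: ramare_sum_def sum_distrib_right)
  finally show ?thesis unfolding f_def g_def .
qed

section \<open>Decomposition of a short window and its mean square\<close>

lemma lwin_win:
  assumes v: "v > 0" "v + 1 \<le> ln Z" and \<delta>: "0 < \<delta>" "\<delta> \<le> \<Delta>" "\<Delta> \<le> 1" and Z: "Z > 0"
  shows "lwin v \<delta> - \<delta> / \<Delta> * lwin v \<Delta> = (\<Sum>n | n > 0 \<and> real n \<le> Z. real_of_int (liouville n) * win \<delta> \<Delta> (ln (real n) - v))"
proof -
  have fin: "finite {n::nat. n > 0 \<and> real n \<le> Z}" by (rule finite_nat_le)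
  have "lwin v d = (\<Sum>n | n > 0 \<and> real n \<le> Z. real_of_int (liouville n) * of_bool (0 < ln (real n) - v \<and> ln (real n) - v \<le> d))" if d: "d \<le> 1" for d
    unfolding lwin_def
  proof (rule sum.mono_neutral_cong_left[OF fin])
    show "{n. 0 < ln (real n) - v \<and> ln (real n) - v \<le> d} \<subseteq> {n. 0 < n \<and> real n \<le> Z}"
    proof
      fix n assume "n \<in> {n. 0 < ln (real n) - v \<and> ln (real n) - v \<le> d}"
      then have n: "0 < ln (real n) - v" "ln (real n) - v \<le> d" by auto
      \<comment> \<open>Here \<open>v > 0\<close> is used: by the convention \<open>ln 0 = 0\<close>
        the index 0 could otherwise lie in the window.\<close>
      have "n \<noteq> 0" using n(1) v(1) by (intro notI) simp
      then have n0: "n > 0" by simp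
      have "ln (real n) \<le> ln Z" using n(2) d v(2) by linarith
      then show "n \<in> {n. 0 < n \<and> real n \<le> Z}" using n0 Z by simp
    qed
  qed auto
  note e = this
  have "lwin v \<delta> - \<delta> / \<Delta> * lwin v \<Delta> = (\<Sum>n | n > 0 \<and> real n \<le> Z. real_of_int (liouville n) * of_bool (0 < ln (real n) - v \<and> ln (real n) - v \<le> \<delta>))
     - \<delta> / \<Delta> * (\<Sum>n | n > 0 \<and> real n \<le> Z. real_of_int (liouville n) * of_bool (0 < ln (real n) - v \<and> ln (real n) - v \<le> \<Delta>))"
    using e[of \<delta>] e[of \<Delta>] \<delta> by simp
  also have "\<dots> = (\<Sum>n | n > 0 \<and> real n \<le> Z. real_of_int (liouville n) * win \<delta> \<Delta> (ln (real n) - v))"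
    unfolding sum_distrib_left sum_subtractf[symmetric] by (intro sum.cong refl) (simp only: win_def right_diff_distrib mult_ac)
  finally show ?thesis .
qed

lemma lwin_decomposition:
  fixes Z v H :: real
  assumes v: "v > 0" "v + 1 \<le> ln Z" and \<delta>: "0 < \<delta>" "\<delta> \<le> \<Delta>" "\<Delta> \<le> 1" and Z: "Z > 0"
  shows "lwin v \<delta> = (\<Sum>n | n > 0 \<and> real n \<le> Z. ramare_sum H n * win \<delta> \<Delta> (ln (real n) - v))
    + (\<Sum>n\<in>ramare_bad H Z. (real_of_int (liouville n) - ramare_sum H n) * win \<delta> \<Delta> (ln (real n) - v)) + \<delta> / \<Delta> * lwin v \<Delta>"
proof -
  have fin: "finite {n::nat. n > 0 \<and> real n \<le> Z}" by (rule finite_nat_le)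
  have "(\<Sum>n\<in>ramare_bad H Z. (real_of_int (liouville n) - ramare_sum H n) * win \<delta> \<Delta> (ln (real n) - v))
     = (\<Sum>n | n > 0 \<and> real n \<le> Z. (real_of_int (liouville n) - ramare_sum H n) * win \<delta> \<Delta> (ln (real n) - v))"
  proof (rule sum.mono_neutral_left[OF fin])
    show "ramare_bad H Z \<subseteq> {n. 0 < n \<and> real n \<le> Z}" by (auto simp: ramare_bad_def)
    show "\<forall>n\<in>{n. 0 < n \<and> real n \<le> Z} - ramare_bad H Z. (real_of_int (liouville n) - ramare_sum H n) * win \<delta> \<Delta> (ln (real n) - v) = 0"
    proof
      fix n assume n: "n \<in> {n. 0 < n \<and> real n \<le> Z} - ramare_bad H Z"
      have "ramare_sum H n = real_of_int (liouville n)"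
      proof (rule ramare_identity)
        show "n > 0" "\<exists>p. prime p \<and> p dvd n \<and> real p > H" using n by (auto simp: ramare_bad_def not_le)
        show "\<not> p\<^sup>2 dvd n" if "prime p" "real p > H" for p using n that by (auto simp: ramare_bad_def)
      qed
      then show "(real_of_int (liouville n) - ramare_sum H n) * win \<delta> \<Delta> (ln (real n) - v) = 0" by simp
    qed
  qed
  also have "\<dots> = (\<Sum>n | n > 0 \<and> real n \<le> Z. real_of_int (liouville n) * win \<delta> \<Delta> (ln (real n) - v))
     - (\<Sum>n | n > 0 \<and> real n \<le> Z. ramare_sum H n * win \<delta> \<Delta> (ln (real n) - v))"
    by (simp add: left_diff_distrib sum_subtractf)
  finally show ?thesis using lwin_win[OF v \<delta> Z] by linarith
qed

text \<open>The bound 9 is a convenient integer above \<open>3 * exp 1\<close>: for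
  \<open>v \<le> ln (3 * X)\<close> and windows of length at most 1 no larger \<open>n\<close>
  occurs. The length \<open>X powr (-(1/240))\<close> of the long window leaves a margin over the
  saving \<open>X powr (-(1/60))\<close> of \<open>lwin_bound\<close>.\<close>

definition ramare_form :: "real \<Rightarrow> real \<Rightarrow> real \<Rightarrow> real \<Rightarrow> real" where
  "ramare_form X H \<delta> v = (\<Sum>n | n > 0 \<and> real n \<le> 9 * X. ramare_sum H n * win \<delta> (X powr (-(1/240))) (ln (real n) - v))"

text \<open>The bilinear sum is estimated over the whole line, where Plancherel applies, but it
  agrees with \<open>ramare_form\<close> only as long as its truncations are invisible; hence a
  separate function \<open>F\<close>. The exponent 1/960 is a quarter of 1/240, as it is
  \<open>\<Delta> powr (1/4)\<close> that must outweigh the powers of \<open>H\<close>.\<close>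

lemma ramare_form_l2:
  assumes RH: "riemann_hypothesis"
  obtains C where "C > 0" "\<And>X H h \<delta>. X > 0 \<Longrightarrow> ln X \<ge> 10 \<Longrightarrow> exp 2 \<le> H \<Longrightarrow> H ^ 3 * (ln X)\<^sup>2 \<le> X powr (1/960) \<Longrightarrow>
    1 \<le> h \<Longrightarrow> h \<le> H \<Longrightarrow> 0 < \<delta> \<Longrightarrow> \<delta> \<le> 3 * h / X \<Longrightarrow>
    \<exists>F. integrable lborel (\<lambda>v. (F v)\<^sup>2) \<and> integral\<^sup>L lborel (\<lambda>v. (F v)\<^sup>2) \<le> C * h * (ln X) ^ 6 \<and>
      (\<forall>v. v \<le> ln (3 * X) \<longrightarrow> F v = ramare_form X H \<delta> v)"
proof -
  obtain C0 where C0: "C0 \<ge> 1" "\<And>X H i t. ln X \<ge> 10 \<Longrightarrow> exp 2 \<le> H \<Longrightarrow> H \<le> X \<Longrightarrow> \<bar>t\<bar> \<le> X ^ 4 \<Longrightarrow>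
    i \<in> blocks (nat \<lceil>ln (9 * X)\<rceil>) (nat \<lceil>ln H\<rceil>) \<Longrightarrow>
    norm (block_poly (ln H) (nat \<lceil>ln (9 * X)\<rceil>) (nat \<lceil>ln H\<rceil>) i t)
      \<le> C0 * exp (block_center (ln H) i / 2) * (ln X)\<^sup>2 + C0 * H * exp (block_center (ln H) i) * (1 + \<bar>t\<bar>) powr (-(3/4))"
    using block_poly_bound[OF RH] by blast
  define e :: real where "e = exp 1"
  have e: "e \<le> 3" "e > 0" using exp_le by (auto simp: e_def)
  define C where "C = 8 * 163 * 81 * 9 * C0\<^sup>2 + 16 * 81\<^sup>2 * 9 * C0\<^sup>2 + 128 * 9 * (9 * e\<^sup>2)\<^sup>2"
  show thesis
  proof (rule that[of C])
    show "C > 0" unfolding C_def using C0(1) by (intro add_pos_nonneg mult_pos_pos) auto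
    fix X H h \<delta> :: real
    assume X0: "X > 0" and hX: "ln X \<ge> 10" and hH: "exp 2 \<le> H" and small: "H ^ 3 * (ln X)\<^sup>2 \<le> X powr (1/960)"
      and h1: "1 \<le> h" and hh: "h \<le> H" and \<delta>0: "0 < \<delta>" and \<delta>h: "\<delta> \<le> 3 * h / X"
    have H0: "H > 0" using hH exp_gt_zero[of "2::real"] by linarith
    have H2: "H \<ge> 3" using hH exp_ge_add_one_self[of "2::real"] by linarith
    have X1: "X \<ge> 11" using hX X0 ln_le_minus_one[OF X0] by linarith
    define y0 where "y0 = ln H"
    define J where "J = nat \<lceil>ln (9 * X)\<rceil>"
    define K where "K = nat \<lceil>ln H\<rceil>"
    define \<Delta> where "\<Delta> = X powr (-(1/240))"
    have Hp: "H \<le> X powr (1/960)" "H\<^sup>2 \<le> X powr (1/960)"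
    proof -
      have l2: "1 \<le> (ln X)\<^sup>2" using power_mono[of 1 "ln X" 2] hX by simp
      have "H * 1 \<le> H ^ 3" using H2 power_increasing[of 1 3 H] by simp
      moreover have "H\<^sup>2 * 1 \<le> H ^ 3" using H2 power_increasing[of 2 3 H] by simp
      moreover have "H ^ 3 * 1 \<le> H ^ 3 * (ln X)\<^sup>2" using l2 H0 by (intro mult_left_mono) auto
      ultimately show "H \<le> X powr (1/960)" "H\<^sup>2 \<le> X powr (1/960)" using small by linarith+
    qed
    have HX: "H \<le> X"
    proof -
      have "X powr (1/960) \<le> X powr 1" using X1 by (intro powr_mono) auto
      then show ?thesis using Hp X0 by simp
    qed
    have \<delta>\<Delta>: "\<delta> \<le> \<Delta>" "\<Delta> \<le> 1"
    proof -
      have "3 * h \<le> H\<^sup>2" using hh h1 H2 mult_mono[of 3 H h H] by (simp add: power2_eq_square)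
      then have "3 * h / X \<le> X powr (1/960) / X" using Hp X0 by (intro divide_right_mono) auto
      also have "\<dots> = X powr (1/960 - 1)" using X0 powr_diff[of X "1/960" 1] by simp
      also have "\<dots> \<le> \<Delta>" unfolding \<Delta>_def using X1 by (intro powr_mono) auto
      finally show "\<delta> \<le> \<Delta>" using \<delta>h by linarith
      have "\<Delta> \<le> X powr 0" unfolding \<Delta>_def using X1 by (intro powr_mono) auto
      then show "\<Delta> \<le> 1" using X0 by simp
    qed
    define I where "I = blocks J K"
    define Q where "Q = {p::nat. prime p \<and> ln (real p) \<le> y0 + real J + 1}"
    \<comment> \<open>This is \<open>exp 1 * Z\<close> with \<open>Z = 9 * X\<close>: the factor
      \<open>exp 1\<close> allows for primes up to one unit below the block centre in the
      logarithm.\<close>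
    define Y where "Y = e * (9 * X)"
    have Y: "0 < Y" "Y \<le> 27 * X" using e X0 by (auto simp: Y_def)
    define y where "y = block_center y0"
    define N where "N = (\<lambda>i. {m::nat. m > 0 \<and> real m \<le> Y * exp (- y i)})"
    define F where "F = (\<lambda>v. \<Sum>(i,p,m)\<in>Sigma I (\<lambda>i. Q \<times> N i). block_weight y0 K i (ln (real p)) * ramare_coeff H m * win \<delta> \<Delta> (ln (real p) + ln (real m) - v))"
    define \<beta> where "\<beta> = (\<lambda>i. C0 * exp (y i / 2) * (ln X)\<^sup>2)"
    define \<mu> where "\<mu> = (\<lambda>i. C0 * H * exp (y i))"
    have bs: "real J \<le> ln X + 5" "ln (9 * X) \<le> real J" "real K \<le> ln X + 1"
      using block_size_bounds[OF hX hH HX] by (auto simp: J_def K_def)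
    have cI: "real (card I) \<le> 3 * ln X"
    proof -
      have "real (card I) = real J + real K + 1" using sum_blocks[of "\<lambda>_. 1::real" J K] by (simp add: I_def)
      then show ?thesis using bs hX by linarith
    qed
    have yi: "y0 \<le> y i" if "i \<in> I" for i using block_weight_bounds(4)[of i J K y0] that by (simp add: y_def I_def)
    have \<delta>Y: "\<delta> * Y \<le> 81 * h"
    proof -
      have "\<delta> * Y \<le> (3 * h / X) * (27 * X)" using \<delta>h \<delta>0 Y h1 X0 by (intro mult_mono) auto
      then show ?thesis using X0 by simp
    qed
    define z where "z = \<delta> * Y"
    have z: "0 \<le> z" "z \<le> 81 * h" using \<delta>0 Y \<delta>Y by (auto simp: z_def)
    have P: "(\<Sum>p\<in>Q. complex_of_real (block_weight y0 K i (ln (real p))) * cis (t * ln (real p))) = block_poly y0 J K i t" for i t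
      by (simp add: block_poly_def Q_def)
    have fin: "finite I" "finite Q" by (auto simp: I_def Q_def finite_primes_ln)
    have X41: "X ^ 4 \<ge> 1" using X1 by (intro one_le_power) auto
    have pos: "\<beta> i \<ge> 0" "\<mu> i \<ge> 0" if "i \<in> I" for i using C0(1) H0 by (auto simp: \<beta>_def \<mu>_def)
    have bd: "norm (\<Sum>p\<in>Q. complex_of_real (block_weight y0 K i (ln (real p))) * cis (t * ln (real p))) \<le> \<beta> i + \<mu> i * (1 + \<bar>t\<bar>) powr (-(3/4))"
      if "i \<in> I" "\<bar>t\<bar> \<le> X ^ 4" for i t
      using C0(2)[OF hX hH HX that(2), of i] that(1) unfolding P unfolding \<beta>_def \<mu>_def y_def y0_def J_def K_def I_def .
    have triv: "norm (\<Sum>p\<in>Q. complex_of_real (block_weight y0 K i (ln (real p))) * cis (t * ln (real p))) * (Y * exp (- y i)) \<le> 9 * e\<^sup>2 * X"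
      if i: "i \<in> I" for i t
    proof -
      have "norm (block_poly y0 J K i t) * (Y * exp (- y i)) \<le> exp (y i + 1) * (Y * exp (- y i))"
        using norm_block_poly_le[of i J K y0 t] i Y by (intro mult_right_mono) (auto simp: I_def y_def)
      also have "\<dots> = 9 * e\<^sup>2 * X" by (simp add: Y_def e_def exp_add exp_minus power2_eq_square)
      finally show ?thesis unfolding P .
    qed
    \<comment> \<open>The restriction to primes above \<open>H\<close> is used here:
      \<open>m\<close> runs up to \<open>Y / H\<close> at most, and \<open>h \<le> H\<close> then
      leaves boundedly many \<open>m\<close> in a window.\<close>
    have L: "2 * \<delta> * (Y * exp (- y i)) \<le> 162" if i: "i \<in> I" for i
    proof -
      have "exp (- y i) \<le> exp (- ln H)" using yi[OF i] by (simp add: y0_def)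
      also have "\<dots> = 1 / H" using H0 by (simp add: exp_minus divide_inverse)
      finally have "(2 * z) * exp (- y i) \<le> (2 * (81 * h)) * (1 / H)"
        using z h1 by (intro mult_mono) auto
      also have "\<dots> \<le> 162" using hh H0 by (simp add: divide_le_eq)
      finally show ?thesis by (simp add: z_def mult.assoc)
    qed
    have main: "integral\<^sup>L lborel (\<lambda>v. (F v)\<^sup>2)
      \<le> 8 * (162 + 1) * \<delta> * Y * (\<Sum>i\<in>I. \<beta> i / exp (y i / 2))\<^sup>2
      + 16 * \<delta>\<^sup>2 * \<Delta> powr (1/4) * (\<Sum>i\<in>I. \<mu> i * (Y * exp (- y i)))\<^sup>2 + 128 * (real (card I) * (9 * e\<^sup>2 * X))\<^sup>2 * (1 + X ^ 4) powr (-(3/4))"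
      unfolding F_def N_def
      by (rule bilinear_l2_bound(1)[OF fin \<delta>0 \<delta>\<Delta> X41 less_imp_le[OF Y(1)] abs_ramare_coeff]; (rule pos bd triv L; assumption))
    have int: "integrable lborel (\<lambda>v. (F v)\<^sup>2)"
      unfolding F_def N_def
      by (rule bilinear_l2_bound(2)[where \<beta> = \<beta> and \<mu> = \<mu> and \<tau> = "9 * e\<^sup>2 * X" and L = 162, OF fin \<delta>0 \<delta>\<Delta> X41 less_imp_le[OF Y(1)] abs_ramare_coeff];
         (rule pos bd triv L; assumption))
    \<comment> \<open>The main term: \<open>O (ln X)\<close> blocks, each with a loss
      \<open>(ln X)\<^sup>2\<close>, give \<open>(ln X) ^ 3\<close>, and squaring gives the exponent
      6.\<close>
    have t1: "8 * (162 + 1) * \<delta> * Y * (\<Sum>i\<in>I. \<beta> i / exp (y i / 2))\<^sup>2 \<le> 8 * 163 * 81 * 9 * C0\<^sup>2 * (h * (ln X) ^ 6)"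
    proof -
      have "(\<Sum>i\<in>I. \<beta> i / exp (y i / 2)) = real (card I) * (C0 * (ln X)\<^sup>2)" by (simp add: \<beta>_def)
      also have "\<dots> \<le> (3 * ln X) * (C0 * (ln X)\<^sup>2)" using cI C0(1) by (intro mult_right_mono) auto
      finally have "(\<Sum>i\<in>I. \<beta> i / exp (y i / 2))\<^sup>2 \<le> ((3 * ln X) * (C0 * (ln X)\<^sup>2))\<^sup>2"
        using C0(1) by (intro power_mono sum_nonneg) (auto simp: \<beta>_def)
      also have "\<dots> = 9 * C0\<^sup>2 * (ln X) ^ 6" by (simp add: power_mult_distrib flip: power_mult power_add)
      finally have "(8 * 163 * z) * (\<Sum>i\<in>I. \<beta> i / exp (y i / 2))\<^sup>2 \<le> (8 * 163 * (81 * h)) * (9 * C0\<^sup>2 * (ln X) ^ 6)"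
        using z h1 by (intro mult_mono) auto
      then show ?thesis by (simp add: z_def mult_ac)
    qed
    \<comment> \<open>The pole terms: every block contributes \<open>C0 * H * Y\<close>. After
      multiplication by \<open>\<delta>\<^sup>2\<close> there is a surplus of
      \<open>h * H\<^sup>2 * (ln X)\<^sup>2\<close>, which
      \<open>\<Delta> powr (1/4) = X powr (-(1/960))\<close> compensates.\<close>
    have t2: "16 * \<delta>\<^sup>2 * \<Delta> powr (1/4) * (\<Sum>i\<in>I. \<mu> i * (Y * exp (- y i)))\<^sup>2 \<le> 16 * 81\<^sup>2 * 9 * C0\<^sup>2 * h"
    proof -
      have "(\<Sum>i\<in>I. \<mu> i * (Y * exp (- y i))) = real (card I) * (C0 * H * Y)"
        by (simp add: \<mu>_def exp_minus field_simps)
      also have "\<dots> \<le> (3 * ln X) * (C0 * H * Y)" using cI C0(1) H0 Y by (intro mult_right_mono) auto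
      finally have "(\<Sum>i\<in>I. \<mu> i * (Y * exp (- y i)))\<^sup>2 \<le> ((3 * ln X) * (C0 * H * Y))\<^sup>2"
        using C0(1) H0 Y by (intro power_mono sum_nonneg) (auto simp: \<mu>_def)
      then have "(16 * \<Delta> powr (1/4) * \<delta>\<^sup>2) * (\<Sum>i\<in>I. \<mu> i * (Y * exp (- y i)))\<^sup>2 \<le> (16 * \<Delta> powr (1/4) * \<delta>\<^sup>2) * ((3 * ln X) * (C0 * H * Y))\<^sup>2"
        by (intro mult_left_mono) auto
      also have "\<dots> = (16 * 9 * C0\<^sup>2 * (\<Delta> powr (1/4) * (H\<^sup>2 * (ln X)\<^sup>2))) * z\<^sup>2" by (simp add: z_def power_mult_distrib mult_ac)
      also have "\<dots> \<le> (16 * 9 * C0\<^sup>2 * (\<Delta> powr (1/4) * (H\<^sup>2 * (ln X)\<^sup>2))) * (81 * h)\<^sup>2"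
        using z by (intro mult_left_mono power_mono) auto
      also have "\<dots> = (16 * 81\<^sup>2 * 9 * C0\<^sup>2 * h) * (\<Delta> powr (1/4) * (H\<^sup>2 * (ln X)\<^sup>2) * h)" by (simp add: power2_eq_square mult_ac)
      also have "\<dots> \<le> (16 * 81\<^sup>2 * 9 * C0\<^sup>2 * h) * 1"
      proof (rule mult_left_mono)
        have "\<Delta> powr (1/4) * (H\<^sup>2 * (ln X)\<^sup>2) * h \<le> \<Delta> powr (1/4) * (H\<^sup>2 * (ln X)\<^sup>2) * H" using hh by (intro mult_left_mono) auto
        also have "\<dots> = \<Delta> powr (1/4) * (H ^ 3 * (ln X)\<^sup>2)" by (simp add: power2_eq_square power3_eq_cube mult_ac)
        also have "\<dots> \<le> \<Delta> powr (1/4) * X powr (1/960)" using small by (intro mult_left_mono) auto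
        also have "\<dots> = X powr (-(1/960)) * X powr (1/960)" by (simp add: \<Delta>_def powr_powr)
        also have "\<dots> = 1" using X0 by (simp flip: powr_add)
        finally show "\<Delta> powr (1/4) * (H\<^sup>2 * (ln X)\<^sup>2) * h \<le> 1" .
      qed (use h1 in auto)
      finally show ?thesis by (simp add: mult_ac)
    qed
    \<comment> \<open>High frequencies: the trivial bound is \<open>O (X * ln X)\<close> before
      squaring, and the truncation at \<open>X ^ 4\<close> saves \<open>X ^ 3\<close>, more than the
      \<open>X\<^sup>2\<close> that is needed.\<close>
    have t3: "128 * (real (card I) * (9 * e\<^sup>2 * X))\<^sup>2 * (1 + X ^ 4) powr (-(3/4)) \<le> 128 * 9 * (9 * e\<^sup>2)\<^sup>2 * (ln X)\<^sup>2"
    proof -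
      have "(1 + X ^ 4) powr (-(3/4)) \<le> (X ^ 4) powr (-(3/4))" using X0 by (intro powr_mono2') auto
      also have "\<dots> = X powr (-3)"
      proof -
        have "X ^ 4 = X powr 4" using X0 by (simp add: powr_numeral)
        then show ?thesis by (simp add: powr_powr)
      qed
      also have "\<dots> \<le> X powr (-2)" using X1 by (intro powr_mono) auto
      also have "\<dots> = 1 / X\<^sup>2" using X0 by (simp add: powr_minus_divide powr_numeral)
      finally have a: "(1 + X ^ 4) powr (-(3/4)) \<le> 1 / X\<^sup>2" .
      have "(real (card I) * (9 * e\<^sup>2 * X))\<^sup>2 \<le> ((3 * ln X) * (9 * e\<^sup>2 * X))\<^sup>2"
        using cI X0 by (intro power_mono mult_right_mono) auto
      then have "128 * (real (card I) * (9 * e\<^sup>2 * X))\<^sup>2 * (1 + X ^ 4) powr (-(3/4)) \<le> 128 * ((3 * ln X) * (9 * e\<^sup>2 * X))\<^sup>2 * (1 / X\<^sup>2)"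
        using a by (intro mult_mono) auto
      also have "\<dots> = 128 * 9 * (9 * e\<^sup>2)\<^sup>2 * (ln X)\<^sup>2" using X0 by (simp add: power_mult_distrib)
      finally show ?thesis .
    qed
    have "integral\<^sup>L lborel (\<lambda>v. (F v)\<^sup>2) \<le> C * h * (ln X) ^ 6"
    proof -
      have l: "1 \<le> (ln X) ^ 6" "(ln X)\<^sup>2 \<le> (ln X) ^ 6" using hX by (auto intro: one_le_power power_increasing)
      have "16 * 81\<^sup>2 * 9 * C0\<^sup>2 * h * 1 \<le> 16 * 81\<^sup>2 * 9 * C0\<^sup>2 * h * (ln X) ^ 6"
        using l h1 by (intro mult_left_mono) auto
      moreover have "128 * 9 * (9 * e\<^sup>2)\<^sup>2 * (ln X)\<^sup>2 \<le> 128 * 9 * (9 * e\<^sup>2)\<^sup>2 * (h * (ln X) ^ 6)"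
        using l h1 mult_mono[of 1 h "(ln X)\<^sup>2" "(ln X) ^ 6"] by (intro mult_left_mono) auto
      moreover have "C * h * (ln X) ^ 6 = 8 * 163 * 81 * 9 * C0\<^sup>2 * (h * (ln X) ^ 6) + 16 * 81\<^sup>2 * 9 * C0\<^sup>2 * h * (ln X) ^ 6 + 128 * 9 * (9 * e\<^sup>2)\<^sup>2 * (h * (ln X) ^ 6)"
        by (simp only: C_def distrib_right mult.assoc)
      ultimately show ?thesis using main t1 t2 t3 by linarith
    qed
    moreover have "F v = ramare_form X H \<delta> v" if v: "v \<le> ln (3 * X)" for v
    proof -
      have "v + 1 \<le> ln (9 * X)"
      proof -
        have "1 \<le> ln (3::real)" using e by (simp add: ln_ge_iff e_def)
        moreover have "ln (9 * X) = ln 3 + ln (3 * X)" using X0 ln_mult[of 3 "3 * X"] by simp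
        ultimately show ?thesis using v by linarith
      qed
      then show ?thesis
        unfolding F_def I_def Q_def N_def Y_def y_def ramare_form_def e_def \<Delta>_def[symmetric] using X1 H2 bs(2) \<delta>0 \<delta>\<Delta>
        by (intro triple_sum_eq_ramare) (auto simp: y0_def)
    qed
    ultimately show "\<exists>F. integrable lborel (\<lambda>v. (F v)\<^sup>2) \<and> integral\<^sup>L lborel (\<lambda>v. (F v)\<^sup>2) \<le> C * h * (ln X) ^ 6 \<and>
      (\<forall>v. v \<le> ln (3 * X) \<longrightarrow> F v = ramare_form X H \<delta> v)" using int by blast
  qed
qed

text \<open>Here \<open>l = ln (ln X)\<close>, \<open>g = ln H\<close>, \<open>u = ln X / ln H\<close>, and \<open>V = H powr (1 - \<sigma>)\<close> for the exponent
  \<open>\<sigma>\<close> in Rankin's method.\<close>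
lemma rankin_parameters:
  fixes C :: real
  assumes C: "C \<ge> 1"
  shows "eventually (\<lambda>l::real. \<forall>g u V. g = exp (l/2) * sqrt ((1/2 - 1/sqrt l) * l) \<longrightarrow> u = exp l / g \<longrightarrow> V = u / l\<^sup>2 \<longrightarrow>
    2 \<le> g \<and> 1 \<le> V \<and> ln V \<le> g / 4 \<and> g \<le> u * ln V - 9 * V * ln (C * g)) at_top"
proof -
  have e1: "eventually (\<lambda>l::real. exp l / (exp (l/2) * sqrt ((1/2 - 1/sqrt l) * l)) \<ge> l\<^sup>2) at_top" by real_asymp
  have e2: "eventually (\<lambda>l::real. 4 * l \<le> exp (l/2) * sqrt ((1/2 - 1/sqrt l) * l)) at_top" by real_asymp
  have e3: "eventually (\<lambda>l::real. exp (l/2) * sqrt ((1/2 - 1/sqrt l) * l) \<le> exp l / C) at_top" using C by real_asymp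
  \<comment> \<open>The decisive inequality. With \<open>q = l / 2 - sqrt l\<close> one needs
    \<open>q \<le> ln V - 9 / l\<close>, where \<open>ln V\<close> is \<open>l / 2\<close> minus at
    most \<open>5/2 * ln l\<close>; the gap \<open>sqrt l\<close> that makes this true is the
    contribution of \<open>\<eta>\<close>.\<close>
  have e4: "eventually (\<lambda>l::real. 5/2 * ln l + 9 / l \<le> sqrt l) at_top" by real_asymp
  have e5: "eventually (\<lambda>l::real. l \<ge> 5) at_top" by (rule eventually_ge_at_top)
  show ?thesis using e1 e2 e3 e4 e5
  proof (eventually_elim, intro allI impI)
    fix l g u V :: real
    assume h: "exp l / (exp (l/2) * sqrt ((1/2 - 1/sqrt l) * l)) \<ge> l\<^sup>2" "4 * l \<le> exp (l/2) * sqrt ((1/2 - 1/sqrt l) * l)"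
      "exp (l/2) * sqrt ((1/2 - 1/sqrt l) * l) \<le> exp l / C" "5/2 * ln l + 9 / l \<le> sqrt l" "l \<ge> 5"
      and g: "g = exp (l/2) * sqrt ((1/2 - 1/sqrt l) * l)" and u: "u = exp l / g" and V: "V = u / l\<^sup>2"
    have sl: "sqrt l > 2" using h(5) real_sqrt_less_mono[of 4 l] by simp
    define q where "q = (1/2 - 1/sqrt l) * l"
    have q: "0 < q" "q \<le> l" using sl h(5) by (auto simp: q_def field_simps)
    have qe: "q = l / 2 - sqrt l"
      using sl h(5) by (simp add: q_def left_diff_distrib real_div_sqrt)
    have g': "g = exp (l/2) * sqrt q" "g \<ge> 4 * l" "C * g \<le> exp l" using h(2,3) C by (simp_all add: g q_def field_simps)
    have g0: "g > 0" "g \<ge> 2" using g'(2) h(5) by linarith+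
    have u0: "u > 0" "u \<ge> l\<^sup>2" using h(1) g0 by (auto simp: u g[symmetric])
    have V1: "V \<ge> 1" using u0 h(5) by (simp add: V)
    have lV: "ln V = ln u - 2 * ln l" using u0 h(5) by (simp add: V ln_div ln_realpow)
    have lu: "ln u = l / 2 - ln q / 2"
      using g0(1) q by (simp add: u ln_div g'(1) ln_mult ln_sqrt)
    have "ln q \<le> ln l" "0 \<le> ln l" using q h(5) by simp_all
    have "ln V \<le> l"
    proof -
      have "V \<le> u / 1" unfolding V using u0 h(5) by (intro divide_left_mono) auto
      also have "u / 1 \<le> exp l / 1" unfolding u div_by_1 using g0 by (simp add: divide_le_eq)
      finally have "ln V \<le> ln (exp l)" using V1 by (subst ln_le_cancel_iff) auto
      then show ?thesis by simp
    qed
    then have c3: "ln V \<le> g / 4" using g' by linarith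
    have lCg: "ln (C * g) \<le> l"
    proof -
      have "ln (C * g) \<le> ln (exp l)" using g'(3) C g0 by (subst ln_le_cancel_iff) auto
      then show ?thesis by simp
    qed
    \<comment> \<open>The division by \<open>l\<^sup>2\<close> in \<open>V\<close> is made for this:
      the Euler product costs at most \<open>u * (9 / l)\<close>, negligible against
      \<open>u * ln V\<close>.\<close>
    have "9 * V * ln (C * g) \<le> 9 * V * l" using lCg V1 by (intro mult_left_mono) auto
    also have "\<dots> = u * (9 / l)" using h(5) by (simp add: V power2_eq_square)
    finally have a: "9 * V * ln (C * g) \<le> u * (9 / l)" .
    have "q \<le> ln V - 9 / l" using qe lV lu h(4) \<open>ln q \<le> ln l\<close> by linarith
    then have "u * q \<le> u * (ln V - 9 / l)" using u0 by (intro mult_left_mono) auto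
    moreover have "u * q = g"
    proof -
      have "g * g = exp l * q" using q by (simp add: g'(1) mult_ac flip: exp_add)
      then show ?thesis using g0 by (simp add: u field_simps)
    qed
    ultimately have "g \<le> u * ln V - 9 * V * ln (C * g)" using a by (simp add: right_diff_distrib)
    then show "2 \<le> g \<and> 1 \<le> V \<and> ln V \<le> g / 4 \<and> g \<le> u * ln V - 9 * V * ln (C * g)" using g0 V1 c3 by blast
  qed
qed

text \<open>The choice \<open>\<eta>(X) = 1 / sqrt (ln (ln X))\<close>.\<close>
definition short_scale :: "real \<Rightarrow> real" where
  "short_scale X = exp (sqrt ((1/2 - 1 / sqrt (ln (ln X))) * ln X * ln (ln X)))"

text \<open>The inequality \<open>g \<le> u * ln V - 9 * V * ln (C * g)\<close> says exactly that
  the saving of Rankin's method exceeds its cost by a factor \<open>exp g = H\<close>. Smooth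
  integers contribute 9 to the constant, multiples of large squares 18.\<close>

lemma card_ramare_bad_short_scale:
  obtains D where "D > 0" "eventually (\<lambda>X. real (card (ramare_bad (short_scale X) (9 * X))) \<le> D * X / short_scale X) at_top"
proof -
  obtain C where C: "C \<ge> 1" "\<And>H \<sigma> X. H \<ge> exp 1 \<Longrightarrow> 3/4 \<le> \<sigma> \<Longrightarrow> \<sigma> \<le> 1 \<Longrightarrow> X \<ge> 1 \<Longrightarrow>
     real (card {n::nat. n > 0 \<and> real n \<le> X \<and> (\<forall>p. prime p \<longrightarrow> p dvd n \<longrightarrow> real p \<le> H)})
       \<le> X powr \<sigma> * exp (9 * H powr (1 - \<sigma>) * ln (C * ln H))"
    using smooth_count by blast
  have lim: "filterlim (\<lambda>X::real. ln (ln X)) at_top at_top" by real_asymp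
  have ev: "eventually (\<lambda>X::real. X \<ge> 3) at_top" by (rule eventually_ge_at_top)
  have ev2: "eventually (\<lambda>X::real. ln X \<ge> 3) at_top" by real_asymp
  show thesis
  proof (rule that[of 27])
    show "eventually (\<lambda>X. real (card (ramare_bad (short_scale X) (9 * X))) \<le> 27 * X / short_scale X) at_top"
      using eventually_compose_filterlim[OF rankin_parameters[OF C(1)] lim] ev ev2
    proof eventually_elim
      case (elim X)
      define H where "H = short_scale X"
      define l where "l = ln (ln X)"
      define g where "g = exp (l/2) * sqrt ((1/2 - 1/sqrt l) * l)"
      define u where "u = exp l / g"
      define V where "V = u / l\<^sup>2"
      have p: "2 \<le> g" "1 \<le> V" "ln V \<le> g / 4" "g \<le> u * ln V - 9 * V * ln (C * g)"
        using elim(1)[rule_format, of g u V] by (simp_all add: g_def u_def V_def l_def)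
      have X: "X > 0" "exp l = ln X" using elim by (auto simp: l_def)
      have "(exp (l/2))\<^sup>2 = exp l" by (simp add: power2_eq_square flip: exp_add)
      then have "exp (l/2) = sqrt (ln X)" using X(2) by (metis exp_ge_zero real_sqrt_unique)
      then have g: "g = sqrt ((1/2 - 1 / sqrt l) * ln X * l)" by (simp add: g_def mult_ac flip: real_sqrt_mult)
      have Hg: "H = exp g" by (simp add: H_def short_scale_def g l_def)
      \<comment> \<open>Chosen so that \<open>H powr (1 - \<sigma>) = V\<close> and
        \<open>X powr (1 - \<sigma>) = exp (u * ln V)\<close>.\<close>
      define \<sigma> where "\<sigma> = 1 - ln V / g"
      have lV: "0 \<le> ln V / g" "ln V / g \<le> 1/4" using p by (auto simp: field_simps)
      have "real (card {n::nat. n > 0 \<and> real n \<le> 9 * X \<and> (\<forall>p. prime p \<longrightarrow> p dvd n \<longrightarrow> real p \<le> H)})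
         \<le> (9 * X) powr \<sigma> * exp (9 * H powr (1 - \<sigma>) * ln (C * ln H))"
        using p lV elim(2) by (intro C(2)) (auto simp: Hg \<sigma>_def)
      also have "H powr (1 - \<sigma>) = V" using p by (simp add: Hg powr_def \<sigma>_def)
      also have "ln H = g" by (simp add: Hg)
      also have "(9 * X) powr \<sigma> = 9 powr \<sigma> * X powr \<sigma>" by (rule powr_mult)
      also have "X powr \<sigma> = X * exp (- (u * ln V))"
      proof -
        have "X powr \<sigma> = exp (ln X - u * ln V)" using X p by (simp add: powr_def \<sigma>_def u_def right_diff_distrib left_diff_distrib mult_ac)
        then show ?thesis using X by (simp add: exp_diff exp_minus divide_inverse)
      qed
      finally have "real (card {n::nat. n > 0 \<and> real n \<le> 9 * X \<and> (\<forall>p. prime p \<longrightarrow> p dvd n \<longrightarrow> real p \<le> H)})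
        \<le> 9 powr \<sigma> * (X * exp (9 * V * ln (C * g) - u * ln V))" by (simp add: exp_diff exp_minus divide_inverse mult_ac)
      also have "\<dots> \<le> 9 powr 1 * (X * exp (- g))"
        using p X lV by (intro mult_mono powr_mono) (auto simp: \<sigma>_def)
      also have "\<dots> = 9 * X / H" by (simp add: Hg exp_minus divide_inverse)
      finally have s: "real (card {n::nat. n > 0 \<and> real n \<le> 9 * X \<and> (\<forall>p. prime p \<longrightarrow> p dvd n \<longrightarrow> real p \<le> H)}) \<le> 9 * X / H" .
      have "H \<ge> 1" using p by (simp add: Hg)
      then have "real (card (ramare_bad H (9 * X))) \<le> 9 * X / H + 2 * (9 * X) / H"
        using card_ramare_bad[of H "9 * X"] s X by linarith
      then show ?case by (simp add: H_def add_divide_distrib[symmetric])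
    qed
  qed simp
qed

text \<open>By \<open>lwin_decomposition\<close> three terms remain: Ramare's sum, the exceptional
  integers and the rescaled long window. Only the first needs the powers of \<open>ln X\<close>; the
  other two are \<open>O (h)\<close> in mean square.\<close>

lemma lwin_l2:
  assumes RH: "riemann_hypothesis" and D: "D > 0"
  obtains C where "C > 0" "\<And>X H h \<delta>. X > 0 \<Longrightarrow> ln X \<ge> 10 \<Longrightarrow> exp 2 \<le> H \<Longrightarrow> H ^ 3 * (ln X)\<^sup>2 \<le> X powr (1/960) \<Longrightarrow>
    real (card (ramare_bad H (9 * X))) \<le> D * X / H \<Longrightarrow>
    1 \<le> h \<Longrightarrow> h \<le> H \<Longrightarrow> 0 < \<delta> \<Longrightarrow> \<delta> \<le> 3 * h / X \<Longrightarrow>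
    (\<integral>\<^sup>+v. ennreal ((lwin v \<delta>)\<^sup>2) * indicator {ln X..ln (3 * X)} v \<partial>lborel) \<le> ennreal (C * h * (ln X) ^ 6)"
proof -
  obtain C1 where C1: "C1 > 0" "\<And>X v. X \<ge> 1 \<Longrightarrow> ln X \<le> v \<Longrightarrow> v \<le> ln (3 * X) \<Longrightarrow>
    \<bar>lwin v (X powr (-(1/240)))\<bar> \<le> C1 * X powr (59/60)"
    using lwin_bound[OF RH] by blast
  obtain C2 where C2: "C2 > 0" "\<And>X H h \<delta>. X > 0 \<Longrightarrow> ln X \<ge> 10 \<Longrightarrow> exp 2 \<le> H \<Longrightarrow> H ^ 3 * (ln X)\<^sup>2 \<le> X powr (1/960) \<Longrightarrow>
    1 \<le> h \<Longrightarrow> h \<le> H \<Longrightarrow> 0 < \<delta> \<Longrightarrow> \<delta> \<le> 3 * h / X \<Longrightarrow>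
    \<exists>F. integrable lborel (\<lambda>v. (F v)\<^sup>2) \<and> integral\<^sup>L lborel (\<lambda>v. (F v)\<^sup>2) \<le> C2 * h * (ln X) ^ 6 \<and>
      (\<forall>v. v \<le> ln (3 * X) \<longrightarrow> F v = ramare_form X H \<delta> v)"
    using ramare_form_l2[OF RH] by blast
  define C where "C = 3 * C2 + 12 * (660 * D) + 3 * (18 * C1\<^sup>2)"
  show thesis
  proof (rule that[of C])
    show "C > 0" using C1(1) C2(1) D by (simp add: C_def add_pos_pos)
    fix X H h \<delta> :: real
    assume X0: "X > 0" and hX: "ln X \<ge> 10" and hH: "exp 2 \<le> H" and small: "H ^ 3 * (ln X)\<^sup>2 \<le> X powr (1/960)"
      and bad: "real (card (ramare_bad H (9 * X))) \<le> D * X / H"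
      and h1: "1 \<le> h" and hh: "h \<le> H" and \<delta>0: "0 < \<delta>" and \<delta>h: "\<delta> \<le> 3 * h / X"
    obtain F where F: "integrable lborel (\<lambda>v. (F v)\<^sup>2)" "integral\<^sup>L lborel (\<lambda>v. (F v)\<^sup>2) \<le> C2 * h * (ln X) ^ 6"
      "\<And>v. v \<le> ln (3 * X) \<Longrightarrow> F v = ramare_form X H \<delta> v"
      using C2(2)[OF X0 hX hH small h1 hh \<delta>0 \<delta>h] by blast
    have H0: "H \<ge> 3" using hH exp_ge_add_one_self[of "2::real"] by linarith
    have X1: "X \<ge> 11" using hX X0 ln_le_minus_one[OF X0] by linarith
    define \<Delta> where "\<Delta> = X powr (-(1/240))"
    have \<Delta>0: "\<Delta> > 0" using X0 by (simp add: \<Delta>_def)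
    have Hp: "H\<^sup>2 \<le> X powr (1/960)"
    proof -
      have l2: "1 \<le> (ln X)\<^sup>2" using power_mono[of 1 "ln X" 2] hX by simp
      have "H\<^sup>2 * 1 \<le> H ^ 3" using H0 power_increasing[of 2 3 H] by simp
      moreover have "H ^ 3 * 1 \<le> H ^ 3 * (ln X)\<^sup>2" using l2 H0 by (intro mult_left_mono) auto
      ultimately show "H\<^sup>2 \<le> X powr (1/960)" using small by linarith
    qed
    have \<delta>\<Delta>: "\<delta> \<le> \<Delta>" "\<Delta> \<le> 1"
    proof -
      have "3 * h \<le> H\<^sup>2" using hh h1 H0 mult_mono[of 3 H h H] by (simp add: power2_eq_square)
      then have "3 * h / X \<le> X powr (1/960) / X" using Hp X0 by (intro divide_right_mono) auto
      also have "\<dots> = X powr (1/960 - 1)" using X0 powr_diff[of X "1/960" 1] by simp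
      also have "\<dots> \<le> \<Delta>" unfolding \<Delta>_def using X1 by (intro powr_mono) auto
      finally show "\<delta> \<le> \<Delta>" using \<delta>h by linarith
      have "\<Delta> \<le> X powr 0" unfolding \<Delta>_def using X1 by (intro powr_mono) auto
      then show "\<Delta> \<le> 1" using X0 by simp
    qed
    define N where "N = ramare_bad H (9 * X)"
    have N: "finite N" "\<And>n. n \<in> N \<Longrightarrow> 0 < n \<and> real n \<le> 9 * X"
      unfolding N_def ramare_bad_def by (auto intro: finite_subset[OF _ finite_nat_le[of "\<lambda>_. True" "9 * X"]])
    \<comment> \<open>Halving brings the coefficients, which are at most 2 in modulus, into the
      range required by \<open>window_win_bound\<close>; the factor returns as
      \<open>2 * G v\<close>.\<close>
    define b where "b = (\<lambda>n. (real_of_int (liouville n) - ramare_sum H n) / 2)"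
    have b: "\<bar>b n\<bar> \<le> 1" if "n \<in> N" for n
    proof -
      have "\<bar>real_of_int (liouville n)\<bar> = 1" by (simp flip: of_int_abs)
      then show ?thesis using abs_ramare_sum[of n H] N(2)[OF that] by (simp add: b_def abs_le_iff) linarith
    qed
    define G where "G = (\<lambda>v. \<Sum>n\<in>N. b n * win \<delta> \<Delta> (ln (real n) - v))"
    have G1: "integrable lborel (\<lambda>v. (G v)\<^sup>2)"
      using win_plancherel[OF N(1) \<delta>0 \<Delta>0, of b "\<lambda>n. ln (real n)"] unfolding G_def by (blast intro: integrable.intros)
    \<comment> \<open>The mean square is of order
      \<open>\<delta> * (\<delta> * X + 1) * D * X / H\<close>, that is,
      \<open>h * (h + 1) / H\<close>; the density \<open>D / H\<close> of the exceptional set just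
      absorbs the second \<open>h\<close>.\<close>
    have G2: "integral\<^sup>L lborel (\<lambda>v. (G v)\<^sup>2) \<le> 660 * D * h"
    proof -
      have "integral\<^sup>L lborel (\<lambda>v. (G v)\<^sup>2) \<le> 4 * \<delta> * (2 * \<delta> * (9 * X) + 1) * real (card N)"
        unfolding G_def using X0 by (intro window_win_bound N b \<delta>0 \<delta>\<Delta>) auto
      also have "\<dots> \<le> 4 * (3 * h / X) * (2 * (3 * h / X) * (9 * X) + 1) * (D * X / H)"
        using \<delta>h \<delta>0 X0 h1 bad D H0 unfolding N_def by (intro mult_mono add_mono order.refl mult_nonneg_nonneg add_nonneg_nonneg) auto
      also have "\<dots> = 12 * D * h * ((54 * h + 1) / H)" using X0 by simp
      also have "\<dots> \<le> 12 * D * h * 55"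
        using hh h1 H0 D by (intro mult_left_mono) (auto simp: divide_le_eq)
      finally show ?thesis by simp
    qed
    define c where "c = \<delta> / \<Delta> * (C1 * X powr (59/60))"
    have c0: "c \<ge> 0" using \<delta>0 \<Delta>0 C1(1) by (simp add: c_def)
    \<comment> \<open>Rescaling costs \<open>X powr (1/240)\<close> against the saving
      \<open>X powr (1/60)\<close> of the long window. The net gain \<open>X powr (1/80)\<close>
      pays for the surplus factor \<open>h\<close>.\<close>
    have c2: "c\<^sup>2 \<le> 9 * C1\<^sup>2 * h"
    proof -
      have "c \<le> (3 * h / X) / \<Delta> * (C1 * X powr (59/60))"
        unfolding c_def using \<delta>h \<Delta>0 C1(1) by (intro mult_right_mono divide_right_mono) auto
      also have "\<dots> = 3 * C1 * h * (X powr (1/240) * X powr (59/60) / X powr 1)"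
        using X0 by (simp add: \<Delta>_def powr_minus field_simps)
      also have "X powr (1/240) * X powr (59/60) / X powr 1 = X powr (1/240 + 59/60 - 1)"
        by (simp only: powr_add powr_diff)
      also have "X powr (1/240 + 59/60 - 1) = X powr (-(1/80))" by simp
      finally have "c\<^sup>2 \<le> (3 * C1 * h * X powr (-(1/80)))\<^sup>2" using c0 by (rule power_mono)
      also have "\<dots> = 9 * C1\<^sup>2 * h * (h * (X powr (-(1/80)))\<^sup>2)" by (simp add: power_mult_distrib power2_eq_square mult_ac)
      also have "\<dots> \<le> 9 * C1\<^sup>2 * h * 1"
      proof (rule mult_left_mono)
        have "h \<le> H\<^sup>2" using hh h1 H0 mult_mono[of 1 H h H] by (simp add: power2_eq_square)
        then have "h \<le> X powr (1/960)" using Hp by linarith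
        then have "h * (X powr (-(1/80)))\<^sup>2 \<le> X powr (1/960) * (X powr (-(1/80)))\<^sup>2" by (rule mult_right_mono) simp
        also have "\<dots> = X powr (-(23/960))" by (simp add: power2_eq_square flip: powr_add)
        also have "\<dots> \<le> X powr 0" using X1 by (intro powr_mono) auto
        finally show "h * (X powr (-(1/80)))\<^sup>2 \<le> 1" using X0 by simp
      qed (use h1 in auto)
      finally show ?thesis by simp
    qed
    define A where "A = {ln X..ln (3 * X)}"
    define U where "U = (\<lambda>v. 3 * (F v)\<^sup>2 + 12 * (G v)\<^sup>2 + 3 * c\<^sup>2 * indicator A v)"
    have mA: "A \<in> sets lborel" "emeasure lborel A < \<infinity>" "measure lborel A \<le> 2"
    proof -
      have l3: "ln (3 * X) = ln 3 + ln X" using X0 by (simp add: ln_mult)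
      have "0 \<le> ln (3::real)" "ln (3::real) \<le> 2" using ln_le_minus_one[of "3::real"] by simp_all
      then show "A \<in> sets lborel" "emeasure lborel A < \<infinity>" "measure lborel A \<le> 2" by (auto simp: A_def l3)
    qed
    have U: "has_bochner_integral lborel U (3 * integral\<^sup>L lborel (\<lambda>v. (F v)\<^sup>2) + 12 * integral\<^sup>L lborel (\<lambda>v. (G v)\<^sup>2) + 3 * c\<^sup>2 * measure lborel A)"
      unfolding U_def using F(1) G1 mA
      by (intro has_bochner_integral_add has_bochner_integral_mult_right has_bochner_integral_real_indicator) (auto simp: has_bochner_integral_iff)
    have U0: "U v \<ge> 0" for v by (simp add: U_def)
    have ptw: "(lwin v \<delta>)\<^sup>2 \<le> U v" if v: "v \<in> A" for v
    proof -
      have v': "v > 0" "v + 1 \<le> ln (9 * X)" "ln X \<le> v" "v \<le> ln (3 * X)"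
      proof -
        have "1 \<le> ln (3::real)" using exp_le by (simp add: ln_ge_iff)
        moreover have "ln (9 * X) = ln 3 + ln (3 * X)" using X0 ln_mult[of 3 "3 * X"] by simp
        ultimately show "v > 0" "v + 1 \<le> ln (9 * X)" "ln X \<le> v" "v \<le> ln (3 * X)" using v hX by (auto simp: A_def)
      qed
      have eq: "lwin v \<delta> = F v + 2 * G v + \<delta> / \<Delta> * lwin v \<Delta>"
      proof -
        have "2 * G v = (\<Sum>n\<in>N. (real_of_int (liouville n) - ramare_sum H n) * win \<delta> \<Delta> (ln (real n) - v))"
          by (simp add: G_def b_def sum_distrib_left)
        then show ?thesis
          using lwin_decomposition[OF v'(1,2) \<delta>0 \<delta>\<Delta>, of H] X0 F(3)[OF v'(4)] by (simp add: ramare_form_def \<Delta>_def N_def)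
      qed
      have "\<bar>\<delta> / \<Delta> * lwin v \<Delta>\<bar> \<le> c"
        unfolding abs_mult c_def using C1(2)[of X v] v' X1 \<delta>0 \<Delta>0 by (intro mult_mono) (auto simp: \<Delta>_def)
      then have "\<bar>\<delta> / \<Delta> * lwin v \<Delta>\<bar>\<^sup>2 \<le> c\<^sup>2" by (rule power_mono) simp
      then have cc: "(\<delta> / \<Delta> * lwin v \<Delta>)\<^sup>2 \<le> c\<^sup>2" by (simp only: power2_abs)
      have "(p + q + r)\<^sup>2 \<le> 3 * p\<^sup>2 + 3 * q\<^sup>2 + 3 * r\<^sup>2" for p q r :: real
        using zero_le_power2[of "p - q"] zero_le_power2[of "q - r"] zero_le_power2[of "p - r"]
        by (simp add: power2_eq_square algebra_simps)
      from this[of "F v" "2 * G v" "\<delta> / \<Delta> * lwin v \<Delta>"]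
      have "(lwin v \<delta>)\<^sup>2 \<le> 3 * (F v)\<^sup>2 + 3 * (2 * G v)\<^sup>2 + 3 * c\<^sup>2"
        unfolding eq using cc by linarith
      then show ?thesis using v by (simp add: U_def power_mult_distrib)
    qed
    have "integral\<^sup>L lborel U = 3 * integral\<^sup>L lborel (\<lambda>v. (F v)\<^sup>2) + 12 * integral\<^sup>L lborel (\<lambda>v. (G v)\<^sup>2) + 3 * c\<^sup>2 * measure lborel A"
      using U by (rule has_bochner_integral_integral_eq)
    also have "\<dots> \<le> 3 * (C2 * h * (ln X) ^ 6) + 12 * (660 * D * h) + 3 * (9 * C1\<^sup>2 * h) * 2"
      using F(2) G2 c2 mA(3) h1 by (intro add_mono mult_mono mult_left_mono) auto
    also have "\<dots> \<le> C * h * (ln X) ^ 6"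
    proof -
      have l: "1 \<le> (ln X) ^ 6" using hX by (auto intro: one_le_power)
      have "(12 * (660 * D) + 3 * (18 * C1\<^sup>2)) * h * 1 \<le> (12 * (660 * D) + 3 * (18 * C1\<^sup>2)) * h * (ln X) ^ 6"
        using l h1 D by (intro mult_left_mono) auto
      then show ?thesis by (simp add: C_def algebra_simps)
    qed
    finally have "ennreal (integral\<^sup>L lborel U) \<le> ennreal (C * h * (ln X) ^ 6)" by (rule ennreal_leI)
    moreover have "(\<integral>\<^sup>+v. ennreal ((lwin v \<delta>)\<^sup>2) * indicator A v \<partial>lborel) \<le> (\<integral>\<^sup>+v. ennreal (U v) \<partial>lborel)"
      using ptw by (intro nn_integral_mono) (auto split: split_indicator intro!: ennreal_leI)
    moreover have "(\<integral>\<^sup>+v. ennreal (U v) \<partial>lborel) = ennreal (integral\<^sup>L lborel U)"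
      using U U0 by (intro nn_integral_eq_integral) (auto simp: has_bochner_integral_iff)
    ultimately show "(\<integral>\<^sup>+v. ennreal ((lwin v \<delta>)\<^sup>2) * indicator {ln X..ln (3 * X)} v \<partial>lborel) \<le> ennreal (C * h * (ln X) ^ 6)"
      unfolding A_def by simp
  qed
qed

section \<open>From multiplicative to additive windows\<close>

text \<open>Write \<open>S (x + h) - S x\<close> as \<open>(S u - S x) - (S u - S (x + h))\<close> and average over
  \<open>u \<in> [x + 2 h, x + 3 h]\<close>; then substitute \<open>u = x exp \<delta>\<close>.\<close>
lemma saffari_vaughan:
  fixes S :: "real \<Rightarrow> real"
  assumes S [measurable]: "S \<in> borel_measurable borel" and X: "X > 0" and h: "h > 0" "3 * h \<le> X" and M: "M \<ge> 0"
    and mult: "\<And>\<delta>. 0 < \<delta> \<Longrightarrow> \<delta> \<le> 3 * h / X \<Longrightarrow>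
      (\<integral>\<^sup>+v. ennreal ((S (exp v * exp \<delta>) - S (exp v))\<^sup>2) * indicator {ln X..ln (3 * X)} v \<partial>lborel) \<le> ennreal M"
  shows "(\<integral>\<^sup>+x. ennreal ((S (x + h) - S x)\<^sup>2) * indicator {X..2 * X} x \<partial>lborel) \<le> ennreal (324 * X * M)"
proof -
  \<comment> \<open>Since \<open>exp b \<ge> 1 + b\<close>, a multiplicative window of length
    \<open>b\<close> starting at any \<open>x \<ge> X\<close> reaches at least to
    \<open>x + 3 * h\<close>.\<close>
  define b where "b = 3 * h / X"
  have b: "0 < b" "b \<le> 1" using X h by (auto simp: b_def)
  define k :: "real \<Rightarrow> real \<Rightarrow> ennreal" where "k = (\<lambda>x u. if x \<le> u \<and> u \<le> x * exp b then ennreal ((S u - S x)\<^sup>2) else 0)"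
  have k [measurable]: "case_prod k \<in> borel_measurable (lborel \<Otimes>\<^sub>M lborel)"
    unfolding k_def case_prod_beta by measurable
  define \<Phi> where "\<Phi> = (\<lambda>x. \<integral>\<^sup>+u. k x u \<partial>lborel)"
  have \<Phi> [measurable]: "\<Phi> \<in> borel_measurable lborel"
    unfolding \<Phi>_def by measurable
  have reach: "x + 3 * h \<le> x * exp b" if "x \<ge> X" for x
  proof -
    have "x * (1 + b) \<le> x * exp b" using exp_ge_add_one_self[of b] that X by (intro mult_left_mono) auto
    moreover have "X * b \<le> x * b" using that b by (intro mult_right_mono) auto
    moreover have "X * b = 3 * h" using X by (simp add: b_def)
    ultimately show ?thesis by (simp add: distrib_left)
  qed
  \<comment> \<open>For \<open>u\<close> between \<open>x + 2 * h\<close> and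
    \<open>x + 3 * h\<close> both \<open>x\<close> and \<open>x + h\<close> lie below
    \<open>u\<close>, within \<open>3 * h\<close>. This range of \<open>u\<close> has length
    \<open>h\<close>, the factor on the left.\<close>
  have step1: "ennreal h * ennreal ((S (x + h) - S x)\<^sup>2) \<le> 2 * \<Phi> x + 2 * \<Phi> (x + h)" if x: "x \<ge> X" for x
  proof -
    have "ennreal h * ennreal ((S (x + h) - S x)\<^sup>2) = (\<integral>\<^sup>+u. ennreal ((S (x + h) - S x)\<^sup>2) * indicator {x + 2 * h..x + 3 * h} u \<partial>lborel)"
      using h by (subst nn_integral_cmult_indicator) (auto simp: mult.commute)
    also have "\<dots> \<le> (\<integral>\<^sup>+u. 2 * k x u + 2 * k (x + h) u \<partial>lborel)"
    proof (rule nn_integral_mono)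
      fix u
      show "ennreal ((S (x + h) - S x)\<^sup>2) * indicator {x + 2 * h..x + 3 * h} u \<le> 2 * k x u + 2 * k (x + h) u"
      proof (cases "u \<in> {x + 2 * h..x + 3 * h}")
        case True
        have 1: "k x u = ennreal ((S u - S x)\<^sup>2)" using True reach[OF x] h by (simp add: k_def)
        have 2: "k (x + h) u = ennreal ((S u - S (x + h))\<^sup>2)" using True reach[of "x + h"] x h by (simp add: k_def)
        have "(p - q)\<^sup>2 \<le> 2 * (r - q)\<^sup>2 + 2 * (r - p)\<^sup>2" for p q r :: real
          using zero_le_power2[of "r - q + (r - p)"] by (simp add: power2_eq_square algebra_simps)
        from ennreal_leI[OF this[of "S (x + h)" "S x" "S u"]]
        have "ennreal ((S (x + h) - S x)\<^sup>2) \<le> 2 * k x u + 2 * k (x + h) u"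
          unfolding 1 2 by (simp add: ennreal_mult ennreal_plus)
        then show ?thesis using True by simp
      qed simp
    qed
    also have "\<dots> = 2 * \<Phi> x + 2 * \<Phi> (x + h)"
      unfolding \<Phi>_def by (subst nn_integral_add) (auto simp: nn_integral_cmult)
    finally show ?thesis .
  qed
  define T where "T = (\<integral>\<^sup>+x. \<Phi> x * indicator {X..3 * X} x \<partial>lborel)"
  have "ennreal h * (\<integral>\<^sup>+x. ennreal ((S (x + h) - S x)\<^sup>2) * indicator {X..2 * X} x \<partial>lborel)
     = (\<integral>\<^sup>+x. (ennreal h * ennreal ((S (x + h) - S x)\<^sup>2)) * indicator {X..2 * X} x \<partial>lborel)"
    by (subst nn_integral_cmult[symmetric]) (auto simp: mult.assoc)
  also have "\<dots> \<le> (\<integral>\<^sup>+x. 2 * (\<Phi> x * indicator {X..3 * X} x) + 2 * (\<Phi> (h + 1 * x) * indicator {X..3 * X} (h + 1 * x)) \<partial>lborel)"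
  proof (rule nn_integral_mono)
    fix x
    show "ennreal h * ennreal ((S (x + h) - S x)\<^sup>2) * indicator {X..2 * X} x
      \<le> 2 * (\<Phi> x * indicator {X..3 * X} x) + 2 * (\<Phi> (h + 1 * x) * indicator {X..3 * X} (h + 1 * x))"
      using step1[of x] h X by (auto split: split_indicator simp: add.commute[of h])
  qed
  also have "\<dots> = 2 * T + 2 * (\<integral>\<^sup>+x. \<Phi> (h + 1 * x) * indicator {X..3 * X} (h + 1 * x) \<partial>lborel)"
    unfolding T_def by (subst nn_integral_add) (auto simp: nn_integral_cmult)
  also have "(\<integral>\<^sup>+x. \<Phi> (h + 1 * x) * indicator {X..3 * X} (h + 1 * x) \<partial>lborel) = T"
    unfolding T_def by (subst (2) nn_integral_real_affine[of _ 1 h]) auto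
  finally have main: "ennreal h * (\<integral>\<^sup>+x. ennreal ((S (x + h) - S x)\<^sup>2) * indicator {X..2 * X} x \<partial>lborel) \<le> 2 * T + 2 * T" .
  define W where "W = (\<lambda>x \<delta>. ennreal ((S (x * exp \<delta>) - S x)\<^sup>2) * indicator {0..b} \<delta> * indicator {X..3 * X} x)"
  have W [measurable]: "case_prod W \<in> borel_measurable (lborel \<Otimes>\<^sub>M lborel)"
    unfolding W_def case_prod_beta by measurable
  have e3: "exp b \<le> 3" using b exp_le order.trans[of "exp b" "exp 1" 3] by simp
  have step2: "\<Phi> x * indicator {X..3 * X} x \<le> ennreal (9 * X) * (\<integral>\<^sup>+\<delta>. W x \<delta> \<partial>lborel)" for x
  proof (cases "x \<in> {X..3 * X}")
    case True
    then have x: "X \<le> x" "x \<le> 3 * X" "x > 0" using X by auto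
    have "\<Phi> x = (\<integral>\<^sup>+u. ennreal ((S u - S x)\<^sup>2) * indicator {x * exp 0..x * exp b} u \<partial>lborel)"
      unfolding \<Phi>_def k_def by (intro nn_integral_cong) (auto split: split_indicator)
    also have "\<dots> = (\<integral>\<^sup>+u. ennreal ((S u - S x)\<^sup>2 * indicator {x * exp 0..x * exp b} u) \<partial>lborel)"
      by (intro nn_integral_cong) (auto split: split_indicator)
    also have "\<dots> = (\<integral>\<^sup>+\<delta>. ennreal ((S (x * exp \<delta>) - S x)\<^sup>2 * (x * exp \<delta>) * indicator {0..b} \<delta>) \<partial>lborel)"
      using x b by (intro nn_integral_substitution) (auto intro!: derivative_eq_intros continuous_intros simp: set_borel_measurable_def)
    also have "\<dots> \<le> (\<integral>\<^sup>+\<delta>. ennreal (9 * X) * W x \<delta> \<partial>lborel)"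
    proof (rule nn_integral_mono)
      fix \<delta>
      show "ennreal ((S (x * exp \<delta>) - S x)\<^sup>2 * (x * exp \<delta>) * indicator {0..b} \<delta>) \<le> ennreal (9 * X) * W x \<delta>"
      proof (cases "\<delta> \<in> {0..b}")
        case d: True
        then have "exp \<delta> \<le> exp b" by simp
        then have "exp \<delta> \<le> 3" using e3 by (rule order.trans)
        then have "x * exp \<delta> \<le> (3 * X) * 3" using x X by (intro mult_mono) auto
        then have "(S (x * exp \<delta>) - S x)\<^sup>2 * (x * exp \<delta>) \<le> (9 * X) * (S (x * exp \<delta>) - S x)\<^sup>2"
          using mult_left_mono[of "x * exp \<delta>" "9 * X" "(S (x * exp \<delta>) - S x)\<^sup>2"] by (simp add: mult_ac)
        then have "ennreal ((S (x * exp \<delta>) - S x)\<^sup>2 * (x * exp \<delta>)) \<le> ennreal ((9 * X) * (S (x * exp \<delta>) - S x)\<^sup>2)"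
          by (rule ennreal_leI)
        then show ?thesis using d True X by (simp add: W_def ennreal_mult)
      qed simp
    qed
    also have "\<dots> = ennreal (9 * X) * (\<integral>\<^sup>+\<delta>. W x \<delta> \<partial>lborel)"
      by (rule nn_integral_cmult) measurable
    finally show ?thesis using True by simp
  qed simp
  have step3: "(\<integral>\<^sup>+x. W x \<delta> \<partial>lborel) \<le> ennreal (3 * X * M) * indicator {0..b} \<delta>" for \<delta>
  proof (cases "0 < \<delta> \<and> \<delta> \<le> b")
    case True
    have "(\<integral>\<^sup>+x. W x \<delta> \<partial>lborel) = (\<integral>\<^sup>+x. ennreal ((S (x * exp \<delta>) - S x)\<^sup>2 * indicator {exp (ln X)..exp (ln (3 * X))} x) \<partial>lborel)"
      using True X by (intro nn_integral_cong) (auto simp: W_def split: split_indicator)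
    also have "\<dots> = (\<integral>\<^sup>+v. ennreal ((S (exp v * exp \<delta>) - S (exp v))\<^sup>2 * exp v * indicator {ln X..ln (3 * X)} v) \<partial>lborel)"
      using X by (intro nn_integral_substitution) (auto intro!: derivative_eq_intros continuous_intros simp: set_borel_measurable_def)
    also have "\<dots> \<le> (\<integral>\<^sup>+v. ennreal (3 * X) * (ennreal ((S (exp v * exp \<delta>) - S (exp v))\<^sup>2) * indicator {ln X..ln (3 * X)} v) \<partial>lborel)"
    proof (rule nn_integral_mono)
      fix v
      show "ennreal ((S (exp v * exp \<delta>) - S (exp v))\<^sup>2 * exp v * indicator {ln X..ln (3 * X)} v)
        \<le> ennreal (3 * X) * (ennreal ((S (exp v * exp \<delta>) - S (exp v))\<^sup>2) * indicator {ln X..ln (3 * X)} v)"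
      proof (cases "v \<in> {ln X..ln (3 * X)}")
        case v: True
        then have "exp v \<le> exp (ln (3 * X))" by (simp del: exp_ln)
        then have "exp v \<le> 3 * X" using X by simp
        then have "(S (exp v * exp \<delta>) - S (exp v))\<^sup>2 * exp v \<le> (3 * X) * (S (exp v * exp \<delta>) - S (exp v))\<^sup>2"
          using mult_left_mono[of "exp v" "3 * X" "(S (exp v * exp \<delta>) - S (exp v))\<^sup>2"] by (simp add: mult_ac)
        then have "ennreal ((S (exp v * exp \<delta>) - S (exp v))\<^sup>2 * exp v) \<le> ennreal ((3 * X) * (S (exp v * exp \<delta>) - S (exp v))\<^sup>2)"
          by (rule ennreal_leI)
        then show ?thesis using v X by (simp add: ennreal_mult)
      qed simp
    qed
    also have "\<dots> = ennreal (3 * X) * (\<integral>\<^sup>+v. ennreal ((S (exp v * exp \<delta>) - S (exp v))\<^sup>2) * indicator {ln X..ln (3 * X)} v \<partial>lborel)"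
      by (rule nn_integral_cmult) measurable
    also have "\<dots> \<le> ennreal (3 * X) * ennreal M" using mult[of \<delta>] True by (intro mult_left_mono) (auto simp: b_def)
    finally show ?thesis using True X M by (simp add: ennreal_mult)
  qed (cases "\<delta> = 0"; simp add: W_def)
  have "T \<le> (\<integral>\<^sup>+x. ennreal (9 * X) * (\<integral>\<^sup>+\<delta>. W x \<delta> \<partial>lborel) \<partial>lborel)"
    unfolding T_def by (intro nn_integral_mono step2)
  also have "\<dots> = ennreal (9 * X) * (\<integral>\<^sup>+x. (\<integral>\<^sup>+\<delta>. W x \<delta> \<partial>lborel) \<partial>lborel)"
    by (rule nn_integral_cmult) measurable
  also have "(\<integral>\<^sup>+x. (\<integral>\<^sup>+\<delta>. W x \<delta> \<partial>lborel) \<partial>lborel) = (\<integral>\<^sup>+\<delta>. (\<integral>\<^sup>+x. W x \<delta> \<partial>lborel) \<partial>lborel)"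
    using lborel_pair.Fubini'[of W] W by simp
  also have "\<dots> \<le> (\<integral>\<^sup>+\<delta>. ennreal (3 * X * M) * indicator {0..b} \<delta> \<partial>lborel)"
    by (intro nn_integral_mono step3)
  also have "\<dots> = ennreal (3 * X * M) * ennreal b"
    using b by (subst nn_integral_cmult_indicator) auto
  finally have T: "T \<le> ennreal (9 * X) * (ennreal (3 * X * M) * ennreal b)" by (simp add: mult_left_mono)
  also have "\<dots> = ennreal (9 * X * (3 * X * M * b))"
  proof -
    have "ennreal p * (ennreal q * ennreal r) = ennreal (p * (q * r))" if "0 \<le> p" "0 \<le> q" "0 \<le> r" for p q r
      using that by (simp add: ennreal_mult)
    then show ?thesis using X M b by simp
  qed
  \<comment> \<open>The range of \<open>\<delta>\<close> has length \<open>b = 3 * h / X\<close>.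
    This produces the factor \<open>h\<close> that cancels against the length of the averaging
    interval.\<close>
  also have "9 * X * (3 * X * M * b) = h * (81 * X * M)" using X by (simp add: b_def)
  finally have T: "T \<le> ennreal (h * (81 * X * M))" .
  have "ennreal h * (\<integral>\<^sup>+x. ennreal ((S (x + h) - S x)\<^sup>2) * indicator {X..2 * X} x \<partial>lborel) \<le> 4 * T"
    using main by (simp add: distrib_right[symmetric])
  also have "\<dots> \<le> 4 * ennreal (h * (81 * X * M))" using T by (intro mult_left_mono) auto
  also have "\<dots> = ennreal h * ennreal (324 * X * M)"
  proof -
    have "4 * ennreal p = ennreal (4 * p)" if "0 \<le> p" for p using that by (simp add: ennreal_mult)
    from this[of "h * (81 * X * M)"] have "4 * ennreal (h * (81 * X * M)) = ennreal (h * (324 * X * M))"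
      using h X M by (simp add: mult_ac)
    then show ?thesis using h X M by (simp add: ennreal_mult[of h])
  qed
  finally show ?thesis using h by (subst (asm) ennreal_mult_le_mult_iff) auto
qed

section \<open>The summatory function and the conclusion\<close>

definition liouville_sum :: "real \<Rightarrow> real" where
  "liouville_sum x = (\<Sum>n | n > 0 \<and> real n \<le> x. real_of_int (liouville n))"

lemma liouville_sum_measurable [measurable]: "liouville_sum \<in> borel_measurable borel"
proof -
  have "liouville_sum = (\<lambda>k. \<Sum>n | n > 0 \<and> int n \<le> k. real_of_int (liouville n)) \<circ> (floor :: real \<Rightarrow> int)"
    by (auto simp: fun_eq_iff liouville_sum_def le_floor_iff)
  moreover have "(\<lambda>k. \<Sum>n | n > 0 \<and> int n \<le> k. real_of_int (liouville n)) \<circ> (floor :: real \<Rightarrow> int) \<in> borel_measurable borel"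
    by (rule measurable_comp[OF measurable_real_floor]) simp
  ultimately show ?thesis by simp
qed

lemma liouville_sum_diff:
  assumes "x \<le> y"
  shows "liouville_sum y - liouville_sum x = (\<Sum>n | n > 0 \<and> x < real n \<and> real n \<le> y. real_of_int (liouville n))"
proof -
  have "liouville_sum y = liouville_sum x + (\<Sum>n | n > 0 \<and> x < real n \<and> real n \<le> y. real_of_int (liouville n))"
    unfolding liouville_sum_def
  proof (subst sum.union_disjoint[symmetric])
    show "finite {n::nat. n > 0 \<and> real n \<le> x}" by (rule finite_nat_le)
    show "finite {n::nat. n > 0 \<and> x < real n \<and> real n \<le> y}"
      using finite_nat_le[of "\<lambda>n. n > 0 \<and> x < real n" y] by (simp add: conj_assoc)
    show "(\<Sum>n | n > 0 \<and> real n \<le> y. real_of_int (liouville n)) =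
      (\<Sum>n\<in>{n. n > 0 \<and> real n \<le> x} \<union> {n. n > 0 \<and> x < real n \<and> real n \<le> y}. real_of_int (liouville n))"
      using assms by (intro sum.cong) auto
  qed auto
  then show ?thesis by simp
qed

lemma lwin_eq_liouville_sum:
  assumes "v > 0" "\<delta> \<ge> 0"
  shows "lwin v \<delta> = liouville_sum (exp v * exp \<delta>) - liouville_sum (exp v)"
proof -
  have "0 < ln (real n) - v \<and> ln (real n) - v \<le> \<delta> \<longleftrightarrow> n > 0 \<and> exp v < real n \<and> real n \<le> exp v * exp \<delta>" for n :: nat
  proof (cases "n = 0")
    case False
    then have n: "real n > 0" by simp
    have "0 < ln (real n) - v \<longleftrightarrow> exp v < real n" using exp_less_cancel_iff[of v "ln (real n)"] n by simp
    moreover have "ln (real n) - v \<le> \<delta> \<longleftrightarrow> real n \<le> exp (v + \<delta>)" using exp_le_cancel_iff[of "ln (real n)" "v + \<delta>"] n by (simp del: exp_le_cancel_iff) linarith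
    ultimately show ?thesis using False by (simp add: exp_add)
  qed (use assms in simp)
  moreover have "exp v \<le> exp v * exp \<delta>" using assms by simp
  ultimately show ?thesis unfolding lwin_def by (simp add: liouville_sum_diff)
qed

text \<open>The short sum includes its left end point whereas a difference of summatory functions
  does not; they agree unless \<open>x\<close> is an integer.\<close>

lemma liouville_short_sum_eq:
  assumes "x \<notin> \<nat>" "h \<ge> 0"
  shows "real_of_int (liouville_short_sum x h) = liouville_sum (x + h) - liouville_sum x"
proof -
  have "{n::nat. 1 \<le> n \<and> x \<le> real n \<and> real n \<le> x + h} = {n. n > 0 \<and> x < real n \<and> real n \<le> x + h}"
    using assms(1) by (auto simp: le_less)
  then show ?thesis using assms(2) by (simp add: liouville_short_sum_def liouville_sum_diff)
qed

text \<open>The integers form a null set, so the integrand may be changed there. If the integrand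
  were not integrable, its integral would be 0 by convention, so that case is settled by
  \<open>M \<ge> 0\<close>.\<close>

lemma integral_liouville_short_sum_le:
  assumes "(\<integral>\<^sup>+x. ennreal ((liouville_sum (x + h) - liouville_sum x)\<^sup>2) * indicator {a..b} x \<partial>lborel) \<le> ennreal M"
    and M: "M \<ge> 0" and h: "h \<ge> 0"
  shows "integral {a..b} (\<lambda>x. (real_of_int (liouville_short_sum x h))\<^sup>2) \<le> M"
proof (cases "(\<lambda>x. (real_of_int (liouville_short_sum x h))\<^sup>2) integrable_on {a..b}")
  case True
  define I where "I = integral {a..b} (\<lambda>x. (real_of_int (liouville_short_sum x h))\<^sup>2)"
  have int: "((\<lambda>x. (real_of_int (liouville_short_sum x h))\<^sup>2) has_integral I) {a..b}"
    using True by (simp add: I_def integrable_integral)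
  have "negligible (\<nat> :: real set)"
    by (simp add: negligible_iff_null_sets countable_imp_null_set_lborel null_sets_completionI Nats_def)
  then have "((\<lambda>x. (liouville_sum (x + h) - liouville_sum x)\<^sup>2) has_integral I) {a..b}"
    by (rule has_integral_spike[OF _ _ int]) (use h in \<open>auto simp: liouville_short_sum_eq\<close>)
  then have "integral\<^sup>N lborel (\<lambda>x. ennreal (indicator {a..b} x * (liouville_sum (x + h) - liouville_sum x)\<^sup>2)) = ennreal I"
    by (intro nn_integral_has_integral_lebesgue) auto
  also have "integral\<^sup>N lborel (\<lambda>x. ennreal (indicator {a..b} x * (liouville_sum (x + h) - liouville_sum x)\<^sup>2))
    = (\<integral>\<^sup>+x. ennreal ((liouville_sum (x + h) - liouville_sum x)\<^sup>2) * indicator {a..b} x \<partial>lborel)"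
    by (intro nn_integral_cong) (auto split: split_indicator)
  finally have "ennreal I \<le> ennreal M" using assms(1) by simp
  then show ?thesis using M by (simp add: I_def ennreal_le_iff)
qed (use M in \<open>simp add: not_integrable_integral\<close>)

theorem theorem2:
  assumes "riemann_hypothesis"
  shows "\<exists>\<eta> :: real \<Rightarrow> real. (\<eta> \<longlongrightarrow> 0) at_top \<and>
    (\<exists>C > 0. \<forall>\<^sub>F X in at_top.
       \<forall>h::real. 1 \<le> h \<and> h \<le> exp (sqrt ((1/2 - \<eta> X) * ln X * ln (ln X))) \<longrightarrow>
         integral {X..2*X} (\<lambda>x. (real_of_int (liouville_short_sum x h))^2)
           \<le> C * X * h * (ln X)^6)"
proof -
  obtain D where D: "D > 0" "eventually (\<lambda>X. real (card (ramare_bad (short_scale X) (9 * X))) \<le> D * X / short_scale X) at_top"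
    using card_ramare_bad_short_scale by blast
  obtain C where C: "C > 0" "\<And>X H h \<delta>. X > 0 \<Longrightarrow> ln X \<ge> 10 \<Longrightarrow> exp 2 \<le> H \<Longrightarrow> H ^ 3 * (ln X)\<^sup>2 \<le> X powr (1/960) \<Longrightarrow>
    real (card (ramare_bad H (9 * X))) \<le> D * X / H \<Longrightarrow>
    1 \<le> h \<Longrightarrow> h \<le> H \<Longrightarrow> 0 < \<delta> \<Longrightarrow> \<delta> \<le> 3 * h / X \<Longrightarrow>
    (\<integral>\<^sup>+v. ennreal ((lwin v \<delta>)\<^sup>2) * indicator {ln X..ln (3 * X)} v \<partial>lborel) \<le> ennreal (C * h * (ln X) ^ 6)"
    using lwin_l2[OF assms D(1)] by blast
  \<comment> \<open>Every admissible \<open>h\<close> is compared with the same scale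
    \<open>short_scale X\<close>. The conditions below therefore involve \<open>X\<close> alone, and
    the threshold for \<open>X\<close> is uniform in \<open>h\<close>. They hold because
    \<open>ln (short_scale X)\<close> tends to infinity but is of smaller order than
    \<open>ln X\<close>.\<close>
  have e1: "eventually (\<lambda>X::real. X > 0) at_top" by (rule eventually_gt_at_top)
  have e2: "eventually (\<lambda>X::real. ln X \<ge> 10) at_top" by real_asymp
  have e3: "eventually (\<lambda>X. exp 2 \<le> short_scale X) at_top" unfolding short_scale_def by real_asymp
  have e4: "eventually (\<lambda>X. short_scale X ^ 3 * (ln X)\<^sup>2 \<le> X powr (1/960)) at_top" unfolding short_scale_def by real_asymp
  have e5: "eventually (\<lambda>X. 3 * short_scale X \<le> X) at_top" unfolding short_scale_def by real_asymp
  show ?thesis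
  proof (rule exI[of _ "\<lambda>X. 1 / sqrt (ln (ln X))"], intro conjI exI[of _ "324 * C"])
    show "((\<lambda>X::real. 1 / sqrt (ln (ln X))) \<longlongrightarrow> 0) at_top" by real_asymp
    show "324 * C > 0" using C(1) by simp
    show "\<forall>\<^sub>F X in at_top. \<forall>h::real. 1 \<le> h \<and> h \<le> exp (sqrt ((1/2 - 1 / sqrt (ln (ln X))) * ln X * ln (ln X))) \<longrightarrow>
         integral {X..2*X} (\<lambda>x. (real_of_int (liouville_short_sum x h))^2) \<le> 324 * C * X * h * (ln X)^6"
      using D(2) e1 e2 e3 e4 e5
    proof (eventually_elim, intro allI impI)
      fix X h :: real
      assume X: "real (card (ramare_bad (short_scale X) (9 * X))) \<le> D * X / short_scale X" "X > 0" "ln X \<ge> 10"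
        "exp 2 \<le> short_scale X" "short_scale X ^ 3 * (ln X)\<^sup>2 \<le> X powr (1/960)" "3 * short_scale X \<le> X"
        and "1 \<le> h \<and> h \<le> exp (sqrt ((1/2 - 1 / sqrt (ln (ln X))) * ln X * ln (ln X)))"
      then have h: "1 \<le> h" "h \<le> short_scale X" by (simp_all add: short_scale_def)
      have M: "C * h * (ln X) ^ 6 \<ge> 0" using C(1) h by simp
      have "(\<integral>\<^sup>+x. ennreal ((liouville_sum (x + h) - liouville_sum x)\<^sup>2) * indicator {X..2 * X} x \<partial>lborel)
         \<le> ennreal (324 * X * (C * h * (ln X) ^ 6))"
      proof (rule saffari_vaughan)
        show "3 * h \<le> X" "h > 0" using h X(6) by linarith+
        fix \<delta> :: real assume \<delta>: "0 < \<delta>" "\<delta> \<le> 3 * h / X"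
        have "(\<integral>\<^sup>+v. ennreal ((liouville_sum (exp v * exp \<delta>) - liouville_sum (exp v))\<^sup>2) * indicator {ln X..ln (3 * X)} v \<partial>lborel)
          = (\<integral>\<^sup>+v. ennreal ((lwin v \<delta>)\<^sup>2) * indicator {ln X..ln (3 * X)} v \<partial>lborel)"
          using X(3) \<delta> by (intro nn_integral_cong) (auto simp: lwin_eq_liouville_sum split: split_indicator)
        also have "\<dots> \<le> ennreal (C * h * (ln X) ^ 6)" by (rule C(2)[OF X(2-5,1) h \<delta>])
        finally show "(\<integral>\<^sup>+v. ennreal ((liouville_sum (exp v * exp \<delta>) - liouville_sum (exp v))\<^sup>2) * indicator {ln X..ln (3 * X)} v \<partial>lborel)
          \<le> ennreal (C * h * (ln X) ^ 6)" .
      qed (use X M in simp_all)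
      then have "integral {X..2*X} (\<lambda>x. (real_of_int (liouville_short_sum x h))^2) \<le> 324 * X * (C * h * (ln X) ^ 6)"
        by (rule integral_liouville_short_sum_le) (use X h M in \<open>simp_all add: mult_nonneg_nonneg\<close>)
      then show "integral {X..2*X} (\<lambda>x. (real_of_int (liouville_short_sum x h))^2) \<le> 324 * C * X * h * (ln X)^6"
        by (simp add: mult_ac)
    qed
  qed
qed

end
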